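(* Suppose that $x\nu_x\le 0$ throughout $\partial\Omega$, and that there are an open interval $I$ and a positive constant $C_I$ such that \[ x\nu_x\le -C_I \] on the intersection of $\partial\Omega$ with $I\times\mathbb R^{d-1}$. Suppose further that the intersection of $\Omega$ with $I\times\mathbb R^{d-1}$ is bounded. Then for any $\delta>0$ there are positive constants $E_0$ and $C$ such that \[ \big\|(1+|x|)^{-\frac{3+\delta}{2}}(-\Delta-E-i\varepsilon)^{-1}(1+|x|)^{-\frac{3+\delta}{2}}\big\|_{L^2(\Omega)\to L^2(\Omega)}\le C E^{1/2} \] for all $E\ge E_0$ and $\varepsilon\in(0,1]$.
   Context: $\Omega\subset\mathbb R^d$, $d\ge 2$, is an open set of infinite volume. Coordinates on $\mathbb R^d$ are $(x,y)=(x,y_1,\dots,y_{d-1})\in\mathbb R\times\mathbb R^{d-1}$, and $\nu=(\nu_x,\nu_{y_1},\dots,\nu_{y_{d-1}})$ is the outward pointing unit normal vector to $\partial\Omega$. Standing regularity assumption: $\partial\Omega$ is Lipschitz, and every $p\in\partial\Omega$ has a neighborhood $U_p$ such that either $U_p\cap\Omega$ is convex or $U_p\cap\partial\Omega$ is $C^{1,1}$ (so $\nu$ is defined almost everywhere on $\partial\Omega$, and conditions on $\nu$ are understood where it is defined). $\Delta$ is the Dirichlet Laplacian on $\Omega$ (the Friedrichs extension from $C_c^\infty(\Omega)$); the spectrum of $-\Delta$ is contained in $[0,\infty)$, and $(-\Delta-z)^{-1}:L^2(\Omega)\to L^2(\Omega)$ is its resolvent. Powers of $1+|x|$ act as multiplication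 operators. *)

theory Defs
  imports "HOL-Analysis.Analysis"
begin

section \<open>The geometry of the boundary\<close>

text \<open>
  For a unit vector \<open>e\<close>, the point \<open>q - (q \<bullet> e) e\<close> is the projection of \<open>q\<close> to the hyperplane
  orthogonal to \<open>e\<close>, so \<open>graph_height e \<gamma> q\<close> is the signed height, in direction \<open>e\<close>, of \<open>q\<close>
  above the graph of \<open>\<gamma>\<close> over this hyperplane. Only the values of \<open>\<gamma>\<close> on the hyperplane matter;
  a Lipschitz (or \<open>C\<^sup>1\<^sup>,\<^sup>1\<close>) function defined near a point of the hyperplane agrees near that point
  with one that is globally defined on the whole space.
\<close>

definition graph_height :: "'a::euclidean_space \<Rightarrow> ('a \<Rightarrow> real) \<Rightarrow> 'a \<Rightarrow> real" where
  "graph_height e \<gamma> q = q \<bullet> e - \<gamma> (q - (q \<bullet> e) *\<^sub>R e)"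

text \<open>Inside \<open>U\<close>, up to a rigid motion, \<open>\<Omega>\<close> is the region above the graph of a Lipschitz function;
  it follows that \<open>frontier \<Omega> \<inter> U\<close> is the part of the graph inside \<open>U\<close>.\<close>

definition lipschitz_chart ::
    "'a::euclidean_space set \<Rightarrow> 'a set \<Rightarrow> 'a \<Rightarrow> ('a \<Rightarrow> real) \<Rightarrow> bool" where
  "lipschitz_chart \<Omega> U e \<gamma> \<longleftrightarrow>
     open U \<and> norm e = 1 \<and> (\<exists>L. L-lipschitz_on UNIV \<gamma>) \<and>
     \<Omega> \<inter> U = {q \<in> U. 0 < graph_height e \<gamma> q}"

definition lipschitz_boundary :: "'a::euclidean_space set \<Rightarrow> bool" where
  "lipschitz_boundary \<Omega> \<longleftrightarrow> (\<forall>p\<in>frontier \<Omega>. \<exists>U e \<gamma>. p \<in> U \<and> lipschitz_chart \<Omega> U e \<gamma>)"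

definition C11_hypersurface :: "'a::euclidean_space set \<Rightarrow> bool" where
  "C11_hypersurface S \<longleftrightarrow>
     (\<forall>p\<in>S. \<exists>U e \<gamma> G L. open U \<and> p \<in> U \<and> norm e = 1 \<and>
        (\<forall>v. GDERIV \<gamma> v :> G v) \<and> L-lipschitz_on UNIV G \<and>
        S \<inter> U = {q \<in> U. graph_height e \<gamma> q = 0})"

definition locally_convex_or_C11 :: "'a::euclidean_space set \<Rightarrow> bool" where
  "locally_convex_or_C11 \<Omega> \<longleftrightarrow>
     (\<forall>p\<in>frontier \<Omega>. \<exists>U. open U \<and> p \<in> U \<and>
        (convex (U \<inter> \<Omega>) \<or> C11_hypersurface (U \<inter> frontier \<Omega>)))"

text \<open>
  The outward unit normal is defined at those boundary points at which the function whose graph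
  is the boundary is differentiable, hence almost everywhere by Rademacher's theorem. As \<open>\<Omega>\<close> is
  locally \<open>{q. 0 < graph_height e \<gamma> q}\<close>, the gradient \<open>D\<close> points into \<open>\<Omega>\<close>; it is nonzero because
  \<open>D \<bullet> e = 1\<close>.
\<close>

definition outward_unit_normal :: "'a::euclidean_space set \<Rightarrow> 'a \<Rightarrow> 'a \<Rightarrow> bool" where
  "outward_unit_normal \<Omega> p n \<longleftrightarrow>
     p \<in> frontier \<Omega> \<and>
     (\<exists>U e \<gamma> D. p \<in> U \<and> lipschitz_chart \<Omega> U e \<gamma> \<and>
        GDERIV (graph_height e \<gamma>) p :> D \<and> n = - (1 / norm D) *\<^sub>R D)"

section \<open>Square-integrable functions and operators on them\<close>

text \<open>
  Elements of \<open>L\<^sup>2(\<Omega>)\<close> are represented by functions on the whole space, of which only the values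
  on \<open>\<Omega>\<close> matter, and only up to null sets. Unbounded operators are given by their graphs.
\<close>

definition L2_space :: "'a::euclidean_space set \<Rightarrow> ('a \<Rightarrow> complex) set" where
  "L2_space \<Omega> = {f \<in> borel_measurable (lebesgue_on \<Omega>).
     integrable (lebesgue_on \<Omega>) (\<lambda>p. (cmod (f p))\<^sup>2)}"

definition L2_inner :: "'a::euclidean_space set \<Rightarrow> ('a \<Rightarrow> complex) \<Rightarrow> ('a \<Rightarrow> complex) \<Rightarrow> complex" where
  "L2_inner \<Omega> f g = (\<integral>p. f p * cnj (g p) \<partial>lebesgue_on \<Omega>)"

definition L2_norm :: "'a::euclidean_space set \<Rightarrow> ('a \<Rightarrow> complex) \<Rightarrow> real" where
  "L2_norm \<Omega> f = sqrt (\<integral>p. (cmod (f p))\<^sup>2 \<partial>lebesgue_on \<Omega>)"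

text \<open>The operator norm is \<open>\<infinity>\<close> if \<open>T\<close> does not map \<open>L\<^sup>2(\<Omega>)\<close> boundedly to itself.\<close>

definition L2_opnorm ::
    "'a::euclidean_space set \<Rightarrow> (('a \<Rightarrow> complex) \<Rightarrow> ('a \<Rightarrow> complex)) \<Rightarrow> ennreal" where
  "L2_opnorm \<Omega> T = Inf {ennreal K | K. 0 \<le> K \<and>
     (\<forall>f\<in>L2_space \<Omega>. T f \<in> L2_space \<Omega> \<and> L2_norm \<Omega> (T f) \<le> K * L2_norm \<Omega> f)}"

text \<open>
  Let \<open>A\<close> be a nonnegative symmetric operator with domain \<open>D\<close>, and let \<open>a[\<phi>,\<psi>] = \<langle>A \<phi>, \<psi>\<rangle>\<close> for \<open>\<phi>\<close>
  and \<open>\<psi>\<close> in \<open>D\<close>. The domain of the closure of the form \<open>a\<close> consists of those \<open>u\<close> that have a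
  sequence \<open>\<phi>\<close> in \<open>D\<close> with \<open>form_approx \<Omega> D A \<phi> u\<close>, and the value of the closed form at \<open>(u,v)\<close> is
  the limit of \<open>a[\<phi> n, \<psi> n]\<close> for arbitrary such sequences \<open>\<phi>\<close> for \<open>u\<close> and \<open>\<psi>\<close> for \<open>v\<close>.
  The Friedrichs extension is the operator associated with the closed form.
\<close>

definition form_approx ::
    "'a::euclidean_space set \<Rightarrow> ('a \<Rightarrow> complex) set \<Rightarrow> (('a \<Rightarrow> complex) \<Rightarrow> ('a \<Rightarrow> complex)) \<Rightarrow>
     (nat \<Rightarrow> 'a \<Rightarrow> complex) \<Rightarrow> ('a \<Rightarrow> complex) \<Rightarrow> bool" where
  "form_approx \<Omega> D A \<phi> u \<longleftrightarrow>
     u \<in> L2_space \<Omega> \<and> (\<forall>n. \<phi> n \<in> D) \<and>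
     (\<lambda>n. L2_norm \<Omega> (\<lambda>p. \<phi> n p - u p)) \<longlonglongrightarrow> 0 \<and>
     (\<forall>\<eta>>0. \<exists>N. \<forall>m\<ge>N. \<forall>n\<ge>N.
        cmod (L2_inner \<Omega> (A (\<lambda>p. \<phi> m p - \<phi> n p)) (\<lambda>p. \<phi> m p - \<phi> n p)) < \<eta>)"

definition friedrichs_extension ::
    "'a::euclidean_space set \<Rightarrow> ('a \<Rightarrow> complex) set \<Rightarrow> (('a \<Rightarrow> complex) \<Rightarrow> ('a \<Rightarrow> complex)) \<Rightarrow>
     (('a \<Rightarrow> complex) \<times> ('a \<Rightarrow> complex)) set" where
  "friedrichs_extension \<Omega> D A = {(u, f). f \<in> L2_space \<Omega> \<and>
     (\<exists>\<phi>. form_approx \<Omega> D A \<phi> u \<and>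
       (\<forall>v \<psi>. form_approx \<Omega> D A \<psi> v \<longrightarrow>
          (\<lambda>n. L2_inner \<Omega> (A (\<phi> n)) (\<psi> n)) \<longlonglongrightarrow> L2_inner \<Omega> f v))}"

text \<open>
  \<open>resolvent T z f\<close> is a solution \<open>u\<close> in the domain of \<open>T\<close> of \<open>T u - z u = f\<close>. For \<open>z\<close> outside the
  spectrum of \<open>T\<close> and \<open>f\<close> in \<open>L\<^sup>2(\<Omega>)\<close>, it exists and is unique up to null sets.
\<close>

definition resolvent ::
    "(('a \<Rightarrow> complex) \<times> ('a \<Rightarrow> complex)) set \<Rightarrow> complex \<Rightarrow> ('a \<Rightarrow> complex) \<Rightarrow> 'a \<Rightarrow> complex" where
  "resolvent T z f = (SOME u. (u, \<lambda>p. f p + z * u p) \<in> T)"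

section \<open>The Dirichlet Laplacian\<close>

primrec times_differentiable ::
    "nat \<Rightarrow> ('a::real_normed_vector \<Rightarrow> 'b::real_normed_vector) \<Rightarrow> bool" where
  "times_differentiable 0 f \<longleftrightarrow> continuous_on UNIV f"
| "times_differentiable (Suc k) f \<longleftrightarrow>
     (\<forall>p. f differentiable (at p)) \<and>
     (\<forall>v. times_differentiable k (\<lambda>p. frechet_derivative f (at p) v))"

definition smooth :: "('a::real_normed_vector \<Rightarrow> 'b::real_normed_vector) \<Rightarrow> bool" where
  "smooth f \<longleftrightarrow> (\<forall>k. times_differentiable k f)"

text \<open>The space \<open>C\<^sub>c\<^sup>\<infinity>(\<Omega>)\<close>; its elements are extended by zero.\<close>

definition test_functions :: "'a::euclidean_space set \<Rightarrow> ('a \<Rightarrow> complex) set" where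
  "test_functions \<Omega> = {\<phi>. smooth \<phi> \<and>
     compact (closure {p. \<phi> p \<noteq> 0}) \<and> closure {p. \<phi> p \<noteq> 0} \<subseteq> \<Omega>}"

definition laplacian :: "('a::euclidean_space \<Rightarrow> complex) \<Rightarrow> 'a \<Rightarrow> complex" where
  "laplacian \<phi> p =
     (\<Sum>b\<in>Basis. frechet_derivative (\<lambda>q. frechet_derivative \<phi> (at q) b) (at p) b)"

text \<open>The nonnegative operator \<open>-\<Delta>\<close>.\<close>

definition neg_dirichlet_laplacian ::
    "'a::euclidean_space set \<Rightarrow> (('a \<Rightarrow> complex) \<times> ('a \<Rightarrow> complex)) set" where
  "neg_dirichlet_laplacian \<Omega> =
     friedrichs_extension \<Omega> (test_functions \<Omega>) (\<lambda>\<phi> p. - laplacian \<phi> p)"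

definition weighted_resolvent ::
    "(real \<times> (real ^ 'n::finite)) set \<Rightarrow> real \<Rightarrow> complex \<Rightarrow>
     (real \<times> (real ^ 'n) \<Rightarrow> complex) \<Rightarrow> real \<times> (real ^ 'n) \<Rightarrow> complex" where
  "weighted_resolvent \<Omega> s z f =
     (let w = (\<lambda>p. complex_of_real ((1 + \<bar>fst p\<bar>) powr (- s)))
      in (\<lambda>p. w p * resolvent (neg_dirichlet_laplacian \<Omega>) z (\<lambda>q. w q * f q) p))"

end

theory Submission
  imports Defs
begin

text \<open>
  The proof is a positive commutator argument without boundary traces. Take an increasing bounded
  \<open>w\<close> with \<open>w 0 = 0\<close> and \<open>w' x\<close> of order \<open>\<bar>x\<bar> powr (- 1 - \<delta>)\<close> at infinity, and a small bump
  \<open>\<xi> \<ge> 0\<close> supported in \<open>I\<close>, and let \<open>\<Psi> t (x, y) = (x - t w(x), (1 - t \<xi>(x)) y)\<close>. The hypotheses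
  on the normals say that \<open>\<Psi> t\<close> maps the complement of \<open>\<Omega>\<close> into itself for small \<open>t \<ge> 0\<close>, so
  \<open>\<phi> \<circ> \<Psi> t\<close> is a test function on \<open>\<Omega>\<close> whenever \<open>\<phi>\<close> is one. The first variation in \<open>t\<close> of the form
  \<open>\<integral>|\<nabla>\<phi>|\<^sup>2 - E \<integral>|\<phi>|\<^sup>2\<close> along this flow, combined with the same form tested against a real
  multiple \<open>m(x) \<phi>\<close>, controls \<open>\<integral>w'|\<partial>\<^sub>x\<phi>|\<^sup>2 + E \<integral>\<xi>|\<phi>|\<^sup>2\<close>, and Hardy's inequality in \<open>x\<close> turns this
  into a bound for \<open>\<integral>(1 + |x|) powr (- 3 - \<delta>) |\<phi>|\<^sup>2\<close>: the bump covers, for large \<open>E\<close>, the interval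
  where the Hardy weight is negative.

  The solution \<open>u\<close> with data \<open>f\<close> is approximated in the form norm by test functions, \<open>t\<close> is kept fixed
  in this limit, and \<open>t \<rightarrow> 0\<close> is taken last. The factor \<open>E powr (1 / 2)\<close> comes from the term
  \<open>\<epsilon> \<parallel>u\<parallel> \<parallel>u \<circ> \<Psi> t - u\<parallel> / t\<close>, which is of order \<open>\<epsilon> \<parallel>u\<parallel> \<parallel>\<nabla>u\<parallel>\<close> and hence of order
  \<open>E powr (1 / 2) \<epsilon> \<parallel>u\<parallel>\<^sup>2\<close>, while \<open>\<epsilon> \<parallel>u\<parallel>\<^sup>2\<close> is bounded by the weighted norms of \<open>f\<close> and \<open>u\<close>.
\<close>

section \<open>Normals at points touched by an interior ball\<close>

text \<open>Elements of the Friedrichs domain are known only as form limits of test functions, so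
  the second derivatives up to the boundary that the classical multiplier identity uses are out of
  reach. The increment of \<open>\<phi>\<close> along \<open>\<Psi> t\<close> replaces them: it is
  an admissible test function, but only for \<open>t \<ge> 0\<close>, so identities become one-sided
  inequalities, and the sign of the boundary term is encoded in an inclusion of domains. The
  exponents come from two demands: \<open>w'\<close> must be integrable for \<open>w\<close> to be
  bounded, and Hardy's inequality costs two further powers. The multiplier \<open>m\<close> is the
  divergence of the field \<open>(w, \<xi> y)\<close> minus \<open>\<xi>\<close>. It removes
  \<open>E\<close> from every place except in front of \<open>\<xi>\<close>, and half of
  \<open>\<xi>\<close> stays in front of the y-gradient. The Hardy weight is centred inside
  \<open>I\<close> because its negative part has to lie where a large \<open>E\<close> can pay for
  it. As \<open>\<xi>\<close> depends on x, the flow mixes the derivatives; boundedness of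
  \<open>\<Omega>\<close> over \<open>I\<close> and the choice of \<open>\<xi>\<close> as a multiple
  of a square keep this mixing absorbable.\<close>

lemma graph_height_add:
  assumes "norm e = 1"
  shows "graph_height e \<gamma> (q + t *\<^sub>R e) = graph_height e \<gamma> q + t"
proof -
  have "e \<bullet> e = 1" using assms by (simp add: dot_square_norm)
  then show ?thesis by (simp add: graph_height_def algebra_simps)
qed

lemma graph_height_lipschitz:
  assumes e: "norm e = 1" and L: "L-lipschitz_on UNIV \<gamma>"
  shows "\<bar>graph_height e \<gamma> p - graph_height e \<gamma> q\<bar> \<le> (1 + 2 * L) * norm (p - q)"
proof -
  let ?P = "\<lambda>q. q - (q \<bullet> e) *\<^sub>R e"
  have ip: "\<bar>(p - q) \<bullet> e\<bar> \<le> norm (p - q)"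
    using Cauchy_Schwarz_ineq2[of "p - q" e] e by simp
  have "?P p - ?P q = (p - q) - ((p - q) \<bullet> e) *\<^sub>R e" by (simp add: algebra_simps)
  then have "norm (?P p - ?P q) \<le> norm (p - q) + \<bar>(p - q) \<bullet> e\<bar>"
    using norm_triangle_ineq4[of "p - q" "((p - q) \<bullet> e) *\<^sub>R e"] e by (metis mult.right_neutral norm_scaleR)
  then have P: "norm (?P p - ?P q) \<le> 2 * norm (p - q)" using ip by simp
  have L0: "L \<ge> 0" using L lipschitz_on_nonneg by blast
  have "\<bar>\<gamma> (?P p) - \<gamma> (?P q)\<bar> \<le> L * norm (?P p - ?P q)"
    using lipschitz_onD[OF L, of "?P p" "?P q"] by (simp add: dist_norm)
  also have "\<dots> \<le> L * (2 * norm (p - q))" using P L0 by (rule mult_left_mono)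
  finally have "\<bar>\<gamma> (?P p) - \<gamma> (?P q)\<bar> \<le> L * (2 * norm (p - q))" .
  then show ?thesis using ip by (simp add: graph_height_def inner_diff_left algebra_simps abs_if split: if_splits)
qed

text \<open>Sliding \<open>p + d\<close> along \<open>e\<close> onto the graph turns the tangency
  condition on boundary points into a first-order expansion of the height: the slid displacement is
  \<open>d\<close> minus the height of \<open>p + d\<close> times \<open>e\<close>, and its length
  is bounded by a multiple of that of \<open>d\<close> because the height is Lipschitz. The gradient
  is therefore the multiple of \<open>n\<close> whose product with \<open>e\<close> is 1.\<close>

lemma graph_height_differentiable:
  assumes e: "norm e = 1" and L: "L-lipschitz_on UNIV \<gamma>" and Hp: "graph_height e \<gamma> p = 0"
    and n: "n \<noteq> 0"
    and tan: "\<And>\<epsilon>. \<epsilon> > 0 \<Longrightarrow> \<exists>\<delta>>0. \<forall>d. norm d < \<delta> \<longrightarrow> graph_height e \<gamma> (p + d) = 0 \<longrightarrow> \<bar>n \<bullet> d\<bar> \<le> \<epsilon> * norm d"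
  shows "\<exists>D. GDERIV (graph_height e \<gamma>) p :> D"
proof -
  let ?H = "graph_height e \<gamma>"
  define M where "M = 1 + 2 * L"
  have L0: "L \<ge> 0" using L lipschitz_on_nonneg by blast
  then have M: "M \<ge> 1" by (simp add: M_def)
  have slide: "\<exists>\<delta>>0. \<forall>d. norm d < \<delta> \<longrightarrow> \<bar>n \<bullet> d - ?H (p + d) * (n \<bullet> e)\<bar> \<le> \<epsilon> * norm d"
    if \<epsilon>: "\<epsilon> > 0" for \<epsilon>
  proof -
    obtain \<delta> where \<delta>: "\<delta> > 0"
      "\<And>d. norm d < \<delta> \<Longrightarrow> ?H (p + d) = 0 \<Longrightarrow> \<bar>n \<bullet> d\<bar> \<le> \<epsilon> / (1 + M) * norm d"
      using tan[of "\<epsilon> / (1 + M)"] \<epsilon> M by auto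
    have "\<bar>n \<bullet> d - ?H (p + d) * (n \<bullet> e)\<bar> \<le> \<epsilon> * norm d" if d: "norm d < \<delta> / (1 + M)" for d
    proof -
      define d' where "d' = d + (- ?H (p + d)) *\<^sub>R e"
      have "\<bar>?H (p + d)\<bar> \<le> M * norm d"
        using graph_height_lipschitz[OF e L, of "p + d" p] Hp by (simp add: M_def)
      then have nd': "norm d' \<le> (1 + M) * norm d"
        unfolding d'_def using norm_triangle_ineq[of d "(- ?H (p + d)) *\<^sub>R e"] e
        by (simp add: algebra_simps)
      also have "\<dots> < \<delta>" using d M by (simp add: field_simps)
      finally have "norm d' < \<delta>" .
      moreover have "?H (p + d') = 0"
        unfolding d'_def using graph_height_add[OF e, of \<gamma> "p + d" "- ?H (p + d)"]
        by (simp add: algebra_simps)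
      ultimately have "\<bar>n \<bullet> d'\<bar> \<le> \<epsilon> / (1 + M) * norm d'" by (rule \<delta>(2))
      also have "\<dots> \<le> \<epsilon> / (1 + M) * ((1 + M) * norm d)"
        using nd' \<epsilon> M by (intro mult_left_mono) auto
      also have "\<dots> = \<epsilon> * norm d" using M by simp
      finally show ?thesis by (simp add: d'_def inner_diff_right)
    qed
    moreover have "\<delta> / (1 + M) > 0" using \<delta> M by simp
    ultimately show ?thesis by blast
  qed
  \<comment> \<open>If \<open>n\<close> were orthogonal to \<open>e\<close>, then
    \<open>slide\<close>, applied to a small multiple of \<open>n\<close>, would bound a positive
    number by its half.\<close>
  have ne: "n \<bullet> e \<noteq> 0"
  proof
    assume 0: "n \<bullet> e = 0"
    obtain \<delta> where \<delta>: "\<delta> > 0" "\<And>d. norm d < \<delta> \<Longrightarrow> \<bar>n \<bullet> d\<bar> \<le> norm n / 2 * norm d"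
      using slide[of "norm n / 2"] n 0 by auto
    define s where "s = \<delta> / (2 * norm n)"
    have s: "s > 0" using \<delta> n by (simp add: s_def)
    have "norm (s *\<^sub>R n) = \<delta> / 2" using n \<delta> by (simp add: s_def)
    then have "\<bar>n \<bullet> (s *\<^sub>R n)\<bar> \<le> norm n / 2 * norm (s *\<^sub>R n)" using \<delta> by (intro \<delta>(2)) simp
    then have "s * (norm n * norm n) \<le> s * (norm n * norm n) / 2"
      using s by (simp add: dot_square_norm power2_eq_square algebra_simps)
    moreover have "s * (norm n * norm n) > 0" using s n by simp
    ultimately show False by linarith
  qed
  define D where "D = (1 / (n \<bullet> e)) *\<^sub>R n"
  have "(?H has_derivative (\<lambda>h. h \<bullet> D)) (at p)"
    unfolding has_derivative_at_alt
  proof (intro conjI allI impI)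
    show "bounded_linear (\<lambda>h. h \<bullet> D)" by (rule bounded_linear_inner_left)
    fix \<epsilon> :: real assume \<epsilon>: "\<epsilon> > 0"
    obtain \<delta> where \<delta>: "\<delta> > 0"
      "\<And>d. norm d < \<delta> \<Longrightarrow> \<bar>n \<bullet> d - ?H (p + d) * (n \<bullet> e)\<bar> \<le> \<epsilon> * \<bar>n \<bullet> e\<bar> * norm d"
      using slide[of "\<epsilon> * \<bar>n \<bullet> e\<bar>"] \<epsilon> ne by auto
    have "norm (?H y - ?H p - (y - p) \<bullet> D) \<le> \<epsilon> * norm (y - p)" if y: "norm (y - p) < \<delta>" for y
    proof -
      have "\<bar>n \<bullet> (y - p) - ?H y * (n \<bullet> e)\<bar> \<le> \<epsilon> * \<bar>n \<bullet> e\<bar> * norm (y - p)"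
        using \<delta>(2)[OF y] by simp
      moreover have "n \<bullet> (y - p) - ?H y * (n \<bullet> e) = - (n \<bullet> e) * (?H y - ?H p - (y - p) \<bullet> D)"
        using ne Hp by (simp add: D_def inner_commute field_simps)
      ultimately have "\<bar>n \<bullet> e\<bar> * norm (?H y - ?H p - (y - p) \<bullet> D) \<le> \<bar>n \<bullet> e\<bar> * (\<epsilon> * norm (y - p))"
        by (simp only: abs_mult abs_minus real_norm_def mult_ac)
      then show ?thesis using ne by simp
    qed
    then show "\<exists>\<delta>>0. \<forall>y. norm (y - p) < \<delta> \<longrightarrow> norm (?H y - ?H p - (y - p) \<bullet> D) \<le> \<epsilon> * norm (y - p)"
      using \<delta>(1) by blast
  qed
  then show ?thesis unfolding gderiv_def by blast
qed

text \<open>Let \<open>k\<close> be the component of \<open>D\<close> orthogonal to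
  \<open>n\<close>. The vector \<open>- k\<close>, tilted by \<open>\<epsilon>\<close> times
  \<open>- n\<close>, lies in the open half space, and testing with it bounds
  \<open>k \<bullet> k\<close> by \<open>\<epsilon>\<close> times a constant for every
  \<open>\<epsilon>\<close>, so \<open>k\<close> vanishes.\<close>

lemma parallel_if_halfspace:
  fixes n D :: "'a::real_inner"
  assumes n: "norm n = 1" and le: "\<And>d. d \<bullet> n < 0 \<Longrightarrow> d \<bullet> D \<ge> 0"
  shows "D = - norm D *\<^sub>R n"
proof -
  define k where "k = D - (D \<bullet> n) *\<^sub>R n"
  have nn: "n \<bullet> n = 1" using n by (simp add: dot_square_norm)
  have kn: "k \<bullet> n = 0" by (simp add: k_def inner_diff_left nn)
  have kD: "k \<bullet> D = k \<bullet> k"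
    unfolding k_def by (simp add: inner_diff_left inner_diff_right nn inner_commute)
  have small: "k \<bullet> k \<le> \<epsilon> * \<bar>n \<bullet> D\<bar>" if "\<epsilon> > 0" for \<epsilon>
  proof -
    have "(- k - \<epsilon> *\<^sub>R n) \<bullet> D \<ge> 0"
      using that kn nn by (intro le) (simp add: inner_diff_left)
    then have "k \<bullet> k \<le> - (\<epsilon> * (n \<bullet> D))" using kD by (simp add: inner_diff_left)
    also have "\<dots> \<le> \<epsilon> * \<bar>n \<bullet> D\<bar>" using that by (metis abs_ge_minus_self abs_mult abs_of_pos)
    finally show ?thesis .
  qed
  have "k \<bullet> k \<le> 0"
  proof (rule ccontr)
    assume "\<not> k \<bullet> k \<le> 0"
    then have kk: "k \<bullet> k > 0" by linarith
    define \<epsilon> where "\<epsilon> = k \<bullet> k / (2 * (\<bar>n \<bullet> D\<bar> + 1))"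
    have "\<epsilon> > 0" using kk by (simp add: \<epsilon>_def add_nonneg_pos)
    then have "k \<bullet> k \<le> \<epsilon> * (\<bar>n \<bullet> D\<bar> + 1)" using small[of \<epsilon>] by (simp add: algebra_simps)
    also have "\<dots> = k \<bullet> k / 2" unfolding \<epsilon>_def by (simp add: field_simps)
    finally show False using kk by simp
  qed
  then have "k = 0" by (metis inner_gt_zero_iff linorder_not_le)
  then have Dn: "D = (D \<bullet> n) *\<^sub>R n" by (simp add: k_def)
  have "D \<bullet> n \<le> 0" using le[of "- n"] nn by (simp add: inner_commute)
  moreover have "norm D = \<bar>D \<bullet> n\<bar>" using arg_cong[OF Dn, of norm] n by simp
  ultimately show ?thesis using Dn by simp
qed

text \<open>The normal exists at every touching point, not merely almost everywhere; this makes the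
  hypotheses on normals usable at nearest points of the complement. The ball controls the boundary
  from one side. On the other side local convexity supplies a supporting hyperplane, while a
  \<open>C\<^sup>1\<^sup>,\<^sup>1\<close> hypersurface brings its own tangent plane. Either way the
  height is differentiable at \<open>p\<close>, and the ball then determines the direction of its
  gradient.\<close>

lemma frontier_touch_normal:
  fixes \<Omega> :: "'a::euclidean_space set"
  assumes op: "open \<Omega>" and lip: "lipschitz_boundary \<Omega>" and reg: "locally_convex_or_C11 \<Omega>"
    and pf: "p \<in> frontier \<Omega>" and B: "ball c (dist c p) \<subseteq> \<Omega>" and cp: "c \<noteq> p"
  shows "outward_unit_normal \<Omega> p ((1 / norm (p - c)) *\<^sub>R (p - c))"
proof -
  obtain U e \<gamma> where pU: "p \<in> U" and ch: "lipschitz_chart \<Omega> U e \<gamma>"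
    using lip pf unfolding lipschitz_boundary_def by blast
  then obtain L where oU: "open U" and e: "norm e = 1" and L: "L-lipschitz_on UNIV \<gamma>"
    and OU: "\<Omega> \<inter> U = {q \<in> U. 0 < graph_height e \<gamma> q}"
    unfolding lipschitz_chart_def by blast
  let ?H = "graph_height e \<gamma>"
  have OU_iff: "q \<in> \<Omega> \<longleftrightarrow> 0 < ?H q" if "q \<in> U" for q using OU that by blast
  define M where "M = 1 + 2 * L"
  have Hlip: "\<bar>?H x - ?H y\<bar> \<le> M * norm (x - y)" for x y
    unfolding M_def by (rule graph_height_lipschitz[OF e L])
  have M1: "M \<ge> 1" using lipschitz_on_nonneg[OF L] by (simp add: M_def)
  have pO: "p \<notin> \<Omega>" using pf op by (simp add: frontier_def interior_open)
  have frU: "q \<in> frontier \<Omega>" if q: "q \<in> U" "?H q = 0" for q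
  proof -
    have "q \<notin> \<Omega>" using OU_iff q by simp
    moreover have "q \<in> closure \<Omega>"
      unfolding closure_approachable
    proof (intro allI impI)
      fix \<epsilon> :: real assume \<epsilon>: "\<epsilon> > 0"
      obtain \<rho> where \<rho>: "\<rho> > 0" "ball q \<rho> \<subseteq> U" using oU q(1) open_contains_ball by blast
      define t where "t = min \<epsilon> \<rho> / 2"
      have t: "t > 0" "t < \<epsilon>" "t < \<rho>" using \<epsilon> \<rho> by (auto simp: t_def)
      have "q + t *\<^sub>R e \<in> U" using \<rho>(2) t e by (auto simp: dist_norm)
      moreover have "?H (q + t *\<^sub>R e) > 0" using graph_height_add[OF e, of \<gamma> q t] q t by simp
      ultimately have "q + t *\<^sub>R e \<in> \<Omega>" using OU by blast
      then show "\<exists>y\<in>\<Omega>. dist y q < \<epsilon>" using t e by (intro bexI[of _ "q + t *\<^sub>R e"]) (auto simp: dist_norm)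
    qed
    ultimately show ?thesis using op by (simp add: frontier_def interior_open)
  qed
  have frH: "?H q = 0" if q: "q \<in> U" "q \<in> frontier \<Omega>" for q
  proof -
    have "q \<notin> \<Omega>" using q op by (simp add: frontier_def interior_open)
    then have le: "?H q \<le> 0" using OU_iff q(1) by (simp add: not_less)
    have "\<not> ?H q < 0"
    proof
      assume neg: "?H q < 0"
      obtain \<rho> where \<rho>: "\<rho> > 0" "ball q \<rho> \<subseteq> U" using oU q(1) open_contains_ball by blast
      have "min \<rho> (- ?H q / M) > 0" using \<rho> neg M1 by (simp add: divide_neg_pos)
      then obtain y where y: "y \<in> \<Omega>" "dist y q < min \<rho> (- ?H q / M)"
        using q(2) unfolding frontier_def by (meson DiffD1 closure_approachable)
      then have "y \<in> U" using \<rho> by (auto simp: dist_commute)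
      then have "?H y > 0" using y OU by blast
      moreover have "M * norm (y - q) < - ?H q" using y(2) M1 by (simp add: dist_norm field_simps)
      ultimately show False using Hlip[of y q] by linarith
    qed
    then show ?thesis using le by simp
  qed
  have Hp: "?H p = 0" by (rule frH[OF pU pf])
  define \<rho> where "\<rho> = norm (p - c)"
  have \<rho>: "\<rho> > 0" using cp by (simp add: \<rho>_def)
  define n where "n = (1 / \<rho>) *\<^sub>R (p - c)"
  have n1: "norm n = 1" using \<rho> by (simp add: n_def \<rho>_def)
  have pcn: "p - c = \<rho> *\<^sub>R n" using \<rho> by (simp add: n_def)
  \<comment> \<open>Expansion of the squared distance to \<open>c\<close>: membership in the
    touching ball becomes a sign condition on a quadratic expression in \<open>d\<close>.\<close>
  have inball: "p + d \<in> \<Omega>" if "norm d ^ 2 + 2 * \<rho> * (n \<bullet> d) < 0" for d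
  proof -
    have "norm (p + d - c) ^ 2 = norm (d + \<rho> *\<^sub>R n) ^ 2" using pcn by (simp add: algebra_simps)
    also have "\<dots> = norm d ^ 2 + 2 * \<rho> * (n \<bullet> d) + \<rho> ^ 2 * (norm n)\<^sup>2"
      unfolding power2_norm_eq_inner by (simp add: inner_add_left inner_add_right inner_commute power2_eq_square)
    also have "\<dots> = norm d ^ 2 + 2 * \<rho> * (n \<bullet> d) + \<rho> ^ 2" using n1 by simp
    also have "\<dots> < \<rho> ^ 2" using that by simp
    finally have "norm (p + d - c) < \<rho>" using \<rho> by (simp add: power_less_imp_less_base)
    then have "p + d \<in> ball c (dist c p)" by (simp add: dist_norm \<rho>_def norm_minus_commute)
    then show ?thesis using B by blast
  qed
  obtain V where oV: "open V" and pV: "p \<in> V" and cases: "convex (V \<inter> \<Omega>) \<or> C11_hypersurface (V \<inter> frontier \<Omega>)"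
    using reg pf unfolding locally_convex_or_C11_def by blast
  have "open (U \<inter> V)" "p \<in> U \<inter> V" using oU oV pU pV by auto
  then obtain r where "r > 0" "ball p r \<subseteq> U \<inter> V" using open_contains_ball_eq by blast
  then have r: "r > 0" "ball p r \<subseteq> U" "ball p r \<subseteq> V" by auto
  have inr: "p + d \<in> U" "p + d \<in> V" if "norm d < r" for d
    using r that by (auto simp: dist_norm)
  have "\<exists>D. GDERIV ?H p :> D"
    using cases
  proof
    assume cv: "convex (V \<inter> \<Omega>)"
    have "p \<notin> V \<inter> \<Omega>" using pO by blast
    then obtain m k where m: "m \<noteq> 0" and mk: "\<And>x. x \<in> V \<inter> \<Omega> \<Longrightarrow> k \<le> m \<bullet> x" "m \<bullet> p \<le> k"
      using separating_hyperplane_sets[of "{p}" "V \<inter> \<Omega>"] cv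
    proof -
      have "V \<inter> \<Omega> \<noteq> {}"
        using pf oV pV unfolding frontier_def by (auto simp: closure_iff_nhds_not_empty)
      then show ?thesis using separating_hyperplane_sets[of "{p}" "V \<inter> \<Omega>"] cv \<open>p \<notin> V \<inter> \<Omega>\<close> that by auto
    qed
    have half: "m \<bullet> d \<ge> 0" if "p + d \<in> V \<inter> \<Omega>" for d
      using mk(1)[OF that] mk(2) by (simp add: inner_add_right)
    \<comment> \<open>Small multiples of \<open>d\<close> enter the ball and hence
      \<open>\<Omega>\<close>. So the half space of the supporting hyperplane contains that of the
      ball, and \<open>m\<close> is a negative multiple of \<open>n\<close>.\<close>
    have "d \<bullet> m \<ge> 0" if dn: "d \<bullet> n < 0" for d
    proof -
      have d0: "d \<noteq> 0" using dn by auto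
      define t where "t = min (r / (2 * norm d)) (\<rho> * - (n \<bullet> d) / norm d ^ 2)"
      have nd: "n \<bullet> d < 0" using dn by (simp add: inner_commute)
      have t: "t > 0" using r \<rho> d0 nd by (simp add: t_def divide_neg_pos mult_pos_neg)
      have "t \<le> r / (2 * norm d)" by (simp add: t_def)
      then have "norm (t *\<^sub>R d) \<le> r / 2" using t d0 by (simp add: field_simps)
      then have tr: "norm (t *\<^sub>R d) < r" using r by simp
      have "t \<le> \<rho> * - (n \<bullet> d) / norm d ^ 2" by (simp add: t_def)
      then have "t * norm d ^ 2 \<le> - (\<rho> * (n \<bullet> d))" using d0 by (simp add: field_simps)
      then have "t * (t * norm d ^ 2) \<le> t * - (\<rho> * (n \<bullet> d))" using t by (intro mult_left_mono) auto
      moreover have "t * (\<rho> * (n \<bullet> d)) < 0" using t \<rho> nd by (simp add: mult_pos_neg)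
      moreover have "norm (t *\<^sub>R d) ^ 2 = t * (t * norm d ^ 2)" by (simp add: power_mult_distrib power2_eq_square)
      ultimately have "norm (t *\<^sub>R d) ^ 2 + 2 * (t * (\<rho> * (n \<bullet> d))) < 0" by linarith
      then have "norm (t *\<^sub>R d) ^ 2 + 2 * \<rho> * (n \<bullet> (t *\<^sub>R d)) < 0" by (simp only: inner_scaleR_right mult_ac)
      then have "m \<bullet> (t *\<^sub>R d) \<ge> 0" using half inball inr(2)[OF tr] by blast
      then show ?thesis using t by (simp add: inner_commute zero_le_mult_iff)
    qed
    then have mn: "m = - norm m *\<^sub>R n" by (rule parallel_if_halfspace[OF n1])
    have halfn: "n \<bullet> d \<le> 0" if "p + d \<in> V \<inter> \<Omega>" for d
    proof -
      have "- norm m * (n \<bullet> d) \<ge> 0" using half[OF that] by (subst (asm) mn) simp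
      then show ?thesis using m by (simp add: mult_le_0_iff)
    qed
    show ?thesis
    proof (rule graph_height_differentiable[OF e L Hp])
      show "n \<noteq> 0" using n1 by auto
      fix \<epsilon> :: real assume \<epsilon>: "\<epsilon> > 0"
      show "\<exists>\<delta>>0. \<forall>d. norm d < \<delta> \<longrightarrow> ?H (p + d) = 0 \<longrightarrow> \<bar>n \<bullet> d\<bar> \<le> \<epsilon> * norm d"
      proof (intro exI conjI allI impI)
        show "min (r / 2) (2 * \<rho> * \<epsilon>) > 0" using r \<rho> \<epsilon> by simp
        fix d assume d: "norm d < min (r / 2) (2 * \<rho> * \<epsilon>)" and H0: "?H (p + d) = 0"
        have dr: "norm d < r" using d r by simp
        \<comment> \<open>A point of the graph is a limit of points of \<open>\<Omega>\<close> lying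
          above it in direction \<open>e\<close>, so the half space inequality holds there up to an
          arbitrarily small loss.\<close>
        have up: "n \<bullet> d \<le> \<sigma>" if \<sigma>: "\<sigma> > 0" for \<sigma>
        proof -
          define s where "s = min \<sigma> (r / 2)"
          have s: "s > 0" "s \<le> \<sigma>" "s \<le> r / 2" using \<sigma> r by (auto simp: s_def)
          have "norm (d + s *\<^sub>R e) < r" using norm_triangle_ineq[of d "s *\<^sub>R e"] e d s by simp
          from inr[OF this] have UV: "p + (d + s *\<^sub>R e) \<in> U" "p + (d + s *\<^sub>R e) \<in> V" .
          have "?H (p + (d + s *\<^sub>R e)) > 0"
            using graph_height_add[OF e, of \<gamma> "p + d" s] H0 s by (simp add: algebra_simps)
          then have "p + (d + s *\<^sub>R e) \<in> V \<inter> \<Omega>" using UV OU by blast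
          then have "n \<bullet> (d + s *\<^sub>R e) \<le> 0" by (rule halfn)
          then have "n \<bullet> d \<le> s * - (n \<bullet> e)" by (simp add: inner_add_right)
          also have "\<dots> \<le> s * 1"
            using Cauchy_Schwarz_ineq2[of n e] n1 e s by (intro mult_left_mono) auto
          finally show ?thesis using s by simp
        qed
        have "n \<bullet> d \<le> 0"
        proof (rule ccontr)
          assume "\<not> n \<bullet> d \<le> 0"
          then show False using up[of "n \<bullet> d / 2"] by simp
        qed
        \<comment> \<open>A boundary point cannot lie in the ball, so \<open>n \<bullet> d\<close>
          is at least \<open>- (norm d)\<^sup>2 / (2 * \<rho>)\<close>, which is of smaller order
          than \<open>norm d\<close>.\<close>
        moreover have "norm d ^ 2 + 2 * \<rho> * (n \<bullet> d) \<ge> 0"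
        proof (rule ccontr)
          assume "\<not> norm d ^ 2 + 2 * \<rho> * (n \<bullet> d) \<ge> 0"
          then have "p + d \<in> \<Omega>" using inball by simp
          then show False using OU_iff[OF inr(1)[OF dr]] H0 by simp
        qed
        moreover have "norm d ^ 2 \<le> (2 * \<rho> * \<epsilon>) * norm d"
          using d by (simp add: power2_eq_square mult_right_mono)
        ultimately have "2 * \<rho> * \<bar>n \<bullet> d\<bar> \<le> 2 * \<rho> * (\<epsilon> * norm d)" by (simp add: algebra_simps)
        then show "\<bar>n \<bullet> d\<bar> \<le> \<epsilon> * norm d" using \<rho> by simp
      qed
    qed
  next
    assume "C11_hypersurface (V \<inter> frontier \<Omega>)"
    moreover have "p \<in> V \<inter> frontier \<Omega>" using pf pV by blast
    ultimately obtain W e' \<gamma>' G where W: "open W" "p \<in> W" "norm e' = 1" "\<forall>v. GDERIV \<gamma>' v :> G v"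
      "V \<inter> frontier \<Omega> \<inter> W = {q \<in> W. graph_height e' \<gamma>' q = 0}"
      unfolding C11_hypersurface_def by meson
    let ?K = "graph_height e' \<gamma>'"
    let ?P = "\<lambda>q. q - (q \<bullet> e') *\<^sub>R e'"
    have e'e': "e' \<bullet> e' = 1" using W(3) by (simp add: dot_square_norm)
    \<comment> \<open>The gradient at \<open>p\<close> of the height over the second graph. Its
      direction \<open>e'\<close> may differ from \<open>e\<close>, so differentiability is carried
      over to \<open>?H\<close> through tangency of the common zero set.\<close>
    define D where "D = e' - ?P (G (?P p))"
    have "(\<gamma>' has_derivative (\<lambda>h. h \<bullet> G (?P p))) (at (?P p))"
      using W(4) by (simp add: gderiv_def)
    then have "(\<gamma>' \<circ> ?P has_derivative (\<lambda>h. h \<bullet> G (?P p)) \<circ> ?P) (at p)"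
      by (intro diff_chain_at) (auto intro!: derivative_eq_intros)
    then have "(?K has_derivative (\<lambda>h. h \<bullet> e' - ?P h \<bullet> G (?P p))) (at p)"
      unfolding graph_height_def by (auto intro!: derivative_eq_intros simp: o_def)
    moreover have "(\<lambda>h. h \<bullet> e' - ?P h \<bullet> G (?P p)) = (\<lambda>h. h \<bullet> D)"
      by (simp add: D_def inner_diff_left inner_diff_right inner_commute fun_eq_iff)
    ultimately have KD: "(?K has_derivative (\<lambda>h. h \<bullet> D)) (at p)" by simp
    have "D \<bullet> e' = 1" using e'e' by (simp add: D_def inner_diff_left inner_diff_right inner_commute)
    then have D0: "D \<noteq> 0" by auto
    have Kp: "?K p = 0" using W(5) W(2) pV pf by blast
    obtain r' where r': "r' > 0" "ball p r' \<subseteq> W" using W(1,2) open_contains_ball by blast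
    show ?thesis
    proof (rule graph_height_differentiable[OF e L Hp D0])
      fix \<epsilon> :: real assume \<epsilon>: "\<epsilon> > 0"
      obtain \<delta> where \<delta>: "\<delta> > 0" "\<And>y. norm (y - p) < \<delta> \<Longrightarrow> norm (?K y - ?K p - (y - p) \<bullet> D) \<le> \<epsilon> * norm (y - p)"
        using KD \<epsilon> unfolding has_derivative_at_alt by blast
      show "\<exists>\<delta>>0. \<forall>d. norm d < \<delta> \<longrightarrow> ?H (p + d) = 0 \<longrightarrow> \<bar>D \<bullet> d\<bar> \<le> \<epsilon> * norm d"
      proof (intro exI conjI allI impI)
        show "min \<delta> (min r r') > 0" using \<delta> r r' by simp
        fix d assume d: "norm d < min \<delta> (min r r')" and H0: "?H (p + d) = 0"
        have "p + d \<in> W" using d r' by (auto simp: dist_norm)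
        moreover have "p + d \<in> V \<inter> frontier \<Omega>" using inr[of d] d frU H0 by auto
        ultimately have "?K (p + d) = 0" using W(5) by blast
        then show "\<bar>D \<bullet> d\<bar> \<le> \<epsilon> * norm d" using \<delta>(2)[of "p + d"] d Kp by (simp add: inner_commute)
      qed
    qed
  qed
  then obtain D where D: "GDERIV ?H p :> D" by blast
  then have hd: "(?H has_derivative (\<lambda>h. h \<bullet> D)) (at p)" by (simp add: gderiv_def)
  have dir: "((\<lambda>t. ?H (p + t *\<^sub>R d)) has_real_derivative (d \<bullet> D)) (at 0)" for d
  proof -
    have h0: "(?H has_derivative (\<lambda>h. h \<bullet> D)) (at (p + 0 *\<^sub>R d))" using hd by simp
    have "(?H \<circ> (\<lambda>t. p + t *\<^sub>R d) has_derivative (\<lambda>h. h \<bullet> D) \<circ> (\<lambda>t. t *\<^sub>R d)) (at 0)"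
      by (rule diff_chain_at[where f = "\<lambda>t. p + t *\<^sub>R d", OF _ h0]) (auto intro!: derivative_eq_intros)
    then show ?thesis by (simp add: has_field_derivative_def o_def mult_commute_abs)
  qed
  have "e \<bullet> D = 1"
  proof -
    have "((\<lambda>t. t) has_real_derivative (e \<bullet> D)) (at 0)"
      using dir[of e] graph_height_add[OF e, of \<gamma> p] Hp by simp
    then show ?thesis using DERIV_unique DERIV_ident by blast
  qed
  then have D0: "D \<noteq> 0" by auto
  \<comment> \<open>Such directions enter the ball, where the height is positive; as it vanishes at
    \<open>p\<close>, it cannot decrease along \<open>d\<close>.\<close>
  have "d \<bullet> D \<ge> 0" if dn: "d \<bullet> n < 0" for d
  proof (rule ccontr)
    assume neg: "\<not> d \<bullet> D \<ge> 0"
    have d0: "d \<noteq> 0" using dn by auto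
    have nd: "n \<bullet> d < 0" using dn by (simp add: inner_commute)
    obtain \<delta> where \<delta>: "\<delta> > 0" "\<And>h. h > 0 \<Longrightarrow> h < \<delta> \<Longrightarrow> ?H (p + h *\<^sub>R d) < ?H p"
      using DERIV_neg_dec_right[OF dir[of d]] neg by auto
    define t where "t = min (\<delta> / 2) (min (r / (2 * norm d)) (\<rho> * - (n \<bullet> d) / norm d ^ 2))"
    have t: "t > 0" using r \<rho> d0 nd \<delta> by (simp add: t_def divide_neg_pos mult_pos_neg)
    have t\<delta>: "t < \<delta>" using \<delta> by (auto simp: t_def min_less_iff_disj)
    have "t \<le> r / (2 * norm d)" by (simp add: t_def)
    then have "norm (t *\<^sub>R d) \<le> r / 2" using t d0 by (simp add: field_simps)
    then have tr: "norm (t *\<^sub>R d) < r" using r by simp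
    have "t \<le> \<rho> * - (n \<bullet> d) / norm d ^ 2" by (simp add: t_def)
    then have "t * norm d ^ 2 \<le> - (\<rho> * (n \<bullet> d))" using d0 by (simp add: field_simps)
    then have "t * (t * norm d ^ 2) \<le> t * - (\<rho> * (n \<bullet> d))" using t by (intro mult_left_mono) auto
    moreover have "t * (\<rho> * (n \<bullet> d)) < 0" using t \<rho> nd by (simp add: mult_pos_neg)
    moreover have "norm (t *\<^sub>R d) ^ 2 = t * (t * norm d ^ 2)" by (simp add: power_mult_distrib power2_eq_square)
    ultimately have "norm (t *\<^sub>R d) ^ 2 + 2 * (t * (\<rho> * (n \<bullet> d))) < 0" by linarith
      then have "norm (t *\<^sub>R d) ^ 2 + 2 * \<rho> * (n \<bullet> (t *\<^sub>R d)) < 0" by (simp only: inner_scaleR_right mult_ac)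
    then have "p + t *\<^sub>R d \<in> \<Omega>" by (rule inball)
    then have "?H (p + t *\<^sub>R d) > 0" using OU_iff[OF inr(1)[OF tr]] by simp
    then show False using \<delta>(2)[OF t t\<delta>] Hp by simp
  qed
  then have Dn: "D = - norm D *\<^sub>R n" by (rule parallel_if_halfspace[OF n1])
  have "n = - (1 / norm D) *\<^sub>R D" by (subst (2) Dn) (use D0 in simp)
  then have "(1 / norm (p - c)) *\<^sub>R (p - c) = - (1 / norm D) *\<^sub>R D" unfolding n_def \<rho>_def .
  with pf pU ch D show ?thesis unfolding outward_unit_normal_def by (intro conjI exI)
qed

text \<open>
  Up to the first exit, the nearest points of the complement are touched by interior balls, so the
  hypothesis prevents the distance to the complement from decreasing along the segment.
\<close>

lemma segment_in_open_if_touch_monotone: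
  fixes \<Omega> :: "'a::euclidean_space set"
  assumes op: "open \<Omega>" and q: "q \<in> \<Omega>" and \<rho>: "\<rho> > 0"
    and mono: "\<And>s p c. \<lbrakk>0 \<le> s; s \<le> 1; p \<in> frontier \<Omega>; dist p (q + s *\<^sub>R v) < \<rho>;
      ball c (dist c p) \<subseteq> \<Omega>; c \<in> \<Omega>\<rbrakk> \<Longrightarrow> v \<bullet> (p - c) \<le> 0"
  shows "q + v \<in> \<Omega>"
proof (rule ccontr)
  assume out: "q + v \<notin> \<Omega>"
  define T where "T = {s \<in> {0..1}. q + s *\<^sub>R v \<notin> \<Omega>}"
  have "closed T"
  proof -
    have "T = {0..1} \<inter> (\<lambda>s. q + s *\<^sub>R v) -` (- \<Omega>)" by (auto simp: T_def)
    moreover have "closed ((\<lambda>s. q + s *\<^sub>R v) -` (- \<Omega>))"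
      using op by (intro continuous_closed_vimage) (auto simp: closed_Compl)
    ultimately show ?thesis by (simp add: closed_Int)
  qed
  moreover have "1 \<in> T" using out by (simp add: T_def)
  moreover have "bdd_below T" by (rule bdd_belowI[of _ 0]) (auto simp: T_def)
  ultimately have InfT: "Inf T \<in> T" by (intro closed_contains_Inf) auto
  define \<tau> where "\<tau> = Inf T"
  have \<tau>1: "0 \<le> \<tau>" "\<tau> \<le> 1" "q + \<tau> *\<^sub>R v \<notin> \<Omega>" using InfT by (auto simp: T_def \<tau>_def)
  have before: "q + s *\<^sub>R v \<in> \<Omega>" if "0 \<le> s" "s < \<tau>" for s
  proof (rule ccontr)
    assume "q + s *\<^sub>R v \<notin> \<Omega>"
    then have "s \<in> T" using that \<tau>1 by (simp add: T_def)
    then have "\<tau> \<le> s" unfolding \<tau>_def using \<open>bdd_below T\<close> by (rule cInf_lower)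
    then show False using that by simp
  qed
  have \<tau>0: "\<tau> > 0" using \<tau>1 q by (cases "\<tau> = 0") auto
  define d where "d s = infdist (q + s *\<^sub>R v) (- \<Omega>)" for s
  have ne: "- \<Omega> \<noteq> {}" using out by blast
  have cl: "closed (- \<Omega>)" using op by (simp add: closed_Compl)
  \<comment> \<open>Only the last stretch before the exit time \<open>\<tau>\<close> is used. There
    the distance to the complement is at most \<open>(\<tau> - s) * norm v\<close>, which is below
    \<open>\<rho>\<close>, so nearest points fall into the range of \<open>mono\<close>.\<close>
  define s1 where "s1 = max 0 (\<tau> - \<rho> / (2 * (norm v + 1)))"
  have s1: "0 \<le> s1" "s1 < \<tau>"
    using \<tau>0 \<rho> by (auto simp: s1_def add_nonneg_pos)
  have near: "(\<tau> - s) * norm v < \<rho>" if "s1 \<le> s" for s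
  proof -
    have "norm v + 1 > 0" by (simp add: add_nonneg_pos)
    have "\<tau> - s \<le> \<rho> / (2 * (norm v + 1))" using that by (simp add: s1_def)
    then have "(\<tau> - s) * norm v \<le> \<rho> / (2 * (norm v + 1)) * norm v" by (rule mult_right_mono) simp
    also have "\<dots> = \<rho> * (norm v / (2 * (norm v + 1)))" by simp
    also have "\<dots> < \<rho> * 1"
    proof (intro mult_strict_left_mono)
      have "x < 2 * (x + 1)" if "x \<ge> 0" for x :: real using that by simp
      from this[OF norm_ge_zero] have "norm v < 2 * (norm v + 1)" .
      then show "norm v / (2 * (norm v + 1)) < 1"
        using \<open>norm v + 1 > 0\<close> by (subst divide_less_eq_1_pos) auto
    qed (use \<rho> in simp)
    also have "\<dots> = \<rho>" by simp
    finally show ?thesis .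
  qed
  \<comment> \<open>Let \<open>p\<close> be a point of the complement nearest to the later position
    \<open>c\<close>. Going back along the segment, the first-order change of the squared distance
    to \<open>p\<close> is a nonnegative multiple of \<open>v \<bullet> (p - c)\<close>, hence not
    positive; only the quadratic term remains.\<close>
  have step: "(d s)\<^sup>2 \<le> (d s')\<^sup>2 + (s' - s)\<^sup>2 * (norm v)\<^sup>2" if s: "s1 \<le> s" "s \<le> s'" "s' \<le> \<tau>" for s s'
  proof -
    define c where "c = q + s' *\<^sub>R v"
    obtain p where p: "p \<in> - \<Omega>" "infdist c (- \<Omega>) = dist c p"
      using infdist_attains_inf[OF cl ne] by blast
    have dd: "d s' = dist c p" using p by (simp add: d_def c_def)
    have vp: "v \<bullet> (p - c) \<le> 0"
    proof (cases "s' = \<tau>")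
      case True
      then have "d s' = 0" using \<tau>1 by (simp add: d_def)
      then show ?thesis using dd by simp
    next
      case False
      then have c\<Omega>: "c \<in> \<Omega>" using before[of s'] s s1 by (simp add: c_def)
      have B: "ball c (dist c p) \<subseteq> \<Omega>"
      proof
        fix x assume x: "x \<in> ball c (dist c p)"
        show "x \<in> \<Omega>"
        proof (rule ccontr)
          assume "x \<notin> \<Omega>"
          then have "infdist c (- \<Omega>) \<le> dist c x" by (intro infdist_le) auto
          then show False using x p by simp
        qed
      qed
      have "p \<noteq> c" using c\<Omega> p by auto
      then have "p \<in> closure (ball c (dist c p))" by (simp add: closure_ball)
      then have "p \<in> closure \<Omega>" using B closure_mono by blast
      then have "p \<in> frontier \<Omega>" using p op by (simp add: frontier_def interior_open)
      moreover have "dist p (q + s' *\<^sub>R v) < \<rho>"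
      proof -
        have "dist c p \<le> dist c (q + \<tau> *\<^sub>R v)" unfolding p(2)[symmetric] using \<tau>1 by (intro infdist_le) auto
        also have "\<dots> = (\<tau> - s') * norm v"
          using s by (simp add: c_def dist_norm flip: scaleR_diff_left)
        also have "\<dots> < \<rho>" using near[of s'] s by simp
        finally show ?thesis by (simp add: c_def dist_commute)
      qed
      moreover have "0 \<le> s'" "s' \<le> 1" using s s1 \<tau>1 by auto
      ultimately show ?thesis using mono[OF _ _ _ _ B c\<Omega>, of s'] by blast
    qed
    have "d s \<le> dist (q + s *\<^sub>R v) p" unfolding d_def using p by (intro infdist_le) auto
    then have "(d s)\<^sup>2 \<le> (norm (p - c + (s' - s) *\<^sub>R v))\<^sup>2"
      by (intro power_mono) (auto simp: d_def infdist_nonneg c_def dist_norm algebra_simps norm_minus_commute)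
    also have "\<dots> = (norm (p - c))\<^sup>2 + 2 * (s' - s) * (v \<bullet> (p - c)) + (s' - s)\<^sup>2 * (norm v)\<^sup>2"
    proof -
      have "(norm (a + h *\<^sub>R v))\<^sup>2 = (norm a)\<^sup>2 + 2 * h * (v \<bullet> a) + h\<^sup>2 * (norm v)\<^sup>2" for a :: 'a and h :: real
      proof -
        have "(a + h *\<^sub>R v) \<bullet> (a + h *\<^sub>R v) = a \<bullet> a + 2 * h * (v \<bullet> a) + h * h * (v \<bullet> v)"
          by (simp add: inner_add_left inner_add_right inner_commute[of a v] algebra_simps)
        then show ?thesis by (simp only: power2_norm_eq_inner power2_eq_square[of h])
      qed
      then show ?thesis .
    qed
    also have "\<dots> \<le> (norm (p - c))\<^sup>2 + (s' - s)\<^sup>2 * (norm v)\<^sup>2"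
      using vp s by (simp add: mult_nonneg_nonpos)
    finally show ?thesis using dd by (simp add: dist_norm norm_minus_commute)
  qed
  \<comment> \<open>With \<open>N\<close> equal steps the quadratic errors add up to order
    \<open>1 / N\<close>. In the limit the distance at \<open>s1\<close> is zero, although that
    point still lies in \<open>\<Omega>\<close>.\<close>
  have "(d s1)\<^sup>2 \<le> ((\<tau> - s1)\<^sup>2 * (norm v)\<^sup>2) / real N" if N: "N > 0" for N :: nat
  proof -
    define h where "h = (\<tau> - s1) / real N"
    have h: "h \<ge> 0" "real N * h = \<tau> - s1" using s1 N by (auto simp: h_def)
    have "(d s1)\<^sup>2 \<le> (d (s1 + real k * h))\<^sup>2 + real k * (h\<^sup>2 * (norm v)\<^sup>2)" if "k \<le> N" for k
      using that
    proof (induction k)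
      case 0 then show ?case by simp
    next
      case (Suc k)
      have "real (Suc k) * h \<le> real N * h" using Suc.prems h by (intro mult_right_mono) auto
      then have "(d (s1 + real k * h))\<^sup>2 \<le> (d (s1 + real (Suc k) * h))\<^sup>2
          + (s1 + real (Suc k) * h - (s1 + real k * h))\<^sup>2 * (norm v)\<^sup>2"
        using h by (intro step) (auto simp: algebra_simps)
      also have "s1 + real (Suc k) * h - (s1 + real k * h) = h" by (simp add: algebra_simps)
      finally show ?case using Suc by (simp add: algebra_simps)
    qed
    from this[of N] have "(d s1)\<^sup>2 \<le> (d \<tau>)\<^sup>2 + real N * (h\<^sup>2 * (norm v)\<^sup>2)" using h by simp
    moreover have "d \<tau> = 0" using \<tau>1 by (simp add: d_def)
    moreover have "real N * h\<^sup>2 = (\<tau> - s1)\<^sup>2 / real N" using N by (simp add: h_def power2_eq_square)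
    ultimately show ?thesis by (simp flip: mult.assoc)
  qed
  note bound = this
  have lim: "(\<lambda>N. ((\<tau> - s1)\<^sup>2 * (norm v)\<^sup>2) / real N) \<longlonglongrightarrow> 0" by (rule lim_const_over_n)
  have "\<exists>N. \<forall>n\<ge>N. (d s1)\<^sup>2 \<le> ((\<tau> - s1)\<^sup>2 * (norm v)\<^sup>2) / real n"
    using bound by (intro exI[of _ 1]) auto
  then have "(d s1)\<^sup>2 \<le> 0" using LIMSEQ_le_const[OF lim] by blast
  then have "d s1 = 0" by simp
  then have "q + s1 *\<^sub>R v \<in> - \<Omega>"
    unfolding d_def using in_closed_iff_infdist_zero[OF cl ne] by blast
  then show False using before[of s1] s1 by simp
qed

text \<open>\<open>v\<close> points away from the hyperplane x = 0, so by the sign of the normals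
  its first component never pushes outward. Over \<open>J\<close> the surplus \<open>c\<close> pays
  for a y-component of relative size up to \<open>c\<close>.\<close>

lemma shift_in_domain:
  fixes \<Omega> :: "(real \<times> 'b::euclidean_space) set"
  assumes op: "open \<Omega>" and lip: "lipschitz_boundary \<Omega>" and reg: "locally_convex_or_C11 \<Omega>"
    and sgn: "\<And>p n. outward_unit_normal \<Omega> p n \<Longrightarrow> fst p * fst n \<le> 0"
    and J: "open J" and c: "c \<ge> 0"
    and sgnJ: "\<And>p n. fst p \<in> J \<Longrightarrow> outward_unit_normal \<Omega> p n \<Longrightarrow> \<bar>fst p\<bar> * c \<le> - (fst p * fst n)"
    and q: "q \<in> \<Omega>" and v: "fst q * fst v > 0"
    and vy: "snd v = 0 \<or> ((\<forall>s\<in>{0..1}. fst q + s * fst v \<in> J) \<and> norm (snd v) \<le> c * \<bar>fst v\<bar>)"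
  shows "q + v \<in> \<Omega>"
proof -
  \<comment> \<open>\<open>\<rho>\<close> keeps the touching points on the side of x = 0 on which
    \<open>q\<close> lies, and over \<open>J\<close> when \<open>v\<close> has a
    y-component.\<close>
  have "\<exists>\<rho>>0. \<rho> \<le> \<bar>fst q\<bar> \<and> (snd v \<noteq> 0 \<longrightarrow> (\<forall>s\<in>{0..1}. \<forall>x. dist x (fst q + s * fst v) < \<rho> \<longrightarrow> x \<in> J))"
  proof (cases "snd v = 0")
    case True
    then show ?thesis using v by (intro exI[of _ "\<bar>fst q\<bar>"]) auto
  next
    case False
    have "compact ((\<lambda>s. fst q + s * fst v) ` {0..1})" by (intro compact_continuous_image continuous_intros) auto
    moreover have "(\<lambda>s. fst q + s * fst v) ` {0..1} \<subseteq> J" using vy False by auto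
    ultimately obtain e where e: "e > 0" "(\<Union>x\<in>(\<lambda>s. fst q + s * fst v) ` {0..1}. cball x e) \<subseteq> J"
      using compact_subset_open_imp_cball_epsilon_subset[OF _ J] by blast
    show ?thesis
      using e v by (intro exI[of _ "min e \<bar>fst q\<bar>"]) (force simp: dist_commute)
  qed
  then obtain \<rho> where \<rho>: "\<rho> > 0" "\<rho> \<le> \<bar>fst q\<bar>"
    "\<And>s x. \<lbrakk>snd v \<noteq> 0; 0 \<le> s; s \<le> 1; dist x (fst q + s * fst v) < \<rho>\<rbrakk> \<Longrightarrow> x \<in> J"
    by auto
  show ?thesis
  proof (rule segment_in_open_if_touch_monotone[OF op q \<rho>(1)])
    fix s p c0 assume s: "0 \<le> s" "s \<le> 1" and p: "p \<in> frontier \<Omega>" and near: "dist p (q + s *\<^sub>R v) < \<rho>"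
      and B: "ball c0 (dist c0 p) \<subseteq> \<Omega>" and c0: "c0 \<in> \<Omega>"
    have "p \<notin> \<Omega>" using p op by (simp add: frontier_def interior_open)
    then have ne: "c0 \<noteq> p" using c0 by auto
    define n where "n = (1 / norm (p - c0)) *\<^sub>R (p - c0)"
    have N: "outward_unit_normal \<Omega> p n"
      unfolding n_def by (rule frontier_touch_normal[OF op lip reg p B ne])
    have n1: "norm n = 1" using ne by (simp add: n_def)
    have snd_n: "norm (snd n) \<le> 1" using norm_snd_le[of "snd n" "fst n"] n1 by simp
    have dx: "dist (fst p) (fst q + s * fst v) < \<rho>"
      using dist_fst_le[of p "q + s *\<^sub>R v"] near by simp
    have "\<bar>fst p - (fst q + s * fst v)\<bar> < \<bar>fst q\<bar>" using dx \<rho>(2) by (simp add: dist_real_def)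
    consider "fst q > 0" "fst v > 0" | "fst q < 0" "fst v < 0" using v by (auto simp: zero_less_mult_iff)
    then have sp: "fst p * fst v > 0"
    proof cases
      case 1
      then have "s * fst v \<ge> 0" using s by simp
      then have "fst p > 0" using 1 \<open>\<bar>fst p - (fst q + s * fst v)\<bar> < \<bar>fst q\<bar>\<close> by linarith
      then show ?thesis using 1 by simp
    next
      case 2
      then have "s * fst v \<le> 0" using s by (simp add: mult_nonneg_nonpos)
      then have "fst p < 0" using 2 \<open>\<bar>fst p - (fst q + s * fst v)\<bar> < \<bar>fst q\<bar>\<close> by linarith
      then show ?thesis using 2 by (simp add: mult_neg_neg)
    qed
    have le0: "fst p * fst n \<le> 0" by (rule sgn[OF N])
    have "v \<bullet> n \<le> 0"
    proof (cases "snd v = 0")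
      case True
      then have "v \<bullet> n = fst v * fst n" by (simp add: inner_prod_def)
      then show ?thesis using le0 sp by (auto simp: mult_le_0_iff zero_less_mult_iff)
    next
      case False
      then have "fst p \<in> J" using \<rho>(3)[OF False s dx] by simp
      then have cn: "\<bar>fst p\<bar> * c \<le> - (fst p * fst n)" using sgnJ N by blast
      then have "\<bar>fst v\<bar> * c \<le> - (fst v * fst n)"
      proof (cases "fst p > 0")
        case True
        then have "fst p * c \<le> fst p * - fst n" using cn by simp
        then have "c \<le> - fst n" using True mult_le_cancel_left_pos by blast
        moreover have "fst v > 0" using sp True by (simp add: zero_less_mult_iff)
        ultimately show ?thesis using mult_left_mono[of c "- fst n" "fst v"] by simp
      next
        case f: False
        then have neg: "fst p < 0" "fst v < 0" using sp by (auto simp: zero_less_mult_iff)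
        then have "- fst p * c \<le> - fst p * fst n" using cn by simp
        then have "c \<le> fst n" using neg mult_le_cancel_left_pos[of "- fst p" c "fst n"] by simp
        then show ?thesis using neg mult_left_mono[of c "fst n" "- fst v"] by simp
      qed
      moreover have "snd v \<bullet> snd n \<le> norm (snd v) * 1"
        using norm_cauchy_schwarz[of "snd v" "snd n"] mult_left_mono[OF snd_n, of "norm (snd v)"] by simp
      moreover have "norm (snd v) \<le> c * \<bar>fst v\<bar>" using vy False by simp
      ultimately show ?thesis by (simp add: inner_prod_def mult.commute)
    qed
    then show "v \<bullet> (p - c0) \<le> 0"
      using ne by (simp add: n_def divide_le_0_iff mult_le_0_iff zero_le_divide_iff not_le)
  qed
qed

section \<open>Smooth functions\<close>

lemma times_differentiable_continuous: "times_differentiable k f \<Longrightarrow> continuous_on UNIV f"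
  by (cases k) (auto simp: continuous_on_eq_continuous_at intro: differentiable_imp_continuous_within)

lemma times_differentiable_SucI:
  assumes "\<And>p. (f has_derivative F p) (at p)" "\<And>v. times_differentiable k (\<lambda>p. F p v)"
  shows "times_differentiable (Suc k) f"
proof -
  have "frechet_derivative f (at p) = F p" for p using frechet_derivative_at[OF assms(1)] by simp
  then show ?thesis using assms by (auto simp: differentiable_def)
qed

lemma times_differentiable_SucD: "times_differentiable (Suc k) f \<Longrightarrow> times_differentiable k f"
proof (induction k arbitrary: f)
  case 0
  then show ?case
    by (auto simp: continuous_on_eq_continuous_at intro: differentiable_imp_continuous_within)
next
  case (Suc k)
  then show ?case by (metis times_differentiable.simps(2))
qed

lemma times_differentiable_derivative:
  "times_differentiable (Suc k) f \<Longrightarrow> (f has_derivative frechet_derivative f (at p)) (at p)"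
  by (simp add: frechet_derivative_works)

lemma times_differentiable_const: "times_differentiable k (\<lambda>_. c)"
proof (induction k arbitrary: c)
  case (Suc k)
  show ?case by (rule times_differentiable_SucI[where F = "\<lambda>_ _. 0"]) (auto intro: Suc)
qed auto

lemma times_differentiable_add:
  "times_differentiable k f \<Longrightarrow> times_differentiable k g \<Longrightarrow> times_differentiable k (\<lambda>p. f p + g p)"
proof (induction k arbitrary: f g)
  case 0
  then show ?case by (auto intro: continuous_intros)
next
  case (Suc k)
  show ?case
    by (rule times_differentiable_SucI[where F = "\<lambda>p v. frechet_derivative f (at p) v + frechet_derivative g (at p) v"])
      (use Suc in \<open>auto intro!: has_derivative_add simp: frechet_derivative_works\<close>)
qed

lemma times_differentiable_sum:
  "(\<And>i. i \<in> S \<Longrightarrow> times_differentiable k (f i)) \<Longrightarrow> times_differentiable k (\<lambda>p. \<Sum>i\<in>S. f i p)"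
  by (induction S rule: infinite_finite_induct) (simp_all add: times_differentiable_const times_differentiable_add)

lemma times_differentiable_bilinear:
  assumes "bounded_bilinear pr"
  shows "times_differentiable k f \<Longrightarrow> times_differentiable k g \<Longrightarrow> times_differentiable k (\<lambda>p. pr (f p) (g p))"
proof (induction k arbitrary: f g)
  case 0
  then show ?case by (auto intro: bounded_bilinear.continuous_on[OF assms])
next
  case (Suc k)
  show ?case
  proof (rule times_differentiable_SucI)
    show "((\<lambda>p. pr (f p) (g p)) has_derivative
        (\<lambda>v. pr (f p) (frechet_derivative g (at p) v) + pr (frechet_derivative f (at p) v) (g p))) (at p)" for p
      by (rule bounded_bilinear.FDERIV[OF assms times_differentiable_derivative[OF Suc.prems(1)]
            times_differentiable_derivative[OF Suc.prems(2)]])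
    show "times_differentiable k (\<lambda>p. pr (f p) (frechet_derivative g (at p) v) + pr (frechet_derivative f (at p) v) (g p))" for v
      using Suc.prems by (intro times_differentiable_add Suc.IH)
        (simp_all add: times_differentiable_SucD[OF Suc.prems(1)] times_differentiable_SucD[OF Suc.prems(2)])
  qed
qed

lemma times_differentiable_linear:
  assumes h: "bounded_linear h"
  shows "times_differentiable k f \<Longrightarrow> times_differentiable k (\<lambda>p. h (f p))"
proof (induction k arbitrary: f)
  case 0
  then show ?case by (auto intro: bounded_linear.continuous_on[OF h])
next
  case (Suc k)
  show ?case
    by (rule times_differentiable_SucI[where F = "\<lambda>p v. h (frechet_derivative f (at p) v)"])
      (use Suc in \<open>auto intro!: bounded_linear.has_derivative[OF h] simp: frechet_derivative_works\<close>)
qed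

lemma times_differentiable_ident: "times_differentiable k (\<lambda>p. p)"
  by (cases k) (auto intro: times_differentiable_const simp flip: frechet_derivative_at[OF has_derivative_ident])

text \<open>\<open>times_differentiable\<close> looks at derivatives in fixed directions only,
  whereas the chain rule produces a direction that depends on the point. Expanding it in
  \<open>Basis\<close> restores fixed directions, at the price of scalar factors covered by the
  product rule.\<close>

lemma times_differentiable_compose:
  fixes f :: "'b::euclidean_space \<Rightarrow> 'c::real_normed_vector" and g :: "'a::real_normed_vector \<Rightarrow> 'b"
  shows "times_differentiable k f \<Longrightarrow> times_differentiable k g \<Longrightarrow> times_differentiable k (\<lambda>p. f (g p))"
proof (induction k arbitrary: f g)
  case 0
  then show ?case by (auto intro: continuous_on_compose2)
next
  case (Suc k)
  have lin: "frechet_derivative f (at q) w = (\<Sum>b\<in>Basis. (w \<bullet> b) *\<^sub>R frechet_derivative f (at q) b)" for q w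
  proof -
    have "linear (frechet_derivative f (at q))"
      using times_differentiable_derivative[OF Suc.prems(1)] has_derivative_linear by blast
    then have "frechet_derivative f (at q) (\<Sum>b\<in>Basis. (w \<bullet> b) *\<^sub>R b) = (\<Sum>b\<in>Basis. (w \<bullet> b) *\<^sub>R frechet_derivative f (at q) b)"
      by (simp add: linear_sum linear_scale)
    then show ?thesis by (simp add: euclidean_representation)
  qed
  show ?case
  proof (rule times_differentiable_SucI)
    show "((\<lambda>p. f (g p)) has_derivative (\<lambda>v. \<Sum>b\<in>Basis. (frechet_derivative g (at p) v \<bullet> b) *\<^sub>R frechet_derivative f (at (g p)) b)) (at p)" for p
    proof -
      have "(f \<circ> g has_derivative frechet_derivative f (at (g p)) \<circ> frechet_derivative g (at p)) (at p)"
        using Suc.prems by (intro diff_chain_at times_differentiable_derivative[where k = k])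
      moreover have "frechet_derivative f (at (g p)) \<circ> frechet_derivative g (at p)
          = (\<lambda>v. \<Sum>b\<in>Basis. (frechet_derivative g (at p) v \<bullet> b) *\<^sub>R frechet_derivative f (at (g p)) b)"
        by (rule ext, unfold o_def, rule lin)
      ultimately show ?thesis by (simp add: o_def)
    qed
    show "times_differentiable k (\<lambda>p. \<Sum>b\<in>Basis. (frechet_derivative g (at p) v \<bullet> b) *\<^sub>R frechet_derivative f (at (g p)) b)" for v
    proof (intro times_differentiable_sum times_differentiable_bilinear[OF bounded_bilinear_scaleR])
      fix b :: 'b
      show "times_differentiable k (\<lambda>p. frechet_derivative g (at p) v \<bullet> b)"
        using Suc.prems by (intro times_differentiable_linear[OF bounded_linear_inner_left]) auto
      show "times_differentiable k (\<lambda>p. frechet_derivative f (at (g p)) b)"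
        using Suc.IH[of "\<lambda>q. frechet_derivative f (at q) b" g] Suc.prems times_differentiable_SucD by auto
    qed
  qed
qed

lemma smooth_continuous: "smooth f \<Longrightarrow> continuous_on UNIV f"
  unfolding smooth_def using times_differentiable_continuous by blast

lemma smooth_has_derivative: "smooth f \<Longrightarrow> (f has_derivative frechet_derivative f (at p)) (at p)"
  unfolding smooth_def using times_differentiable_derivative by blast

lemma smooth_derivative: "smooth f \<Longrightarrow> smooth (\<lambda>p. frechet_derivative f (at p) v)"
  unfolding smooth_def using times_differentiable.simps(2) by blast

lemma smooth_const: "smooth (\<lambda>_. c)"
  by (simp add: smooth_def times_differentiable_const)

lemma smooth_ident: "smooth (\<lambda>p. p)"
  by (simp add: smooth_def times_differentiable_ident)

lemma smooth_add: "smooth f \<Longrightarrow> smooth g \<Longrightarrow> smooth (\<lambda>p. f p + g p)"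
  by (simp add: smooth_def times_differentiable_add)

lemma smooth_linear: "bounded_linear h \<Longrightarrow> smooth f \<Longrightarrow> smooth (\<lambda>p. h (f p))"
  by (simp add: smooth_def times_differentiable_linear)

lemma smooth_minus: "smooth f \<Longrightarrow> smooth (\<lambda>p. - f p)"
  by (rule smooth_linear[OF bounded_linear_minus[OF bounded_linear_ident]])

lemma smooth_diff: "smooth f \<Longrightarrow> smooth g \<Longrightarrow> smooth (\<lambda>p. f p - g p)"
  using smooth_add[OF _ smooth_minus, of f g] by simp

lemma smooth_mult:
  fixes f g :: "'a::real_normed_vector \<Rightarrow> 'b::real_normed_algebra"
  shows "smooth f \<Longrightarrow> smooth g \<Longrightarrow> smooth (\<lambda>p. f p * g p)"
  by (simp add: smooth_def times_differentiable_bilinear[OF bounded_bilinear_mult])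

lemma smooth_scaleR: "smooth f \<Longrightarrow> smooth g \<Longrightarrow> smooth (\<lambda>p. f p *\<^sub>R g p)"
  by (simp add: smooth_def times_differentiable_bilinear[OF bounded_bilinear_scaleR])

lemma smooth_compose:
  fixes f :: "'b::euclidean_space \<Rightarrow> 'c::real_normed_vector"
  shows "smooth f \<Longrightarrow> smooth g \<Longrightarrow> smooth (\<lambda>p. f (g p))"
  by (simp add: smooth_def times_differentiable_compose)

lemma smooth_Pair:
  fixes f :: "'a::real_normed_vector \<Rightarrow> 'b::real_normed_vector" and g :: "'a \<Rightarrow> 'c::real_normed_vector"
  assumes "smooth f" "smooth g" shows "smooth (\<lambda>p. (f p, g p))"
proof -
  have "smooth (\<lambda>p. (f p, 0) + (0, g p))"
    by (intro smooth_add smooth_linear[OF bounded_linear_Pair[OF bounded_linear_ident bounded_linear_zero] assms(1)]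
        smooth_linear[OF bounded_linear_Pair[OF bounded_linear_zero bounded_linear_ident] assms(2)])
  then show ?thesis by simp
qed

section \<open>Smooth profiles and bump functions on the line\<close>

lemma smooth_real_antiderivative:
  fixes f g :: "real \<Rightarrow> real"
  assumes "\<And>x. (f has_real_derivative g x) (at x)" "smooth g"
  shows "smooth f"
  unfolding smooth_def
proof
  fix k
  have "times_differentiable (Suc k) f"
  proof (rule times_differentiable_SucI)
    show "(f has_derivative (\<lambda>v. v * g x)) (at x)" for x
      using assms(1)[of x] by (simp add: has_field_derivative_def mult_commute_abs)
    show "times_differentiable k (\<lambda>p. v * g p)" for v
      using smooth_mult[OF smooth_const assms(2)] by (simp add: smooth_def)
  qed
  then show "times_differentiable k f" by (rule times_differentiable_SucD)
qed

text \<open>Differentiation yields a linear factor times the same power with exponent lowered by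
  one, so the induction has to run over all \<open>q\<close> at once.\<close>

lemma smooth_powr_quadratic:
  fixes x0 r q :: real
  assumes r: "r > 0"
  shows "smooth (\<lambda>x. ((x - x0)\<^sup>2 + r\<^sup>2) powr q)"
  unfolding smooth_def
proof
  fix k
  have pos: "(x - x0)\<^sup>2 + r\<^sup>2 > 0" for x using r by (simp add: add_nonneg_pos)
  have der: "((\<lambda>x. ((x - x0)\<^sup>2 + r\<^sup>2) powr q) has_derivative (\<lambda>v. v * ((q * (2 * (x - x0))) * ((x - x0)\<^sup>2 + r\<^sup>2) powr (q - 1)))) (at x)" for x q
  proof -
    have "((\<lambda>x. ((x - x0)\<^sup>2 + r\<^sup>2) powr q) has_real_derivative ((q * (2 * (x - x0))) * ((x - x0)\<^sup>2 + r\<^sup>2) powr (q - 1))) (at x)"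
      using pos[of x] by (auto intro!: derivative_eq_intros simp: algebra_simps)
    then show ?thesis by (simp add: has_field_derivative_def mult_commute_abs)
  qed
  show "times_differentiable k (\<lambda>x. ((x - x0)\<^sup>2 + r\<^sup>2) powr q)" for q
  proof (induction k arbitrary: q)
    case 0
    show ?case using pos by (auto intro!: continuous_intros simp: less_imp_neq[symmetric])
  next
    case (Suc k)
    have lin: "times_differentiable k (\<lambda>x. q * (2 * (x - x0)))" for q
      using smooth_mult[OF smooth_const smooth_mult[OF smooth_const smooth_diff[OF smooth_ident smooth_const]], of q 2 x0]
      by (simp add: smooth_def)
    show ?case
      by (rule times_differentiable_SucI[OF der])
        (intro times_differentiable_bilinear[OF bounded_bilinear_mult] times_differentiable_const lin Suc)
  qed
qed

text \<open>The case \<open>k = 0\<close> is the classical flat function; with the powers of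
  \<open>1 / x\<close> the family is closed under differentiation up to linear combinations.\<close>

definition flat_exp :: "nat \<Rightarrow> real \<Rightarrow> real" where
  "flat_exp k x = (if x > 0 then (1 / x) ^ k * exp (- (1 / x)) else 0)"

lemma flat_exp_tendsto: "(flat_exp k \<longlongrightarrow> 0) (at 0)"
proof -
  have "((\<lambda>x::real. (1 / x) ^ k * exp (- (1 / x))) \<longlongrightarrow> 0) (at_right 0)"
  proof -
    have "((\<lambda>y::real. y ^ k / exp y) \<longlongrightarrow> 0) at_top" by (rule tendsto_power_div_exp_0)
    then have "((\<lambda>x::real. inverse x ^ k / exp (inverse x)) \<longlongrightarrow> 0) (at_right 0)"
      by (rule filterlim_compose[OF _ filterlim_inverse_at_top_right])
    then show ?thesis by (simp add: exp_minus field_simps)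
  qed
  then have "(flat_exp k \<longlongrightarrow> 0) (at_right 0)"
    by (rule Lim_transform_eventually) (auto simp: flat_exp_def eventually_at_right_less intro!: eventually_mono[OF eventually_at_right_less])
  moreover have "(flat_exp k \<longlongrightarrow> 0) (at_left 0)"
    by (rule Lim_transform_eventually[OF tendsto_const])
      (auto simp: flat_exp_def eventually_at_filter)
  ultimately show ?thesis by (simp add: filterlim_split_at)
qed

lemma flat_exp_derivative:
  "(flat_exp k has_real_derivative (flat_exp (k + 2) x - real k * flat_exp (k + 1) x)) (at x)"
proof (cases x "0::real" rule: linorder_cases)
  case greater
  have "((\<lambda>x. (1 / x) ^ k * exp (- (1 / x))) has_real_derivative (flat_exp (k + 2) x - real k * flat_exp (k + 1) x)) (at x)"
  proof (cases k)
    case 0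
    then show ?thesis using greater
      by (auto intro!: derivative_eq_intros simp: flat_exp_def field_simps power2_eq_square)
  next
    case (Suc j)
    then show ?thesis using greater
      by (auto intro!: derivative_eq_intros simp: flat_exp_def field_simps power2_eq_square)
        (metis One_nat_def power_eq_if)
  qed
  moreover have "\<forall>\<^sub>F y in nhds x. flat_exp k y = (1 / y) ^ k * exp (- (1 / y))"
    using eventually_nhds_in_open[of "{0<..}" x] greater by (auto simp: flat_exp_def elim!: eventually_mono)
  ultimately show ?thesis by (subst DERIV_cong_ev[OF refl _ refl])
next
  case less
  have "\<forall>\<^sub>F y in nhds x. flat_exp k y = 0"
    using eventually_nhds_in_open[of "{..<0}" x] less by (auto simp: flat_exp_def elim!: eventually_mono)
  then show ?thesis using less by (subst DERIV_cong_ev[OF refl _ refl]) (auto simp: flat_exp_def)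
next
  case equal
  \<comment> \<open>At 0 the difference quotient of \<open>flat_exp k\<close> is
    \<open>flat_exp (Suc k)\<close> itself.\<close>
  have "((\<lambda>h. flat_exp (Suc k) h) \<longlongrightarrow> 0) (at 0)" by (rule flat_exp_tendsto)
  then have "((\<lambda>h. (flat_exp k (0 + h) - flat_exp k 0) / h) \<longlongrightarrow> 0) (at 0)"
    by (rule Lim_transform_eventually) (auto simp: flat_exp_def field_simps eventually_at_filter)
  then show ?thesis using equal by (simp add: DERIV_def flat_exp_def)
qed

lemma smooth_flat_exp: "smooth (flat_exp k)"
  unfolding smooth_def
proof
  fix n
  show "times_differentiable n (flat_exp k)"
  proof (induction n arbitrary: k)
    case 0
    show ?case using DERIV_isCont[OF flat_exp_derivative] by (auto intro: continuous_at_imp_continuous_on)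
  next
    case (Suc n)
    show ?case
    proof (rule times_differentiable_SucI)
      show "(flat_exp k has_derivative (\<lambda>v. v * (flat_exp (k + 2) x + (- real k) * flat_exp (k + 1) x))) (at x)" for x
        using flat_exp_derivative[of k x] by (simp add: has_field_derivative_def mult_commute_abs)
      show "times_differentiable n (\<lambda>p. v * (flat_exp (k + 2) p + (- real k) * flat_exp (k + 1) p))" for v
        by (intro times_differentiable_bilinear[OF bounded_bilinear_mult] times_differentiable_add times_differentiable_const Suc)
    qed
  qed
qed

lemma smooth_bump_exists:
  fixes x0 b :: real
  assumes "b > 0"
  shows "\<exists>\<zeta>. smooth \<zeta> \<and> (\<forall>x. \<zeta> x \<ge> 0) \<and> (\<forall>x. \<bar>x - x0\<bar> < b \<longrightarrow> \<zeta> x > 0) \<and> (\<forall>x. \<bar>x - x0\<bar> \<ge> b \<longrightarrow> \<zeta> x = (0::real))"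
proof (intro exI conjI allI impI)
  let ?z = "\<lambda>x. flat_exp 0 (b * b - (x - x0) * (x - x0))"
  show "smooth ?z"
    by (intro smooth_compose[OF smooth_flat_exp] smooth_diff smooth_mult smooth_const smooth_ident)
  show "?z x \<ge> 0" for x by (simp add: flat_exp_def)
  show "?z x > 0" if "\<bar>x - x0\<bar> < b" for x
    using that abs_le_square_iff[of b "x - x0"] assms by (simp add: flat_exp_def power2_eq_square not_le[symmetric])
  show "?z x = 0" if "\<bar>x - x0\<bar> \<ge> b" for x
    using that abs_le_square_iff[of b "x - x0"] assms by (simp add: flat_exp_def power2_eq_square)
qed

section \<open>Square-integrable functions\<close>

definition l2 :: "'a measure \<Rightarrow> ('a \<Rightarrow> complex) set" where
  "l2 M = {f \<in> borel_measurable M. integrable M (\<lambda>p. (cmod (f p))\<^sup>2)}"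

definition nrm :: "'a measure \<Rightarrow> ('a \<Rightarrow> complex) \<Rightarrow> real" where
  "nrm M f = sqrt (\<integral>p. (cmod (f p))\<^sup>2 \<partial>M)"

text \<open>The real part of the inner product, over an arbitrary measure so that it serves both
  \<open>\<Omega>\<close> and the whole space. Imaginary parts are recovered by multiplying one
  argument by \<open>\<i>\<close>, which keeps all later estimates real.\<close>

definition rip :: "'a measure \<Rightarrow> ('a \<Rightarrow> complex) \<Rightarrow> ('a \<Rightarrow> complex) \<Rightarrow> real" where
  "rip M f g = (\<integral>p. f p \<bullet> g p \<partial>M)"

lemma L2_space_eq: "L2_space \<Omega> = l2 (lebesgue_on \<Omega>)" by (simp add: L2_space_def l2_def)

lemma L2_norm_eq: "L2_norm \<Omega> f = nrm (lebesgue_on \<Omega>) f" by (simp add: L2_norm_def nrm_def)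

lemma l2_measurable [measurable_dest]: "f \<in> l2 M \<Longrightarrow> f \<in> borel_measurable M" by (simp add: l2_def)

lemma l2_square_integrable: "f \<in> l2 M \<Longrightarrow> integrable M (\<lambda>p. (cmod (f p))\<^sup>2)" by (simp add: l2_def)

lemma nrm_nonneg: "nrm M f \<ge> 0" by (simp add: nrm_def)

lemma nrm_square: "(nrm M f)\<^sup>2 = (\<integral>p. (cmod (f p))\<^sup>2 \<partial>M)" by (simp add: nrm_def)

lemma l2_integrable_norm_mult:
  assumes "f \<in> l2 M" "g \<in> l2 M"
  shows "integrable M (\<lambda>p. cmod (f p) * cmod (g p))"
proof (rule Bochner_Integration.integrable_bound)
  show "integrable M (\<lambda>p. (cmod (f p))\<^sup>2 + (cmod (g p))\<^sup>2)"
    using assms by (intro Bochner_Integration.integrable_add l2_square_integrable)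
  have "x * y \<le> x\<^sup>2 + y\<^sup>2" if "x \<ge> 0" "y \<ge> 0" for x y :: real
    using sum_squares_bound[of x y] mult_nonneg_nonneg[OF that] by linarith
  then show "AE p in M. norm (cmod (f p) * cmod (g p)) \<le> norm ((cmod (f p))\<^sup>2 + (cmod (g p))\<^sup>2)"
    by (simp add: abs_of_nonneg)
  show "(\<lambda>p. cmod (f p) * cmod (g p)) \<in> borel_measurable M"
    using l2_measurable[OF assms(1)] l2_measurable[OF assms(2)] by measurable
qed

lemma l2_integrable_inner:
  assumes "f \<in> l2 M" "g \<in> l2 M"
  shows "integrable M (\<lambda>p. f p \<bullet> g p)"
  by (rule Bochner_Integration.integrable_bound[OF l2_integrable_norm_mult[OF assms]])
    (use assms in \<open>auto simp: Cauchy_Schwarz_ineq2\<close>)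

lemma l2_integrable_cnj:
  assumes "f \<in> l2 M" "g \<in> l2 M"
  shows "integrable M (\<lambda>p. f p * cnj (g p))"
  by (rule Bochner_Integration.integrable_bound[OF l2_integrable_norm_mult[OF assms]])
    (use assms in \<open>auto simp: norm_mult intro!: borel_measurable_times borel_measurable_continuous_on[of cnj] continuous_on_cnj dest: l2_measurable\<close>)

lemma l2_mult:
  assumes f: "f \<in> l2 M" and g: "g \<in> borel_measurable M" and B: "\<And>p. p \<in> space M \<Longrightarrow> cmod (g p) \<le> B"
  shows "(\<lambda>p. g p * f p) \<in> l2 M" "nrm M (\<lambda>p. g p * f p) \<le> B * nrm M f"
proof -
  have le: "(cmod (g p * f p))\<^sup>2 \<le> B\<^sup>2 * (cmod (f p))\<^sup>2" if "p \<in> space M" for p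
    using power_mono[OF B[OF that], of 2] by (simp add: norm_mult power_mult_distrib mult_right_mono)
  have i: "integrable M (\<lambda>p. B\<^sup>2 * (cmod (f p))\<^sup>2)" using l2_square_integrable[OF f] by simp
  have i2: "integrable M (\<lambda>p. (cmod (g p * f p))\<^sup>2)"
    by (rule Bochner_Integration.integrable_bound[OF i]) (use f g le in \<open>auto simp: abs_of_nonneg\<close>)
  then show "(\<lambda>p. g p * f p) \<in> l2 M" using f g by (auto simp: l2_def)
  show "nrm M (\<lambda>p. g p * f p) \<le> B * nrm M f"
  proof (cases "space M = {}")
    case True
    then show ?thesis by (simp add: nrm_def Bochner_Integration.integral_empty)
  next
    case False
    then have B0: "B \<ge> 0" using B norm_ge_zero order_trans by blast
    have "(\<integral>p. (cmod (g p * f p))\<^sup>2 \<partial>M) \<le> (\<integral>p. B\<^sup>2 * (cmod (f p))\<^sup>2 \<partial>M)"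
      by (rule integral_mono[OF i2 i]) (rule le)
    also have "\<dots> = (B * nrm M f)\<^sup>2" by (simp add: power_mult_distrib nrm_square)
    finally show ?thesis unfolding nrm_def[of M "\<lambda>p. g p * f p"]
      using B0 nrm_nonneg[of M f] by (intro real_le_lsqrt) auto
  qed
qed

lemma l2_cmult: "f \<in> l2 M \<Longrightarrow> (\<lambda>p. c * f p) \<in> l2 M"
  by (rule l2_mult(1)[where B = "cmod c"]) auto

lemma nrm_cmult: "nrm M (\<lambda>p. c * f p) = cmod c * nrm M f"
  by (simp add: nrm_def norm_mult power_mult_distrib real_sqrt_mult)

lemma l2_add:
  assumes "f \<in> l2 M" "g \<in> l2 M" shows "(\<lambda>p. f p + g p) \<in> l2 M"
proof -
  have "integrable M (\<lambda>p. (cmod (f p + g p))\<^sup>2)"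
  proof (rule Bochner_Integration.integrable_bound)
    show "integrable M (\<lambda>p. (cmod (f p))\<^sup>2 + (cmod (g p))\<^sup>2 + 2 * (cmod (f p) * cmod (g p)))"
      using assms by (intro Bochner_Integration.integrable_add integrable_mult_right l2_square_integrable l2_integrable_norm_mult)
    have "(cmod (f p + g p))\<^sup>2 \<le> (cmod (f p))\<^sup>2 + (cmod (g p))\<^sup>2 + 2 * (cmod (f p) * cmod (g p))" for p
      using power_mono[OF norm_triangle_ineq[of "f p" "g p"], of 2] by (simp add: power2_sum)
    then show "AE p in M. norm ((cmod (f p + g p))\<^sup>2) \<le> norm ((cmod (f p))\<^sup>2 + (cmod (g p))\<^sup>2 + 2 * (cmod (f p) * cmod (g p)))"
      by (simp add: abs_of_nonneg)
  qed (use assms in \<open>auto dest: l2_measurable\<close>)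
  then show ?thesis using assms by (auto simp: l2_def)
qed

lemma l2_diff:
  assumes "f \<in> l2 M" "g \<in> l2 M" shows "(\<lambda>p. f p - g p) \<in> l2 M"
  using l2_add[OF assms(1) l2_cmult[OF assms(2), of "-1"]] by simp

text \<open>The minimum over \<open>t\<close> of the right-hand side is twice the claimed bound, but
  the minimiser is not a positive number when \<open>A\<close> or \<open>B\<close> vanishes. Instead
  a violation is refuted at one \<open>t\<close>: a large one if \<open>A = 0\<close>, and
  \<open>x / A\<close> otherwise.\<close>

lemma le_sqrt_mult_sqrtI:
  fixes x A B :: real
  assumes A: "A \<ge> 0" and B: "B \<ge> 0" and le: "\<And>t. t > 0 \<Longrightarrow> 2 * x \<le> t * A + B / t"
  shows "x \<le> sqrt A * sqrt B"
proof (rule ccontr)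
  assume "\<not> x \<le> sqrt A * sqrt B"
  then have x: "x > sqrt A * sqrt B" by simp
  define a where "a = sqrt A"
  define b where "b = sqrt B"
  have ab: "a \<ge> 0" "b \<ge> 0" "A = a * a" "B = b * b" using A B by (auto simp: a_def b_def)
  have x': "x > a * b" using x by (simp add: a_def b_def)
  then have x0: "x > 0" using ab by (meson mult_nonneg_nonneg order_le_less_trans)
  show False
  proof (cases "a = 0")
    case True
    have "2 * x \<le> ((B + 1) / x) * A + B / ((B + 1) / x)" using B x0 by (intro le) simp
    also have "\<dots> = x * (B / (B + 1))" using True ab by simp
    also have "\<dots> \<le> x * 1" using x0 B by (intro mult_left_mono) auto
    finally show False using x0 by simp
  next
    case False
    then have a0: "a > 0" using ab by simp
    define t where "t = x / (a * a)"
    have "2 * x \<le> t * A + B / t" using x0 a0 by (intro le) (simp add: t_def)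
    also have "\<dots> = x + (a * b) * (a * b) / x" using a0 x0 by (simp add: t_def ab field_simps)
    finally have "x * x \<le> (a * b) * (a * b)" using x0 by (simp add: field_simps)
    moreover have "(a * b) * (a * b) < x * x"
      using x' ab by (intro mult_strict_mono') auto
    ultimately show False by simp
  qed
qed

lemma nrm_Cauchy_Schwarz:
  assumes f: "f \<in> l2 M" and g: "g \<in> l2 M"
  shows "(\<integral>p. cmod (f p) * cmod (g p) \<partial>M) \<le> nrm M f * nrm M g"
  unfolding nrm_def
proof (rule le_sqrt_mult_sqrtI)
  fix t :: real assume t: "t > 0"
  have pt: "2 * (x * y) \<le> t * x\<^sup>2 + y\<^sup>2 / t" for x y :: real
  proof -
    have "(t * x - y)\<^sup>2 / t \<ge> 0" using t by simp
    moreover have "(t * x - y)\<^sup>2 / t = t * x\<^sup>2 + y\<^sup>2 / t - 2 * (x * y)"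
      using t by (simp add: power2_eq_square field_simps)
    ultimately show ?thesis by simp
  qed
  have "2 * (\<integral>p. cmod (f p) * cmod (g p) \<partial>M) = (\<integral>p. 2 * (cmod (f p) * cmod (g p)) \<partial>M)" by simp
  also have "\<dots> \<le> (\<integral>p. t * (cmod (f p))\<^sup>2 + (cmod (g p))\<^sup>2 / t \<partial>M)"
    using f g by (intro integral_mono pt) (auto intro!: l2_integrable_norm_mult l2_square_integrable)
  also have "\<dots> = t * (\<integral>p. (cmod (f p))\<^sup>2 \<partial>M) + (\<integral>p. (cmod (g p))\<^sup>2 \<partial>M) / t"
    using f g by (simp add: l2_square_integrable)
  finally show "2 * (\<integral>p. cmod (f p) * cmod (g p) \<partial>M)
     \<le> t * (\<integral>p. (cmod (f p))\<^sup>2 \<partial>M) + (\<integral>p. (cmod (g p))\<^sup>2 \<partial>M) / t" .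
qed auto

lemma rip_le:
  assumes f: "f \<in> l2 M" and g: "g \<in> l2 M"
  shows "\<bar>rip M f g\<bar> \<le> nrm M f * nrm M g"
proof -
  have "\<bar>rip M f g\<bar> \<le> (\<integral>p. \<bar>f p \<bullet> g p\<bar> \<partial>M)" unfolding rip_def by (rule integral_abs_bound)
  also have "\<dots> \<le> (\<integral>p. cmod (f p) * cmod (g p) \<partial>M)"
    using f g by (intro integral_mono Cauchy_Schwarz_ineq2 integrable_abs l2_integrable_inner l2_integrable_norm_mult)
  also have "\<dots> \<le> nrm M f * nrm M g" by (rule nrm_Cauchy_Schwarz[OF f g])
  finally show ?thesis .
qed

lemma nrm_square_rip: "(nrm M f)\<^sup>2 = rip M f f" by (simp add: nrm_square rip_def dot_square_norm)

lemma rip_commute: "rip M f g = rip M g f" by (simp add: rip_def inner_commute)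

lemma rip_add:
  assumes "f \<in> l2 M" "g \<in> l2 M" "h \<in> l2 M"
  shows "rip M (\<lambda>p. f p + g p) h = rip M f h + rip M g h" "rip M h (\<lambda>p. f p + g p) = rip M h f + rip M h g"
  using assms by (simp_all add: rip_def inner_add_left inner_add_right l2_integrable_inner)

lemma rip_diff:
  assumes "f \<in> l2 M" "g \<in> l2 M" "h \<in> l2 M"
  shows "rip M (\<lambda>p. f p - g p) h = rip M f h - rip M g h" "rip M h (\<lambda>p. f p - g p) = rip M h f - rip M h g"
  using assms by (simp_all add: rip_def inner_diff_left inner_diff_right l2_integrable_inner)

lemma rip_real_mult:
  "rip M (\<lambda>p. complex_of_real c * f p) h = c * rip M f h" "rip M h (\<lambda>p. complex_of_real c * f p) = c * rip M h f"
  by (simp_all add: rip_def flip: scaleR_conv_of_real)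

lemma nrm_triangle:
  assumes f: "f \<in> l2 M" and g: "g \<in> l2 M"
  shows "nrm M (\<lambda>p. f p + g p) \<le> nrm M f + nrm M g"
proof (rule power2_le_imp_le)
  have "(nrm M (\<lambda>p. f p + g p))\<^sup>2 = (nrm M f)\<^sup>2 + 2 * rip M f g + (nrm M g)\<^sup>2"
    using f g by (simp add: nrm_square_rip rip_add l2_add rip_commute[of M g f])
  also have "\<dots> \<le> (nrm M f)\<^sup>2 + 2 * (nrm M f * nrm M g) + (nrm M g)\<^sup>2" using rip_le[OF f g] by simp
  also have "\<dots> = (nrm M f + nrm M g)\<^sup>2" by (simp add: power2_sum)
  finally show "(nrm M (\<lambda>p. f p + g p))\<^sup>2 \<le> (nrm M f + nrm M g)\<^sup>2" .
qed (simp add: nrm_nonneg)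

lemma nrm_minus_commute: "nrm M (\<lambda>p. f p - g p) = nrm M (\<lambda>p. g p - f p)"
  by (simp add: nrm_def norm_minus_commute)

lemma nrm_triangle_diff:
  assumes "f \<in> l2 M" "g \<in> l2 M" "h \<in> l2 M"
  shows "nrm M (\<lambda>p. f p - h p) \<le> nrm M (\<lambda>p. f p - g p) + nrm M (\<lambda>p. g p - h p)"
  using nrm_triangle[OF l2_diff[OF assms(1,2)] l2_diff[OF assms(2,3)]] by simp

lemma nn_integral_nrm:
  assumes "f \<in> l2 M" shows "(\<integral>\<^sup>+p. ennreal ((cmod (f p))\<^sup>2) \<partial>M) = ennreal ((nrm M f)\<^sup>2)"
  unfolding nrm_square using l2_square_integrable[OF assms] by (intro nn_integral_eq_integral) auto

text \<open>Riesz-Fischer. Along a fast subsequence the series of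
  \<open>2 ^ k * (cmod (g k p))\<^sup>2\<close> has a finite integral, so almost everywhere the
  increments decay geometrically and the subsequence converges; Fatou's lemma transfers the Cauchy
  bounds to the limit.\<close>

lemma l2_complete:
  assumes f: "\<And>n. f n \<in> l2 M"
    and cauchy: "\<And>\<epsilon>. \<epsilon> > 0 \<Longrightarrow> \<exists>N. \<forall>m\<ge>N. \<forall>n\<ge>N. nrm M (\<lambda>p. f m p - f n p) < \<epsilon>"
  shows "\<exists>u\<in>l2 M. (\<lambda>n. nrm M (\<lambda>p. f n p - u p)) \<longlonglongrightarrow> 0"
proof -
  have "\<exists>N. \<forall>k::nat. \<forall>m\<ge>N k. \<forall>n\<ge>N k. nrm M (\<lambda>p. f m p - f n p) < (1/2) ^ k"
    by (rule choice) (use cauchy in auto)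
  then obtain N where N: "\<And>k m n. m \<ge> N k \<Longrightarrow> n \<ge> N k \<Longrightarrow> nrm M (\<lambda>p. f m p - f n p) < (1/2) ^ k" by blast
  \<comment> \<open>The maximum over all earlier thresholds: \<open>r k\<close> lies beyond
    \<open>N j\<close> for every \<open>j \<le> k\<close>, so each Cauchy bound holds along the
    whole tail of the subsequence.\<close>
  define r where "r k = Max (N ` {..k})" for k
  have rN: "N j \<le> r k" if "j \<le> k" for j k unfolding r_def using that by (intro Max_ge) auto
  define g where "g k p = f (r (Suc k)) p - f (r k) p" for k p
  have g: "g k \<in> l2 M" for k unfolding g_def by (intro l2_diff f)
  have gn: "nrm M (g k) \<le> (1/2) ^ k" for k
    unfolding g_def by (rule less_imp_le[OF N]; rule rN) auto
  have fm: "f n \<in> borel_measurable M" for n using f by (rule l2_measurable)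
  have gm: "g n \<in> borel_measurable M" for n using g by (rule l2_measurable)
  have "(\<integral>\<^sup>+p. (\<Sum>k. ennreal (2 ^ k * (cmod (g k p))\<^sup>2)) \<partial>M) = (\<Sum>k. \<integral>\<^sup>+p. ennreal (2 ^ k * (cmod (g k p))\<^sup>2) \<partial>M)"
    using gm by (intro nn_integral_suminf) measurable
  also have "\<dots> \<le> (\<Sum>k. ennreal ((1/2) ^ k))"
  proof (rule suminf_le)
    fix k
    have "(\<integral>\<^sup>+p. ennreal (2 ^ k * (cmod (g k p))\<^sup>2) \<partial>M) = ennreal (2 ^ k) * (\<integral>\<^sup>+p. ennreal ((cmod (g k p))\<^sup>2) \<partial>M)"
      using gm by (simp add: ennreal_mult nn_integral_cmult)
    also have "\<dots> = ennreal (2 ^ k * (nrm M (g k))\<^sup>2)" by (simp add: nn_integral_nrm[OF g] ennreal_mult)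
    also have "\<dots> \<le> ennreal ((1/2) ^ k)"
    proof (rule ennreal_leI)
      have "2 ^ k * (nrm M (g k))\<^sup>2 \<le> 2 ^ k * ((1/2) ^ k)\<^sup>2"
        using gn nrm_nonneg by (intro mult_left_mono power_mono) auto
      also have "\<dots> = (1/2) ^ k" by (simp add: power2_eq_square field_simps)
      finally show "2 ^ k * (nrm M (g k))\<^sup>2 \<le> (1/2) ^ k" .
    qed
    finally show "(\<integral>\<^sup>+p. ennreal (2 ^ k * (cmod (g k p))\<^sup>2) \<partial>M) \<le> ennreal ((1/2) ^ k)" .
  qed auto
  also have "\<dots> = ennreal (\<Sum>k. (1/2) ^ k)" by (intro suminf_ennreal2) (auto intro: summable_geometric)
  also have "\<dots> < \<infinity>" by simp
  finally have "AE p in M. (\<Sum>k. ennreal (2 ^ k * (cmod (g k p))\<^sup>2)) \<noteq> \<infinity>"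
    using gm by (intro nn_integral_PInf_AE) (auto simp: less_top)
  then have conv: "AE p in M. convergent (\<lambda>k. f (r k) p)"
  proof (rule eventually_mono)
    fix p assume fin: "(\<Sum>k. ennreal (2 ^ k * (cmod (g k p))\<^sup>2)) \<noteq> \<infinity>"
    then have "summable (\<lambda>k. 2 ^ k * (cmod (g k p))\<^sup>2)" by (intro summable_suminf_not_top) auto
    then have "Bseq (\<lambda>k. 2 ^ k * (cmod (g k p))\<^sup>2)" by (intro convergent_imp_Bseq) (use summable_LIMSEQ_zero convergentI in blast)
    then obtain B where B: "B > 0" "\<And>k. norm (2 ^ k * (cmod (g k p))\<^sup>2) \<le> B" unfolding Bseq_def by blast
    have le: "cmod (g k p) \<le> sqrt B * (sqrt (1/2)) ^ k" for k
    proof -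
      have "(cmod (g k p))\<^sup>2 \<le> B * (1/2) ^ k" using B(2)[of k] by (simp add: field_simps)
      then have "sqrt ((cmod (g k p))\<^sup>2) \<le> sqrt (B * (1/2) ^ k)" by (rule real_sqrt_le_mono)
      then show ?thesis by (simp add: real_sqrt_mult real_sqrt_power)
    qed
    have "summable (\<lambda>k. g k p)"
    proof (rule summable_comparison_test'[where N = 0])
      show "summable (\<lambda>k. sqrt B * (sqrt (1/2)) ^ k)" by (intro summable_mult summable_geometric) auto
    qed (rule le)
    then have "convergent (\<lambda>n. (\<Sum>k<n. g k p))" by (simp add: summable_iff_convergent)
    moreover have "(\<Sum>k<n. g k p) = f (r n) p - f (r 0) p" for n
      unfolding g_def by (rule sum_lessThan_telescope)
    ultimately have "convergent (\<lambda>n. f (r n) p - f (r 0) p)" by simp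
    from convergent_add[OF this convergent_const[of "f (r 0) p"]] show "convergent (\<lambda>n. f (r n) p)" by simp
  qed
  define u where "u p = lim (\<lambda>k. f (r k) p)" for p
  have um: "u \<in> borel_measurable M" unfolding u_def using fm by (rule borel_measurable_lim_metric)
  have close: "(\<integral>\<^sup>+p. ennreal ((cmod (f n p - u p))\<^sup>2) \<partial>M) \<le> ennreal (((1/2) ^ k)\<^sup>2)" if n: "n \<ge> N k" for n k
  proof -
    have "(\<integral>\<^sup>+p. ennreal ((cmod (f n p - u p))\<^sup>2) \<partial>M)
        = (\<integral>\<^sup>+p. liminf (\<lambda>j. ennreal ((cmod (f n p - f (r j) p))\<^sup>2)) \<partial>M)"
    proof (rule nn_integral_cong_AE, use conv in eventually_elim)
      fix p assume "convergent (\<lambda>k. f (r k) p)"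
      then have "(\<lambda>j. f (r j) p) \<longlonglongrightarrow> u p" unfolding u_def by (simp add: convergent_LIMSEQ_iff)
      then have "(\<lambda>j. ennreal ((cmod (f n p - f (r j) p))\<^sup>2)) \<longlonglongrightarrow> ennreal ((cmod (f n p - u p))\<^sup>2)"
        by (intro tendsto_ennrealI tendsto_intros)
      then show "ennreal ((cmod (f n p - u p))\<^sup>2) = liminf (\<lambda>j. ennreal ((cmod (f n p - f (r j) p))\<^sup>2))"
        by (rule lim_imp_Liminf[OF trivial_limit_sequentially, symmetric])
    qed
    also have "\<dots> \<le> liminf (\<lambda>j. \<integral>\<^sup>+p. ennreal ((cmod (f n p - f (r j) p))\<^sup>2) \<partial>M)"
      using fm by (intro nn_integral_liminf) measurable
    also have "\<dots> \<le> ennreal (((1/2) ^ k)\<^sup>2)"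
    proof (rule Liminf_le)
      show "\<forall>\<^sub>F j in sequentially. (\<integral>\<^sup>+p. ennreal ((cmod (f n p - f (r j) p))\<^sup>2) \<partial>M) \<le> ennreal (((1/2) ^ k)\<^sup>2)"
      proof (rule eventually_sequentiallyI)
        fix j assume "k \<le> j"
        then have "nrm M (\<lambda>p. f n p - f (r j) p) \<le> (1/2) ^ k" by (intro less_imp_le[OF N[OF n]] rN)
        then show "(\<integral>\<^sup>+p. ennreal ((cmod (f n p - f (r j) p))\<^sup>2) \<partial>M) \<le> ennreal (((1/2) ^ k)\<^sup>2)"
          unfolding nn_integral_nrm[OF l2_diff[OF f f]]
          by (intro ennreal_leI power_mono nrm_nonneg)
      qed
    qed simp
    finally show ?thesis .
  qed
  have diffl2: "(\<lambda>p. f n p - u p) \<in> l2 M" if "n \<ge> N k" for n k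
  proof -
    have "(\<integral>\<^sup>+p. ennreal ((cmod (f n p - u p))\<^sup>2) \<partial>M) < \<infinity>"
      using close[OF that] by (rule order_le_less_trans) simp
    then have "integrable M (\<lambda>p. (cmod (f n p - u p))\<^sup>2)"
      using fm um by (intro integrableI_bounded) auto
    then show ?thesis using fm um by (auto simp: l2_def)
  qed
  have u: "u \<in> l2 M" using l2_diff[OF f[of "N 0"] diffl2[OF order_refl, of 0]] by simp
  moreover have "(\<lambda>n. nrm M (\<lambda>p. f n p - u p)) \<longlonglongrightarrow> 0"
  proof (rule LIMSEQ_I)
    fix e :: real assume "e > 0"
    then obtain k where k: "(1/2) ^ k < e" using real_arch_pow_inv[of e "1/2"] by auto
    have "norm (nrm M (\<lambda>p. f n p - u p) - 0) < e" if n: "n \<ge> N k" for n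
    proof -
      have "ennreal ((nrm M (\<lambda>p. f n p - u p))\<^sup>2) \<le> ennreal (((1/2) ^ k)\<^sup>2)"
        using close[OF n] nn_integral_nrm[OF l2_diff[OF f u]] by simp
      then have "(nrm M (\<lambda>p. f n p - u p))\<^sup>2 \<le> ((1/2) ^ k)\<^sup>2" by (simp add: ennreal_le_iff)
      then have "nrm M (\<lambda>p. f n p - u p) \<le> (1/2) ^ k" by (rule power2_le_imp_le) simp
      then show ?thesis using k nrm_nonneg[of M "\<lambda>p. f n p - u p"] by simp
    qed
    then show "\<exists>no. \<forall>n\<ge>no. norm (nrm M (\<lambda>p. f n p - u p) - 0) < e" by blast
  qed
  ultimately show ?thesis by blast
qed

section \<open>Test functions\<close>

definition cc :: "('a::euclidean_space \<Rightarrow> 'b::real_normed_vector) \<Rightarrow> bool" where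
  "cc f \<longleftrightarrow> continuous_on UNIV f \<and> (\<exists>K. compact K \<and> (\<forall>p. p \<notin> K \<longrightarrow> f p = 0))"

lemma ccI: "continuous_on UNIV F \<Longrightarrow> cc f \<Longrightarrow> (\<And>p. f p = 0 \<Longrightarrow> F p = 0) \<Longrightarrow> cc F"
  unfolding cc_def by blast

lemma cc_continuous: "cc f \<Longrightarrow> continuous_on UNIV f" by (simp add: cc_def)

lemma cc_add:
  assumes "cc f" "cc g" shows "cc (\<lambda>p. f p + g p)"
proof -
  obtain K L where "compact K" "\<And>p. p \<notin> K \<Longrightarrow> f p = 0" "compact L" "\<And>p. p \<notin> L \<Longrightarrow> g p = 0"
    using assms by (auto simp: cc_def)
  then show ?thesis using assms
    unfolding cc_def by (intro conjI exI[of _ "K \<union> L"]) (auto intro: continuous_intros compact_Un)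
qed

lemma cc_zero: "cc (\<lambda>p. 0)" unfolding cc_def by auto

lemma cc_sum: "(\<And>i. i \<in> S \<Longrightarrow> cc (f i)) \<Longrightarrow> cc (\<lambda>p. \<Sum>i\<in>S. f i p)"
  by (induction S rule: infinite_finite_induct) (simp_all add: cc_zero cc_add)

lemma cc_integrable:
  fixes f :: "'a::euclidean_space \<Rightarrow> 'b::{banach,second_countable_topology}"
  assumes "cc f" shows "integrable lborel f"
proof -
  obtain K where K: "compact K" "\<And>p. p \<notin> K \<Longrightarrow> f p = 0" using assms by (auto simp: cc_def)
  have "integrable lborel (\<lambda>p. indicator K p *\<^sub>R f p)"
    using K(1) continuous_on_subset[OF cc_continuous[OF assms]] by (intro borel_integrable_compact) auto
  moreover have "(\<lambda>p. indicator K p *\<^sub>R f p) = f" using K(2) by (auto simp: indicator_def fun_eq_iff)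
  ultimately show ?thesis by simp
qed

lemma continuous_UNIV_borel:
  fixes f :: "'a::euclidean_space \<Rightarrow> 'b::topological_space"
  shows "continuous_on UNIV f \<Longrightarrow> f \<in> borel_measurable borel"
  by (rule borel_measurable_continuous_onI)

lemma cc_borel: "cc f \<Longrightarrow> f \<in> borel_measurable borel"
  by (intro continuous_UNIV_borel cc_continuous)

text \<open>By translation invariance the difference quotients of \<open>F\<close> have integral
  zero; dominated convergence carries this to the derivative.\<close>

lemma integral_derivative_zero:
  fixes F :: "'a::euclidean_space \<Rightarrow> real"
  assumes cF: "cc F" and dF: "\<And>p. (F has_derivative F' p) (at p)" and cont: "continuous_on UNIV (\<lambda>p. F' p v)"
  shows "integral\<^sup>L lborel (\<lambda>p. F' p v) = 0"
proof -
  obtain K where K: "compact K" "\<And>p. p \<notin> K \<Longrightarrow> F p = 0" using cF by (auto simp: cc_def)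
  have z: "F' p v = 0" if "p \<notin> K" for p
  proof -
    have "((\<lambda>_. 0) has_derivative F' p) (at p)"
      by (rule has_derivative_transform_within_open[OF dF, of "- K"])
        (use that K compact_imp_closed in \<open>auto simp: open_Compl\<close>)
    then have "F' p = (\<lambda>_. 0)" using has_derivative_unique[OF _ has_derivative_const] by blast
    then show ?thesis by simp
  qed
  have "bounded ((\<lambda>p. F' p v) ` K)"
    by (intro compact_imp_bounded compact_continuous_image K continuous_on_subset[OF cont]) auto
  then obtain B where B: "\<And>p. p \<in> K \<Longrightarrow> \<bar>F' p v\<bar> \<le> B" unfolding bounded_iff by auto
  define B' where "B' = max B 0"
  have B': "\<bar>F' p v\<bar> \<le> B'" for p using B[of p] z[of p] unfolding B'_def by (cases "p \<in> K") auto
  \<comment> \<open>The points from which the segment of length at most one step in direction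
    \<open>v\<close> meets \<open>K\<close>. By the mean value theorem all difference quotients
    vanish outside this compact set.\<close>
  define K' where "K' = (\<lambda>(p, t). p - t *\<^sub>R v) ` (K \<times> {0..1::real})"
  have cK': "compact K'" unfolding K'_def
    by (intro compact_continuous_image compact_Times K) (auto intro!: continuous_intros simp: case_prod_beta)
  define h where "h n = 1 / real (Suc n)" for n
  have h: "h n > 0" "h n \<le> 1" for n by (auto simp: h_def)
  define s where "s n p = (F (h n *\<^sub>R v + p) - F p) / h n" for n p
  have FB: "F \<in> borel_measurable borel" by (rule cc_borel[OF cF])
  have FI: "integrable lborel F" by (rule cc_integrable[OF cF])
  have shift: "integrable lborel (\<lambda>p. F (c + p))" "integral\<^sup>L lborel (\<lambda>p. F (c + p)) = integral\<^sup>L lborel F" for c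
  proof -
    have "integrable (distr lborel borel ((+) c)) F" using FI by (simp add: lborel_distr_plus)
    then show "integrable lborel (\<lambda>p. F (c + p))" by (subst (asm) integrable_distr_eq) (use FB in auto)
    have "integral\<^sup>L (distr lborel borel ((+) c)) F = integral\<^sup>L lborel (\<lambda>p. F (c + p))"
      by (rule integral_distr) (use FB in auto)
    then show "integral\<^sup>L lborel (\<lambda>p. F (c + p)) = integral\<^sup>L lborel F" by (simp add: lborel_distr_plus)
  qed
  have s0: "integral\<^sup>L lborel (s n) = 0" for n
    unfolding s_def using FI shift by simp
  have mvt: "\<exists>t\<in>{0..1}. s n p = F' (p + t *\<^sub>R v) v" for n p
  proof -
    have der: "((\<lambda>t. F (p + t *\<^sub>R v)) has_real_derivative F' (p + t *\<^sub>R v) v) (at t)" for t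
    proof -
      have "(F \<circ> (\<lambda>t. p + t *\<^sub>R v) has_derivative F' (p + t *\<^sub>R v) \<circ> (\<lambda>t. t *\<^sub>R v)) (at t)"
        by (rule diff_chain_at[OF _ dF]) (auto intro!: derivative_eq_intros)
      moreover have "F' q (x *\<^sub>R v) = F' q v * x" for x q
        using has_derivative_linear[OF dF, THEN linear_scale, of q x v] by simp
      ultimately show ?thesis by (simp add: has_field_derivative_def o_def)
    qed
    obtain t where t: "0 < t" "t < h n" "F (p + h n *\<^sub>R v) - F (p + 0 *\<^sub>R v) = (h n - 0) * F' (p + t *\<^sub>R v) v"
      using MVT2[OF h(1)[of n], of "\<lambda>t. F (p + t *\<^sub>R v)" "\<lambda>t. F' (p + t *\<^sub>R v) v"] der by blast
    then have "s n p = F' (p + t *\<^sub>R v) v" using h[of n] by (simp add: s_def add.commute)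
    then show ?thesis using t h[of n] by (intro bexI[of _ t]) auto
  qed
  have bd: "norm (s n p) \<le> B' * indicator K' p" for n p
  proof -
    obtain t where t: "t \<in> {0..1}" "s n p = F' (p + t *\<^sub>R v) v" using mvt by blast
    show ?thesis
    proof (cases "p \<in> K'")
      case True then show ?thesis using B' t by simp
    next
      case False
      have "p + t *\<^sub>R v \<notin> K"
      proof
        assume "p + t *\<^sub>R v \<in> K"
        then have "(\<lambda>(p, t). p - t *\<^sub>R v) (p + t *\<^sub>R v, t) \<in> K'" unfolding K'_def using t(1) by (intro imageI) auto
        then show False using False by simp
      qed
      then show ?thesis using z t False by simp
    qed
  qed
  have lim: "(\<lambda>n. s n p) \<longlonglongrightarrow> F' p v" for p
  proof -
    have "((\<lambda>t. F (p + t *\<^sub>R v)) has_real_derivative F' p v) (at 0)"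
    proof -
      have dF0: "(F has_derivative F' p) (at (p + 0 *\<^sub>R v))" using dF by simp
      have "(F \<circ> (\<lambda>t. p + t *\<^sub>R v) has_derivative F' p \<circ> (\<lambda>t. t *\<^sub>R v)) (at 0)"
        by (rule diff_chain_at[where f = "\<lambda>t. p + t *\<^sub>R v", OF _ dF0]) (auto intro!: derivative_eq_intros)
      moreover have "F' p (x *\<^sub>R v) = F' p v * x" for x
        using has_derivative_linear[OF dF, THEN linear_scale, of p x v] by simp
      ultimately show ?thesis by (simp add: has_field_derivative_def o_def)
    qed
    then have "(\<lambda>x. (F (p + x *\<^sub>R v) - F p) / x) \<midarrow>0\<rightarrow> F' p v"
      by (simp add: DERIV_def)
    moreover have "filterlim h (at 0) sequentially"
    proof -
      have "h \<longlonglongrightarrow> 0" unfolding h_def using LIMSEQ_inverse_real_of_nat by (simp add: inverse_eq_divide)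
      moreover have "h n \<noteq> 0" for n using h(1)[of n] by simp
      ultimately show ?thesis by (simp add: filterlim_at)
    qed
    ultimately have "(\<lambda>n. (F (p + h n *\<^sub>R v) - F p) / h n) \<longlonglongrightarrow> F' p v"
      by (rule filterlim_compose)
    then show ?thesis by (simp add: s_def add.commute)
  qed
  have "(\<lambda>n. integral\<^sup>L lborel (s n)) \<longlonglongrightarrow> integral\<^sup>L lborel (\<lambda>p. F' p v)"
  proof (rule integral_dominated_convergence[where w = "\<lambda>p. B' * indicator K' p"])
    show "(\<lambda>p. F' p v) \<in> borel_measurable lborel" using continuous_UNIV_borel[OF cont] by simp
    show "s n \<in> borel_measurable lborel" for n unfolding s_def using FB by measurable
    show "integrable lborel (\<lambda>p. B' * indicator K' p)"
      using emeasure_compact_finite[OF cK'] compact_imp_closed[OF cK']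
      by (intro integrable_mult_right) (auto simp: integrable_indicator_iff)
  qed (use lim bd in auto)
  then have "(\<lambda>n. 0) \<longlonglongrightarrow> integral\<^sup>L lborel (\<lambda>p. F' p v)" by (simp add: s0)
  then show ?thesis using LIMSEQ_unique[OF _ tendsto_const] by blast
qed

abbreviation pd :: "'a::real_normed_vector \<Rightarrow> ('a \<Rightarrow> 'b::real_normed_vector) \<Rightarrow> 'a \<Rightarrow> 'b" where
  "pd v \<phi> \<equiv> \<lambda>p. frechet_derivative \<phi> (at p) v"

lemma test_functionI:
  assumes "smooth \<phi>" "compact K" "K \<subseteq> \<Omega>" "\<And>p. p \<notin> K \<Longrightarrow> \<phi> p = 0"
  shows "\<phi> \<in> test_functions \<Omega>"
proof -
  have "closure {p. \<phi> p \<noteq> 0} \<subseteq> K"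
    using assms by (intro closure_minimal compact_imp_closed) auto
  moreover from this have "compact (closure {p. \<phi> p \<noteq> 0})"
    using assms(2) compact_Int_closed[of K "closure {p. \<phi> p \<noteq> 0}"] by (simp add: Int_absorb1)
  ultimately show ?thesis using assms by (auto simp: test_functions_def)
qed

lemma test_functionE:
  assumes "\<phi> \<in> test_functions \<Omega>"
  obtains K where "smooth \<phi>" "compact K" "K \<subseteq> \<Omega>" "\<And>p. p \<notin> K \<Longrightarrow> \<phi> p = 0"
proof -
  have "\<phi> p = 0" if "p \<notin> closure {p. \<phi> p \<noteq> 0}" for p
    using that closure_subset[of "{p. \<phi> p \<noteq> 0}"] by blast
  then show ?thesis using assms that unfolding test_functions_def by blast
qed

lemma test_function_smooth: "\<phi> \<in> test_functions \<Omega> \<Longrightarrow> smooth \<phi>" by (simp add: test_functions_def)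

lemma test_function_cc: "\<phi> \<in> test_functions \<Omega> \<Longrightarrow> cc \<phi>"
  by (elim test_functionE) (auto simp: cc_def intro: smooth_continuous)

lemma test_function_outside: "\<phi> \<in> test_functions \<Omega> \<Longrightarrow> p \<notin> \<Omega> \<Longrightarrow> \<phi> p = 0"
  by (elim test_functionE) auto

lemma test_function_has_derivative:
  "\<phi> \<in> test_functions \<Omega> \<Longrightarrow> (\<phi> has_derivative frechet_derivative \<phi> (at p)) (at p)"
  by (intro smooth_has_derivative test_function_smooth)

lemma test_function_pd:
  assumes "\<phi> \<in> test_functions \<Omega>" shows "pd v \<phi> \<in> test_functions \<Omega>"
proof -
  obtain K where K: "smooth \<phi>" "compact K" "K \<subseteq> \<Omega>" "\<And>p. p \<notin> K \<Longrightarrow> \<phi> p = 0"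
    by (rule test_functionE[OF assms(1)]) (rule that)
  show ?thesis
  proof (rule test_functionI[OF smooth_derivative[OF K(1)] K(2,3)])
    fix p assume p: "p \<notin> K"
    have "((\<lambda>_. 0) has_derivative frechet_derivative \<phi> (at p)) (at p)"
      by (rule has_derivative_transform_within_open[OF smooth_has_derivative[OF K(1)], of "- K"])
        (use p K compact_imp_closed in \<open>auto simp: open_Compl\<close>)
    then have "frechet_derivative \<phi> (at p) = (\<lambda>_. 0)"
      using has_derivative_unique[OF _ has_derivative_const] by blast
    then show "frechet_derivative \<phi> (at p) v = 0" by simp
  qed
qed

lemma test_function_add:
  assumes "\<phi> \<in> test_functions \<Omega>" "\<psi> \<in> test_functions \<Omega>"
  shows "(\<lambda>p. \<phi> p + \<psi> p) \<in> test_functions \<Omega>"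
proof -
  obtain K where K: "smooth \<phi>" "compact K" "K \<subseteq> \<Omega>" "\<And>p. p \<notin> K \<Longrightarrow> \<phi> p = 0"
    by (rule test_functionE[OF assms(1)]) (rule that)
  obtain L where L: "smooth \<psi>" "compact L" "L \<subseteq> \<Omega>" "\<And>p. p \<notin> L \<Longrightarrow> \<psi> p = 0"
    by (rule test_functionE[OF assms(2)]) (rule that)
  show ?thesis
    by (rule test_functionI[OF smooth_add[OF K(1) L(1)] compact_Un[OF K(2) L(2)]]) (use K L in auto)
qed

lemma test_function_mult:
  assumes "\<phi> \<in> test_functions \<Omega>" "smooth m"
  shows "(\<lambda>p. m p * \<phi> p) \<in> test_functions \<Omega>"
proof -
  obtain K where K: "smooth \<phi>" "compact K" "K \<subseteq> \<Omega>" "\<And>p. p \<notin> K \<Longrightarrow> \<phi> p = 0"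
    by (rule test_functionE[OF assms(1)]) (rule that)
  show ?thesis
    by (rule test_functionI[OF smooth_mult[OF assms(2) K(1)] K(2,3)]) (use K in auto)
qed

lemma test_function_cmult: "\<phi> \<in> test_functions \<Omega> \<Longrightarrow> (\<lambda>p. c * \<phi> p) \<in> test_functions \<Omega>"
  by (rule test_function_mult[OF _ smooth_const])

lemma test_function_diff:
  "\<phi> \<in> test_functions \<Omega> \<Longrightarrow> \<psi> \<in> test_functions \<Omega> \<Longrightarrow> (\<lambda>p. \<phi> p - \<psi> p) \<in> test_functions \<Omega>"
  using test_function_add[OF _ test_function_cmult, of \<phi> \<Omega> \<psi> "-1"] by simp

lemma test_function_zero: "(\<lambda>_. 0) \<in> test_functions \<Omega>"
  by (rule test_functionI[OF smooth_const compact_empty]) auto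

lemma test_function_compose:
  fixes \<Psi> :: "'a::euclidean_space \<Rightarrow> 'a"
  assumes \<phi>: "\<phi> \<in> test_functions \<Omega>" and \<Psi>: "smooth \<Psi>"
    and inv: "\<And>p. \<Psi> p \<in> \<Omega> \<Longrightarrow> p \<in> \<Omega>"
    and proper: "\<And>K. compact K \<Longrightarrow> bounded (\<Psi> -` K)"
  shows "(\<lambda>p. \<phi> (\<Psi> p)) \<in> test_functions \<Omega>"
proof -
  obtain K where K: "smooth \<phi>" "compact K" "K \<subseteq> \<Omega>" "\<And>p. p \<notin> K \<Longrightarrow> \<phi> p = 0"
    by (rule test_functionE[OF \<phi>]) (rule that)
  have "closed (\<Psi> -` K)"
    using continuous_on_closed_vimage[of UNIV \<Psi>] compact_imp_closed[OF K(2)] smooth_continuous[OF \<Psi>] by simp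
  then have "compact (\<Psi> -` K)" using proper[OF K(2)] compact_eq_bounded_closed by blast
  then show ?thesis
    by (rule test_functionI[OF smooth_compose[OF K(1) \<Psi>]]) (use K inv in auto)
qed

lemma pd_eqI: "(\<phi> has_derivative D) (at p) \<Longrightarrow> frechet_derivative \<phi> (at p) v = D v"
  using frechet_derivative_at by metis

lemma pd_add:
  "\<phi> \<in> test_functions \<Omega> \<Longrightarrow> \<psi> \<in> test_functions \<Omega> \<Longrightarrow> pd v (\<lambda>p. \<phi> p + \<psi> p) = (\<lambda>p. pd v \<phi> p + pd v \<psi> p)"
  by (rule ext, rule pd_eqI) (intro has_derivative_add test_function_has_derivative)

lemma pd_diff:
  "\<phi> \<in> test_functions \<Omega> \<Longrightarrow> \<psi> \<in> test_functions \<Omega> \<Longrightarrow> pd v (\<lambda>p. \<phi> p - \<psi> p) = (\<lambda>p. pd v \<phi> p - pd v \<psi> p)"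
  by (rule ext, rule pd_eqI) (intro has_derivative_diff test_function_has_derivative)

lemma pd_cmult:
  "\<phi> \<in> test_functions \<Omega> \<Longrightarrow> pd v (\<lambda>p. c * \<phi> p) = (\<lambda>p. c * pd v \<phi> p)"
  by (rule ext, rule pd_eqI) (intro has_derivative_mult_right test_function_has_derivative)

lemma laplacian_test_function:
  "\<phi> \<in> test_functions \<Omega> \<Longrightarrow> (\<lambda>p. - laplacian \<phi> p) \<in> test_functions \<Omega>"
proof -
  assume \<phi>: "\<phi> \<in> test_functions \<Omega>"
  have "(\<lambda>p. \<Sum>b\<in>S. pd b (pd b \<phi>) p) \<in> test_functions \<Omega>" for S :: "'a set"
    by (induction S rule: infinite_finite_induct)
      (use \<phi> in \<open>simp_all add: test_function_zero test_function_add test_function_pd\<close>)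
  from test_function_cmult[OF this, of "-1" Basis] show ?thesis by (simp add: laplacian_def)
qed

section \<open>Test functions in the L2 space of the domain, and the Dirichlet form\<close>

lemma lebesgue_on_integral:
  fixes f :: "'a::euclidean_space \<Rightarrow> 'b::{banach,second_countable_topology}"
  assumes "open \<Omega>" "f \<in> borel_measurable borel" "\<And>p. p \<notin> \<Omega> \<Longrightarrow> f p = 0"
  shows "integral\<^sup>L (lebesgue_on \<Omega>) f = integral\<^sup>L lborel f"
    and "integrable (lebesgue_on \<Omega>) f \<longleftrightarrow> integrable lborel f"
proof -
  have ind: "(\<lambda>p. indicator \<Omega> p *\<^sub>R f p) = f" using assms(3) by (auto simp: indicator_def fun_eq_iff)
  have \<Omega>: "\<Omega> \<inter> space lebesgue \<in> sets lebesgue" using assms(1) by (simp add: lmeasurable_open borel_open sets_completionI_sets)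
  show "integral\<^sup>L (lebesgue_on \<Omega>) f = integral\<^sup>L lborel f"
    using assms(2) by (simp add: integral_restrict_space[OF \<Omega>] ind integral_completion)
  show "integrable (lebesgue_on \<Omega>) f \<longleftrightarrow> integrable lborel f"
    using assms(2) by (simp add: integrable_restrict_space[OF \<Omega>] ind integrable_completion)
qed

lemma borel_measurable_lebesgue_on: "f \<in> borel_measurable borel \<Longrightarrow> f \<in> borel_measurable (lebesgue_on \<Omega>)"
  by (intro measurable_restrict_space1 measurable_completion) simp

lemma cc_square: "cc f \<Longrightarrow> cc (\<lambda>p. (norm (f p))\<^sup>2)"
  by (rule ccI[of _ f]) (auto intro!: continuous_intros dest: cc_continuous)

lemma cc_inner:
  fixes g :: "'a::euclidean_space \<Rightarrow> 'b::real_inner"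
  shows "cc f \<Longrightarrow> continuous_on UNIV g \<Longrightarrow> cc (\<lambda>p. f p \<bullet> g p)"
  by (rule ccI[of _ f]) (auto intro!: continuous_intros dest: cc_continuous)

lemma test_function_l2:
  assumes "open \<Omega>" "\<phi> \<in> test_functions \<Omega>" shows "\<phi> \<in> l2 (lebesgue_on \<Omega>)"
proof -
  have "integrable (lebesgue_on \<Omega>) (\<lambda>p. (cmod (\<phi> p))\<^sup>2)"
    using cc_square[OF test_function_cc[OF assms(2)]] test_function_outside[OF assms(2)]
    by (subst lebesgue_on_integral(2)[OF assms(1)]) (auto intro: cc_integrable cc_borel)
  then show ?thesis
    using test_function_cc[OF assms(2)] by (auto simp: l2_def intro: borel_measurable_lebesgue_on cc_borel)
qed

lemma cc_l2: "cc \<phi> \<Longrightarrow> \<phi> \<in> l2 lborel"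
  using cc_square[of \<phi>] by (auto simp: l2_def intro: cc_integrable dest: cc_borel)

lemma test_function_rip:
  assumes "open \<Omega>" "\<phi> \<in> test_functions \<Omega>" "\<psi> \<in> test_functions \<Omega>"
  shows "rip (lebesgue_on \<Omega>) \<phi> \<psi> = rip lborel \<phi> \<psi>"
  unfolding rip_def using assms
  by (intro lebesgue_on_integral(1) cc_borel cc_inner)
     (auto intro: test_function_cc cc_continuous simp: test_function_outside)

lemma test_function_nrm:
  assumes "open \<Omega>" "\<phi> \<in> test_functions \<Omega>"
  shows "nrm (lebesgue_on \<Omega>) \<phi> = nrm lborel \<phi>"
proof (rule power2_eq_imp_eq)
  show "(nrm (lebesgue_on \<Omega>) \<phi>)\<^sup>2 = (nrm lborel \<phi>)\<^sup>2"
    unfolding nrm_square_rip by (rule test_function_rip[OF assms assms(2)])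
qed (simp_all add: nrm_nonneg)

text \<open>The real part of the Dirichlet form. Integrating over the whole space changes nothing
  for test functions, and it spares the later changes of variables from following
  \<open>\<Omega>\<close>.\<close>

definition dir :: "('a::euclidean_space \<Rightarrow> complex) \<Rightarrow> ('a \<Rightarrow> complex) \<Rightarrow> real" where
  "dir \<phi> \<psi> = (\<Sum>b\<in>Basis. rip lborel (pd b \<phi>) (pd b \<psi>))"

lemma integration_by_parts:
  assumes \<phi>: "\<phi> \<in> test_functions \<Omega>" and \<psi>: "\<psi> \<in> test_functions \<Omega>"
  shows "rip lborel (pd v \<phi>) \<psi> = - rip lborel \<phi> (pd v \<psi>)"
proof -
  have "integral\<^sup>L lborel (\<lambda>p. \<phi> p \<bullet> pd v \<psi> p + pd v \<phi> p \<bullet> \<psi> p) = 0"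
  proof (rule integral_derivative_zero[where F' = "\<lambda>p v. \<phi> p \<bullet> pd v \<psi> p + pd v \<phi> p \<bullet> \<psi> p"])
    show "cc (\<lambda>p. \<phi> p \<bullet> \<psi> p)" using \<phi> \<psi> by (intro cc_inner cc_continuous test_function_cc)
    show "((\<lambda>p. \<phi> p \<bullet> \<psi> p) has_derivative (\<lambda>v. \<phi> p \<bullet> pd v \<psi> p + pd v \<phi> p \<bullet> \<psi> p)) (at p)" for p
      by (rule has_derivative_inner[OF test_function_has_derivative[OF \<phi>] test_function_has_derivative[OF \<psi>]])
    show "continuous_on UNIV (\<lambda>p. \<phi> p \<bullet> pd v \<psi> p + pd v \<phi> p \<bullet> \<psi> p)"
      using \<phi> \<psi> by (intro continuous_intros cc_continuous test_function_cc test_function_pd)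
  qed
  moreover have "integrable lborel (\<lambda>p. \<phi> p \<bullet> pd v \<psi> p)" "integrable lborel (\<lambda>p. pd v \<phi> p \<bullet> \<psi> p)"
    using \<phi> \<psi> by (auto intro!: cc_integrable cc_inner intro: cc_continuous test_function_cc test_function_pd)
  ultimately show ?thesis by (simp add: rip_def)
qed

lemma laplacian_form:
  assumes op: "open \<Omega>" and \<phi>: "\<phi> \<in> test_functions \<Omega>" and \<psi>: "\<psi> \<in> test_functions \<Omega>"
  shows "rip (lebesgue_on \<Omega>) (\<lambda>p. - laplacian \<phi> p) \<psi> = dir \<phi> \<psi>"
proof -
  have i: "integrable lborel (\<lambda>p. pd b (pd b \<phi>) p \<bullet> \<psi> p)" for b
    using \<phi> \<psi> by (intro cc_integrable cc_inner cc_continuous test_function_cc test_function_pd)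
  have "rip (lebesgue_on \<Omega>) (\<lambda>p. - laplacian \<phi> p) \<psi> = rip lborel (\<lambda>p. - laplacian \<phi> p) \<psi>"
    by (rule test_function_rip[OF op laplacian_test_function[OF \<phi>] \<psi>])
  also have "\<dots> = - (\<Sum>b\<in>Basis. rip lborel (pd b (pd b \<phi>)) \<psi>)"
    using i by (simp add: rip_def laplacian_def inner_sum_left)
  also have "\<dots> = dir \<phi> \<psi>"
    using integration_by_parts[OF test_function_pd[OF \<phi>] \<psi>] by (simp add: dir_def sum_negf)
  finally show ?thesis .
qed

lemma L2_inner_Re_Im:
  assumes "f \<in> l2 (lebesgue_on \<Omega>)" "g \<in> l2 (lebesgue_on \<Omega>)"
  shows "Re (L2_inner \<Omega> f g) = rip (lebesgue_on \<Omega>) f g"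
    and "Im (L2_inner \<Omega> f g) = rip (lebesgue_on \<Omega>) f (\<lambda>p. \<i> * g p)"
proof -
  note i = l2_integrable_cnj[OF assms]
  have "Re (L2_inner \<Omega> f g) = (\<integral>p. Re (f p * cnj (g p)) \<partial>lebesgue_on \<Omega>)"
    unfolding L2_inner_def by (rule integral_bounded_linear[OF bounded_linear_Re i, symmetric])
  then show "Re (L2_inner \<Omega> f g) = rip (lebesgue_on \<Omega>) f g" by (simp add: rip_def inner_complex_def)
  have "Im (L2_inner \<Omega> f g) = (\<integral>p. Im (f p * cnj (g p)) \<partial>lebesgue_on \<Omega>)"
    unfolding L2_inner_def by (rule integral_bounded_linear[OF bounded_linear_Im i, symmetric])
  then show "Im (L2_inner \<Omega> f g) = rip (lebesgue_on \<Omega>) f (\<lambda>p. \<i> * g p)" by (simp add: rip_def inner_complex_def algebra_simps)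
qed

section \<open>Approximate solutions of coercive problems in an incomplete space\<close>

text \<open>A quadratic polynomial in \<open>t\<close> without sign change has nonpositive
  discriminant; for \<open>n = 0\<close> it is affine, so \<open>A = 0\<close>. With a free constant
  term it serves both the Cauchy-Schwarz inequality and near-minimisers.\<close>

lemma discriminant_bound:
  fixes A n e :: real
  assumes n: "n \<ge> 0" and q: "\<And>t. e\<^sup>2 + 2 * t * A + t\<^sup>2 * n \<ge> 0"
  shows "\<bar>A\<bar> \<le> \<bar>e\<bar> * sqrt n"
proof (cases "n = 0")
  case True
  have "A = 0"
  proof (rule ccontr)
    assume A: "A \<noteq> 0"
    have "e\<^sup>2 + 2 * (- (e\<^sup>2 + 1) / (2 * A)) * A \<ge> 0" using q[of "- (e\<^sup>2 + 1) / (2 * A)"] True by simp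
    then show False using A by (simp add: field_simps)
  qed
  then show ?thesis using n by simp
next
  case False
  then have n: "n > 0" using n by simp
  have "e\<^sup>2 + 2 * (- A / n) * A + (- A / n)\<^sup>2 * n \<ge> 0" by (rule q)
  then have "A\<^sup>2 \<le> e\<^sup>2 * n" using n by (simp add: power2_eq_square field_simps)
  then have "sqrt (A\<^sup>2) \<le> sqrt (e\<^sup>2 * n)" by (rule real_sqrt_le_mono)
  then show ?thesis by (simp add: real_sqrt_mult)
qed

text \<open>\<open>cmb x c y\<close> stands for \<open>x + c y\<close>; completeness is not assumed.\<close>

locale pre_hilbert =
  fixes D :: "'v set" and cmb :: "'v \<Rightarrow> real \<Rightarrow> 'v \<Rightarrow> 'v" and s :: "'v \<Rightarrow> 'v \<Rightarrow> real"
  assumes cmb: "x \<in> D \<Longrightarrow> y \<in> D \<Longrightarrow> cmb x c y \<in> D"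
    and s_left: "x \<in> D \<Longrightarrow> y \<in> D \<Longrightarrow> w \<in> D \<Longrightarrow> s (cmb x c y) w = s x w + c * s y w"
    and s_sym: "s x y = s y x"
    and s_nonneg: "x \<in> D \<Longrightarrow> s x x \<ge> 0"
    and D_ne: "D \<noteq> {}"
begin

definition N where "N x = sqrt (s x x)"

lemma N_nonneg: "x \<in> D \<Longrightarrow> N x \<ge> 0" by (simp add: N_def s_nonneg)

lemma N_sq: "x \<in> D \<Longrightarrow> (N x)\<^sup>2 = s x x" by (simp add: N_def s_nonneg)

lemma s_right: "x \<in> D \<Longrightarrow> y \<in> D \<Longrightarrow> w \<in> D \<Longrightarrow> s w (cmb x c y) = s w x + c * s w y"
  using s_left[of x y w c] s_sym[of w] by simp

lemma s_cmb: "x \<in> D \<Longrightarrow> y \<in> D \<Longrightarrow> s (cmb x c y) (cmb x c y) = s x x + 2 * c * s x y + c\<^sup>2 * s y y"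
  using s_left[of x y "cmb x c y" c] s_right[of x y x c] s_right[of x y y c] cmb[of x y c] s_sym[of y x]
  by (simp add: power2_eq_square algebra_simps)

lemma s_Cauchy_Schwarz: "x \<in> D \<Longrightarrow> y \<in> D \<Longrightarrow> \<bar>s x y\<bar> \<le> N x * N y"
proof -
  assume xy: "x \<in> D" "y \<in> D"
  have "\<bar>s x y\<bar> \<le> \<bar>N x\<bar> * sqrt (s y y)"
  proof (rule discriminant_bound)
    fix t show "(N x)\<^sup>2 + 2 * t * s x y + t\<^sup>2 * s y y \<ge> 0"
      using s_nonneg[OF cmb[OF xy, of t]] s_cmb[OF xy, of t] N_sq[OF xy(1)] by simp
  qed (use xy s_nonneg in auto)
  then show ?thesis using N_nonneg[OF xy(1)] by (simp add: N_def[of y])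
qed

text \<open>\<open>x\<close> minimises the functional \<open>J\<close> up to
  \<open>e\<^sup>2\<close>. A variation \<open>cmb x t y\<close> can then lower \<open>J\<close> by
  at most \<open>e\<^sup>2\<close>, and the discriminant of this quadratic in \<open>t\<close>
  bounds the linear term.\<close>

lemma near_riesz:
  assumes lin: "\<And>x y c. x \<in> D \<Longrightarrow> y \<in> D \<Longrightarrow> l (cmb x c y) = l x + c * l y"
    and bd: "\<And>x. x \<in> D \<Longrightarrow> \<bar>l x\<bar> \<le> K * N x" and e: "e > 0"
  shows "\<exists>x\<in>D. \<forall>y\<in>D. \<bar>l y - s x y\<bar> \<le> e * N y"
proof -
  define J where "J x = s x x - 2 * l x" for x
  have Jlow: "J x \<ge> - K\<^sup>2" if "x \<in> D" for x
  proof -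
    have "J x \<ge> (N x)\<^sup>2 - 2 * (K * N x)" using bd[OF that] N_sq[OF that] by (simp add: J_def abs_le_iff)
    also have "(N x)\<^sup>2 - 2 * (K * N x) = (N x - K)\<^sup>2 - K\<^sup>2" by (simp add: power2_eq_square algebra_simps)
    finally show ?thesis using zero_le_power2[of "N x - K"] by linarith
  qed
  then have bb: "bdd_below (J ` D)" by (intro bdd_belowI2[where m = "- K\<^sup>2"])
  obtain x where x: "x \<in> D" "J x < Inf (J ` D) + e\<^sup>2"
    using cInf_lessD[of "J ` D" "Inf (J ` D) + e\<^sup>2"] D_ne e by auto
  have "\<bar>l y - s x y\<bar> \<le> e * N y" if y: "y \<in> D" for y
  proof -
    have "\<bar>s x y - l y\<bar> \<le> \<bar>e\<bar> * sqrt (s y y)"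
    proof (rule discriminant_bound)
      fix t
      have "Inf (J ` D) \<le> J (cmb x t y)" using bb cmb[OF x(1) y] by (intro cInf_lower) auto
      then have "J x - e\<^sup>2 \<le> J (cmb x t y)" using x by simp
      also have "J (cmb x t y) = J x + 2 * t * (s x y - l y) + t\<^sup>2 * s y y"
        using s_cmb[OF x(1) y, of t] lin[OF x(1) y, of t] by (simp add: J_def algebra_simps)
      finally show "e\<^sup>2 + 2 * t * (s x y - l y) + t\<^sup>2 * s y y \<ge> 0" by simp
    qed (rule s_nonneg[OF y])
    then show ?thesis using e by (simp add: N_def abs_minus_commute)
  qed
  then show ?thesis using x(1) by blast
qed

lemma near_riesz_norm:
  assumes x: "x \<in> D" and near: "\<forall>y\<in>D. \<bar>l y - s x y\<bar> \<le> e * N y" and l: "\<bar>l x\<bar> \<le> K * N x"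
    and "K \<ge> 0" "e \<ge> 0"
  shows "N x \<le> K + e"
proof (cases "N x = 0")
  case False
  then have pos: "N x > 0" using N_nonneg[OF x] by simp
  have "N x * N x \<le> (K + e) * N x"
    using near x l N_sq[OF x] by (auto simp: power2_eq_square algebra_simps abs_le_iff dest!: bspec)
  then show ?thesis using pos by simp
qed (use assms in simp)

text \<open>An exact solution need not exist in \<open>D\<close>, so the object of study is the
  infimum of the attainable residuals in the dual norm. Each residual can be improved by the fixed
  factor \<open>\<kappa>\<close> up to an arbitrarily small error, so a positive infimum is
  impossible.\<close>

lemma near_lax_milgram:
  assumes Bl: "\<And>x y w c. x \<in> D \<Longrightarrow> y \<in> D \<Longrightarrow> w \<in> D \<Longrightarrow> B (cmb x c y) w = B x w + c * B y w"
    and Br: "\<And>x y w c. x \<in> D \<Longrightarrow> y \<in> D \<Longrightarrow> w \<in> D \<Longrightarrow> B w (cmb x c y) = B w x + c * B w y"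
    and Bb: "\<And>x y. x \<in> D \<Longrightarrow> y \<in> D \<Longrightarrow> \<bar>B x y\<bar> \<le> M * N x * N y" and M: "M \<ge> 1"
    and coer: "\<And>x. x \<in> D \<Longrightarrow> B x x \<ge> s x x"
    and lin: "\<And>x y c. x \<in> D \<Longrightarrow> y \<in> D \<Longrightarrow> l (cmb x c y) = l x + c * l y"
    and bd: "\<And>x. x \<in> D \<Longrightarrow> \<bar>l x\<bar> \<le> K * N x" and K: "K \<ge> 0" and e: "e > 0"
  shows "\<exists>x\<in>D. \<forall>y\<in>D. \<bar>l y - B x y\<bar> \<le> e * N y"
proof -
  define S where "S = {\<rho>. \<rho> \<ge> 0 \<and> (\<exists>x\<in>D. \<forall>y\<in>D. \<bar>l y - B x y\<bar> \<le> \<rho> * N y)}"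
  \<comment> \<open>The squared norm of \<open>v\<close> minus \<open>\<theta>\<close> times a
    representative of \<open>B v\<close> carries the factor
    \<open>1 - 2 * \<theta> + \<theta>\<^sup>2 * M\<^sup>2\<close>. This choice minimises it, with
    value \<open>1 - \<theta>\<close>.\<close>
  define \<theta> where "\<theta> = 1 / M\<^sup>2"
  have \<theta>: "0 < \<theta>" "\<theta> \<le> 1" "\<theta> * M\<^sup>2 = 1" using M by (auto simp: \<theta>_def)
  define \<kappa> where "\<kappa> = sqrt (1 - \<theta>)"
  have \<kappa>: "0 \<le> \<kappa>" "\<kappa> < 1" using \<theta> by (auto simp: \<kappa>_def)
  \<comment> \<open>One Richardson step \<open>x + \<theta> v\<close>, with \<open>v\<close> a near Riesz representative of the residual, contracts the residual by \<open>\<kappa>\<close> up to \<open>\<eta>\<close>.\<close>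
  have contr: "\<kappa> * \<rho> + \<eta> \<in> S" if \<rho>: "\<rho> \<in> S" and \<eta>: "\<eta> > 0" for \<rho> \<eta>
  proof -
    have \<rho>0: "\<rho> \<ge> 0" using \<rho> by (simp add: S_def)
    obtain x where x: "x \<in> D" "\<And>y. y \<in> D \<Longrightarrow> \<bar>l y - B x y\<bar> \<le> \<rho> * N y" using \<rho> by (auto simp: S_def)
    \<comment> \<open>The total error when both near-representatives below have accuracy
      \<open>\<epsilon>\<close>. It tends to \<open>\<kappa> * \<rho>\<close> as
      \<open>\<epsilon>\<close> tends to 0, so \<open>\<epsilon>\<close> can be fixed with a loss
      below \<open>\<eta>\<close>.\<close>
    let ?g = "\<lambda>\<epsilon>. \<epsilon> + \<theta> * \<epsilon> + sqrt ((1 - \<theta>) * (\<rho> + \<epsilon>)\<^sup>2 + 2 * \<theta> * \<epsilon> * (\<rho> + \<epsilon>) + \<theta>\<^sup>2 * (2 * M * (\<rho> + \<epsilon>) * \<epsilon> + \<epsilon>\<^sup>2))"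
    have "?g \<midarrow>0\<rightarrow> ?g 0" by (intro tendsto_intros)
    moreover have "?g 0 = \<kappa> * \<rho>" using \<rho>0 by (simp add: \<kappa>_def real_sqrt_mult)
    ultimately have "(?g \<longlongrightarrow> \<kappa> * \<rho>) (at_right 0)" by (simp add: filterlim_at_split)
    then have "\<forall>\<^sub>F \<epsilon> in at_right 0. ?g \<epsilon> < \<kappa> * \<rho> + \<eta>" using \<eta> by (intro order_tendstoD(2)) auto
    then have "\<forall>\<^sub>F \<epsilon> in at_right 0. ?g \<epsilon> < \<kappa> * \<rho> + \<eta> \<and> \<epsilon> > 0"
      by (intro eventually_conj eventually_at_right_less)
    then obtain \<epsilon> where \<epsilon>: "\<epsilon> > 0" "?g \<epsilon> < \<kappa> * \<rho> + \<eta>"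
      using eventually_happens trivial_limit_at_right_real by blast
    define r where "r y = l y - B x y" for y
    have rb: "\<bar>r y\<bar> \<le> \<rho> * N y" if "y \<in> D" for y using x(2)[OF that] by (simp add: r_def)
    obtain v where v: "v \<in> D" "\<forall>y\<in>D. \<bar>r y - s v y\<bar> \<le> \<epsilon> * N y"
    proof -
      have "\<exists>v\<in>D. \<forall>y\<in>D. \<bar>r y - s v y\<bar> \<le> \<epsilon> * N y"
        by (rule near_riesz[where K = \<rho>]) (use rb \<epsilon> lin Br x in \<open>auto simp: r_def algebra_simps\<close>)
      then show ?thesis using that by blast
    qed
    have Nv: "N v \<le> \<rho> + \<epsilon>" using near_riesz_norm[OF v rb[OF v(1)]] \<rho>0 \<epsilon> by simp
    have Nv0: "N v \<ge> 0" by (rule N_nonneg[OF v(1)])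
    obtain w where w: "w \<in> D" "\<forall>y\<in>D. \<bar>B v y - s w y\<bar> \<le> \<epsilon> * N y"
    proof -
      have "\<exists>w\<in>D. \<forall>y\<in>D. \<bar>B v y - s w y\<bar> \<le> \<epsilon> * N y"
        by (rule near_riesz[where K = "M * N v"]) (use Bb \<epsilon> Br v in auto)
      then show ?thesis using that by blast
    qed
    have Nw: "N w \<le> M * N v + \<epsilon>"
      using near_riesz_norm[OF w(1) w(2), of "M * N v"] Bb[OF v(1) w(1)] \<epsilon> M Nv0 by simp
    have sw: "s v w \<ge> s v v - \<epsilon> * N v"
      using w(2) v(1) coer[OF v(1)] s_sym[of v w] by (auto simp: abs_le_iff dest!: bspec[of _ _ v])
    define d where "d = cmb v (- \<theta>) w"
    have d: "d \<in> D" unfolding d_def by (rule cmb[OF v(1) w(1)])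
    have "s d d = s v v - 2 * \<theta> * s v w + \<theta>\<^sup>2 * s w w"
      unfolding d_def using s_cmb[OF v(1) w(1), of "- \<theta>"] by simp
    also have "\<dots> \<le> s v v - 2 * \<theta> * (s v v - \<epsilon> * N v) + \<theta>\<^sup>2 * (M * N v + \<epsilon>)\<^sup>2"
      using sw \<theta> Nw N_nonneg[OF w(1)] N_sq[OF w(1)]
      by (intro add_mono diff_mono mult_left_mono) (auto simp: power_mono simp flip: N_sq[OF w(1)])
    also have "\<dots> = (1 - 2 * \<theta> + \<theta> * (\<theta> * M\<^sup>2)) * (N v)\<^sup>2 + 2 * \<theta> * \<epsilon> * N v + \<theta>\<^sup>2 * (2 * M * N v * \<epsilon> + \<epsilon>\<^sup>2)"
      unfolding N_sq[OF v(1), symmetric] by (simp add: power2_eq_square algebra_simps)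
    also have "\<dots> = (1 - \<theta>) * (N v)\<^sup>2 + 2 * \<theta> * \<epsilon> * N v + \<theta>\<^sup>2 * (2 * M * N v * \<epsilon> + \<epsilon>\<^sup>2)"
      using \<theta>(3) by simp
    also have "\<dots> \<le> (1 - \<theta>) * (\<rho> + \<epsilon>)\<^sup>2 + 2 * \<theta> * \<epsilon> * (\<rho> + \<epsilon>) + \<theta>\<^sup>2 * (2 * M * (\<rho> + \<epsilon>) * \<epsilon> + \<epsilon>\<^sup>2)"
      using Nv Nv0 \<theta> \<epsilon> M by (intro add_mono mult_left_mono mult_right_mono power_mono) auto
    finally have Nd: "N d \<le> sqrt ((1 - \<theta>) * (\<rho> + \<epsilon>)\<^sup>2 + 2 * \<theta> * \<epsilon> * (\<rho> + \<epsilon>) + \<theta>\<^sup>2 * (2 * M * (\<rho> + \<epsilon>) * \<epsilon> + \<epsilon>\<^sup>2))"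
      unfolding N_def by (rule real_sqrt_le_mono)
    have "\<bar>l y - B (cmb x \<theta> v) y\<bar> \<le> (\<kappa> * \<rho> + \<eta>) * N y" if y: "y \<in> D" for y
    proof -
      have "l y - B (cmb x \<theta> v) y = (r y - s v y) + s d y + \<theta> * (s w y - B v y)"
        using Bl[OF x(1) v(1) y] s_left[OF v(1) w(1) y, of "- \<theta>"] by (simp add: r_def d_def algebra_simps)
      also have "\<bar>\<dots>\<bar> \<le> \<bar>r y - s v y\<bar> + \<bar>s d y\<bar> + \<bar>\<theta> * (s w y - B v y)\<bar>" by linarith
      also have "\<bar>\<theta> * (s w y - B v y)\<bar> = \<theta> * \<bar>B v y - s w y\<bar>" using \<theta> by (simp add: abs_mult abs_minus_commute)
      also have "\<bar>r y - s v y\<bar> + \<bar>s d y\<bar> + \<theta> * \<bar>B v y - s w y\<bar> \<le> \<epsilon> * N y + N d * N y + \<theta> * (\<epsilon> * N y)"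
        using v(2) w(2) y s_Cauchy_Schwarz[OF d y] \<theta> by (intro add_mono mult_left_mono) auto
      also have "\<dots> = (\<epsilon> + \<theta> * \<epsilon> + N d) * N y" by (simp add: algebra_simps)
      also have "\<dots> \<le> (\<kappa> * \<rho> + \<eta>) * N y" using Nd \<epsilon>(2) N_nonneg[OF y] by (intro mult_right_mono) auto
      finally show ?thesis .
    qed
    moreover have "cmb x \<theta> v \<in> D" by (rule cmb[OF x(1) v(1)])
    ultimately show ?thesis using \<kappa> \<rho>0 \<eta> unfolding S_def by auto
  qed
  obtain x0 where x0: "x0 \<in> D" using D_ne by blast
  have "K \<in> S"
  proof -
    \<comment> \<open>The zero vector, built as \<open>x0 - x0\<close> because the locale has no
      constant for it. Its residual is \<open>l\<close> itself, so the starting bound is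
      \<open>K\<close>.\<close>
    define o0 where "o0 = cmb x0 (-1) x0"
    have "B o0 y = 0" if "y \<in> D" for y using Bl[OF x0 x0 that, of "-1"] by (simp add: o0_def)
    moreover have "o0 \<in> D" unfolding o0_def by (rule cmb[OF x0 x0])
    ultimately show ?thesis using bd K unfolding S_def by (auto intro!: bexI[of _ o0])
  qed
  have bb: "bdd_below S" by (rule bdd_belowI[of _ 0]) (auto simp: S_def)
  define m where "m = Inf S"
  have m0: "m \<ge> 0" unfolding m_def using \<open>K \<in> S\<close> by (intro cInf_greatest) (auto simp: S_def)
  have "m = 0"
  proof (rule ccontr)
    assume "m \<noteq> 0"
    then have mp: "m > 0" using m0 by simp
    define \<eta> where "\<eta> = (1 - \<kappa>) * m / 4"
    have \<eta>: "\<eta> > 0" using mp \<kappa> by (simp add: \<eta>_def)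
    obtain \<rho> where \<rho>: "\<rho> \<in> S" "\<rho> < m + \<eta>"
      using cInf_lessD[of S "m + \<eta>"] \<open>K \<in> S\<close> \<eta> by (auto simp: m_def)
    have "m \<le> \<kappa> * \<rho> + \<eta>" unfolding m_def by (rule cInf_lower[OF contr[OF \<rho>(1) \<eta>] bb])
    also have "\<dots> \<le> \<kappa> * (m + \<eta>) + \<eta>" using \<rho> \<kappa> by (simp add: mult_left_mono)
    also have "\<dots> \<le> \<kappa> * m + 1 * \<eta> + \<eta>" using \<kappa> \<eta> by (simp add: algebra_simps)
    also have "\<dots> = m - 2 * \<eta>" by (simp add: \<eta>_def field_simps)
    finally show False using \<eta> by simp
  qed
  then obtain \<rho> where "\<rho> \<in> S" "\<rho> < e"
    using cInf_lessD[of S e] \<open>K \<in> S\<close> e by (auto simp: m_def)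
  then obtain x where x: "x \<in> D" "\<And>y. y \<in> D \<Longrightarrow> \<bar>l y - B x y\<bar> \<le> \<rho> * N y" by (auto simp: S_def)
  have "\<bar>l y - B x y\<bar> \<le> e * N y" if y: "y \<in> D" for y
    using x(2)[OF y] mult_right_mono[OF less_imp_le[OF \<open>\<rho> < e\<close>] N_nonneg[OF y]] by linarith
  then show ?thesis using x(1) by blast
qed

end

section \<open>The Friedrichs extension and its resolvent\<close>

lemma test_function_cmb:
  "\<phi> \<in> test_functions \<Omega> \<Longrightarrow> \<psi> \<in> test_functions \<Omega> \<Longrightarrow> (\<lambda>p. \<phi> p + complex_of_real c * \<psi> p) \<in> test_functions \<Omega>"
  by (intro test_function_add test_function_cmult)

lemma pd_l2: "\<phi> \<in> test_functions \<Omega> \<Longrightarrow> pd v \<phi> \<in> l2 lborel"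
  by (intro cc_l2 test_function_cc test_function_pd)

lemma dir_add:
  assumes "x \<in> test_functions \<Omega>" "y \<in> test_functions \<Omega>" "w \<in> test_functions \<Omega>"
  shows "dir (\<lambda>p. x p + y p) w = dir x w + dir y w"
  using assms by (simp add: dir_def pd_add[OF assms(1,2)] rip_add pd_l2 sum.distrib)

lemma dir_sym: "dir x y = dir y x" by (simp add: dir_def rip_commute)

lemma dir_real_mult: "x \<in> test_functions \<Omega> \<Longrightarrow> dir (\<lambda>p. complex_of_real c * x p) w = c * dir x w"
  by (simp add: dir_def pd_cmult rip_real_mult sum_distrib_left)

lemma dir_nonneg: "dir \<phi> \<phi> \<ge> 0"
  unfolding dir_def by (intro sum_nonneg) (simp flip: nrm_square_rip)

lemma dir_imag: "\<phi> \<in> test_functions \<Omega> \<Longrightarrow> dir (\<lambda>p. \<i> * \<phi> p) \<phi> = 0"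
  by (simp add: dir_def pd_cmult rip_def inner_complex_def)

lemma rip_imag: "rip M (\<lambda>p. \<i> * f p) f = 0"
  by (simp add: rip_def inner_complex_def)

lemma dir_cmult_le:
  assumes x: "x \<in> test_functions \<Omega>" and y: "y \<in> test_functions \<Omega>"
  shows "\<bar>dir (\<lambda>p. c * x p) y\<bar> \<le> cmod c * (sqrt (dir x x) * sqrt (dir y y))"
proof -
  have L2: "L2_set (\<lambda>b. nrm lborel (pd b z)) Basis = sqrt (dir z z)" for z :: "'a \<Rightarrow> complex"
    by (simp add: L2_set_def dir_def nrm_square_rip)
  have "\<bar>dir (\<lambda>p. c * x p) y\<bar> \<le> (\<Sum>b\<in>Basis. \<bar>rip lborel (\<lambda>p. c * pd b x p) (pd b y)\<bar>)"
    unfolding dir_def using x by (simp add: pd_cmult sum_abs)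
  also have "\<dots> \<le> (\<Sum>b\<in>Basis. cmod c * (\<bar>nrm lborel (pd b x)\<bar> * \<bar>nrm lborel (pd b y)\<bar>))"
  proof (rule sum_mono)
    fix b :: 'a
    have "\<bar>rip lborel (\<lambda>p. c * pd b x p) (pd b y)\<bar> \<le> nrm lborel (\<lambda>p. c * pd b x p) * nrm lborel (pd b y)"
      by (rule rip_le[OF l2_cmult[OF pd_l2[OF x]] pd_l2[OF y]])
    then show "\<bar>rip lborel (\<lambda>p. c * pd b x p) (pd b y)\<bar> \<le> cmod c * (\<bar>nrm lborel (pd b x)\<bar> * \<bar>nrm lborel (pd b y)\<bar>)"
      by (simp add: nrm_cmult nrm_nonneg mult.assoc)
  qed
  also have "\<dots> = cmod c * (\<Sum>b\<in>Basis. \<bar>nrm lborel (pd b x)\<bar> * \<bar>nrm lborel (pd b y)\<bar>)" by (simp add: sum_distrib_left)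
  also have "\<dots> \<le> cmod c * (sqrt (dir x x) * sqrt (dir y y))"
    using L2_set_mult_ineq[of "\<lambda>b. nrm lborel (pd b x)" "\<lambda>b. nrm lborel (pd b y)" Basis]
    by (intro mult_left_mono) (simp_all add: L2)
  finally show ?thesis .
qed

definition hnorm :: "'a::euclidean_space set \<Rightarrow> ('a \<Rightarrow> complex) \<Rightarrow> real" where
  "hnorm \<Omega> \<phi> = sqrt (dir \<phi> \<phi> + (nrm (lebesgue_on \<Omega>) \<phi>)\<^sup>2)"

lemma hnorm_nonneg: "hnorm \<Omega> \<phi> \<ge> 0" by (simp add: hnorm_def dir_nonneg)

lemma hnorm_square: "(hnorm \<Omega> \<phi>)\<^sup>2 = dir \<phi> \<phi> + (nrm (lebesgue_on \<Omega>) \<phi>)\<^sup>2"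
  by (simp add: hnorm_def dir_nonneg)

lemma sqrt_dir_le_hnorm: "sqrt (dir \<phi> \<phi>) \<le> hnorm \<Omega> \<phi>" by (simp add: hnorm_def)

lemma nrm_le_hnorm: "nrm (lebesgue_on \<Omega>) \<phi> \<le> hnorm \<Omega> \<phi>"
  unfolding hnorm_def by (rule real_le_rsqrt) (simp add: dir_nonneg)

lemma dir_cmult_self:
  assumes "x \<in> test_functions \<Omega>"
  shows "dir (\<lambda>p. c * x p) (\<lambda>p. c * x p) = (cmod c)\<^sup>2 * dir x x"
  using assms by (simp add: dir_def pd_cmult nrm_cmult power_mult_distrib sum_distrib_left flip: nrm_square_rip)

lemma hnorm_cmult:
  assumes "x \<in> test_functions \<Omega>"
  shows "hnorm \<Omega> (\<lambda>p. c * x p) = cmod c * hnorm \<Omega> x"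
  using dir_cmult_self[OF assms, of c]
  by (simp add: hnorm_def nrm_cmult power_mult_distrib real_sqrt_mult flip: distrib_left)

lemma rip_tendsto:
  assumes f: "\<And>n. f n \<in> l2 M" "f0 \<in> l2 M" "(\<lambda>n. nrm M (\<lambda>p. f n p - f0 p)) \<longlonglongrightarrow> 0"
    and g: "\<And>n. g n \<in> l2 M" "g0 \<in> l2 M" "(\<lambda>n. nrm M (\<lambda>p. g n p - g0 p)) \<longlonglongrightarrow> 0"
  shows "(\<lambda>n. rip M (f n) (g n)) \<longlonglongrightarrow> rip M f0 g0"
proof -
  have "(\<lambda>n. rip M (f n) (g n) - rip M f0 g0) \<longlonglongrightarrow> 0"
  proof (rule Lim_null_comparison)
    let ?F = "\<lambda>n. nrm M (\<lambda>p. f n p - f0 p)" and ?G = "\<lambda>n. nrm M (\<lambda>p. g n p - g0 p)"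
    have "norm (rip M (f n) (g n) - rip M f0 g0) \<le> ?F n * (?G n + nrm M g0) + nrm M f0 * ?G n" for n
    proof -
      have "rip M (f n) (g n) - rip M f0 g0 = rip M (\<lambda>p. f n p - f0 p) (g n) + rip M f0 (\<lambda>p. g n p - g0 p)"
        using f g by (simp add: rip_diff)
      moreover have "\<bar>rip M (\<lambda>p. f n p - f0 p) (g n)\<bar> \<le> ?F n * nrm M (g n)" by (intro rip_le l2_diff f g)
      moreover have "?F n * nrm M (g n) \<le> ?F n * (?G n + nrm M g0)"
        using nrm_triangle[OF l2_diff[OF g(1)[of n] g(2)] g(2)] by (intro mult_left_mono) (auto simp: nrm_nonneg)
      moreover have "\<bar>rip M f0 (\<lambda>p. g n p - g0 p)\<bar> \<le> nrm M f0 * ?G n" by (intro rip_le l2_diff f g)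
      ultimately show ?thesis unfolding real_norm_def by linarith
    qed
    then show "\<forall>\<^sub>F n in sequentially. norm (rip M (f n) (g n) - rip M f0 g0) \<le> ?F n * (?G n + nrm M g0) + nrm M f0 * ?G n"
      by simp
    have "(\<lambda>n. ?F n * (?G n + nrm M g0) + nrm M f0 * ?G n) \<longlonglongrightarrow> 0 * (0 + nrm M g0) + nrm M f0 * 0"
      by (intro tendsto_intros f g)
    then show "(\<lambda>n. ?F n * (?G n + nrm M g0) + nrm M f0 * ?G n) \<longlonglongrightarrow> 0" by simp
  qed
  then show ?thesis by (simp add: LIM_zero_iff)
qed

lemma nrm_cmult_tendsto:
  "(\<lambda>n. nrm M (\<lambda>p. f n p - f0 p)) \<longlonglongrightarrow> 0 \<Longrightarrow> (\<lambda>n. nrm M (\<lambda>p. c * f n p - c * f0 p)) \<longlonglongrightarrow> 0"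
proof -
  assume l: "(\<lambda>n. nrm M (\<lambda>p. f n p - f0 p)) \<longlonglongrightarrow> 0"
  have "nrm M (\<lambda>p. c * f n p - c * f0 p) = cmod c * nrm M (\<lambda>p. f n p - f0 p)" for n
    using nrm_cmult[of M c "\<lambda>p. f n p - f0 p"] by (simp add: right_diff_distrib)
  then show ?thesis using tendsto_mult_right_zero[OF l, of "cmod c"] by simp
qed

lemma rip_tendsto_right:
  assumes "f \<in> l2 M" "\<And>n. g n \<in> l2 M" "g0 \<in> l2 M" "(\<lambda>n. nrm M (\<lambda>p. g n p - g0 p)) \<longlonglongrightarrow> 0"
  shows "(\<lambda>n. rip M f (g n)) \<longlonglongrightarrow> rip M f g0"
  using rip_tendsto[of "\<lambda>_. f" M f g g0] assms by (simp add: nrm_def)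

context
  fixes \<Omega> :: "'a::euclidean_space set"
  assumes op: "open \<Omega>"
begin

abbreviation "MO \<equiv> lebesgue_on \<Omega>"
abbreviation "TF \<equiv> test_functions \<Omega>"

lemma TF_l2: "\<phi> \<in> TF \<Longrightarrow> \<phi> \<in> l2 MO" by (rule test_function_l2[OF op])

lemma test_pre_hilbert:
  "pre_hilbert TF (\<lambda>x c y p. x p + complex_of_real c * y p) (\<lambda>\<phi> \<psi>. dir \<phi> \<psi> + rip MO \<phi> \<psi>)"
proof
  show "x \<in> TF \<Longrightarrow> y \<in> TF \<Longrightarrow> (\<lambda>p. x p + complex_of_real c * y p) \<in> TF" for x y c
    by (rule test_function_cmb)
  fix x y w c assume "x \<in> TF" "y \<in> TF" "w \<in> TF"
  then show "dir (\<lambda>p. x p + complex_of_real c * y p) w + rip MO (\<lambda>p. x p + complex_of_real c * y p) w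
      = dir x w + rip MO x w + c * (dir y w + rip MO y w)"
    by (simp add: dir_add[of _ \<Omega>] dir_real_mult[of _ \<Omega>] test_function_cmult rip_add TF_l2 rip_real_mult algebra_simps)
next
  show "dir x y + rip MO x y = dir y x + rip MO y x" for x y by (simp add: dir_sym rip_commute)
  show "dir x x + rip MO x x \<ge> 0" for x using dir_nonneg[of x] by (simp flip: nrm_square_rip)
  show "TF \<noteq> {}" using test_function_zero by blast
qed

text \<open>Near Lax-Milgram solutions of accuracy \<open>1 / real (Suc n)\<close> for the form
  turned by the factor \<open>k\<close>. By coercivity the form norm of a difference is at most the
  sum of the two residuals; hence the sequence is Cauchy at an explicit rate, and \<open>C\<close>
  is \<open>cmod k\<close>.\<close>

lemma resolvent_approx:
  assumes g: "g \<in> l2 MO" and z: "Im z > 0" "Re z \<ge> 0"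
  shows "\<exists>\<phi>::nat \<Rightarrow> 'a \<Rightarrow> complex. \<exists>C\<ge>0. (\<forall>n. \<phi> n \<in> TF) \<and>
    (\<forall>n. \<forall>\<psi>\<in>TF. \<bar>rip MO g \<psi> - (dir (\<phi> n) \<psi> - rip MO (\<lambda>p. z * \<phi> n p) \<psi>)\<bar> \<le> 1 / real (Suc n) * hnorm \<Omega> \<psi>) \<and>
    (\<forall>m n. hnorm \<Omega> (\<lambda>p. \<phi> m p - \<phi> n p) \<le> C * (1 / real (Suc m) + 1 / real (Suc n)))"
proof -
  interpret H: pre_hilbert TF "\<lambda>x c y p. x p + complex_of_real c * y p" "\<lambda>\<phi> \<psi>. dir \<phi> \<psi> + rip MO \<phi> \<psi>"
    by (rule test_pre_hilbert)
  have N: "H.N \<phi> = hnorm \<Omega> \<phi>" for \<phi> by (simp add: hnorm_def H.N_def nrm_square_rip)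
  \<comment> \<open>The factor \<open>k\<close> makes the form coercive, since \<open>z * k\<close> has real part \<open>- 1\<close>.\<close>
  define \<beta> where "\<beta> = (Re z + 1) / Im z"
  define k where "k = Complex 1 \<beta>"
  define A where "A \<phi> \<psi> = dir \<phi> \<psi> - rip MO (\<lambda>p. z * \<phi> p) \<psi>" for \<phi> \<psi>
  define B where "B \<phi> \<psi> = A (\<lambda>p. k * \<phi> p) \<psi>" for \<phi> \<psi>
  have zk: "z * k = Complex (-1) (Re z * \<beta> + Im z)"
    using z by (simp add: k_def \<beta>_def complex_eq_iff field_simps)
  have ckl2: "(\<lambda>p. c * x p) \<in> l2 MO" if "x \<in> TF" for c x using TF_l2[OF that] by (rule l2_cmult)
  have Bl: "B (\<lambda>p. x p + complex_of_real c * y p) w = B x w + c * B y w"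
    if xy: "x \<in> TF" "y \<in> TF" "w \<in> TF" for x y w c
  proof -
    have e1: "(\<lambda>p. k * (x p + complex_of_real c * y p)) = (\<lambda>p. k * x p + complex_of_real c * (k * y p))"
      by (simp add: algebra_simps)
    have e2: "(\<lambda>p. z * (k * x p + complex_of_real c * (k * y p))) = (\<lambda>p. z * (k * x p) + complex_of_real c * (z * (k * y p)))"
      by (simp add: algebra_simps)
    have d: "dir (\<lambda>p. k * x p + complex_of_real c * (k * y p)) w = dir (\<lambda>p. k * x p) w + c * dir (\<lambda>p. k * y p) w"
      using xy by (simp add: dir_add[of _ \<Omega>] dir_real_mult[of _ \<Omega>] test_function_cmult)
    have r: "rip MO (\<lambda>p. z * (k * x p) + complex_of_real c * (z * (k * y p))) w
        = rip MO (\<lambda>p. z * (k * x p)) w + c * rip MO (\<lambda>p. z * (k * y p)) w"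
      using xy by (simp add: rip_add TF_l2 ckl2 l2_cmult rip_real_mult)
    show ?thesis unfolding B_def A_def e1 e2 d r right_diff_distrib by simp
  qed
  have Br: "B w (\<lambda>p. x p + complex_of_real c * y p) = B w x + c * B w y"
    if xy: "x \<in> TF" "y \<in> TF" "w \<in> TF" for x y w c
  proof -
    have d: "dir (\<lambda>p. k * w p) (\<lambda>p. x p + complex_of_real c * y p) = dir (\<lambda>p. k * w p) x + c * dir (\<lambda>p. k * w p) y"
      using xy by (simp add: dir_sym[of "\<lambda>p. k * w p"] dir_add[of _ \<Omega>] dir_real_mult[of _ \<Omega>] test_function_cmult)
    have r: "rip MO (\<lambda>p. z * (k * w p)) (\<lambda>p. x p + complex_of_real c * y p)
        = rip MO (\<lambda>p. z * (k * w p)) x + c * rip MO (\<lambda>p. z * (k * w p)) y"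
      using xy by (simp add: rip_add TF_l2 ckl2 l2_cmult rip_real_mult)
    show ?thesis unfolding B_def A_def d r right_diff_distrib by simp
  qed
  define M where "M = cmod k + cmod (z * k) + 1"
  have M1: "M \<ge> 1" by (simp add: M_def)
  have Bb: "\<bar>B x y\<bar> \<le> M * hnorm \<Omega> x * hnorm \<Omega> y" if xy: "x \<in> TF" "y \<in> TF" for x y
  proof -
    have "\<bar>dir (\<lambda>p. k * x p) y\<bar> \<le> cmod k * (hnorm \<Omega> x * hnorm \<Omega> y)"
      using dir_cmult_le[OF xy, of k] sqrt_dir_le_hnorm[of x \<Omega>] sqrt_dir_le_hnorm[of y \<Omega>]
      by (elim order_trans, intro mult_left_mono mult_mono) (auto simp: dir_nonneg hnorm_nonneg)
    moreover have "\<bar>rip MO (\<lambda>p. z * (k * x p)) y\<bar> \<le> cmod (z * k) * (hnorm \<Omega> x * hnorm \<Omega> y)"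
    proof -
      have "\<bar>rip MO (\<lambda>p. z * (k * x p)) y\<bar> \<le> nrm MO (\<lambda>p. z * (k * x p)) * nrm MO y"
        using xy by (intro rip_le TF_l2 l2_cmult)
      also have "\<dots> = cmod (z * k) * (nrm MO x * nrm MO y)" by (simp add: nrm_cmult norm_mult)
      also have "\<dots> \<le> cmod (z * k) * (hnorm \<Omega> x * hnorm \<Omega> y)"
        by (intro mult_left_mono mult_mono nrm_le_hnorm) (auto simp: nrm_nonneg hnorm_nonneg)
      finally show ?thesis .
    qed
    ultimately have "\<bar>B x y\<bar> \<le> cmod k * (hnorm \<Omega> x * hnorm \<Omega> y) + cmod (z * k) * (hnorm \<Omega> x * hnorm \<Omega> y)"
      unfolding B_def A_def by linarith
    also have "\<dots> \<le> M * hnorm \<Omega> x * hnorm \<Omega> y"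
      using mult_nonneg_nonneg[OF hnorm_nonneg hnorm_nonneg, of \<Omega> x \<Omega> y] by (simp add: M_def algebra_simps)
    finally show ?thesis .
  qed
  have coer: "B x x = dir x x + rip MO x x" if x: "x \<in> TF" for x
  proof -
    have e1: "(\<lambda>p. k * x p) = (\<lambda>p. x p + complex_of_real \<beta> * (\<i> * x p))"
      by (rule ext) (simp add: k_def complex_eq_iff)
    have d: "dir (\<lambda>p. k * x p) x = dir x x"
      unfolding e1 using x
      by (simp add: dir_add[of _ \<Omega>] dir_real_mult[of _ \<Omega>] test_function_cmult dir_imag[of _ \<Omega>])
    have e2: "(\<lambda>p. z * (k * x p)) = (\<lambda>p. complex_of_real (-1) * x p + complex_of_real (Re z * \<beta> + Im z) * (\<i> * x p))"
    proof
      fix p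
      have "z * (k * x p) = (z * k) * x p" by simp
      also have "\<dots> = complex_of_real (-1) * x p + complex_of_real (Re z * \<beta> + Im z) * (\<i> * x p)"
        unfolding zk by (simp add: complex_eq_iff algebra_simps)
      finally show "z * (k * x p) = complex_of_real (-1) * x p + complex_of_real (Re z * \<beta> + Im z) * (\<i> * x p)" .
    qed
    have "rip MO (\<lambda>p. z * (k * x p)) x = - rip MO x x"
      unfolding e2 using TF_l2[OF x] rip_real_mult(1)[of MO "-1" x x]
      by (simp add: rip_add l2_cmult rip_real_mult rip_imag del: of_real_minus of_real_add of_real_mult)
    then show ?thesis using d by (simp add: B_def A_def)
  qed
  have "\<exists>x\<in>TF. \<forall>y\<in>TF. \<bar>rip MO g y - B x y\<bar> \<le> 1 / real (Suc n) * hnorm \<Omega> y" for n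
    unfolding N[symmetric]
  proof (rule H.near_lax_milgram[OF Bl Br _ M1])
    show "\<bar>rip MO g x\<bar> \<le> nrm MO g * H.N x" if "x \<in> TF" for x
      using rip_le[OF g TF_l2[OF that]] mult_left_mono[OF nrm_le_hnorm[of \<Omega> x] nrm_nonneg[of MO g]] by (simp add: N)
    show "\<bar>B x y\<bar> \<le> M * H.N x * H.N y" if "x \<in> TF" "y \<in> TF" for x y using Bb[OF that] by (simp add: N)
    show "dir x x + rip MO x x \<le> B x x" if "x \<in> TF" for x using coer[OF that] by simp
    show "rip MO g (\<lambda>p. x p + complex_of_real c * y p) = rip MO g x + c * rip MO g y" if "x \<in> TF" "y \<in> TF" for x y c
      using that g by (simp add: rip_add TF_l2 l2_cmult rip_real_mult)
  qed (auto simp: nrm_nonneg)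
  then obtain x where x: "\<And>n. x n \<in> TF"
    "\<And>n y. y \<in> TF \<Longrightarrow> \<bar>rip MO g y - B (x n) y\<bar> \<le> 1 / real (Suc n) * hnorm \<Omega> y" by metis
  have close: "hnorm \<Omega> (\<lambda>p. x m p - x n p) \<le> 1 / real (Suc m) + 1 / real (Suc n)" for m n
  proof -
    define d where "d = (\<lambda>p. x m p - x n p)"
    have d: "d \<in> TF" unfolding d_def by (rule test_function_diff[OF x(1) x(1)])
    have dalt: "d = (\<lambda>p. x m p + complex_of_real (-1) * x n p)" by (simp add: d_def)
    have "(hnorm \<Omega> d)\<^sup>2 = B d d" using coer[OF d] by (simp add: hnorm_square nrm_square_rip)
    also have "\<dots> = B (x m) d - B (x n) d"
      using Bl[OF x(1)[of m] x(1)[of n] d, of "-1"] unfolding dalt[symmetric] by simp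
    also have "\<dots> \<le> (1 / real (Suc m) + 1 / real (Suc n)) * hnorm \<Omega> d"
      using x(2)[OF d, of m] x(2)[OF d, of n] unfolding distrib_right abs_le_iff by linarith
    finally have le: "hnorm \<Omega> d * hnorm \<Omega> d \<le> (1 / real (Suc m) + 1 / real (Suc n)) * hnorm \<Omega> d"
      by (simp add: power2_eq_square)
    have "hnorm \<Omega> d \<le> 1 / real (Suc m) + 1 / real (Suc n)"
    proof (cases "hnorm \<Omega> d = 0")
      case False
      then have "hnorm \<Omega> d > 0" using hnorm_nonneg[of \<Omega> d] by simp
      then show ?thesis using le mult_le_cancel_right_pos by blast
    qed simp
    then show ?thesis by (simp add: d_def)
  qed
  show ?thesis
  proof (intro exI conjI allI ballI)
    show "cmod k \<ge> 0" by simp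
    show "(\<lambda>p. k * x n p) \<in> TF" for n by (rule test_function_cmult[OF x(1)])
    show "\<bar>rip MO g \<psi> - (dir (\<lambda>p. k * x n p) \<psi> - rip MO (\<lambda>p. z * (k * x n p)) \<psi>)\<bar> \<le> 1 / real (Suc n) * hnorm \<Omega> \<psi>"
      if "\<psi> \<in> TF" for n \<psi> using x(2)[OF that, of n] by (simp add: B_def A_def)
    show "hnorm \<Omega> (\<lambda>p. k * x m p - k * x n p) \<le> cmod k * (1 / real (Suc m) + 1 / real (Suc n))" for m n
      using mult_left_mono[OF close[of m n], of "cmod k"] hnorm_cmult[OF test_function_diff[OF x(1)[of m] x(1)[of n]], of k]
      by (simp only: right_diff_distrib norm_ge_zero)
  qed
qed

lemma hnorm_triangle:
  assumes "x \<in> TF" "y \<in> TF" shows "hnorm \<Omega> (\<lambda>p. x p + y p) \<le> hnorm \<Omega> x + hnorm \<Omega> y"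
proof (rule power2_le_imp_le)
  interpret H: pre_hilbert TF "\<lambda>x c y p. x p + complex_of_real c * y p" "\<lambda>\<phi> \<psi>. dir \<phi> \<psi> + rip MO \<phi> \<psi>"
    by (rule test_pre_hilbert)
  have N: "H.N \<phi> = hnorm \<Omega> \<phi>" for \<phi> by (simp add: hnorm_def H.N_def nrm_square_rip)
  show "(hnorm \<Omega> (\<lambda>p. x p + y p))\<^sup>2 \<le> (hnorm \<Omega> x + hnorm \<Omega> y)\<^sup>2"
    using H.s_cmb[OF assms, of 1] H.s_Cauchy_Schwarz[OF assms]
    by (simp add: hnorm_square nrm_square_rip N power2_sum abs_le_iff)
qed (simp add: hnorm_nonneg)

lemma L2_inner_laplacian:
  assumes "\<phi> \<in> TF" "\<psi> \<in> TF"
  shows "L2_inner \<Omega> (\<lambda>p. - laplacian \<phi> p) \<psi> = Complex (dir \<phi> \<psi>) (dir \<phi> (\<lambda>p. \<i> * \<psi> p))"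
  using L2_inner_Re_Im[OF TF_l2[OF laplacian_test_function[OF assms(1)]] TF_l2[OF assms(2)]]
    laplacian_form[OF op assms] laplacian_form[OF op assms(1) test_function_cmult[OF assms(2), of \<i>]]
  by (simp add: complex_eq_iff)

text \<open>\<open>form_approx\<close> demands the Cauchy property of the energy alone. Convergence
  in L2 supplies the rest, so the condition is the Cauchy property in the full form norm.\<close>

lemma form_approx_iff:
  "form_approx \<Omega> TF (\<lambda>\<phi> p. - laplacian \<phi> p) \<phi> u \<longleftrightarrow>
     u \<in> l2 MO \<and> (\<forall>n. \<phi> n \<in> TF) \<and> (\<lambda>n. nrm MO (\<lambda>p. \<phi> n p - u p)) \<longlonglongrightarrow> 0 \<and>
     (\<forall>\<eta>>0. \<exists>N. \<forall>m\<ge>N. \<forall>n\<ge>N. hnorm \<Omega> (\<lambda>p. \<phi> m p - \<phi> n p) < \<eta>)"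
proof (cases "u \<in> l2 MO \<and> (\<forall>n. \<phi> n \<in> TF) \<and> (\<lambda>n. nrm MO (\<lambda>p. \<phi> n p - u p)) \<longlonglongrightarrow> 0")
  case True
  then have u: "u \<in> l2 MO" and \<phi>: "\<And>n. \<phi> n \<in> TF" and lim: "(\<lambda>n. nrm MO (\<lambda>p. \<phi> n p - u p)) \<longlonglongrightarrow> 0" by auto
  have d: "(\<lambda>p. \<phi> m p - \<phi> n p) \<in> TF" for m n by (rule test_function_diff[OF \<phi> \<phi>])
  have e: "cmod (L2_inner \<Omega> (\<lambda>p. - laplacian (\<lambda>p. \<phi> m p - \<phi> n p) p) (\<lambda>p. \<phi> m p - \<phi> n p)) = dir (\<lambda>p. \<phi> m p - \<phi> n p) (\<lambda>p. \<phi> m p - \<phi> n p)" for m n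
  proof -
    have i0: "dir (\<lambda>p. \<phi> m p - \<phi> n p) (\<lambda>p. \<i> * (\<phi> m p - \<phi> n p)) = 0"
      using dir_imag[OF d[of m n]] by (subst dir_sym)
    show ?thesis unfolding L2_inner_laplacian[OF d[of m n] d[of m n]] i0 by (simp add: complex_norm dir_nonneg)
  qed
  have nc: "\<exists>N. \<forall>m\<ge>N. \<forall>n\<ge>N. (nrm MO (\<lambda>p. \<phi> m p - \<phi> n p))\<^sup>2 < \<eta>" if \<eta>: "\<eta> > 0" for \<eta>
  proof -
    obtain N where N: "\<And>n. n \<ge> N \<Longrightarrow> nrm MO (\<lambda>p. \<phi> n p - u p) < sqrt \<eta> / 2"
      using order_tendstoD(2)[OF lim, of "sqrt \<eta> / 2"] \<eta> by (auto simp: eventually_sequentially)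
    have "(nrm MO (\<lambda>p. \<phi> m p - \<phi> n p))\<^sup>2 < \<eta>" if "m \<ge> N" "n \<ge> N" for m n
    proof -
      have "nrm MO (\<lambda>p. \<phi> m p - \<phi> n p) < sqrt \<eta>"
        using nrm_triangle_diff[OF TF_l2[OF \<phi>[of m]] u TF_l2[OF \<phi>[of n]]] N[OF that(1)] N[OF that(2)]
        by (simp add: nrm_minus_commute[of MO u])
      then have "(nrm MO (\<lambda>p. \<phi> m p - \<phi> n p))\<^sup>2 < (sqrt \<eta>)\<^sup>2"
        using nrm_nonneg by (intro power_strict_mono) auto
      then show ?thesis using \<eta> by simp
    qed
    then show ?thesis by blast
  qed
  have "(\<forall>\<eta>>0. \<exists>N. \<forall>m\<ge>N. \<forall>n\<ge>N. dir (\<lambda>p. \<phi> m p - \<phi> n p) (\<lambda>p. \<phi> m p - \<phi> n p) < \<eta>)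
     \<longleftrightarrow> (\<forall>\<eta>>0. \<exists>N. \<forall>m\<ge>N. \<forall>n\<ge>N. hnorm \<Omega> (\<lambda>p. \<phi> m p - \<phi> n p) < \<eta>)" (is "?L = ?R")
  proof
    assume L: ?L
    show ?R
    proof (intro allI impI)
      fix \<eta> :: real assume \<eta>: "\<eta> > 0"
      obtain N1 where N1: "\<And>m n. m \<ge> N1 \<Longrightarrow> n \<ge> N1 \<Longrightarrow> dir (\<lambda>p. \<phi> m p - \<phi> n p) (\<lambda>p. \<phi> m p - \<phi> n p) < \<eta>\<^sup>2 / 2"
        using L \<eta> by (metis half_gt_zero zero_less_power)
      obtain N2 where N2: "\<And>m n. m \<ge> N2 \<Longrightarrow> n \<ge> N2 \<Longrightarrow> (nrm MO (\<lambda>p. \<phi> m p - \<phi> n p))\<^sup>2 < \<eta>\<^sup>2 / 2"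
        using nc[of "\<eta>\<^sup>2 / 2"] \<eta> by (metis half_gt_zero zero_less_power)
      have "hnorm \<Omega> (\<lambda>p. \<phi> m p - \<phi> n p) < \<eta>" if "m \<ge> max N1 N2" "n \<ge> max N1 N2" for m n
        unfolding hnorm_def using N1[of m n] N2[of m n] that \<eta>
        by (intro real_less_lsqrt) auto
      then show "\<exists>N. \<forall>m\<ge>N. \<forall>n\<ge>N. hnorm \<Omega> (\<lambda>p. \<phi> m p - \<phi> n p) < \<eta>" by blast
    qed
  next
    assume R: ?R
    show ?L
    proof (intro allI impI)
      fix \<eta> :: real assume \<eta>: "\<eta> > 0"
      then obtain N where N: "\<And>m n. m \<ge> N \<Longrightarrow> n \<ge> N \<Longrightarrow> hnorm \<Omega> (\<lambda>p. \<phi> m p - \<phi> n p) < sqrt \<eta>"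
        using R by (metis real_sqrt_gt_zero)
      have "dir (\<lambda>p. \<phi> m p - \<phi> n p) (\<lambda>p. \<phi> m p - \<phi> n p) < \<eta>" if "m \<ge> N" "n \<ge> N" for m n
      proof -
        have "sqrt (dir (\<lambda>p. \<phi> m p - \<phi> n p) (\<lambda>p. \<phi> m p - \<phi> n p)) < sqrt \<eta>"
          using N[OF that] sqrt_dir_le_hnorm[of "\<lambda>p. \<phi> m p - \<phi> n p" \<Omega>] by linarith
        then show ?thesis by simp
      qed
      then show "\<exists>N. \<forall>m\<ge>N. \<forall>n\<ge>N. dir (\<lambda>p. \<phi> m p - \<phi> n p) (\<lambda>p. \<phi> m p - \<phi> n p) < \<eta>" by blast
    qed
  qed
  then show ?thesis using True by (simp add: form_approx_def L2_space_eq L2_norm_eq e)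
next
  case False
  then show ?thesis by (auto simp: form_approx_def L2_space_eq L2_norm_eq)
qed

lemma form_approx_cmult:
  assumes "form_approx \<Omega> TF (\<lambda>\<phi> p. - laplacian \<phi> p) \<psi> v"
  shows "form_approx \<Omega> TF (\<lambda>\<phi> p. - laplacian \<phi> p) (\<lambda>n p. \<i> * \<psi> n p) (\<lambda>p. \<i> * v p)"
proof -
  have \<psi>: "\<And>n. \<psi> n \<in> TF" using assms by (simp add: form_approx_iff)
  have "hnorm \<Omega> (\<lambda>p. \<i> * \<psi> m p - \<i> * \<psi> n p) = hnorm \<Omega> (\<lambda>p. \<psi> m p - \<psi> n p)" for m n
    using hnorm_cmult[OF test_function_diff[OF \<psi>[of m] \<psi>[of n]], of \<i>] by (simp add: right_diff_distrib)
  moreover have "nrm MO (\<lambda>p. \<i> * \<psi> n p - \<i> * v p) = nrm MO (\<lambda>p. \<psi> n p - v p)" for n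
    using nrm_cmult[of MO \<i> "\<lambda>p. \<psi> n p - v p"] by (simp add: right_diff_distrib)
  ultimately show ?thesis using assms unfolding form_approx_iff by (auto intro: test_function_cmult l2_cmult)
qed

lemma form_approx_bounded:
  assumes "form_approx \<Omega> TF (\<lambda>\<phi> p. - laplacian \<phi> p) \<psi> v"
  shows "\<exists>K. \<forall>n. hnorm \<Omega> (\<psi> n) \<le> K"
proof -
  have \<psi>: "\<And>n. \<psi> n \<in> TF" using assms by (simp add: form_approx_iff)
  obtain N where N: "\<And>m n. m \<ge> N \<Longrightarrow> n \<ge> N \<Longrightarrow> hnorm \<Omega> (\<lambda>p. \<psi> m p - \<psi> n p) < 1"
    using assms unfolding form_approx_iff by (metis zero_less_one)
  have "hnorm \<Omega> (\<psi> n) \<le> Max ((\<lambda>n. hnorm \<Omega> (\<psi> n)) ` {..N}) + 1" for n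
  proof (cases "n \<le> N")
    case True
    then have "hnorm \<Omega> (\<psi> n) \<le> Max ((\<lambda>n. hnorm \<Omega> (\<psi> n)) ` {..N})" by (intro Max_ge) auto
    then show ?thesis by simp
  next
    case False
    have "hnorm \<Omega> (\<psi> n) \<le> hnorm \<Omega> (\<lambda>p. \<psi> n p - \<psi> N p) + hnorm \<Omega> (\<psi> N)"
      using hnorm_triangle[OF test_function_diff[OF \<psi>[of n] \<psi>[of N]] \<psi>[of N]] by simp
    moreover have "hnorm \<Omega> (\<psi> N) \<le> Max ((\<lambda>n. hnorm \<Omega> (\<psi> n)) ` {..N})" by (intro Max_ge) auto
    moreover have "hnorm \<Omega> (\<lambda>p. \<psi> n p - \<psi> N p) < 1" using False by (intro N) auto
    ultimately show ?thesis by linarith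
  qed
  then show ?thesis by blast
qed

text \<open>The near solutions converge in L2, and the limit is a solution because admissible test
  sequences are bounded in the form norm: the residual at stage \<open>n\<close> is at most that
  bound divided by \<open>Suc n\<close>. The imaginary part of the required limit is the real part
  for the test sequence multiplied by \<open>\<i>\<close>.\<close>

lemma resolvent_exists:
  assumes g: "g \<in> l2 MO" and z: "Im z > 0" "Re z \<ge> 0"
  shows "\<exists>u. (u, \<lambda>p. g p + z * u p) \<in> neg_dirichlet_laplacian \<Omega>"
proof -
  obtain \<phi> C where C: "C \<ge> 0" and \<phi>: "\<And>n. \<phi> n \<in> TF"
    and res: "\<And>n \<psi>. \<psi> \<in> TF \<Longrightarrow> \<bar>rip MO g \<psi> - (dir (\<phi> n) \<psi> - rip MO (\<lambda>p. z * \<phi> n p) \<psi>)\<bar> \<le> 1 / real (Suc n) * hnorm \<Omega> \<psi>"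
    and cau: "\<And>m n. hnorm \<Omega> (\<lambda>p. \<phi> m p - \<phi> n p) \<le> C * (1 / real (Suc m) + 1 / real (Suc n))"
    using resolvent_approx[OF g z] by blast
  have cauchy: "\<exists>N. \<forall>m\<ge>N. \<forall>n\<ge>N. hnorm \<Omega> (\<lambda>p. \<phi> m p - \<phi> n p) < \<eta>" if \<eta>: "\<eta> > 0" for \<eta>
  proof -
    have "(\<lambda>n. 2 * C * (1 / real (Suc n))) \<longlonglongrightarrow> 0"
      using tendsto_mult_right_zero[OF LIMSEQ_inverse_real_of_nat, of "2 * C"] by (simp add: inverse_eq_divide)
    then obtain N where N: "2 * C * (1 / real (Suc N)) < \<eta>"
      using order_tendstoD(2)[of _ 0 sequentially \<eta>] \<eta> by (auto simp: eventually_sequentially)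
    have "hnorm \<Omega> (\<lambda>p. \<phi> m p - \<phi> n p) < \<eta>" if "m \<ge> N" "n \<ge> N" for m n
    proof -
      have "1 / real (Suc m) + 1 / real (Suc n) \<le> 1 / real (Suc N) + 1 / real (Suc N)"
        using that by (intro add_mono divide_left_mono) auto
      then have "C * (1 / real (Suc m) + 1 / real (Suc n)) \<le> C * (1 / real (Suc N) + 1 / real (Suc N))"
        using C by (rule mult_left_mono)
      moreover have "C * (1 / real (Suc N) + 1 / real (Suc N)) = 2 * C * (1 / real (Suc N))" by simp
      ultimately show ?thesis using cau[of m n] N by linarith
    qed
    then show ?thesis by blast
  qed
  have nc: "\<exists>N. \<forall>m\<ge>N. \<forall>n\<ge>N. nrm MO (\<lambda>p. \<phi> m p - \<phi> n p) < \<eta>" if \<eta>: "\<eta> > 0" for \<eta>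
    using cauchy[OF \<eta>] by (meson nrm_le_hnorm order_le_less_trans)
  have "\<exists>u\<in>l2 MO. (\<lambda>n. nrm MO (\<lambda>p. \<phi> n p - u p)) \<longlonglongrightarrow> 0"
    by (rule l2_complete[OF TF_l2[OF \<phi>] nc])
  then obtain u where u: "u \<in> l2 MO" "(\<lambda>n. nrm MO (\<lambda>p. \<phi> n p - u p)) \<longlonglongrightarrow> 0" by blast
  have fa: "form_approx \<Omega> TF (\<lambda>\<phi> p. - laplacian \<phi> p) \<phi> u"
    unfolding form_approx_iff using u \<phi> cauchy by blast
  have f: "(\<lambda>p. g p + z * u p) \<in> l2 MO" by (intro l2_add g l2_cmult u)
  have lim: "(\<lambda>n. dir (\<phi> n) (\<psi> n)) \<longlonglongrightarrow> rip MO (\<lambda>p. g p + z * u p) v"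
    if fv: "form_approx \<Omega> TF (\<lambda>\<phi> p. - laplacian \<phi> p) \<psi> v" for \<psi> v
  proof -
    have \<psi>: "\<And>n. \<psi> n \<in> TF" and v: "v \<in> l2 MO" "(\<lambda>n. nrm MO (\<lambda>p. \<psi> n p - v p)) \<longlonglongrightarrow> 0"
      using fv by (auto simp: form_approx_iff)
    obtain K where K: "\<And>n. hnorm \<Omega> (\<psi> n) \<le> K" using form_approx_bounded[OF fv] by blast
    have "(\<lambda>n. rip MO g (\<psi> n) - (dir (\<phi> n) (\<psi> n) - rip MO (\<lambda>p. z * \<phi> n p) (\<psi> n))) \<longlonglongrightarrow> 0"
    proof (rule Lim_null_comparison)
      show "\<forall>\<^sub>F n in sequentially. norm (rip MO g (\<psi> n) - (dir (\<phi> n) (\<psi> n) - rip MO (\<lambda>p. z * \<phi> n p) (\<psi> n))) \<le> 1 / real (Suc n) * K"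
      proof (intro always_eventually allI)
        fix n
        have "1 / real (Suc n) * hnorm \<Omega> (\<psi> n) \<le> 1 / real (Suc n) * K" by (intro mult_left_mono K) simp
        then show "norm (rip MO g (\<psi> n) - (dir (\<phi> n) (\<psi> n) - rip MO (\<lambda>p. z * \<phi> n p) (\<psi> n))) \<le> 1 / real (Suc n) * K"
          using res[OF \<psi>, of n n] unfolding real_norm_def by linarith
      qed
      show "(\<lambda>n. 1 / real (Suc n) * K) \<longlonglongrightarrow> 0"
        using tendsto_mult_left_zero[OF LIMSEQ_inverse_real_of_nat, of K] by (simp add: inverse_eq_divide)
    qed
    moreover have "(\<lambda>n. rip MO g (\<psi> n)) \<longlonglongrightarrow> rip MO g v"
      by (intro rip_tendsto_right g TF_l2 \<psi> v)
    moreover have "(\<lambda>n. rip MO (\<lambda>p. z * \<phi> n p) (\<psi> n)) \<longlonglongrightarrow> rip MO (\<lambda>p. z * u p) v"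
      by (intro rip_tendsto l2_cmult TF_l2 \<psi> \<phi> v u nrm_cmult_tendsto)
    ultimately have "(\<lambda>n. rip MO g (\<psi> n) + rip MO (\<lambda>p. z * \<phi> n p) (\<psi> n) - (rip MO g (\<psi> n) - (dir (\<phi> n) (\<psi> n) - rip MO (\<lambda>p. z * \<phi> n p) (\<psi> n))))
       \<longlonglongrightarrow> rip MO g v + rip MO (\<lambda>p. z * u p) v - 0" by (intro tendsto_diff tendsto_add)
    then show ?thesis using g u v by (simp add: rip_add l2_cmult)
  qed
  have "(\<lambda>n. L2_inner \<Omega> (\<lambda>p. - laplacian (\<phi> n) p) (\<psi> n)) \<longlonglongrightarrow> L2_inner \<Omega> (\<lambda>p. g p + z * u p) v"
    if fv: "form_approx \<Omega> TF (\<lambda>\<phi> p. - laplacian \<phi> p) \<psi> v" for \<psi> v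
  proof -
    have \<psi>: "\<And>n. \<psi> n \<in> TF" and v: "v \<in> l2 MO" using fv by (auto simp: form_approx_iff)
    have "L2_inner \<Omega> (\<lambda>p. g p + z * u p) v = Complex (rip MO (\<lambda>p. g p + z * u p) v) (rip MO (\<lambda>p. g p + z * u p) (\<lambda>p. \<i> * v p))"
      using L2_inner_Re_Im[OF f v] by (simp add: complex_eq_iff)
    then show ?thesis using lim[OF fv] lim[OF form_approx_cmult[OF fv]]
      by (simp add: L2_inner_laplacian[OF \<phi> \<psi>] tendsto_Complex)
  qed
  then show ?thesis
    unfolding neg_dirichlet_laplacian_def friedrichs_extension_def using fa f by (auto simp: L2_space_eq)
qed

text \<open>
  The test functions may depend on \<open>n\<close> only through an additive map that is bounded in the form norm:
  such maps take form-Cauchy sequences to form-Cauchy sequences.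
\<close>

lemma friedrichs_form_limit:
  assumes uf: "(u, f) \<in> neg_dirichlet_laplacian \<Omega>"
  shows "\<exists>\<phi>. f \<in> l2 MO \<and> u \<in> l2 MO \<and> (\<forall>n. \<phi> n \<in> TF) \<and> (\<lambda>n. nrm MO (\<lambda>p. \<phi> n p - u p)) \<longlonglongrightarrow> 0 \<and>
    (\<exists>K. \<forall>n. hnorm \<Omega> (\<phi> n) \<le> K) \<and>
    (\<forall>T K. (\<forall>x\<in>TF. T x \<in> TF \<and> hnorm \<Omega> (T x) \<le> K * hnorm \<Omega> x) \<longrightarrow>
       (\<forall>x\<in>TF. \<forall>y\<in>TF. T (\<lambda>p. x p - y p) = (\<lambda>p. T x p - T y p)) \<longrightarrow>
       (\<lambda>n. dir (\<phi> n) (T (\<phi> n)) - rip MO f (T (\<phi> n))) \<longlonglongrightarrow> 0)"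
proof -
  obtain \<phi> where f: "f \<in> l2 MO" and fa: "form_approx \<Omega> TF (\<lambda>\<phi> p. - laplacian \<phi> p) \<phi> u"
    and lim: "\<And>v \<psi>. form_approx \<Omega> TF (\<lambda>\<phi> p. - laplacian \<phi> p) \<psi> v \<Longrightarrow>
       (\<lambda>n. L2_inner \<Omega> (\<lambda>p. - laplacian (\<phi> n) p) (\<psi> n)) \<longlonglongrightarrow> L2_inner \<Omega> f v"
    using uf unfolding neg_dirichlet_laplacian_def friedrichs_extension_def by (auto simp: L2_space_eq)
  have u: "u \<in> l2 MO" and \<phi>: "\<And>n. \<phi> n \<in> TF" and \<phi>u: "(\<lambda>n. nrm MO (\<lambda>p. \<phi> n p - u p)) \<longlonglongrightarrow> 0"
    and cau: "\<And>\<eta>. \<eta> > 0 \<Longrightarrow> \<exists>N. \<forall>m\<ge>N. \<forall>n\<ge>N. hnorm \<Omega> (\<lambda>p. \<phi> m p - \<phi> n p) < \<eta>"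
    using fa by (auto simp: form_approx_iff)
  have "(\<lambda>n. dir (\<phi> n) (T (\<phi> n)) - rip MO f (T (\<phi> n))) \<longlonglongrightarrow> 0"
    if T: "\<forall>x\<in>TF. T x \<in> TF \<and> hnorm \<Omega> (T x) \<le> K * hnorm \<Omega> x"
      and Td: "\<forall>x\<in>TF. \<forall>y\<in>TF. T (\<lambda>p. x p - y p) = (\<lambda>p. T x p - T y p)" for T K
  proof -
    have TTF: "T (\<phi> n) \<in> TF" for n using T \<phi> by blast
    have cauT: "\<exists>N. \<forall>m\<ge>N. \<forall>n\<ge>N. hnorm \<Omega> (\<lambda>p. T (\<phi> m) p - T (\<phi> n) p) < \<eta>" if \<eta>: "\<eta> > 0" for \<eta>
    proof -
      obtain N where N: "\<And>m n. m \<ge> N \<Longrightarrow> n \<ge> N \<Longrightarrow> hnorm \<Omega> (\<lambda>p. \<phi> m p - \<phi> n p) < \<eta> / (\<bar>K\<bar> + 1)"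
        using cau[of "\<eta> / (\<bar>K\<bar> + 1)"] \<eta> by (auto simp: add_nonneg_pos)
      have "hnorm \<Omega> (\<lambda>p. T (\<phi> m) p - T (\<phi> n) p) < \<eta>" if "m \<ge> N" "n \<ge> N" for m n
      proof -
        have "hnorm \<Omega> (\<lambda>p. T (\<phi> m) p - T (\<phi> n) p) = hnorm \<Omega> (T (\<lambda>p. \<phi> m p - \<phi> n p))" using Td \<phi> by simp
        also have "\<dots> \<le> K * hnorm \<Omega> (\<lambda>p. \<phi> m p - \<phi> n p)" using T test_function_diff[OF \<phi>[of m] \<phi>[of n]] by blast
        also have "\<dots> \<le> (\<bar>K\<bar> + 1) * hnorm \<Omega> (\<lambda>p. \<phi> m p - \<phi> n p)" by (intro mult_right_mono hnorm_nonneg) simp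
        also have "\<dots> < \<eta>" using N[OF that] by (simp add: pos_less_divide_eq add_nonneg_pos mult.commute)
        finally show ?thesis .
      qed
      then show ?thesis by blast
    qed
    have nc: "\<exists>N. \<forall>m\<ge>N. \<forall>n\<ge>N. nrm MO (\<lambda>p. T (\<phi> m) p - T (\<phi> n) p) < \<eta>" if \<eta>: "\<eta> > 0" for \<eta>
      using cauT[OF that] by (meson nrm_le_hnorm order_le_less_trans)
    have "\<exists>v\<in>l2 MO. (\<lambda>n. nrm MO (\<lambda>p. T (\<phi> n) p - v p)) \<longlonglongrightarrow> 0"
      by (rule l2_complete[OF TF_l2[OF TTF] nc])
    then obtain v where v: "v \<in> l2 MO" "(\<lambda>n. nrm MO (\<lambda>p. T (\<phi> n) p - v p)) \<longlonglongrightarrow> 0" by blast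
    have "form_approx \<Omega> TF (\<lambda>\<phi> p. - laplacian \<phi> p) (\<lambda>n. T (\<phi> n)) v"
      unfolding form_approx_iff using v TTF cauT by blast
    from tendsto_Re[OF lim[OF this]] have "(\<lambda>n. dir (\<phi> n) (T (\<phi> n))) \<longlonglongrightarrow> rip MO f v"
      using L2_inner_Re_Im(1)[OF f v(1)] by (simp add: L2_inner_laplacian[OF \<phi> TTF])
    moreover have "(\<lambda>n. rip MO f (T (\<phi> n))) \<longlonglongrightarrow> rip MO f v"
      by (intro rip_tendsto_right f TF_l2 TTF v)
    ultimately show ?thesis using tendsto_diff by fastforce
  qed
  then show ?thesis using f u \<phi> \<phi>u form_approx_bounded[OF fa] by blast
qed

end

section \<open>Change of variables along the flow\<close>

text \<open>Both sides are monotone limits over an exhaustion of the line by intervals. The images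
  of the intervals also exhaust the line, because \<open>g\<close> stays within \<open>B\<close> of
  the identity.\<close>

lemma nn_integral_substitution_line:
  fixes f :: "real \<Rightarrow> ennreal" and g g' :: "real \<Rightarrow> real"
  assumes f: "f \<in> borel_measurable borel"
    and g: "\<And>x. (g has_real_derivative g' x) (at x)" and g': "continuous_on UNIV g'" "\<And>x. g' x \<ge> 0"
    and B: "\<And>x. \<bar>g x - x\<bar> \<le> B"
  shows "(\<integral>\<^sup>+x. f x \<partial>lborel) = (\<integral>\<^sup>+x. f (g x) * ennreal (g' x) \<partial>lborel)"
proof -
  have mono: "g x \<le> g y" if "x \<le> y" for x y
    by (rule DERIV_nonneg_imp_nondecreasing[OF that]) (use g g' in blast)
  have gc: "continuous_on UNIV g" by (rule DERIV_continuous_on) (use g in \<open>auto intro: has_field_derivative_at_within\<close>)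
  note [measurable] = f continuous_UNIV_borel[OF gc] continuous_UNIV_borel[OF g'(1)]
  \<comment> \<open>\<open>Suc n\<close> keeps the intervals nondegenerate, also for
    \<open>n = 0\<close>.\<close>
  define a where "a n = - real (Suc n)" for n
  define b where "b n = real (Suc n)" for n
  have inc1: "incseq (\<lambda>n x. f x * indicator {g (a n)..g (b n)} x :: ennreal)"
  proof (intro incseq_SucI le_funI mult_left_mono)
    fix n x
    have "g (a (Suc n)) \<le> g (a n)" "g (b n) \<le> g (b (Suc n))" by (auto intro!: mono simp: a_def b_def)
    then show "(indicator {g (a n)..g (b n)} x :: ennreal) \<le> indicator {g (a (Suc n))..g (b (Suc n))} x"
      by (auto simp: indicator_def)
  qed auto
  have inc2: "incseq (\<lambda>n x. f (g x) * ennreal (g' x) * indicator {a n..b n} x :: ennreal)"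
    by (intro incseq_SucI le_funI mult_left_mono) (auto simp: indicator_def a_def b_def)
  have sup1: "f x = (SUP n. f x * indicator {g (a n)..g (b n)} x)" for x
  proof -
    obtain n where n: "real n > \<bar>x\<bar> + B" using reals_Archimedean2 by blast
    have "g (a n) \<le> x" "x \<le> g (b n)" using B[of "a n"] B[of "b n"] n by (auto simp: a_def b_def abs_le_iff)
    then show ?thesis by (intro antisym SUP_upper2[of n] SUP_least) (auto simp: indicator_def)
  qed
  have sup2: "f (g x) * ennreal (g' x) = (SUP n. f (g x) * ennreal (g' x) * indicator {a n..b n} x)" for x
  proof -
    obtain n where n: "real n > \<bar>x\<bar>" using reals_Archimedean2 by blast
    then have "a n \<le> x" "x \<le> b n" by (auto simp: a_def b_def)
    then show ?thesis by (intro antisym SUP_upper2[of n] SUP_least) (auto simp: indicator_def)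
  qed
  have "(\<integral>\<^sup>+x. f x \<partial>lborel) = (\<integral>\<^sup>+x. (SUP n. f x * indicator {g (a n)..g (b n)} x) \<partial>lborel)"
    by (simp only: sup1[symmetric])
  also have "\<dots> = (SUP n. \<integral>\<^sup>+x. f x * indicator {g (a n)..g (b n)} x \<partial>lborel)"
    by (rule nn_integral_monotone_convergence_SUP[OF inc1]) measurable
  also have "\<dots> = (SUP n. \<integral>\<^sup>+x. f (g x) * ennreal (g' x) * indicator {a n..b n} x \<partial>lborel)"
    by (intro SUP_cong refl nn_integral_substitution_aux f)
       (use g g' in \<open>auto simp: a_def b_def intro: continuous_on_subset\<close>)
  also have "\<dots> = (\<integral>\<^sup>+x. (SUP n. f (g x) * ennreal (g' x) * indicator {a n..b n} x) \<partial>lborel)"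
    by (rule nn_integral_monotone_convergence_SUP[OF inc2, symmetric]) measurable
  also have "\<dots> = (\<integral>\<^sup>+x. f (g x) * ennreal (g' x) \<partial>lborel)" by (simp only: sup2[symmetric])
  finally show ?thesis .
qed

lemma nn_integral_scale:
  fixes f :: "'b::euclidean_space \<Rightarrow> ennreal"
  assumes [measurable]: "f \<in> borel_measurable borel" and c: "c > 0"
  shows "(\<integral>\<^sup>+y. f y \<partial>lborel) = ennreal (c ^ DIM('b)) * (\<integral>\<^sup>+y. f (c *\<^sub>R y) \<partial>lborel)"
  by (subst lborel_affine[of c 0])
    (use c in \<open>simp_all add: nn_integral_density nn_integral_distr nn_integral_cmult\<close>)

text \<open>The first component depends on x only, and y is scaled by a factor depending on x only.
  Tonelli's theorem therefore reduces the change of variables to a substitution on the line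
  followed, for each x, by a dilation in y.\<close>

lemma nn_integral_shear:
  fixes G :: "real \<times> 'b::euclidean_space \<Rightarrow> ennreal"
  assumes G: "G \<in> borel_measurable borel"
    and \<sigma>: "\<And>x. (\<sigma> has_real_derivative j x) (at x)" and j: "continuous_on UNIV j" "\<And>x. j x \<ge> 0"
    and B: "\<And>x. \<bar>\<sigma> x - x\<bar> \<le> B" and l: "continuous_on UNIV l" "\<And>x. l x > 0"
  shows "(\<integral>\<^sup>+p. G p \<partial>lborel) = (\<integral>\<^sup>+p. ennreal (j (fst p) * l (fst p) ^ DIM('b)) * G (\<sigma> (fst p), l (fst p) *\<^sub>R snd p) \<partial>lborel)"
proof -
  have \<sigma>c: "continuous_on UNIV \<sigma>" by (rule DERIV_continuous_on) (use \<sigma> in \<open>auto intro: has_field_derivative_at_within\<close>)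
  have G'[measurable]: "G \<in> borel_measurable (lborel \<Otimes>\<^sub>M lborel)"
    unfolding lborel_prod using G by simp
  note [measurable] = G continuous_UNIV_borel[OF \<sigma>c] continuous_UNIV_borel[OF j(1)] continuous_UNIV_borel[OF l(1)]
  define h where "h x = (\<integral>\<^sup>+y. G (x, y) \<partial>lborel)" for x
  have hm: "h \<in> borel_measurable borel"
  proof -
    have "(\<lambda>x. \<integral>\<^sup>+y. G (x, y) \<partial>lborel) \<in> borel_measurable lborel"
      by (rule lborel.borel_measurable_nn_integral_fst[OF G'])
    then show ?thesis by (simp add: h_def[abs_def])
  qed
  have F: "(\<integral>\<^sup>+p. g p \<partial>lborel) = (\<integral>\<^sup>+x. \<integral>\<^sup>+y. g (x, y) \<partial>lborel \<partial>lborel)"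
    if g: "g \<in> borel_measurable borel" for g :: "real \<times> 'b \<Rightarrow> ennreal"
  proof -
    have "g \<in> borel_measurable (lborel \<Otimes>\<^sub>M lborel)" unfolding lborel_prod using g by simp
    then show ?thesis using lborel.nn_integral_fst[of g lborel] by (simp add: lborel_prod)
  qed
  have "(\<integral>\<^sup>+p. G p \<partial>lborel) = (\<integral>\<^sup>+x. h x \<partial>lborel)" by (simp add: F[OF G] h_def)
  also have "\<dots> = (\<integral>\<^sup>+x. h (\<sigma> x) * ennreal (j x) \<partial>lborel)"
    by (rule nn_integral_substitution_line[OF hm \<sigma> j B])
  also have "\<dots> = (\<integral>\<^sup>+x. \<integral>\<^sup>+y. ennreal (j x * l x ^ DIM('b)) * G (\<sigma> x, l x *\<^sub>R y) \<partial>lborel \<partial>lborel)"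
  proof (rule nn_integral_cong)
    fix x
    have gx: "(\<lambda>y. G (\<sigma> x, y)) \<in> borel_measurable borel"
      by (rule measurable_compose[OF _ G]) (intro continuous_UNIV_borel continuous_intros)
    have "h (\<sigma> x) = ennreal (l x ^ DIM('b)) * (\<integral>\<^sup>+y. G (\<sigma> x, l x *\<^sub>R y) \<partial>lborel)"
      unfolding h_def by (rule nn_integral_scale[OF gx l(2)])
    moreover have "(\<integral>\<^sup>+y. ennreal (j x * l x ^ DIM('b)) * G (\<sigma> x, l x *\<^sub>R y) \<partial>lborel)
       = ennreal (j x * l x ^ DIM('b)) * (\<integral>\<^sup>+y. G (\<sigma> x, l x *\<^sub>R y) \<partial>lborel)"
      by (rule nn_integral_cmult, rule measurable_compose[OF _ gx]) simp
    ultimately show "h (\<sigma> x) * ennreal (j x) = (\<integral>\<^sup>+y. ennreal (j x * l x ^ DIM('b)) * G (\<sigma> x, l x *\<^sub>R y) \<partial>lborel)"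
      using j l(2)[of x] by (simp add: ennreal_mult mult_ac)
  qed
  also have "\<dots> = (\<integral>\<^sup>+p. ennreal (j (fst p) * l (fst p) ^ DIM('b)) * G (\<sigma> (fst p), l (fst p) *\<^sub>R snd p) \<partial>lborel)"
  proof (subst F)
    have c1: "continuous_on UNIV (\<lambda>p::real \<times> 'b. (\<sigma> (fst p), l (fst p) *\<^sub>R snd p))"
      by (intro continuous_intros continuous_on_compose2[OF \<sigma>c] continuous_on_compose2[OF l(1)]) auto
    have c2: "continuous_on UNIV (\<lambda>p::real \<times> 'b. j (fst p) * l (fst p) ^ DIM('b))"
      by (intro continuous_intros continuous_on_compose2[OF j(1)] continuous_on_compose2[OF l(1)]) auto
    show "(\<lambda>p. ennreal (j (fst p) * l (fst p) ^ DIM('b)) * G (\<sigma> (fst p), l (fst p) *\<^sub>R snd p)) \<in> borel_measurable borel"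
      using measurable_compose[OF continuous_UNIV_borel[OF c1] G] continuous_UNIV_borel[OF c2] by measurable
  qed simp
  finally show ?thesis .
qed

lemma cc_mult:
  fixes f G :: "'a::euclidean_space \<Rightarrow> real"
  shows "cc G \<Longrightarrow> continuous_on UNIV f \<Longrightarrow> cc (\<lambda>p. f p * G p)"
  by (rule ccI[of _ G]) (auto intro!: continuous_intros dest: cc_continuous)

lemma power_one_minus_bounds:
  fixes s :: real
  assumes "0 \<le> s" "s \<le> 1"
  shows "1 - real d * s \<le> (1 - s) ^ d" "(1 - s) ^ d \<le> 1 - real d * s + (real d)\<^sup>2 * s\<^sup>2"
proof -
  show "1 - real d * s \<le> (1 - s) ^ d" using Bernoulli_inequality[of "- s" d] assms by simp
  show "(1 - s) ^ d \<le> 1 - real d * s + (real d)\<^sup>2 * s\<^sup>2"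
  proof (induction d)
    case (Suc d)
    have "(1 - s) ^ Suc d \<le> (1 - s) * (1 - real d * s + (real d)\<^sup>2 * s\<^sup>2)"
      using Suc assms by (simp add: mult_left_mono)
    also have "\<dots> = 1 - real (Suc d) * s + ((real d)\<^sup>2 + real d) * s\<^sup>2 - (real d)\<^sup>2 * (s * s\<^sup>2)"
      by (simp add: power2_eq_square algebra_simps)
    also have "\<dots> \<le> 1 - real (Suc d) * s + ((real d)\<^sup>2 + real d) * s\<^sup>2" using assms by simp
    also have "((real d)\<^sup>2 + real d) * s\<^sup>2 \<le> (real (Suc d))\<^sup>2 * s\<^sup>2"
      by (intro mult_right_mono) (auto simp: power2_eq_square algebra_simps)
    finally show ?case by simp
  qed simp
qed

text \<open>The geometric hypotheses on \<open>\<Omega>\<close> enter only through \<open>inv\<close> and \<open>Ybd\<close>.\<close>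

locale flow =
  fixes \<Omega> :: "(real \<times> 'b::euclidean_space) set"
    and w a \<xi> \<xi>' :: "real \<Rightarrow> real" and t0 W A X L Y dd :: real
  assumes dd: "dd = real DIM('b)" and op: "open \<Omega>"
    and smooth_w: "smooth w" and smooth_\<xi>: "smooth \<xi>"
    and w': "\<And>x. (w has_real_derivative a x) (at x)" and \<xi>': "\<And>x. (\<xi> has_real_derivative \<xi>' x) (at x)"
    and a: "\<And>x. 0 \<le> a x" "\<And>x. a x \<le> A" and w: "\<And>x. \<bar>w x\<bar> \<le> W"
    and \<xi>: "\<And>x. 0 \<le> \<xi> x" "\<And>x. \<xi> x \<le> X"
    and lip_a: "\<And>x x'. \<bar>a x - a x'\<bar> \<le> L * \<bar>x - x'\<bar>" and lip_\<xi>: "\<And>x x'. \<bar>\<xi> x - \<xi> x'\<bar> \<le> L * \<bar>x - x'\<bar>"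
    and t0: "0 < t0" "t0 \<le> 1" "t0 * A \<le> 1 / 4" "t0 * (dd * X) \<le> 1 / 4"
    and inv: "\<And>t p. 0 \<le> t \<Longrightarrow> t \<le> t0 \<Longrightarrow> (fst p - t * w (fst p), (1 - t * \<xi> (fst p)) *\<^sub>R snd p) \<in> \<Omega> \<Longrightarrow> p \<in> \<Omega>"
    and Ybd: "\<And>t p. 0 \<le> t \<Longrightarrow> t \<le> t0 \<Longrightarrow> (fst p - t * w (fst p), (1 - t * \<xi> (fst p)) *\<^sub>R snd p) \<in> \<Omega> \<Longrightarrow>
        \<xi> (fst p) \<noteq> 0 \<Longrightarrow> norm (snd p) \<le> Y"
    and Y: "Y \<ge> 0"
begin

definition \<sigma> :: "real \<Rightarrow> real \<Rightarrow> real" where "\<sigma> t x = x - t * w x"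

definition \<Psi> :: "real \<Rightarrow> real \<times> 'b \<Rightarrow> real \<times> 'b" where
  "\<Psi> t p = (\<sigma> t (fst p), (1 - t * \<xi> (fst p)) *\<^sub>R snd p)"

text \<open>The Jacobian determinant of \<open>\<Psi> t\<close>. The derivative is block triangular,
  so \<open>\<xi>'\<close> does not enter.\<close>

definition J :: "real \<Rightarrow> real \<Rightarrow> real" where
  "J t x = (1 - t * a x) * (1 - t * \<xi> x) ^ DIM('b)"

text \<open>The divergence of the field \<open>(w, \<xi> y)\<close>, that is, minus the derivative
  of \<open>J t\<close> at \<open>t = 0\<close>.\<close>

definition \<gamma> :: "real \<Rightarrow> real" where "\<gamma> x = a x + dd * \<xi> x"

lemma dd_nonneg [simp]: "dd \<ge> 0" by (simp add: dd)

lemma AXLW: "A \<ge> 0" "X \<ge> 0" "L \<ge> 0" "W \<ge> 0"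
  using a[of 0] \<xi>[of 0] lip_a[of 0 1] w[of 0] by (auto intro: order_trans[OF abs_ge_zero])

lemma dd_ge: "dd \<ge> 1" using DIM_positive[where 'a = 'b] unfolding dd by linarith

lemma small:
  assumes "0 \<le> t" "t \<le> t0"
  shows "t * a x \<le> 1 / 4" "t * (dd * \<xi> x) \<le> 1 / 4" "t * \<xi> x \<le> 1 / 4"
proof -
  show "t * a x \<le> 1 / 4" using mult_mono[OF assms(2) a(2)[of x]] assms t0 a by fastforce
  have "dd * \<xi> x \<le> dd * X" using \<xi>[of x] by (intro mult_left_mono) auto
  then have "t * (dd * \<xi> x) \<le> t0 * (dd * X)" using assms \<xi>[of x] by (intro mult_mono) auto
  then show le: "t * (dd * \<xi> x) \<le> 1 / 4" using t0 by simp
  have "1 * \<xi> x \<le> dd * \<xi> x" using \<xi>[of x] dd_ge by (intro mult_right_mono) auto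
  then have "t * \<xi> x \<le> t * (dd * \<xi> x)" using assms by (intro mult_left_mono) auto
  then show "t * \<xi> x \<le> 1 / 4" using le by simp
qed

lemma cont: "continuous_on UNIV w" "continuous_on UNIV a" "continuous_on UNIV \<xi>"
proof -
  show "continuous_on UNIV w" by (rule smooth_continuous[OF smooth_w])
  show "continuous_on UNIV \<xi>" by (rule smooth_continuous[OF smooth_\<xi>])
  have "L-lipschitz_on UNIV a" using lip_a AXLW by (intro lipschitz_onI) (auto simp: dist_real_def)
  then show "continuous_on UNIV a" by (rule lipschitz_on_continuous_on)
qed

text \<open>The expansion is uniform in x. The two quarters in the bounds on \<open>t0\<close> give
  \<open>J t x \<ge> 1 / 2\<close>, so dividing by the Jacobian later costs only a factor 2.\<close>

lemma J_expansion:
  assumes t: "0 \<le> t" "t \<le> t0"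
  shows "1 - t * \<gamma> x \<le> J t x" "J t x \<le> 1 - t * \<gamma> x + t\<^sup>2 * (dd\<^sup>2 * X\<^sup>2 + A * (dd * X))" "1 / 2 \<le> J t x" "J t x \<le> 1"
proof -
  define s where "s = t * \<xi> x"
  define u where "u = t * a x"
  have s: "0 \<le> s" "s \<le> 1" using small(3)[OF t, of x] t \<xi>[of x] by (auto simp: s_def)
  have u: "0 \<le> u" "u \<le> 1/4" using small(1)[OF t, of x] t a[of x] by (auto simp: u_def)
  have ds: "dd * s \<le> 1 / 4" using small(2)[OF t, of x] by (simp add: s_def mult_ac)
  define e where "e = (1 - s) ^ DIM('b) - (1 - dd * s)"
  have e: "0 \<le> e" "e \<le> dd\<^sup>2 * s\<^sup>2" using power_one_minus_bounds[OF s, of "DIM('b)"] by (auto simp: e_def dd)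
  have J: "J t x = 1 - u - dd * s + (1 - u) * e + u * (dd * s)"
    by (simp add: J_def u_def[symmetric] s_def[symmetric] e_def algebra_simps)
  have tg: "t * \<gamma> x = u + dd * s" by (simp add: \<gamma>_def u_def s_def algebra_simps)
  have "(1 - u) * e \<ge> 0" "u * (dd * s) \<ge> 0" using u e s by auto
  then show lo: "1 - t * \<gamma> x \<le> J t x" using J tg by linarith
  then show "1 / 2 \<le> J t x" using tg u ds by linarith
  have "(1 - u) * e \<le> 1 * (dd\<^sup>2 * s\<^sup>2)" using e u by (intro mult_mono) auto
  also have "dd\<^sup>2 * s\<^sup>2 \<le> t\<^sup>2 * (dd\<^sup>2 * X\<^sup>2)"
  proof -
    have "(\<xi> x)\<^sup>2 \<le> X\<^sup>2" using \<xi>[of x] by (intro power_mono) auto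
    then have "(t\<^sup>2 * dd\<^sup>2) * (\<xi> x)\<^sup>2 \<le> (t\<^sup>2 * dd\<^sup>2) * X\<^sup>2" by (intro mult_left_mono) auto
    then show ?thesis by (simp add: s_def power_mult_distrib mult_ac)
  qed
  finally have 1: "(1 - u) * e \<le> t\<^sup>2 * (dd\<^sup>2 * X\<^sup>2)" by simp
  have "a x * \<xi> x \<le> A * X" using a[of x] \<xi>[of x] by (intro mult_mono) auto
  then have "(t\<^sup>2 * dd) * (a x * \<xi> x) \<le> (t\<^sup>2 * dd) * (A * X)" by (intro mult_left_mono) auto
  then have 2: "u * (dd * s) \<le> t\<^sup>2 * (A * (dd * X))" by (simp add: u_def s_def power2_eq_square mult_ac)
  show "J t x \<le> 1 - t * \<gamma> x + t\<^sup>2 * (dd\<^sup>2 * X\<^sup>2 + A * (dd * X))"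
    using 1 2 J tg unfolding distrib_left[of "t\<^sup>2"] by linarith
  have "(1 - s) ^ DIM('b) \<le> 1" using s by (intro power_le_one) auto
  then have "(1 - u) * (1 - s) ^ DIM('b) \<le> 1 * 1" using u s by (intro mult_mono) auto
  then show "J t x \<le> 1" by (simp add: J_def u_def s_def)
qed

lemma smooth_\<Psi>: "smooth (\<Psi> t)"
proof -
  have 1: "smooth (\<lambda>p::real \<times> 'b. fst p)" by (rule smooth_linear[OF bounded_linear_fst smooth_ident])
  have 2: "smooth (\<lambda>p::real \<times> 'b. snd p)" by (rule smooth_linear[OF bounded_linear_snd smooth_ident])
  show ?thesis unfolding \<Psi>_def \<sigma>_def
    by (intro smooth_Pair smooth_diff smooth_mult smooth_scaleR smooth_const 1 2
        smooth_compose[OF smooth_w 1] smooth_compose[OF smooth_\<xi> 1])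
qed

lemma cont_\<Psi>: "continuous_on UNIV (\<Psi> t)" by (rule smooth_continuous[OF smooth_\<Psi>])

lemma \<Psi>_inv: "0 \<le> t \<Longrightarrow> t \<le> t0 \<Longrightarrow> \<Psi> t p \<in> \<Omega> \<Longrightarrow> p \<in> \<Omega>"
  using inv[of t p] by (simp add: \<Psi>_def \<sigma>_def)

lemma \<Psi>_Y: "0 \<le> t \<Longrightarrow> t \<le> t0 \<Longrightarrow> \<Psi> t p \<in> \<Omega> \<Longrightarrow> \<xi> (fst p) \<noteq> 0 \<Longrightarrow> norm (snd p) \<le> Y"
  using Ybd[of t p] by (simp add: \<Psi>_def \<sigma>_def)

lemma \<Psi>_proper:
  assumes t: "0 \<le> t" "t \<le> t0" and K: "compact K" shows "bounded (\<Psi> t -` K)"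
proof -
  obtain B where B: "\<And>q. q \<in> K \<Longrightarrow> norm q \<le> B" using compact_imp_bounded[OF K] unfolding bounded_iff by blast
  have "norm p \<le> (B + W) + 2 * B" if "p \<in> \<Psi> t -` K" for p
  proof -
    have n: "norm (\<Psi> t p) \<le> B" using that B by blast
    have "\<bar>\<sigma> t (fst p)\<bar> \<le> B" using n norm_fst_le[of "\<sigma> t (fst p)" "(1 - t * \<xi> (fst p)) *\<^sub>R snd p"] by (simp add: \<Psi>_def)
    moreover have "\<bar>t * w (fst p)\<bar> \<le> 1 * W" unfolding abs_mult using t t0 w AXLW by (intro mult_mono) auto
    ultimately have 1: "\<bar>fst p\<bar> \<le> B + W" by (simp add: \<sigma>_def)
    have "norm ((1 - t * \<xi> (fst p)) *\<^sub>R snd p) \<le> B"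
      using n norm_snd_le[of "(1 - t * \<xi> (fst p)) *\<^sub>R snd p" "\<sigma> t (fst p)"] by (simp add: \<Psi>_def)
    moreover have "1 / 2 * norm (snd p) \<le> \<bar>1 - t * \<xi> (fst p)\<bar> * norm (snd p)"
      using small(3)[OF t, of "fst p"] by (intro mult_right_mono) auto
    ultimately have 2: "norm (snd p) \<le> 2 * B" by simp
    have "norm p \<le> norm (fst p) + norm (snd p)" using norm_Pair_le[of "fst p" "snd p"] by simp
    then show ?thesis using 1 2 by simp
  qed
  then show ?thesis unfolding bounded_iff by blast
qed

lemma pull_TF:
  assumes "0 \<le> t" "t \<le> t0" "\<phi> \<in> test_functions \<Omega>"
  shows "(\<lambda>p. \<phi> (\<Psi> t p)) \<in> test_functions \<Omega>"
  by (rule test_function_compose[OF assms(3) smooth_\<Psi> \<Psi>_inv[OF assms(1,2)] \<Psi>_proper[OF assms(1,2)]])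

lemma pull_back:
  fixes G :: "real \<times> 'b \<Rightarrow> ennreal"
  assumes t: "0 \<le> t" "t \<le> t0" and G: "G \<in> borel_measurable borel"
  shows "(\<integral>\<^sup>+p. G p \<partial>lborel) = (\<integral>\<^sup>+p. ennreal (J t (fst p)) * G (\<Psi> t p) \<partial>lborel)"
  unfolding J_def \<Psi>_def
proof (rule nn_integral_shear[OF G])
  show "(\<sigma> t has_real_derivative (1 - t * a x)) (at x)" for x
    unfolding \<sigma>_def by (auto intro!: derivative_eq_intros w')
  show "continuous_on UNIV (\<lambda>x. 1 - t * a x)" "continuous_on UNIV (\<lambda>x. 1 - t * \<xi> x)"
    by (intro continuous_intros cont)+
  show "0 \<le> 1 - t * a x" "0 < 1 - t * \<xi> x" for x using small[OF t, of x] by auto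
  show "\<bar>\<sigma> t x - x\<bar> \<le> W" for x
    using mult_mono[of t 1 "\<bar>w x\<bar>" W] t t0 w[of x] AXLW by (simp add: \<sigma>_def abs_mult)
qed

text \<open>\<open>K\<close> is a weight at the source point, \<open>k\<close> one at its image.
  Pulling back the right-hand integral produces \<open>J t x * k (\<sigma> t x)\<close> at the
  source, so comparing weights there avoids any inverse of \<open>\<sigma> t\<close>.\<close>

lemma transport_le:
  fixes G :: "real \<times> 'b \<Rightarrow> real"
  assumes t: "0 \<le> t" "t \<le> t0" and G: "cc G" "\<And>p. G p \<ge> 0"
    and K: "continuous_on UNIV K" "\<And>x. 0 \<le> K x" and k: "continuous_on UNIV k" "\<And>x. 0 \<le> k x"
    and le: "\<And>x. K x \<le> J t x * k (\<sigma> t x)"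
  shows "integrable lborel (\<lambda>p. K (fst p) * G (\<Psi> t p))"
    "(\<integral>p. K (fst p) * G (\<Psi> t p) \<partial>lborel) \<le> (\<integral>p. k (fst p) * G p \<partial>lborel)"
proof -
  have GB: "G \<in> borel_measurable borel" by (rule cc_borel[OF G(1)])
  have KB: "(\<lambda>p::real \<times> 'b. K (fst p)) \<in> borel_measurable borel"
    by (intro continuous_UNIV_borel continuous_on_compose2[OF K(1)]) (auto intro: continuous_intros)
  have ck: "continuous_on UNIV (\<lambda>p::real \<times> 'b. k (fst p))"
    by (intro continuous_on_compose2[OF k(1)]) (auto intro: continuous_intros)
  have kB: "(\<lambda>p::real \<times> 'b. k (fst p)) \<in> borel_measurable borel" by (rule continuous_UNIV_borel[OF ck])
  have \<Psi>B: "\<Psi> t \<in> borel_measurable borel" by (rule continuous_UNIV_borel[OF cont_\<Psi>])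
  have m: "(\<lambda>p. K (fst p) * G (\<Psi> t p)) \<in> borel_measurable borel"
    using KB measurable_compose[OF \<Psi>B GB] by measurable
  have kG: "integrable lborel (\<lambda>p. k (fst p) * G p)"
    by (rule cc_integrable[OF cc_mult[OF G(1) ck]])
  have "(\<integral>\<^sup>+p. ennreal (K (fst p) * G (\<Psi> t p)) \<partial>lborel) \<le> (\<integral>\<^sup>+p. ennreal (J t (fst p)) * ennreal (k (fst (\<Psi> t p)) * G (\<Psi> t p)) \<partial>lborel)"
  proof (rule nn_integral_mono)
    fix p
    have "K (fst p) * G (\<Psi> t p) \<le> J t (fst p) * k (\<sigma> t (fst p)) * G (\<Psi> t p)"
      by (intro mult_right_mono le G)
    then have "ennreal (K (fst p) * G (\<Psi> t p)) \<le> ennreal (J t (fst p) * (k (fst (\<Psi> t p)) * G (\<Psi> t p)))"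
      by (simp add: \<Psi>_def mult_ac ennreal_leI)
    then show "ennreal (K (fst p) * G (\<Psi> t p)) \<le> ennreal (J t (fst p)) * ennreal (k (fst (\<Psi> t p)) * G (\<Psi> t p))"
      using k G J_expansion(3)[OF t, of "fst p"] by (simp add: ennreal_mult)
  qed
  also have "\<dots> = (\<integral>\<^sup>+p. ennreal (k (fst p) * G p) \<partial>lborel)"
    by (rule pull_back[OF t, symmetric]) (use kB GB in measurable)
  also have "\<dots> = ennreal (\<integral>p. k (fst p) * G p \<partial>lborel)"
    using k G by (intro nn_integral_eq_integral kG) auto
  finally have *: "(\<integral>\<^sup>+p. ennreal (K (fst p) * G (\<Psi> t p)) \<partial>lborel) \<le> ennreal (\<integral>p. k (fst p) * G p \<partial>lborel)" .
  show i: "integrable lborel (\<lambda>p. K (fst p) * G (\<Psi> t p))"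
    using m K G order_le_less_trans[OF *] by (intro integrableI_bounded) auto
  have "ennreal (\<integral>p. K (fst p) * G (\<Psi> t p) \<partial>lborel) \<le> ennreal (\<integral>p. k (fst p) * G p \<partial>lborel)"
    using * nn_integral_eq_integral[OF i] K G by simp
  moreover have "(\<integral>p. k (fst p) * G p \<partial>lborel) \<ge> 0" using k G by simp
  ultimately show "(\<integral>p. K (fst p) * G (\<Psi> t p) \<partial>lborel) \<le> (\<integral>p. k (fst p) * G p \<partial>lborel)"
    by simp
qed

lemma transport_ge:
  fixes G :: "real \<times> 'b \<Rightarrow> real"
  assumes t: "0 \<le> t" "t \<le> t0" and G: "cc G" "\<And>p. G p \<ge> 0" and i: "integrable lborel (\<lambda>p. G (\<Psi> t p))"
    and k: "continuous_on UNIV k" "\<And>x. 0 \<le> k x"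
    and le: "\<And>x. J t x * k (\<sigma> t x) \<le> 1"
  shows "(\<integral>p. k (fst p) * G p \<partial>lborel) \<le> (\<integral>p. G (\<Psi> t p) \<partial>lborel)"
proof -
  have GB: "G \<in> borel_measurable borel" by (rule cc_borel[OF G(1)])
  have ck: "continuous_on UNIV (\<lambda>p::real \<times> 'b. k (fst p))"
    by (intro continuous_on_compose2[OF k(1)]) (auto intro: continuous_intros)
  have kB: "(\<lambda>p::real \<times> 'b. k (fst p)) \<in> borel_measurable borel" by (rule continuous_UNIV_borel[OF ck])
  have kG: "integrable lborel (\<lambda>p. k (fst p) * G p)"
    by (rule cc_integrable[OF cc_mult[OF G(1) ck]])
  have "ennreal (\<integral>p. k (fst p) * G p \<partial>lborel) = (\<integral>\<^sup>+p. ennreal (k (fst p) * G p) \<partial>lborel)"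
    using k G by (intro nn_integral_eq_integral[symmetric] kG) auto
  also have "\<dots> = (\<integral>\<^sup>+p. ennreal (J t (fst p)) * ennreal (k (fst (\<Psi> t p)) * G (\<Psi> t p)) \<partial>lborel)"
    by (rule pull_back[OF t]) (use kB GB in measurable)
  also have "\<dots> \<le> (\<integral>\<^sup>+p. ennreal (G (\<Psi> t p)) \<partial>lborel)"
  proof (rule nn_integral_mono)
    fix p
    have "J t (fst p) * k (\<sigma> t (fst p)) * G (\<Psi> t p) \<le> 1 * G (\<Psi> t p)"
      by (intro mult_right_mono le G)
    then have "ennreal (J t (fst p) * (k (fst (\<Psi> t p)) * G (\<Psi> t p))) \<le> ennreal (G (\<Psi> t p))"
      by (simp add: \<Psi>_def mult_ac ennreal_leI)
    then show "ennreal (J t (fst p)) * ennreal (k (fst (\<Psi> t p)) * G (\<Psi> t p)) \<le> ennreal (G (\<Psi> t p))"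
      using k G J_expansion(3)[OF t, of "fst p"] by (simp add: ennreal_mult)
  qed
  also have "\<dots> = ennreal (\<integral>p. G (\<Psi> t p) \<partial>lborel)"
    using G by (intro nn_integral_eq_integral i) auto
  finally show ?thesis using G by simp
qed

lemma lip_\<gamma>: "\<bar>\<gamma> x - \<gamma> x'\<bar> \<le> (L + dd * L) * \<bar>x - x'\<bar>"
proof -
  have "\<gamma> x - \<gamma> x' = (a x - a x') + dd * (\<xi> x - \<xi> x')" by (simp add: \<gamma>_def algebra_simps)
  then have "\<bar>\<gamma> x - \<gamma> x'\<bar> \<le> \<bar>a x - a x'\<bar> + dd * \<bar>\<xi> x - \<xi> x'\<bar>"
    using abs_triangle_ineq[of "a x - a x'" "dd * (\<xi> x - \<xi> x')"] by (simp add: abs_mult)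
  also have "\<dots> \<le> L * \<bar>x - x'\<bar> + dd * (L * \<bar>x - x'\<bar>)" by (intro add_mono lip_a mult_left_mono lip_\<xi>) auto
  finally show ?thesis by (simp add: algebra_simps)
qed

lemma \<gamma>_bound: "0 \<le> \<gamma> x" "\<gamma> x \<le> A + dd * X"
  using a[of x] \<xi>[of x] by (auto simp: \<gamma>_def intro!: add_mono mult_left_mono)

lemma \<sigma>_dist: "0 \<le> t \<Longrightarrow> \<bar>\<sigma> t x - x\<bar> \<le> t * W"
  using w[of x] by (simp add: \<sigma>_def abs_mult mult_left_mono)

text \<open>To first order, the weight \<open>1 - t * \<kappa>\<close> at the source corresponds to
  \<open>1 - t * (\<kappa> - \<gamma>)\<close> at the image, the shift by \<open>\<gamma>\<close>
  being due to the Jacobian. Moving the argument of a Lipschitz weight and multiplying first-order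
  terms both cost order \<open>t\<^sup>2\<close>. The slack \<open>c * t\<^sup>2\<close> on the left
  makes room for the quadratic terms of the energy.\<close>

lemma weight_expansion:
  assumes \<kappa>: "\<And>x. \<bar>\<kappa> x\<bar> \<le> B" and lip: "\<And>x x'. \<bar>\<kappa> x - \<kappa> x'\<bar> \<le> Lk * \<bar>x - x'\<bar>"
  shows "\<exists>C\<ge>0. \<exists>t1>0. t1 \<le> t0 \<and> (\<forall>t x. 0 \<le> t \<longrightarrow> t \<le> t1 \<longrightarrow>
     1 - t * \<kappa> x + c * t\<^sup>2 \<le> J t x * (1 - t * (\<kappa> (\<sigma> t x) - \<gamma> (\<sigma> t x)) + C * t\<^sup>2) \<and>
     0 \<le> 1 - t * (\<kappa> x - \<gamma> x) + C * t\<^sup>2)"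
proof -
  define B' where "B' = B + (A + dd * X)"
  have B0: "B \<ge> 0" using \<kappa>[of 0] by linarith
  have Lk0: "Lk \<ge> 0" using lip[of 0 1] by (auto intro: order_trans[OF abs_ge_zero])
  have G0: "A + dd * X \<ge> 0" using AXLW by simp
  have B'0: "B' \<ge> 0" using B0 G0 by (simp add: B'_def)
  define L' where "L' = Lk + (L + dd * L)"
  have L'0: "L' \<ge> 0" using Lk0 AXLW by (simp add: L'_def)
  define C1 where "C1 = dd\<^sup>2 * X\<^sup>2 + A * (dd * X)"
  have C1: "C1 \<ge> 0" using AXLW by (simp add: C1_def)
  \<comment> \<open>Twice the sum of the second-order errors, since \<open>C * t\<^sup>2\<close>
    gets multiplied by a Jacobian that is only known to be at least one half.\<close>
  define C where "C = 2 * (L' * W + (A + dd * X) * B' + 2 * C1 + \<bar>c\<bar>)"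
  have C0: "C \<ge> 0" using L'0 AXLW G0 B'0 C1 by (simp add: C_def)
  define t1 where "t1 = min t0 (1 / (B' + 1))"
  have t1: "t1 > 0" "t1 \<le> t0" using t0 B'0 by (auto simp: t1_def)
  have "1 - t * \<kappa> x + c * t\<^sup>2 \<le> J t x * (1 - t * (\<kappa> (\<sigma> t x) - \<gamma> (\<sigma> t x)) + C * t\<^sup>2) \<and>
     0 \<le> 1 - t * (\<kappa> x - \<gamma> x) + C * t\<^sup>2" if t: "0 \<le> t" "t \<le> t1" for t x
  proof -
    have tt0: "t \<le> t0" using t t1 by simp
    define k where "k x = \<kappa> x - \<gamma> x" for x
    have kb: "\<bar>k x\<bar> \<le> B'" for x using \<kappa>[of x] \<gamma>_bound[of x] by (auto simp: k_def B'_def)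
    have tk: "\<bar>t * k x\<bar> \<le> 1" for x
    proof -
      have "\<bar>t * k x\<bar> \<le> (1 / (B' + 1)) * B'"
        unfolding abs_mult using t kb[of x] B'0 by (intro mult_mono) (auto simp: t1_def)
      also have "\<dots> \<le> 1" using B'0 by (simp add: field_simps)
      finally show ?thesis .
    qed
    define s where "s = \<sigma> t x"
    have "\<bar>k s - k x\<bar> \<le> L' * \<bar>s - x\<bar>"
      using lip[of s x] lip_\<gamma>[of s x] unfolding k_def L'_def distrib_right by linarith
    also have "\<dots> \<le> L' * (t * W)" using \<sigma>_dist[OF t(1), of x] L'0 by (simp add: s_def mult_left_mono)
    finally have "k s \<le> k x + L' * (t * W)" by linarith
    then have "t * k s \<le> t * (k x + L' * (t * W))" using t by (intro mult_left_mono) auto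
    then have ks: "t * k s \<le> t * k x + t\<^sup>2 * (L' * W)" by (simp add: power2_eq_square algebra_simps)
    define j where "j = J t x"
    note je = J_expansion[OF t(1) tt0, of x, folded j_def C1_def]
    define E where "E = j - (1 - t * \<gamma> x)"
    have E: "0 \<le> E" "E \<le> t\<^sup>2 * C1" using je by (auto simp: E_def)
    have "1 - t * \<kappa> x - t\<^sup>2 * ((A + dd * X) * B') - 2 * (t\<^sup>2 * C1) \<le> j * (1 - t * k x)"
    proof -
      have "j * (1 - t * k x) = 1 - t * \<kappa> x + t\<^sup>2 * (\<gamma> x * k x) + E * (1 - t * k x)"
        by (simp add: E_def k_def power2_eq_square algebra_simps)
      moreover have "E * (1 - t * k x) \<ge> 0" using E tk[of x] by (intro mult_nonneg_nonneg) auto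
      moreover have "\<bar>\<gamma> x * k x\<bar> \<le> (A + dd * X) * B'"
        unfolding abs_mult using \<gamma>_bound[of x] kb[of x] by (intro mult_mono) auto
      then have "t\<^sup>2 * - (\<gamma> x * k x) \<le> t\<^sup>2 * ((A + dd * X) * B')" by (intro mult_left_mono) auto
      moreover have "t\<^sup>2 * C1 \<ge> 0" using C1 by simp
      ultimately show ?thesis by simp
    qed
    moreover have "j * (1 - t * k x) + (t\<^sup>2 * (C / 2) - t\<^sup>2 * (L' * W)) \<le> j * (1 - t * k s + C * t\<^sup>2)"
    proof -
      have "j * (1 - t * k x - t\<^sup>2 * (L' * W) + C * t\<^sup>2) \<le> j * (1 - t * k s + C * t\<^sup>2)"
        using ks je by (intro mult_left_mono) auto
      moreover have "j * (t\<^sup>2 * (L' * W)) \<le> 1 * (t\<^sup>2 * (L' * W))"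
        using je L'0 AXLW by (intro mult_right_mono) auto
      moreover have "1 / 2 * (C * t\<^sup>2) \<le> j * (C * t\<^sup>2)" using je C0 by (intro mult_right_mono) auto
      ultimately show ?thesis by (simp add: algebra_simps)
    qed
    moreover have "t\<^sup>2 * (C / 2) = t\<^sup>2 * (L' * W) + t\<^sup>2 * ((A + dd * X) * B') + 2 * (t\<^sup>2 * C1) + t\<^sup>2 * \<bar>c\<bar>"
      by (simp add: C_def algebra_simps)
    moreover have "c * t\<^sup>2 \<le> t\<^sup>2 * \<bar>c\<bar>" by (metis abs_ge_self mult.commute mult_left_mono zero_le_power2)
    ultimately have "1 - t * \<kappa> x + c * t\<^sup>2 \<le> j * (1 - t * k s + C * t\<^sup>2)" by linarith
    moreover have "0 \<le> 1 - t * k x + C * t\<^sup>2" using tk[of x] C0 by (simp add: abs_le_iff add_nonneg_nonneg)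
    ultimately show ?thesis by (simp add: j_def k_def s_def)
  qed
  then show ?thesis using C0 t1 by blast
qed

text \<open>At the image point, \<open>1 + t * \<gamma>\<close> minus a quadratic correction is a
  lower bound for the reciprocal of the Jacobian. The bound on \<open>t1\<close> also keeps
  \<open>C * t\<^sup>2\<close> below 1, so that this lower weight is nonnegative.\<close>

lemma mass_expansion:
  "\<exists>C\<ge>0. \<exists>t1>0. t1 \<le> t0 \<and> (\<forall>t x. 0 \<le> t \<longrightarrow> t \<le> t1 \<longrightarrow>
     J t x * (1 + t * \<gamma> (\<sigma> t x) - C * t\<^sup>2) \<le> 1 \<and> 0 \<le> 1 + t * \<gamma> x - C * t\<^sup>2)"
proof -
  define L' where "L' = L + dd * L"
  have L'0: "L' \<ge> 0" using AXLW by (simp add: L'_def)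
  define C1 where "C1 = dd\<^sup>2 * X\<^sup>2 + A * (dd * X)"
  have C1: "C1 \<ge> 0" using AXLW by (simp add: C1_def)
  define C where "C = 2 * (L' * W + 2 * C1)"
  have C0: "C \<ge> 0" using L'0 AXLW C1 by (simp add: C_def)
  define t1 where "t1 = min t0 (1 / (C + 1))"
  have t1: "t1 > 0" "t1 \<le> t0" using t0 C0 by (auto simp: t1_def)
  have "J t x * (1 + t * \<gamma> (\<sigma> t x) - C * t\<^sup>2) \<le> 1 \<and> 0 \<le> 1 + t * \<gamma> x - C * t\<^sup>2" if t: "0 \<le> t" "t \<le> t1" for t x
  proof -
    have tt0: "t \<le> t0" "t \<le> 1" using t t1 t0 by auto
    define s where "s = \<sigma> t x"
    have "\<bar>\<gamma> s - \<gamma> x\<bar> \<le> L' * \<bar>s - x\<bar>" using lip_\<gamma>[of s x] by (simp add: L'_def)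
    also have "\<dots> \<le> L' * (t * W)" using \<sigma>_dist[OF t(1), of x] L'0 by (simp add: s_def mult_left_mono)
    finally have "\<gamma> s \<le> \<gamma> x + L' * (t * W)" by linarith
    then have "t * \<gamma> s \<le> t * (\<gamma> x + L' * (t * W))" using t by (intro mult_left_mono) auto
    then have gs: "t * \<gamma> s \<le> t * \<gamma> x + t\<^sup>2 * (L' * W)" by (simp add: power2_eq_square algebra_simps)
    define j where "j = J t x"
    note je = J_expansion[OF t(1) tt0(1), of x, folded j_def C1_def]
    define E where "E = j - (1 - t * \<gamma> x)"
    have E: "0 \<le> E" "E \<le> t\<^sup>2 * C1" using je by (auto simp: E_def)
    have tg: "0 \<le> t * \<gamma> x" "t * \<gamma> x \<le> 1"
      using small[OF t(1) tt0(1), of x] mult_nonneg_nonneg[OF t(1) \<gamma>_bound(1)[of x]] by (auto simp: \<gamma>_def distrib_left)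
    have 1: "j * (1 + t * \<gamma> x) \<le> 1 + 2 * (t\<^sup>2 * C1)"
    proof -
      have "j * (1 + t * \<gamma> x) = 1 - (t * \<gamma> x)\<^sup>2 + E * (1 + t * \<gamma> x)"
        by (simp add: E_def power2_eq_square algebra_simps)
      moreover have "E * (1 + t * \<gamma> x) \<le> (t\<^sup>2 * C1) * 2" using E tg by (intro mult_mono) auto
      ultimately show ?thesis using zero_le_power2[of "t * \<gamma> x"] by linarith
    qed
    have 2: "j * (1 + t * \<gamma> s - C * t\<^sup>2) \<le> j * (1 + t * \<gamma> x) + t\<^sup>2 * (L' * W) - t\<^sup>2 * (C / 2)"
    proof -
      have "j * (1 + t * \<gamma> s - C * t\<^sup>2) \<le> j * (1 + t * \<gamma> x + t\<^sup>2 * (L' * W) - C * t\<^sup>2)"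
        using gs je by (intro mult_left_mono) auto
      moreover have "j * (t\<^sup>2 * (L' * W)) \<le> 1 * (t\<^sup>2 * (L' * W))"
        using je L'0 AXLW by (intro mult_right_mono) auto
      moreover have "1 / 2 * (C * t\<^sup>2) \<le> j * (C * t\<^sup>2)" using je C0 by (intro mult_right_mono) auto
      ultimately show ?thesis by (simp add: algebra_simps)
    qed
    have 3: "t\<^sup>2 * (C / 2) = t\<^sup>2 * (L' * W) + 2 * (t\<^sup>2 * C1)" by (simp add: C_def algebra_simps)
    have "C * t\<^sup>2 \<le> C * (t * 1)" unfolding power2_eq_square using tt0 t C0 by (intro mult_left_mono) auto
    also have "\<dots> \<le> C * (1 / (C + 1))" using t C0 by (intro mult_left_mono) (auto simp: t1_def)
    also have "\<dots> \<le> 1" using C0 by simp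
    finally have "C * t\<^sup>2 \<le> 1" .
    moreover have "j * (1 + t * \<gamma> s - C * t\<^sup>2) \<le> 1" using 1 2 3 by linarith
    ultimately show ?thesis using tg by (simp add: j_def s_def)
  qed
  then show ?thesis using C0 t1 by blast
qed

end

section \<open>Energy, mass and increments along the flow\<close>

lemma sum_Basis_prod:
  fixes f :: "'a::euclidean_space \<times> 'b::euclidean_space \<Rightarrow> 'c::comm_monoid_add"
  shows "sum f Basis = (\<Sum>i\<in>Basis. f (i, 0)) + (\<Sum>i\<in>Basis. f (0, i))"
proof -
  have "inj_on (\<lambda>u. (u::'a, 0::'b)) Basis" "inj_on (\<lambda>u. (0::'a, u::'b)) Basis"
    by (auto intro!: inj_onI Pair_inject)
  thus ?thesis
    unfolding Basis_prod_def
    by (subst sum.union_disjoint) (auto simp: Basis_prod_def sum.reindex)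
qed

definition wint :: "(real \<Rightarrow> real) \<Rightarrow> (real \<times> 'b::euclidean_space \<Rightarrow> real) \<Rightarrow> real" where
  "wint k G = (\<integral>p. k (fst p) * G p \<partial>lborel)"

lemma continuous_on_fst_comp:
  "continuous_on UNIV k \<Longrightarrow> continuous_on UNIV (\<lambda>p::real \<times> 'b::euclidean_space. k (fst p))"
  by (erule continuous_on_compose2) (auto intro: continuous_intros)

lemma wint_cc:
  fixes G :: "real \<times> 'b::euclidean_space \<Rightarrow> real"
  shows "cc G \<Longrightarrow> continuous_on UNIV k \<Longrightarrow> cc (\<lambda>p. k (fst p) * G p)"
  using cc_mult[OF _ continuous_on_fst_comp] by blast

lemma wint_integrable:
  fixes G :: "real \<times> 'b::euclidean_space \<Rightarrow> real"
  shows "cc G \<Longrightarrow> continuous_on UNIV k \<Longrightarrow> integrable lborel (\<lambda>p. k (fst p) * G p)"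
  by (rule cc_integrable[OF wint_cc])

lemma wint_add:
  assumes "cc G" "continuous_on UNIV k" "continuous_on UNIV l"
  shows "wint (\<lambda>x. k x + l x) G = wint k G + wint l G"
  using wint_integrable[OF assms(1,2)] wint_integrable[OF assms(1,3)] by (simp add: wint_def distrib_right)

lemma wint_cmult: "wint (\<lambda>x. c * k x) G = c * wint k G"
  by (simp add: wint_def mult.assoc)

lemma wint_diff:
  assumes "cc G" "continuous_on UNIV k" "continuous_on UNIV l"
  shows "wint (\<lambda>x. k x - l x) G = wint k G - wint l G"
  using wint_integrable[OF assms(1,2)] wint_integrable[OF assms(1,3)] by (simp add: wint_def left_diff_distrib)

lemma wint_mono:
  assumes "cc G" "continuous_on UNIV k" "continuous_on UNIV l" "\<And>p. G p \<ge> 0" "\<And>x. k x \<le> l x"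
  shows "wint k G \<le> wint l G"
  unfolding wint_def using assms by (intro integral_mono wint_integrable mult_right_mono)

lemma wint_nonneg: "(\<And>p. G p \<ge> 0) \<Longrightarrow> (\<And>x. k x \<ge> 0) \<Longrightarrow> wint k G \<ge> 0"
  by (simp add: wint_def)

lemma wint_const: "wint (\<lambda>_. c) G = c * wint (\<lambda>_. 1) G"
  by (simp add: wint_def)

lemma wint_affine:
  assumes "cc G" "continuous_on UNIV k"
  shows "wint (\<lambda>x. 1 + q * k x + r) G = wint (\<lambda>_. 1) G + q * wint k G + r * wint (\<lambda>_. 1) G"
proof -
  have "wint (\<lambda>x. 1 + q * k x + r) G = (\<integral>p. G p + q * (k (fst p) * G p) + r * G p \<partial>lborel)"
    unfolding wint_def by (rule Bochner_Integration.integral_cong) (simp_all add: algebra_simps)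
  then show ?thesis using cc_integrable[OF assms(1)] wint_integrable[OF assms] by (simp add: wint_def)
qed

definition gx :: "(real \<times> 'b::euclidean_space \<Rightarrow> complex) \<Rightarrow> real \<times> 'b \<Rightarrow> real" where
  "gx \<phi> p = (cmod (pd (1, 0) \<phi> p))\<^sup>2"

definition gy :: "(real \<times> 'b::euclidean_space \<Rightarrow> complex) \<Rightarrow> real \<times> 'b \<Rightarrow> real" where
  "gy \<phi> p = (\<Sum>b\<in>Basis. (cmod (pd (0, b) \<phi> p))\<^sup>2)"

definition gm :: "(real \<times> 'b::euclidean_space \<Rightarrow> complex) \<Rightarrow> real \<times> 'b \<Rightarrow> real" where
  "gm \<phi> p = (cmod (\<phi> p))\<^sup>2"

lemma g_nonneg [simp]: "gx \<phi> p \<ge> 0" "gy \<phi> p \<ge> 0" "gm \<phi> p \<ge> 0"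
  by (simp_all add: gx_def gy_def gm_def sum_nonneg)

lemma g_cc:
  assumes "\<phi> \<in> test_functions \<Omega>"
  shows "cc (gx \<phi>)" "cc (gy \<phi>)" "cc (gm \<phi>)"
proof -
  show "cc (gx \<phi>)" unfolding gx_def[abs_def] by (rule cc_square[OF test_function_cc[OF test_function_pd[OF assms]]])
  show "cc (gy \<phi>)" unfolding gy_def[abs_def] by (rule cc_sum) (rule cc_square[OF test_function_cc[OF test_function_pd[OF assms]]])
  show "cc (gm \<phi>)" unfolding gm_def[abs_def] by (rule cc_square[OF test_function_cc[OF assms]])
qed

lemma dir_eq:
  assumes "\<phi> \<in> test_functions \<Omega>"
  shows "dir \<phi> \<phi> = wint (\<lambda>_. 1) (gx \<phi>) + wint (\<lambda>_. 1) (gy \<phi>)"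
proof -
  have "integrable lborel (\<lambda>p. (cmod (pd v \<phi> p))\<^sup>2)" for v
    by (rule cc_integrable[OF cc_square[OF test_function_cc[OF test_function_pd[OF assms]]]])
  then have "(\<integral>p. gy \<phi> p \<partial>lborel) = (\<Sum>b\<in>Basis. (\<integral>p. (cmod (pd (0, b) \<phi> p))\<^sup>2 \<partial>lborel))"
    unfolding gy_def by (rule Bochner_Integration.integral_sum)
  then show ?thesis
    by (simp add: dir_def sum_Basis_prod wint_def gx_def nrm_square flip: nrm_square_rip)
qed

lemma nrm_eq_gm:
  assumes "open \<Omega>" "\<phi> \<in> test_functions \<Omega>"
  shows "(nrm (lebesgue_on \<Omega>) \<phi>)\<^sup>2 = wint (\<lambda>_. 1) (gm \<phi>)"
  by (simp add: test_function_nrm[OF assms] nrm_square wint_def gm_def)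

lemma derivative_snd_bound:
  assumes "\<phi> \<in> test_functions \<Omega>"
  shows "cmod (frechet_derivative \<phi> (at q) (0, y)) \<le> norm y * sqrt (gy \<phi> q)"
proof -
  let ?D = "frechet_derivative \<phi> (at q)"
  have lin: "linear ?D" using test_function_has_derivative[OF assms] has_derivative_linear by blast
  have "(0, y) = (\<Sum>b\<in>Basis. (y \<bullet> b) *\<^sub>R ((0::real), b))"
  proof -
    have "(\<Sum>b\<in>Basis. (y \<bullet> b) *\<^sub>R ((0::real), b)) = (\<Sum>b\<in>Basis. (0, (y \<bullet> b) *\<^sub>R b))" by simp
    also have "\<dots> = (0, \<Sum>b\<in>Basis. (y \<bullet> b) *\<^sub>R b)" by (simp add: sum_prod)
    finally show ?thesis by (simp add: euclidean_representation)
  qed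
  then have "?D (0, y) = ?D (\<Sum>b\<in>Basis. (y \<bullet> b) *\<^sub>R ((0::real), b))" by (rule arg_cong)
  also have "\<dots> = (\<Sum>b\<in>Basis. (y \<bullet> b) *\<^sub>R ?D (0, b))" unfolding linear_sum[OF lin] linear_scale[OF lin] ..
  finally have "cmod (?D (0, y)) = cmod (\<Sum>b\<in>Basis. (y \<bullet> b) *\<^sub>R ?D (0, b))" by simp
  also have "\<dots> \<le> (\<Sum>b\<in>Basis. cmod ((y \<bullet> b) *\<^sub>R ?D (0, b)))" by (rule norm_sum)
  also have "\<dots> = (\<Sum>b\<in>Basis. \<bar>y \<bullet> b\<bar> * \<bar>cmod (?D (0, b))\<bar>)" by simp
  also have "\<dots> \<le> L2_set (\<lambda>b. y \<bullet> b) Basis * L2_set (\<lambda>b. cmod (?D (0, b))) Basis"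
    by (rule L2_set_mult_ineq)
  also have "L2_set (\<lambda>b. y \<bullet> b) Basis = norm y" by (simp add: norm_eq_sqrt_inner L2_set_def euclidean_inner[of y y] power2_eq_square)
  also have "L2_set (\<lambda>b. cmod (?D (0, b))) Basis = sqrt (gy \<phi> q)" by (simp add: L2_set_def gy_def)
  finally show ?thesis .
qed

lemma derivative_split:
  assumes "\<phi> \<in> test_functions \<Omega>"
  shows "frechet_derivative \<phi> (at q) (h, y) = h *\<^sub>R pd (1, 0) \<phi> q + frechet_derivative \<phi> (at q) (0, y)"
proof -
  have lin: "linear (frechet_derivative \<phi> (at q))"
    using test_function_has_derivative[OF assms] has_derivative_linear by blast
  have "(h, y) = h *\<^sub>R (1, 0) + (0, y)" by simp
  then have "frechet_derivative \<phi> (at q) (h, y) = frechet_derivative \<phi> (at q) (h *\<^sub>R (1, 0) + (0, y))" by (rule arg_cong)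
  also have "\<dots> = h *\<^sub>R pd (1, 0) \<phi> q + frechet_derivative \<phi> (at q) (0, y)"
    unfolding linear_add[OF lin] linear_scale[OF lin] ..
  finally show ?thesis .
qed

text \<open>The fundamental theorem of calculus and the Cauchy-Schwarz inequality on
  \<open>{0..t}\<close>. The right-hand side is a nonnegative integral so that Tonelli's theorem can
  later exchange it with the integration over space.\<close>

lemma increment_square_le:
  fixes F f :: "real \<Rightarrow> complex"
  assumes t: "0 \<le> t" and F: "\<And>\<tau>. 0 \<le> \<tau> \<Longrightarrow> \<tau> \<le> t \<Longrightarrow> (F has_vector_derivative f \<tau>) (at \<tau>)"
    and f: "continuous_on {0..t} f" and H: "\<And>\<tau>. 0 \<le> \<tau> \<Longrightarrow> \<tau> \<le> t \<Longrightarrow> (cmod (f \<tau>))\<^sup>2 \<le> H \<tau>"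
  shows "ennreal ((cmod (F t - F 0))\<^sup>2) \<le> ennreal t * (\<integral>\<^sup>+\<tau>. ennreal (H \<tau>) * indicator {0..t} \<tau> \<partial>lborel)"
proof -
  define g where "g = (\<lambda>\<tau>. indicator {0..t} \<tau> *\<^sub>R f \<tau>)"
  define u where "u = (\<lambda>\<tau>. indicator {0..t} \<tau> *\<^sub>R (1::complex))"
  have gi: "integrable lborel g" unfolding g_def by (rule borel_integrable_compact[OF _ f]) simp
  have gsq: "(cmod (g \<tau>))\<^sup>2 = indicator {0..t} \<tau> *\<^sub>R (cmod (f \<tau>))\<^sup>2" for \<tau> by (simp add: g_def indicator_def)
  have "integrable lborel (\<lambda>\<tau>. indicator {0..t} \<tau> *\<^sub>R (cmod (f \<tau>))\<^sup>2)"
    by (intro borel_integrable_compact continuous_intros f) simp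
  then have gl: "g \<in> l2 lborel" unfolding l2_def using gi gsq by (auto dest: borel_measurable_integrable)
  have usq: "(cmod (u \<tau>))\<^sup>2 = indicator {0..t} \<tau>" for \<tau> by (simp add: u_def indicator_def)
  have ul: "u \<in> l2 lborel" unfolding l2_def mem_Collect_eq usq
    by (auto simp: u_def integrable_indicator_iff emeasure_lborel_Icc_eq)
  have nu: "nrm lborel u = sqrt t" unfolding nrm_def usq using t by simp
  have "F t - F 0 = (\<integral>\<tau>. g \<tau> \<partial>lborel)"
    unfolding g_def using t F f by (intro integral_FTC_atLeastAtMost[symmetric]) (auto intro: has_vector_derivative_at_within)
  then have "cmod (F t - F 0) \<le> (\<integral>\<tau>. cmod (g \<tau>) \<partial>lborel)" by simp
  also have "\<dots> = (\<integral>\<tau>. cmod (g \<tau>) * cmod (u \<tau>) \<partial>lborel)"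
    by (rule Bochner_Integration.integral_cong) (auto simp: g_def u_def indicator_def)
  also have "\<dots> \<le> nrm lborel g * sqrt t" using nrm_Cauchy_Schwarz[OF gl ul] by (simp add: nu)
  finally have "(cmod (F t - F 0))\<^sup>2 \<le> (nrm lborel g * sqrt t)\<^sup>2" by (intro power_mono) auto
  then have "ennreal ((cmod (F t - F 0))\<^sup>2) \<le> ennreal (t * (nrm lborel g)\<^sup>2)"
    using t by (intro ennreal_leI) (simp add: power_mult_distrib mult.commute)
  also have "\<dots> = ennreal t * (\<integral>\<^sup>+\<tau>. ennreal ((cmod (g \<tau>))\<^sup>2) \<partial>lborel)"
    using t by (simp add: nn_integral_nrm[OF gl] ennreal_mult)
  also have "\<dots> \<le> ennreal t * (\<integral>\<^sup>+\<tau>. ennreal (H \<tau>) * indicator {0..t} \<tau> \<partial>lborel)"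
    using H by (intro mult_left_mono nn_integral_mono) (auto simp: gsq indicator_def intro: ennreal_leI)
  finally show ?thesis .
qed

section \<open>First variation of energy and mass\<close>

context flow
begin

lemma \<Psi>_has_derivative:
  "(\<Psi> t has_derivative (\<lambda>h. ((1 - t * a (fst p)) * fst h,
      (1 - t * \<xi> (fst p)) *\<^sub>R snd h - (t * \<xi>' (fst p) * fst h) *\<^sub>R snd p))) (at p)"
proof -
  have 1: "((\<lambda>p::real \<times> 'b. w (fst p)) has_derivative (\<lambda>h. a (fst p) * fst h)) (at p)"
    by (rule has_derivative_compose[OF has_derivative_fst[OF has_derivative_ident] w'[unfolded has_field_derivative_def]])
  have 2: "((\<lambda>p::real \<times> 'b. \<xi> (fst p)) has_derivative (\<lambda>h. \<xi>' (fst p) * fst h)) (at p)"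
    by (rule has_derivative_compose[OF has_derivative_fst[OF has_derivative_ident] \<xi>'[unfolded has_field_derivative_def]])
  show ?thesis unfolding \<Psi>_def \<sigma>_def
    by (auto intro!: derivative_eq_intros 1 2 simp: algebra_simps)
qed

lemma pull_derivative:
  assumes "\<phi> \<in> test_functions \<Omega>"
  shows "pd (h, k) (\<lambda>p. \<phi> (\<Psi> t p)) p = frechet_derivative \<phi> (at (\<Psi> t p))
     ((1 - t * a (fst p)) * h, (1 - t * \<xi> (fst p)) *\<^sub>R k - (t * \<xi>' (fst p) * h) *\<^sub>R snd p)"
proof -
  have "(\<phi> \<circ> \<Psi> t has_derivative frechet_derivative \<phi> (at (\<Psi> t p)) \<circ> (\<lambda>h. ((1 - t * a (fst p)) * fst h,
      (1 - t * \<xi> (fst p)) *\<^sub>R snd h - (t * \<xi>' (fst p) * fst h) *\<^sub>R snd p))) (at p)"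
    by (rule diff_chain_at[OF \<Psi>_has_derivative test_function_has_derivative[OF assms]])
  then have "((\<lambda>p. \<phi> (\<Psi> t p)) has_derivative (\<lambda>v. frechet_derivative \<phi> (at (\<Psi> t p))
     ((1 - t * a (fst p)) * fst v, (1 - t * \<xi> (fst p)) *\<^sub>R snd v - (t * \<xi>' (fst p) * fst v) *\<^sub>R snd p))) (at p)"
    by (simp add: o_def)
  from pd_eqI[OF this, of "(h, k)"] show ?thesis by simp
qed

lemma gy_pull:
  assumes "\<phi> \<in> test_functions \<Omega>"
  shows "gy (\<lambda>p. \<phi> (\<Psi> t p)) p = (1 - t * \<xi> (fst p))\<^sup>2 * gy \<phi> (\<Psi> t p)"
proof -
  have lin: "linear (frechet_derivative \<phi> (at (\<Psi> t p)))"
    using test_function_has_derivative[OF assms] has_derivative_linear by blast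
  have "pd (0, b) (\<lambda>p. \<phi> (\<Psi> t p)) p = (1 - t * \<xi> (fst p)) *\<^sub>R pd (0, b) \<phi> (\<Psi> t p)" for b
    using linear_scale[OF lin, of "1 - t * \<xi> (fst p)" "(0, b)"] by (simp add: pull_derivative[OF assms])
  then show ?thesis by (simp add: gy_def power_mult_distrib sum_distrib_left)
qed

lemma g_outside:
  assumes "\<phi> \<in> test_functions \<Omega>" "p \<notin> \<Omega>"
  shows "gx \<phi> p = 0" "gy \<phi> p = 0"
  using test_function_outside[OF test_function_pd[OF assms(1)] assms(2)] by (simp_all add: gx_def gy_def)

text \<open>As \<open>\<xi>\<close> depends on x, the x-derivative of the pulled-back function picks
  up \<open>t * \<xi>'\<close> times the derivative in the direction y. The second assumption on
  \<open>\<mu>\<close> is the discriminant condition that splits the resulting cross term into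
  \<open>\<xi> / 2\<close> of \<open>gy\<close> and \<open>\<mu>\<close> of
  \<open>gx\<close>.\<close>

lemma gx_pull:
  assumes \<phi>: "\<phi> \<in> test_functions \<Omega>" and t: "0 \<le> t" "t \<le> t0"
    and \<mu>: "\<And>x. 0 \<le> \<mu> x" "\<And>x. 2 * (\<xi>' x)\<^sup>2 * Y\<^sup>2 \<le> \<xi> x * \<mu> x" and \<xi>0: "\<And>x. \<xi> x = 0 \<Longrightarrow> \<xi>' x = 0"
  shows "gx (\<lambda>p. \<phi> (\<Psi> t p)) p \<le> ((1 - t * a (fst p))\<^sup>2 + t * \<mu> (fst p)) * gx \<phi> (\<Psi> t p)
     + (t * (\<xi> (fst p) / 2) + t\<^sup>2 * (\<xi> (fst p) * \<mu> (fst p) / 2)) * gy \<phi> (\<Psi> t p)"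
proof -
  define x where "x = fst p"
  define s1 where "s1 = cmod (pd (1, 0) \<phi> (\<Psi> t p))"
  define s2 where "s2 = sqrt (gy \<phi> (\<Psi> t p))"
  have s: "s1 \<ge> 0" "s2 \<ge> 0" by (auto simp: s1_def s2_def)
  have g: "gx \<phi> (\<Psi> t p) = s1\<^sup>2" "gy \<phi> (\<Psi> t p) = s2\<^sup>2" by (auto simp: s1_def s2_def gx_def)
  define m where "m = \<bar>\<xi>' x\<bar> * Y"
  have m: "m \<ge> 0" "2 * m\<^sup>2 \<le> \<xi> x * \<mu> x" using \<mu>(2)[of x] Y by (auto simp: m_def power_mult_distrib)
  have ta: "0 \<le> 1 - t * a x" "1 - t * a x \<le> 1" using small[OF t, of x] t a[of x] by auto
  have "pd (1, 0) (\<lambda>p. \<phi> (\<Psi> t p)) p = (1 - t * a x) *\<^sub>R pd (1, 0) \<phi> (\<Psi> t p)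
      + frechet_derivative \<phi> (at (\<Psi> t p)) (0, - (t * \<xi>' x) *\<^sub>R snd p)"
    unfolding x_def pull_derivative[OF \<phi>] by (subst derivative_split[OF \<phi>]) simp
  then have "cmod (pd (1, 0) (\<lambda>p. \<phi> (\<Psi> t p)) p) \<le> cmod ((1 - t * a x) *\<^sub>R pd (1, 0) \<phi> (\<Psi> t p))
      + cmod (frechet_derivative \<phi> (at (\<Psi> t p)) (0, - (t * \<xi>' x) *\<^sub>R snd p))"
    using norm_triangle_ineq by metis
  also have "cmod ((1 - t * a x) *\<^sub>R pd (1, 0) \<phi> (\<Psi> t p)) = (1 - t * a x) * s1" using ta by (simp add: s1_def)
  also have "cmod (frechet_derivative \<phi> (at (\<Psi> t p)) (0, - (t * \<xi>' x) *\<^sub>R snd p)) \<le> t * m * s2"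
  proof -
    have le: "cmod (frechet_derivative \<phi> (at (\<Psi> t p)) (0, - (t * \<xi>' x) *\<^sub>R snd p)) \<le> (t * \<bar>\<xi>' x\<bar> * norm (snd p)) * s2"
      using derivative_snd_bound[OF \<phi>, of "\<Psi> t p" "- (t * \<xi>' x) *\<^sub>R snd p"] t by (simp add: s2_def abs_mult)
    show ?thesis
    \<comment> \<open>The bound \<open>Y\<close> on y is known only where \<open>\<xi>\<close> is
      nonzero and the image lies in \<open>\<Omega>\<close>; elsewhere \<open>\<xi>'\<close> or
      \<open>gy\<close> vanishes.\<close>
    proof (cases "\<Psi> t p \<in> \<Omega> \<and> \<xi> x \<noteq> 0")
      case True
      then have "norm (snd p) \<le> Y" using \<Psi>_Y[OF t, of p] by (simp add: x_def)
      then have "(t * \<bar>\<xi>' x\<bar> * norm (snd p)) * s2 \<le> (t * \<bar>\<xi>' x\<bar> * Y) * s2"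
        using t s by (intro mult_right_mono mult_left_mono) auto
      then show ?thesis using le by (simp add: m_def mult_ac)
    next
      case False
      then have "s2 = 0 \<or> \<xi>' x = 0" using g_outside(2)[OF \<phi>, of "\<Psi> t p"] \<xi>0 by (auto simp: s2_def)
      then have "(t * \<bar>\<xi>' x\<bar> * norm (snd p)) * s2 = 0" by auto
      moreover have "t * m * s2 \<ge> 0" using t m s by simp
      ultimately show ?thesis using le by linarith
    qed
  qed
  finally have "gx (\<lambda>p. \<phi> (\<Psi> t p)) p \<le> ((1 - t * a x) * s1 + t * m * s2)\<^sup>2"
    unfolding gx_def by (intro power_mono) auto
  also have "\<dots> = (1 - t * a x)\<^sup>2 * s1\<^sup>2 + (1 - t * a x) * (t * (2 * m * s1 * s2)) + t\<^sup>2 * m\<^sup>2 * s2\<^sup>2"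
    by (simp add: power2_eq_square algebra_simps)
  also have "\<dots> \<le> (1 - t * a x)\<^sup>2 * s1\<^sup>2 + 1 * (t * (\<xi> x / 2 * s2\<^sup>2 + \<mu> x * s1\<^sup>2)) + t\<^sup>2 * (\<xi> x * \<mu> x / 2) * s2\<^sup>2"
  proof (intro add_mono order_refl mult_mono mult_left_mono)
    show "2 * m * s1 * s2 \<le> \<xi> x / 2 * s2\<^sup>2 + \<mu> x * s1\<^sup>2"
    proof (rule power2_le_imp_le)
      have "(2 * m * s1 * s2)\<^sup>2 = (2 * (2 * m\<^sup>2)) * (s1\<^sup>2 * s2\<^sup>2)" by (simp add: power_mult_distrib)
      also have "\<dots> \<le> (2 * (\<xi> x * \<mu> x)) * (s1\<^sup>2 * s2\<^sup>2)" using m by (intro mult_right_mono mult_left_mono) auto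
      also have "\<dots> = 4 * (\<xi> x / 2 * s2\<^sup>2) * (\<mu> x * s1\<^sup>2)" by (simp add: mult_ac)
      also have "4 * u * v \<le> (u + v)\<^sup>2" for u v :: real
        using zero_le_power2[of "u - v"] by (simp add: power2_eq_square algebra_simps)
      finally show "(2 * m * s1 * s2)\<^sup>2 \<le> (\<xi> x / 2 * s2\<^sup>2 + \<mu> x * s1\<^sup>2)\<^sup>2" .
    qed (use \<xi>[of x] \<mu>(1)[of x] in simp)
    show "m\<^sup>2 \<le> \<xi> x * \<mu> x / 2" using m by simp
  qed (use ta t m s \<xi>(1)[of x] \<mu>(1)[of x] in auto)
  finally show ?thesis by (simp add: g x_def algebra_simps)
qed

lemma mass_upper:
  assumes \<phi>: "\<phi> \<in> test_functions \<Omega>" and t: "0 \<le> t" "t \<le> t0"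
  shows "wint (\<lambda>_. 1) (gm (\<lambda>p. \<phi> (\<Psi> t p))) \<le> 2 * wint (\<lambda>_. 1) (gm \<phi>)"
proof -
  have "(\<integral>p. 1 * gm \<phi> (\<Psi> t p) \<partial>lborel) \<le> (\<integral>p. 2 * gm \<phi> p \<partial>lborel)"
  proof (rule transport_le(2)[OF t g_cc(3)[OF \<phi>], of "\<lambda>_. 1" "\<lambda>_. 2"])
    show "1 \<le> J t x * 2" for x using J_expansion(3)[OF t, of x] by simp
  qed auto
  then show ?thesis by (simp add: wint_def gm_def)
qed

lemma mass_pull:
  "\<exists>C\<ge>0. \<exists>t1>0. t1 \<le> t0 \<and> (\<forall>t \<phi>. 0 \<le> t \<longrightarrow> t \<le> t1 \<longrightarrow> \<phi> \<in> test_functions \<Omega> \<longrightarrow>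
     wint (\<lambda>_. 1) (gm \<phi>) + t * wint \<gamma> (gm \<phi>) - C * t\<^sup>2 * wint (\<lambda>_. 1) (gm \<phi>) \<le> wint (\<lambda>_. 1) (gm (\<lambda>p. \<phi> (\<Psi> t p))))"
proof -
  obtain C t1 where C: "C \<ge> 0" "t1 > 0" "t1 \<le> t0"
    "\<And>t x. 0 \<le> t \<Longrightarrow> t \<le> t1 \<Longrightarrow> J t x * (1 + t * \<gamma> (\<sigma> t x) - C * t\<^sup>2) \<le> 1"
    "\<And>t x. 0 \<le> t \<Longrightarrow> t \<le> t1 \<Longrightarrow> 0 \<le> 1 + t * \<gamma> x - C * t\<^sup>2"
    using mass_expansion by blast
  have c\<gamma>: "continuous_on UNIV \<gamma>" unfolding \<gamma>_def by (intro continuous_intros cont)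
  have "wint (\<lambda>_. 1) (gm \<phi>) + t * wint \<gamma> (gm \<phi>) - C * t\<^sup>2 * wint (\<lambda>_. 1) (gm \<phi>) \<le> wint (\<lambda>_. 1) (gm (\<lambda>p. \<phi> (\<Psi> t p)))"
    if t: "0 \<le> t" "t \<le> t1" and \<phi>: "\<phi> \<in> test_functions \<Omega>" for t \<phi>
  proof -
    have tt: "t \<le> t0" using t C by simp
    have gi: "integrable lborel (\<lambda>p. gm \<phi> (\<Psi> t p))"
      using cc_integrable[OF g_cc(3)[OF pull_TF[OF t(1) tt \<phi>]]] by (simp add: gm_def[abs_def])
    have "wint (\<lambda>x. 1 + t * \<gamma> x - C * t\<^sup>2) (gm \<phi>) \<le> (\<integral>p. gm \<phi> (\<Psi> t p) \<partial>lborel)"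
      unfolding wint_def
      by (rule transport_ge[OF t(1) tt g_cc(3)[OF \<phi>] _ gi]) (use C t in \<open>auto intro!: continuous_intros c\<gamma>\<close>)
    moreover have "wint (\<lambda>x. 1 + t * \<gamma> x - C * t\<^sup>2) (gm \<phi>) = wint (\<lambda>_. 1) (gm \<phi>) + t * wint \<gamma> (gm \<phi>) - C * t\<^sup>2 * wint (\<lambda>_. 1) (gm \<phi>)"
      using wint_affine[OF g_cc(3)[OF \<phi>] c\<gamma>, of t "- (C * t\<^sup>2)"] by simp
    ultimately show ?thesis by (simp add: wint_def gm_def)
  qed
  then show ?thesis using C by blast
qed

text \<open>
  The share \<open>\<xi> / 2\<close> of the coefficient \<open>2 * \<xi>\<close> of \<open>gy \<phi>\<close> and the share \<open>\<mu>\<close> of the coefficient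
  \<open>2 * a\<close> of \<open>gx \<phi>\<close> absorb the mixed derivatives that arise because \<open>\<xi>\<close> depends on \<open>x\<close>.
\<close>

lemma energy_pull:
  assumes \<mu>: "\<And>x. 0 \<le> \<mu> x" "\<And>x. \<mu> x \<le> Mm" "\<And>x. 2 * (\<xi>' x)\<^sup>2 * Y\<^sup>2 \<le> \<xi> x * \<mu> x"
    and lip: "\<And>x x'. \<bar>\<mu> x - \<mu> x'\<bar> \<le> Lm * \<bar>x - x'\<bar>" and \<xi>0: "\<And>x. \<xi> x = 0 \<Longrightarrow> \<xi>' x = 0"
  shows "\<exists>C\<ge>0. \<exists>t1>0. t1 \<le> t0 \<and> (\<forall>t \<phi>. 0 \<le> t \<longrightarrow> t \<le> t1 \<longrightarrow> \<phi> \<in> test_functions \<Omega> \<longrightarrow>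
     dir (\<lambda>p. \<phi> (\<Psi> t p)) (\<lambda>p. \<phi> (\<Psi> t p)) \<le> dir \<phi> \<phi> - t * (wint (\<lambda>x. 2 * a x - \<mu> x - \<gamma> x) (gx \<phi>) + wint (\<lambda>x. 3 / 2 * \<xi> x - \<gamma> x) (gy \<phi>))
       + C * t\<^sup>2 * dir \<phi> \<phi>)"
proof -
  have Mm: "Mm \<ge> 0" using \<mu>(1)[of 0] \<mu>(2)[of 0] by linarith
  have Lm: "Lm \<ge> 0" using lip[of 0 1] by (auto intro: order_trans[OF abs_ge_zero])
  have c\<mu>: "continuous_on UNIV \<mu>"
    by (rule lipschitz_on_continuous_on[of Lm]) (use lip Lm in \<open>auto intro!: lipschitz_onI simp: dist_real_def\<close>)
  have c\<gamma>: "continuous_on UNIV \<gamma>" unfolding \<gamma>_def by (intro continuous_intros cont)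
  \<comment> \<open>Bounds the coefficients of \<open>t\<^sup>2\<close> left over in the pointwise
    estimates of both gradient parts.\<close>
  define c where "c = A\<^sup>2 + X\<^sup>2 + X * Mm"
  have c0: "c \<ge> 0" using AXLW Mm by (simp add: c_def)
  define B where "B = 2 * A + Mm + 2 * X"
  have B0: "B \<ge> 0" using AXLW Mm by (simp add: B_def)
  \<comment> \<open>\<open>k1\<close> and \<open>k2\<close> are the first-order rates at which the
    coefficients of \<open>gx\<close> and \<open>gy\<close> decrease before the Jacobian is taken
    into account. In \<open>k2\<close>, 3 / 2 is 2 minus the 1 / 2 spent on the cross term.\<close>
  define k1 where "k1 = (\<lambda>x. 2 * a x - \<mu> x)"
  define k2 where "k2 = (\<lambda>x. 3 / 2 * \<xi> x)"
  have k1b: "\<bar>k1 x\<bar> \<le> B" for x using a[of x] \<mu>(1,2)[of x] AXLW by (auto simp: k1_def B_def abs_le_iff)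
  have k2b: "\<bar>k2 x\<bar> \<le> B" for x using \<xi>[of x] Mm AXLW by (auto simp: k2_def B_def abs_le_iff)
  have k1l: "\<bar>k1 x - k1 x'\<bar> \<le> (2 * L + Lm) * \<bar>x - x'\<bar>" for x x'
    using lip_a[of x x'] lip[of x x'] unfolding k1_def distrib_right mult.assoc by linarith
  have k2l: "\<bar>k2 x - k2 x'\<bar> \<le> (2 * L) * \<bar>x - x'\<bar>" for x x'
    using lip_\<xi>[of x x'] unfolding k2_def mult.assoc by linarith
  obtain C1 t1 where C1: "C1 \<ge> 0" "t1 > 0" "t1 \<le> t0"
    "\<And>t x. 0 \<le> t \<Longrightarrow> t \<le> t1 \<Longrightarrow> 1 - t * k1 x + c * t\<^sup>2 \<le> J t x * (1 - t * (k1 (\<sigma> t x) - \<gamma> (\<sigma> t x)) + C1 * t\<^sup>2)"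
    "\<And>t x. 0 \<le> t \<Longrightarrow> t \<le> t1 \<Longrightarrow> 0 \<le> 1 - t * (k1 x - \<gamma> x) + C1 * t\<^sup>2"
    using weight_expansion[where c = c, OF k1b k1l] by blast
  obtain C2 t2 where C2: "C2 \<ge> 0" "t2 > 0" "t2 \<le> t0"
    "\<And>t x. 0 \<le> t \<Longrightarrow> t \<le> t2 \<Longrightarrow> 1 - t * k2 x + c * t\<^sup>2 \<le> J t x * (1 - t * (k2 (\<sigma> t x) - \<gamma> (\<sigma> t x)) + C2 * t\<^sup>2)"
    "\<And>t x. 0 \<le> t \<Longrightarrow> t \<le> t2 \<Longrightarrow> 0 \<le> 1 - t * (k2 x - \<gamma> x) + C2 * t\<^sup>2"
    using weight_expansion[where c = c, OF k2b k2l] by blast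
  define T where "T = min (min t1 t2) (1 / (B + 1))"
  define C where "C = C1 + C2"
  have main: "dir (\<lambda>p. \<phi> (\<Psi> t p)) (\<lambda>p. \<phi> (\<Psi> t p)) \<le> dir \<phi> \<phi> - t * (wint (\<lambda>x. k1 x - \<gamma> x) (gx \<phi>) + wint (\<lambda>x. k2 x - \<gamma> x) (gy \<phi>))
       + C * t\<^sup>2 * dir \<phi> \<phi>"
    if t: "0 \<le> t" "t \<le> T" and \<phi>: "\<phi> \<in> test_functions \<Omega>" for t \<phi>
  proof -
    have tt: "t \<le> t0" "t \<le> t1" "t \<le> t2" using t C1 C2 by (auto simp: T_def)
    have tB: "t * B \<le> 1"
    proof -
      have "t * B \<le> (1 / (B + 1)) * B" using t B0 by (intro mult_right_mono) (auto simp: T_def)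
      also have "\<dots> \<le> 1" using B0 by (simp add: divide_le_eq)
      finally show ?thesis .
    qed
    let ?\<phi>t = "\<lambda>p. \<phi> (\<Psi> t p)"
    have \<phi>t: "?\<phi>t \<in> test_functions \<Omega>" by (rule pull_TF[OF t(1) tt(1) \<phi>])
    define K1 where "K1 = (\<lambda>x. 1 - t * k1 x + c * t\<^sup>2)"
    define K2 where "K2 = (\<lambda>x. 1 - t * k2 x + c * t\<^sup>2)"
    have pos: "0 \<le> 1 - t * k + c * t\<^sup>2" if "\<bar>k\<bar> \<le> B" for k
    proof -
      have "t * k \<le> t * B" using that t by (intro mult_left_mono) auto
      moreover have "c * t\<^sup>2 \<ge> 0" using c0 by simp
      ultimately show ?thesis using tB by linarith
    qed
    have ck1: "continuous_on UNIV k1" and ck2: "continuous_on UNIV k2"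
      unfolding k1_def k2_def by (intro continuous_intros cont c\<mu>)+
    have cK1: "continuous_on UNIV K1" and cK2: "continuous_on UNIV K2"
      unfolding K1_def K2_def by (intro continuous_intros ck1 ck2)+
    have pt: "gx ?\<phi>t p + gy ?\<phi>t p \<le> K1 (fst p) * gx \<phi> (\<Psi> t p) + K2 (fst p) * gy \<phi> (\<Psi> t p)" for p
    proof -
      let ?x = "fst p"
      have e1: "(1 - t * a ?x)\<^sup>2 + t * \<mu> ?x \<le> K1 ?x"
      proof -
        have "(1 - t * a ?x)\<^sup>2 + t * \<mu> ?x = 1 - t * k1 ?x + t\<^sup>2 * (a ?x)\<^sup>2"
          by (simp add: k1_def power2_eq_square algebra_simps)
        also have "t\<^sup>2 * (a ?x)\<^sup>2 \<le> t\<^sup>2 * c"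
        proof (intro mult_left_mono)
          have "(a ?x)\<^sup>2 \<le> A\<^sup>2" using a[of ?x] by (intro power_mono) auto
          then show "(a ?x)\<^sup>2 \<le> c" using AXLW Mm by (simp add: c_def add_increasing2)
        qed simp
        finally show ?thesis by (simp add: K1_def mult.commute)
      qed
      have e2: "(t * (\<xi> ?x / 2) + t\<^sup>2 * (\<xi> ?x * \<mu> ?x / 2)) + (1 - t * \<xi> ?x)\<^sup>2 \<le> K2 ?x"
      proof -
        have "(t * (\<xi> ?x / 2) + t\<^sup>2 * (\<xi> ?x * \<mu> ?x / 2)) + (1 - t * \<xi> ?x)\<^sup>2 = 1 - t * k2 ?x + t\<^sup>2 * ((\<xi> ?x)\<^sup>2 + \<xi> ?x * \<mu> ?x / 2)"
          by (simp add: k2_def power2_eq_square algebra_simps)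
        also have "t\<^sup>2 * ((\<xi> ?x)\<^sup>2 + \<xi> ?x * \<mu> ?x / 2) \<le> t\<^sup>2 * c"
        proof (intro mult_left_mono)
          have "(\<xi> ?x)\<^sup>2 \<le> X\<^sup>2" using \<xi>[of ?x] by (intro power_mono) auto
          moreover have "\<xi> ?x * \<mu> ?x \<le> X * Mm" using \<xi>[of ?x] \<mu>(1,2)[of ?x] AXLW by (intro mult_mono) auto
          moreover have "0 \<le> \<xi> ?x * \<mu> ?x" using \<xi>[of ?x] \<mu>(1)[of ?x] by simp
          ultimately show "(\<xi> ?x)\<^sup>2 + \<xi> ?x * \<mu> ?x / 2 \<le> c" using zero_le_power2[of A] unfolding c_def by linarith
        qed simp
        finally show ?thesis by (simp add: K2_def mult.commute)
      qed
      have "gx ?\<phi>t p + gy ?\<phi>t p \<le> ((1 - t * a ?x)\<^sup>2 + t * \<mu> ?x) * gx \<phi> (\<Psi> t p)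
         + ((t * (\<xi> ?x / 2) + t\<^sup>2 * (\<xi> ?x * \<mu> ?x / 2)) + (1 - t * \<xi> ?x)\<^sup>2) * gy \<phi> (\<Psi> t p)"
        using gx_pull[OF \<phi> t(1) tt(1) \<mu>(1,3) \<xi>0, of p] gy_pull[OF \<phi>, of t p] by (simp add: distrib_right)
      also have "\<dots> \<le> K1 ?x * gx \<phi> (\<Psi> t p) + K2 ?x * gy \<phi> (\<Psi> t p)"
        by (intro add_mono mult_right_mono e1 e2) auto
      finally show ?thesis .
    qed
    have i1: "integrable lborel (\<lambda>p. K1 (fst p) * gx \<phi> (\<Psi> t p))"
      and l1: "(\<integral>p. K1 (fst p) * gx \<phi> (\<Psi> t p) \<partial>lborel) \<le> (\<integral>p. (1 - t * (k1 (fst p) - \<gamma> (fst p)) + C1 * t\<^sup>2) * gx \<phi> p \<partial>lborel)"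
    proof -
      have A1: "\<And>x. 0 \<le> K1 x" unfolding K1_def by (rule pos[OF k1b])
      have A2: "continuous_on UNIV (\<lambda>x. 1 - t * (k1 x - \<gamma> x) + C1 * t\<^sup>2)" by (intro continuous_intros ck1 c\<gamma>)
      have A3: "\<And>x. 0 \<le> 1 - t * (k1 x - \<gamma> x) + C1 * t\<^sup>2" by (rule C1(5)[OF t(1) tt(2)])
      have A4: "\<And>x. K1 x \<le> J t x * (1 - t * (k1 (\<sigma> t x) - \<gamma> (\<sigma> t x)) + C1 * t\<^sup>2)" unfolding K1_def by (rule C1(4)[OF t(1) tt(2)])
      show "integrable lborel (\<lambda>p. K1 (fst p) * gx \<phi> (\<Psi> t p))"
        by (rule transport_le(1)[OF t(1) tt(1) g_cc(1)[OF \<phi>] g_nonneg(1) cK1 A1 A2 A3 A4])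
      show "(\<integral>p. K1 (fst p) * gx \<phi> (\<Psi> t p) \<partial>lborel) \<le> (\<integral>p. (1 - t * (k1 (fst p) - \<gamma> (fst p)) + C1 * t\<^sup>2) * gx \<phi> p \<partial>lborel)"
        by (rule transport_le(2)[OF t(1) tt(1) g_cc(1)[OF \<phi>] g_nonneg(1) cK1 A1 A2 A3 A4])
    qed
    have i2: "integrable lborel (\<lambda>p. K2 (fst p) * gy \<phi> (\<Psi> t p))"
      and l2: "(\<integral>p. K2 (fst p) * gy \<phi> (\<Psi> t p) \<partial>lborel) \<le> (\<integral>p. (1 - t * (k2 (fst p) - \<gamma> (fst p)) + C2 * t\<^sup>2) * gy \<phi> p \<partial>lborel)"
    proof -
      have A1: "\<And>x. 0 \<le> K2 x" unfolding K2_def by (rule pos[OF k2b])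
      have A2: "continuous_on UNIV (\<lambda>x. 1 - t * (k2 x - \<gamma> x) + C2 * t\<^sup>2)" by (intro continuous_intros ck2 c\<gamma>)
      have A3: "\<And>x. 0 \<le> 1 - t * (k2 x - \<gamma> x) + C2 * t\<^sup>2" by (rule C2(5)[OF t(1) tt(3)])
      have A4: "\<And>x. K2 x \<le> J t x * (1 - t * (k2 (\<sigma> t x) - \<gamma> (\<sigma> t x)) + C2 * t\<^sup>2)" unfolding K2_def by (rule C2(4)[OF t(1) tt(3)])
      show "integrable lborel (\<lambda>p. K2 (fst p) * gy \<phi> (\<Psi> t p))"
        by (rule transport_le(1)[OF t(1) tt(1) g_cc(2)[OF \<phi>] g_nonneg(2) cK2 A1 A2 A3 A4])
      show "(\<integral>p. K2 (fst p) * gy \<phi> (\<Psi> t p) \<partial>lborel) \<le> (\<integral>p. (1 - t * (k2 (fst p) - \<gamma> (fst p)) + C2 * t\<^sup>2) * gy \<phi> p \<partial>lborel)"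
        by (rule transport_le(2)[OF t(1) tt(1) g_cc(2)[OF \<phi>] g_nonneg(2) cK2 A1 A2 A3 A4])
    qed
    have "dir ?\<phi>t ?\<phi>t = (\<integral>p. gx ?\<phi>t p + gy ?\<phi>t p \<partial>lborel)"
      using g_cc[OF \<phi>t] by (simp add: dir_eq[OF \<phi>t] wint_def cc_integrable)
    also have "\<dots> \<le> (\<integral>p. K1 (fst p) * gx \<phi> (\<Psi> t p) + K2 (fst p) * gy \<phi> (\<Psi> t p) \<partial>lborel)"
      using g_cc[OF \<phi>t] i1 i2 pt by (intro integral_mono) (auto intro: cc_integrable)
    also have "\<dots> \<le> wint (\<lambda>x. 1 - t * (k1 x - \<gamma> x) + C1 * t\<^sup>2) (gx \<phi>) + wint (\<lambda>x. 1 - t * (k2 x - \<gamma> x) + C2 * t\<^sup>2) (gy \<phi>)"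
      using i1 i2 l1 l2 by (simp add: wint_def)
    also have "wint (\<lambda>x. 1 - t * (k1 x - \<gamma> x) + C1 * t\<^sup>2) (gx \<phi>) = wint (\<lambda>_. 1) (gx \<phi>) - t * wint (\<lambda>x. k1 x - \<gamma> x) (gx \<phi>) + C1 * t\<^sup>2 * wint (\<lambda>_. 1) (gx \<phi>)"
      using wint_affine[OF g_cc(1)[OF \<phi>], of "\<lambda>x. k1 x - \<gamma> x" "- t" "C1 * t\<^sup>2"] ck1 c\<gamma> by (simp add: continuous_on_diff)
    also have "wint (\<lambda>x. 1 - t * (k2 x - \<gamma> x) + C2 * t\<^sup>2) (gy \<phi>) = wint (\<lambda>_. 1) (gy \<phi>) - t * wint (\<lambda>x. k2 x - \<gamma> x) (gy \<phi>) + C2 * t\<^sup>2 * wint (\<lambda>_. 1) (gy \<phi>)"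
      using wint_affine[OF g_cc(2)[OF \<phi>], of "\<lambda>x. k2 x - \<gamma> x" "- t" "C2 * t\<^sup>2"] ck2 c\<gamma> by (simp add: continuous_on_diff)
    also have "C1 * t\<^sup>2 * wint (\<lambda>_. 1) (gx \<phi>) \<le> C * t\<^sup>2 * wint (\<lambda>_. 1) (gx \<phi>)"
      using C2(1) by (intro mult_right_mono wint_nonneg) (auto simp: C_def)
    also have "C2 * t\<^sup>2 * wint (\<lambda>_. 1) (gy \<phi>) \<le> C * t\<^sup>2 * wint (\<lambda>_. 1) (gy \<phi>)"
      using C1(1) by (intro mult_right_mono wint_nonneg) (auto simp: C_def)
    finally show ?thesis by (simp add: dir_eq[OF \<phi>] algebra_simps)
  qed
  have T: "T > 0" "T \<le> t0" using C1 C2 B0 by (auto simp: T_def)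
  have C: "C \<ge> 0" using C1 C2 by (simp add: C_def)
  show ?thesis using main T C unfolding k1_def k2_def by blast
qed

end

section \<open>The L2 size of an increment along the flow\<close>

context flow
begin

lemma displacement_bound:
  assumes \<phi>: "\<phi> \<in> test_functions \<Omega>" and \<tau>: "0 \<le> \<tau>" "\<tau> \<le> t0"
  shows "(cmod (frechet_derivative \<phi> (at (\<Psi> \<tau> p)) (- w (fst p), - \<xi> (fst p) *\<^sub>R snd p)))\<^sup>2
     \<le> 2 * W\<^sup>2 * gx \<phi> (\<Psi> \<tau> p) + 2 * X * Y\<^sup>2 * \<xi> (fst p) * gy \<phi> (\<Psi> \<tau> p)"
proof -
  let ?x = "fst p" and ?q = "\<Psi> \<tau> p"
  define s1 where "s1 = cmod (pd (1, 0) \<phi> ?q)"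
  define s2 where "s2 = sqrt (gy \<phi> ?q)"
  have s: "s1 \<ge> 0" "s2 \<ge> 0" by (auto simp: s1_def s2_def)
  have g: "gx \<phi> ?q = s1\<^sup>2" "gy \<phi> ?q = s2\<^sup>2" by (auto simp: s1_def s2_def gx_def)
  have "cmod (frechet_derivative \<phi> (at ?q) (- w ?x, - \<xi> ?x *\<^sub>R snd p))
      \<le> cmod (- w ?x *\<^sub>R pd (1, 0) \<phi> ?q) + cmod (frechet_derivative \<phi> (at ?q) (0, - \<xi> ?x *\<^sub>R snd p))"
    by (subst derivative_split[OF \<phi>]) (rule norm_triangle_ineq)
  also have "cmod (- w ?x *\<^sub>R pd (1, 0) \<phi> ?q) \<le> W * s1" using w[of ?x] s by (simp add: s1_def mult_right_mono)
  also have "cmod (frechet_derivative \<phi> (at ?q) (0, - \<xi> ?x *\<^sub>R snd p)) \<le> \<xi> ?x * Y * s2"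
  proof -
    have le: "cmod (frechet_derivative \<phi> (at ?q) (0, - \<xi> ?x *\<^sub>R snd p)) \<le> \<xi> ?x * norm (snd p) * s2"
      using derivative_snd_bound[OF \<phi>, of ?q "- \<xi> ?x *\<^sub>R snd p"] \<xi>[of ?x] by (simp add: s2_def)
    show ?thesis
    proof (cases "?q \<in> \<Omega> \<and> \<xi> ?x \<noteq> 0")
      case True
      then have "norm (snd p) \<le> Y" using \<Psi>_Y[OF \<tau>, of p] by simp
      then have "\<xi> ?x * norm (snd p) * s2 \<le> \<xi> ?x * Y * s2"
        using \<xi>[of ?x] s by (intro mult_right_mono mult_left_mono) auto
      then show ?thesis using le by linarith
    next
      case False
      then have "s2 = 0 \<or> \<xi> ?x = 0" using g_outside(2)[OF \<phi>, of ?q] by (auto simp: s2_def)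
      then have "\<xi> ?x * norm (snd p) * s2 = 0" by auto
      moreover have "\<xi> ?x * Y * s2 \<ge> 0" using \<xi>[of ?x] Y s by simp
      ultimately show ?thesis using le by linarith
    qed
  qed
  finally have "(cmod (frechet_derivative \<phi> (at ?q) (- w ?x, - \<xi> ?x *\<^sub>R snd p)))\<^sup>2 \<le> (W * s1 + \<xi> ?x * Y * s2)\<^sup>2"
    by (intro power_mono) auto
  also have "\<dots> \<le> 2 * (W * s1)\<^sup>2 + 2 * (\<xi> ?x * Y * s2)\<^sup>2"
    using zero_le_power2[of "W * s1 - \<xi> ?x * Y * s2"] unfolding power2_sum power2_diff by linarith
  also have "2 * (\<xi> ?x * Y * s2)\<^sup>2 \<le> 2 * X * Y\<^sup>2 * \<xi> ?x * s2\<^sup>2"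
  proof -
    have "(\<xi> ?x * \<xi> ?x) * (2 * Y\<^sup>2 * s2\<^sup>2) \<le> (X * \<xi> ?x) * (2 * Y\<^sup>2 * s2\<^sup>2)"
      using \<xi>[of ?x] by (intro mult_right_mono) auto
    then show ?thesis by (simp add: power2_eq_square mult_ac)
  qed
  finally show ?thesis by (simp add: g power_mult_distrib mult_ac)
qed

text \<open>The increment is integrated along the orbit, and each time slice is transported
  separately; \<open>om\<close> varies by at most the factor \<open>Cw\<close> over the
  displacement. The weight \<open>\<xi>\<close> in front of \<open>gy\<close> has to survive,
  because this is the only part of the y-gradient controlled later. Moving it to the image point
  costs \<open>t * L * W\<close> times the full \<open>gy\<close>, an error that disappears as
  \<open>t\<close> tends to 0.\<close>

lemma pull_difference:
  assumes om: "continuous_on UNIV om" "\<And>x. om x \<ge> 0" "\<And>x x'. \<bar>x - x'\<bar> \<le> W \<Longrightarrow> om x \<le> Cw * om x'" and Cw: "Cw \<ge> 0"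
    and t: "0 \<le> t" "t \<le> t0" and \<phi>: "\<phi> \<in> test_functions \<Omega>"
  shows "wint om (gm (\<lambda>p. \<phi> (\<Psi> t p) - \<phi> p)) \<le> t\<^sup>2 * (4 * Cw * (W\<^sup>2 * wint om (gx \<phi>)
     + X * Y\<^sup>2 * (wint (\<lambda>x. om x * \<xi> x) (gy \<phi>) + t * L * W * wint om (gy \<phi>))))"
proof -
  define H where "H \<tau> p = 2 * W\<^sup>2 * gx \<phi> (\<Psi> \<tau> p) + 2 * X * Y\<^sup>2 * \<xi> (fst p) * gy \<phi> (\<Psi> \<tau> p)" for \<tau> p
  define B where "B = 4 * Cw * (W\<^sup>2 * wint om (gx \<phi>) + X * Y\<^sup>2 * (wint (\<lambda>x. om x * \<xi> x) (gy \<phi>) + t * L * W * wint om (gy \<phi>)))"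
  have wn: "wint om (gx \<phi>) \<ge> 0" "wint om (gy \<phi>) \<ge> 0" "wint (\<lambda>x. om x * \<xi> x) (gy \<phi>) \<ge> 0"
    using om \<xi> by (auto intro!: wint_nonneg)
  have B0: "B \<ge> 0" unfolding B_def using Cw AXLW t wn
    by (intro mult_nonneg_nonneg add_nonneg_nonneg) auto
  have gc: "continuous_on UNIV (gx \<phi>)" "continuous_on UNIV (gy \<phi>)"
    using g_cc[OF \<phi>] by (auto intro: cc_continuous)
  have H0: "H \<tau> p \<ge> 0" for \<tau> p using AXLW \<xi>[of "fst p"] by (auto simp: H_def)
  have jc: "continuous_on UNIV (\<lambda>z::(real \<times> 'b) \<times> real. \<Psi> (snd z) (fst z))"
    unfolding \<Psi>_def \<sigma>_def
    by (intro continuous_intros continuous_on_compose2[OF cont(1)] continuous_on_compose2[OF cont(3)]) auto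
  have Hc: "continuous_on UNIV (\<lambda>z. H (snd z) (fst z))" unfolding H_def
    by (intro continuous_intros continuous_on_compose2[OF gc(1) jc] continuous_on_compose2[OF gc(2) jc]
        continuous_on_compose2[OF cont(3)]) auto
  have omc: "continuous_on UNIV (\<lambda>p::real \<times> 'b. om (fst p))" by (rule continuous_on_fst_comp[OF om(1)])
  have pt: "ennreal (gm (\<lambda>p. \<phi> (\<Psi> t p) - \<phi> p) p) \<le> ennreal t * (\<integral>\<^sup>+\<tau>. ennreal (H \<tau> p) * indicator {0..t} \<tau> \<partial>lborel)" for p
  proof -
    let ?v = "(- w (fst p), - \<xi> (fst p) *\<^sub>R snd p)"
    have "ennreal ((cmod (\<phi> (\<Psi> t p) - \<phi> (\<Psi> 0 p)))\<^sup>2) \<le> ennreal t * (\<integral>\<^sup>+\<tau>. ennreal (H \<tau> p) * indicator {0..t} \<tau> \<partial>lborel)"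
    proof (rule increment_square_le[where f = "\<lambda>\<tau>. frechet_derivative \<phi> (at (\<Psi> \<tau> p)) ?v", OF t(1)])
      fix \<tau> assume \<tau>: "0 \<le> \<tau>" "\<tau> \<le> t"
      have dp: "((\<lambda>\<tau>. \<Psi> \<tau> p) has_derivative (\<lambda>h. h *\<^sub>R ?v)) (at \<tau>)"
        unfolding \<Psi>_def \<sigma>_def by (auto intro!: derivative_eq_intros simp: algebra_simps)
      have "(\<phi> \<circ> (\<lambda>\<tau>. \<Psi> \<tau> p) has_derivative frechet_derivative \<phi> (at (\<Psi> \<tau> p)) \<circ> (\<lambda>h. h *\<^sub>R ?v)) (at \<tau>)"
        by (rule diff_chain_at[OF dp test_function_has_derivative[OF \<phi>]])
      moreover have "frechet_derivative \<phi> (at (\<Psi> \<tau> p)) \<circ> (\<lambda>h. h *\<^sub>R ?v) = (\<lambda>h. h *\<^sub>R frechet_derivative \<phi> (at (\<Psi> \<tau> p)) ?v)"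
      proof
        fix h
        have "linear (frechet_derivative \<phi> (at (\<Psi> \<tau> p)))"
          using test_function_has_derivative[OF \<phi>] has_derivative_linear by blast
        then show "(frechet_derivative \<phi> (at (\<Psi> \<tau> p)) \<circ> (\<lambda>h. h *\<^sub>R ?v)) h = h *\<^sub>R frechet_derivative \<phi> (at (\<Psi> \<tau> p)) ?v"
          unfolding o_def by (rule linear_scale)
      qed
      ultimately show "((\<lambda>\<tau>. \<phi> (\<Psi> \<tau> p)) has_vector_derivative frechet_derivative \<phi> (at (\<Psi> \<tau> p)) ?v) (at \<tau>)"
        unfolding has_vector_derivative_def by (simp only: o_def)
      show "(cmod (frechet_derivative \<phi> (at (\<Psi> \<tau> p)) ?v))\<^sup>2 \<le> H \<tau> p"
        unfolding H_def by (rule displacement_bound[OF \<phi> \<tau>(1)]) (use \<tau> t in simp)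
    next
      have "continuous_on UNIV (\<lambda>\<tau>. \<Psi> \<tau> p)" unfolding \<Psi>_def \<sigma>_def by (intro continuous_intros)
      then have "continuous_on UNIV (\<lambda>\<tau>. pd ?v \<phi> (\<Psi> \<tau> p))"
        using continuous_on_compose2[OF cc_continuous[OF test_function_cc[OF test_function_pd[OF \<phi>]]], of UNIV "\<lambda>\<tau>. \<Psi> \<tau> p" ?v] by blast
      then show "continuous_on {0..t} (\<lambda>\<tau>. frechet_derivative \<phi> (at (\<Psi> \<tau> p)) ?v)"
        by (rule continuous_on_subset) simp
    qed
    then show ?thesis by (simp add: gm_def \<Psi>_def[of 0] \<sigma>_def)
  qed
  have inner: "(\<integral>\<^sup>+p. ennreal (om (fst p)) * ennreal (H \<tau> p) \<partial>lborel) \<le> ennreal B" if \<tau>: "0 \<le> \<tau>" "\<tau> \<le> t" for \<tau>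
  proof -
    have \<tau>0: "\<tau> \<le> t0" using \<tau> t by simp
    have shift: "om x \<le> Cw * om (\<sigma> \<tau> x)" for x
    proof (rule om(3))
      have "\<bar>\<sigma> \<tau> x - x\<bar> \<le> \<tau> * W" by (rule \<sigma>_dist[OF \<tau>(1)])
      also have "\<dots> \<le> 1 * W" using \<tau>0 t0 AXLW by (intro mult_right_mono) auto
      finally show "\<bar>x - \<sigma> \<tau> x\<bar> \<le> W" by (simp add: abs_minus_commute)
    qed
    have half: "z \<le> J \<tau> x * (2 * z)" if "z \<ge> 0" for x z
      using mult_right_mono[OF J_expansion(3)[OF \<tau>(1) \<tau>0, of x], of "2 * z"] that by simp
    define K1 where "K1 x = 2 * W\<^sup>2 * om x" for x
    define k1 where "k1 x = 4 * W\<^sup>2 * Cw * om x" for x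
    define K2 where "K2 x = 2 * X * Y\<^sup>2 * (om x * \<xi> x)" for x
    define k2 where "k2 x = 4 * X * Y\<^sup>2 * Cw * (om x * \<xi> x + t * L * W * om x)" for x
    have c: "continuous_on UNIV K1" "continuous_on UNIV k1" "continuous_on UNIV K2" "continuous_on UNIV k2"
      unfolding K1_def k1_def K2_def k2_def by (intro continuous_intros om(1) cont(3))+
    have pos: "0 \<le> K1 x" "0 \<le> k1 x" "0 \<le> K2 x" "0 \<le> k2 x" for x
      using om(2)[of x] Cw AXLW \<xi>[of x] t
      by (auto simp: K1_def k1_def K2_def k2_def intro!: mult_nonneg_nonneg add_nonneg_nonneg)
    have le1: "K1 x \<le> J \<tau> x * k1 (\<sigma> \<tau> x)" for x
    proof -
      have "K1 x \<le> 2 * W\<^sup>2 * (Cw * om (\<sigma> \<tau> x))" unfolding K1_def using shift[of x] by (intro mult_left_mono) auto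
      also have "\<dots> \<le> J \<tau> x * (2 * (2 * W\<^sup>2 * (Cw * om (\<sigma> \<tau> x))))" using Cw om by (intro half) auto
      finally show ?thesis by (simp add: k1_def mult_ac)
    qed
    have le2: "K2 x \<le> J \<tau> x * k2 (\<sigma> \<tau> x)" for x
    proof -
      have "\<xi> x \<le> \<xi> (\<sigma> \<tau> x) + L * \<bar>\<sigma> \<tau> x - x\<bar>" using lip_\<xi>[of "\<sigma> \<tau> x" x] by linarith
      also have "L * \<bar>\<sigma> \<tau> x - x\<bar> \<le> L * (t * W)"
        using \<sigma>_dist[OF \<tau>(1), of x] mult_right_mono[OF \<tau>(2), of W] AXLW by (intro mult_left_mono) auto
      finally have "\<xi> x \<le> \<xi> (\<sigma> \<tau> x) + t * L * W" by (simp add: mult_ac)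
      then have "om x * \<xi> x \<le> (Cw * om (\<sigma> \<tau> x)) * (\<xi> (\<sigma> \<tau> x) + t * L * W)"
        using shift[of x] \<xi>[of x] om Cw by (intro mult_mono) auto
      then have "K2 x \<le> 2 * X * Y\<^sup>2 * ((Cw * om (\<sigma> \<tau> x)) * (\<xi> (\<sigma> \<tau> x) + t * L * W))"
        unfolding K2_def using AXLW by (intro mult_left_mono) auto
      also have "\<dots> \<le> J \<tau> x * (2 * (2 * X * Y\<^sup>2 * ((Cw * om (\<sigma> \<tau> x)) * (\<xi> (\<sigma> \<tau> x) + t * L * W))))"
        using Cw om AXLW \<xi> t by (intro half mult_nonneg_nonneg add_nonneg_nonneg) auto
      finally show ?thesis by (simp add: k2_def algebra_simps)
    qed
    note T1 = transport_le[OF \<tau>(1) \<tau>0 g_cc(1)[OF \<phi>] g_nonneg(1) c(1) pos(1) c(2) pos(2) le1]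
    note T2 = transport_le[OF \<tau>(1) \<tau>0 g_cc(2)[OF \<phi>] g_nonneg(2) c(3) pos(3) c(4) pos(4) le2]
    have "(\<integral>\<^sup>+p. ennreal (om (fst p)) * ennreal (H \<tau> p) \<partial>lborel)
        = (\<integral>\<^sup>+p. ennreal (K1 (fst p) * gx \<phi> (\<Psi> \<tau> p) + K2 (fst p) * gy \<phi> (\<Psi> \<tau> p)) \<partial>lborel)"
      using om H0 by (intro nn_integral_cong) (simp add: H_def K1_def K2_def algebra_simps flip: ennreal_mult)
    also have "\<dots> = ennreal (\<integral>p. K1 (fst p) * gx \<phi> (\<Psi> \<tau> p) + K2 (fst p) * gy \<phi> (\<Psi> \<tau> p) \<partial>lborel)"
      using T1(1) T2(1) pos by (intro nn_integral_eq_integral) auto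
    also have "\<dots> = ennreal ((\<integral>p. K1 (fst p) * gx \<phi> (\<Psi> \<tau> p) \<partial>lborel) + (\<integral>p. K2 (fst p) * gy \<phi> (\<Psi> \<tau> p) \<partial>lborel))"
      using T1(1) T2(1) by simp
    also have "\<dots> \<le> ennreal (wint k1 (gx \<phi>) + wint k2 (gy \<phi>))"
      using T1(2) T2(2) unfolding wint_def by (intro ennreal_leI add_mono)
    also have "wint k1 (gx \<phi>) + wint k2 (gy \<phi>) = B"
    proof -
      have e: "wint k2 (gy \<phi>) = 4 * X * Y\<^sup>2 * Cw * (wint (\<lambda>x. om x * \<xi> x) (gy \<phi>) + t * L * W * wint om (gy \<phi>))"
        unfolding k2_def wint_cmult using g_cc(2)[OF \<phi>] om(1) cont(3)
        by (simp add: wint_add wint_cmult[of "t * L * W"] continuous_intros)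
      show ?thesis unfolding e k1_def wint_cmult B_def by (simp add: algebra_simps)
    qed
    finally show ?thesis .
  qed
  have Hm: "(\<lambda>(p, \<tau>). ennreal (om (fst p)) * (ennreal (H \<tau> p) * indicator {0..t} \<tau>)) \<in> borel_measurable ((lborel :: (real \<times> 'b) measure) \<Otimes>\<^sub>M (lborel :: real measure))"
  proof -
    have 1: "(\<lambda>z::(real \<times> 'b) \<times> real. om (fst (fst z))) \<in> borel_measurable borel"
      by (rule continuous_UNIV_borel) (intro continuous_on_compose2[OF omc] continuous_intros, auto)
    have 2: "(\<lambda>z. H (snd z) (fst z)) \<in> borel_measurable borel" by (rule continuous_UNIV_borel[OF Hc])
    have 3: "(\<lambda>z::(real \<times> 'b) \<times> real. indicator {0..t} (snd z) :: ennreal) \<in> borel_measurable borel"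
    proof -
      have "(\<lambda>z::(real \<times> 'b) \<times> real. snd z) \<in> borel_measurable borel" by (intro continuous_UNIV_borel continuous_intros)
      then show ?thesis by measurable
    qed
    show ?thesis unfolding lborel_prod using 1 2 3 by (simp add: case_prod_beta)
  qed
  have "(\<integral>\<^sup>+p. ennreal (om (fst p) * gm (\<lambda>p. \<phi> (\<Psi> t p) - \<phi> p) p) \<partial>lborel)
     \<le> (\<integral>\<^sup>+p. ennreal t * (\<integral>\<^sup>+\<tau>. ennreal (om (fst p)) * (ennreal (H \<tau> p) * indicator {0..t} \<tau>) \<partial>lborel) \<partial>lborel)"
  proof (rule nn_integral_mono)
    fix p :: "real \<times> 'b"
    have m: "(\<lambda>\<tau>. ennreal (H \<tau> p) * indicator {0..t} \<tau>) \<in> borel_measurable lborel"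
    proof -
      have "continuous_on UNIV (\<lambda>\<tau>::real. (p, \<tau>))" by (intro continuous_intros)
      then have "continuous_on UNIV (\<lambda>\<tau>. H \<tau> p)"
        using continuous_on_compose2[OF Hc, of UNIV "\<lambda>\<tau>. (p, \<tau>)"] by auto
      then have "(\<lambda>\<tau>. H \<tau> p) \<in> borel_measurable borel" by (rule continuous_UNIV_borel)
      then show ?thesis by measurable
    qed
    have "ennreal (om (fst p) * gm (\<lambda>p. \<phi> (\<Psi> t p) - \<phi> p) p) = ennreal (om (fst p)) * ennreal (gm (\<lambda>p. \<phi> (\<Psi> t p) - \<phi> p) p)"
      using om by (simp add: ennreal_mult)
    also have "\<dots> \<le> ennreal (om (fst p)) * (ennreal t * (\<integral>\<^sup>+\<tau>. ennreal (H \<tau> p) * indicator {0..t} \<tau> \<partial>lborel))"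
      by (rule mult_left_mono[OF pt]) simp
    also have "\<dots> = ennreal t * (\<integral>\<^sup>+\<tau>. ennreal (om (fst p)) * (ennreal (H \<tau> p) * indicator {0..t} \<tau>) \<partial>lborel)"
      unfolding nn_integral_cmult[OF m] by (rule mult.left_commute)
    finally show "ennreal (om (fst p) * gm (\<lambda>p. \<phi> (\<Psi> t p) - \<phi> p) p) \<le> ennreal t * (\<integral>\<^sup>+\<tau>. ennreal (om (fst p)) * (ennreal (H \<tau> p) * indicator {0..t} \<tau>) \<partial>lborel)" .
  qed
  also have "\<dots> = ennreal t * (\<integral>\<^sup>+p. \<integral>\<^sup>+\<tau>. ennreal (om (fst p)) * (ennreal (H \<tau> p) * indicator {0..t} \<tau>) \<partial>lborel \<partial>lborel)"
    by (rule nn_integral_cmult) (use lborel.borel_measurable_nn_integral_fst[OF Hm] in simp)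
  also have "(\<integral>\<^sup>+p. \<integral>\<^sup>+\<tau>. ennreal (om (fst p)) * (ennreal (H \<tau> p) * indicator {0..t} \<tau>) \<partial>lborel \<partial>lborel)
     = (\<integral>\<^sup>+\<tau>. \<integral>\<^sup>+p. ennreal (om (fst p)) * (ennreal (H \<tau> p) * indicator {0..t} \<tau>) \<partial>lborel \<partial>lborel)"
    by (rule lborel_pair.Fubini'[OF Hm, symmetric])
  also have "\<dots> \<le> (\<integral>\<^sup>+\<tau>. ennreal B * indicator {0..t} \<tau> \<partial>lborel)"
  proof (rule nn_integral_mono)
    fix \<tau> :: real
    show "(\<integral>\<^sup>+p. ennreal (om (fst p)) * (ennreal (H \<tau> p) * indicator {0..t} \<tau>) \<partial>lborel) \<le> ennreal B * indicator {0..t} \<tau>"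
      using inner[of \<tau>] by (auto simp: indicator_def)
  qed
  also have "\<dots> = ennreal (B * t)" using t B0 by (simp add: nn_integral_cmult_indicator ennreal_mult)
  finally have "(\<integral>\<^sup>+p. ennreal (om (fst p) * gm (\<lambda>p. \<phi> (\<Psi> t p) - \<phi> p) p) \<partial>lborel) \<le> ennreal (t * (B * t))"
    using t B0 by (simp add: ennreal_mult mult_left_mono)
  moreover have "(\<integral>\<^sup>+p. ennreal (om (fst p) * gm (\<lambda>p. \<phi> (\<Psi> t p) - \<phi> p) p) \<partial>lborel) = ennreal (wint om (gm (\<lambda>p. \<phi> (\<Psi> t p) - \<phi> p)))"
    unfolding wint_def using om
    by (intro nn_integral_eq_integral wint_integrable g_cc(3)[OF test_function_diff[OF pull_TF[OF t \<phi>] \<phi>]]) auto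
  ultimately have "wint om (gm (\<lambda>p. \<phi> (\<Psi> t p) - \<phi> p)) \<le> t * (B * t)"
    using t B0 by (simp add: ennreal_le_iff)
  then show ?thesis by (simp add: B_def power2_eq_square mult_ac)
qed

end

section \<open>Integration by parts in the direction of the first coordinate\<close>

lemma weighted_ibp:
  fixes \<phi> :: "real \<times> 'b::euclidean_space \<Rightarrow> complex"
  assumes \<phi>: "\<phi> \<in> test_functions \<Omega>" and h: "\<And>x. (h has_real_derivative h' x) (at x)" and h': "continuous_on UNIV h'"
  shows "integrable lborel (\<lambda>p. h (fst p) * (pd (1, 0) \<phi> p \<bullet> \<phi> p))"
    "2 * (\<integral>p. h (fst p) * (pd (1, 0) \<phi> p \<bullet> \<phi> p) \<partial>lborel) = - wint h' (gm \<phi>)"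
proof -
  have hc: "continuous_on UNIV h" by (rule DERIV_continuous_on) (use h in \<open>auto intro: has_field_derivative_at_within\<close>)
  have \<phi>c: "continuous_on UNIV \<phi>" "continuous_on UNIV (pd (1, 0) \<phi>)"
    using \<phi> by (auto intro!: cc_continuous test_function_cc test_function_pd)
  have ccp: "cc (\<lambda>p. pd (1, 0) \<phi> p \<bullet> \<phi> p)" by (rule cc_inner[OF test_function_cc[OF test_function_pd[OF \<phi>]] \<phi>c(1)])
  show i: "integrable lborel (\<lambda>p. h (fst p) * (pd (1, 0) \<phi> p \<bullet> \<phi> p))" by (rule wint_integrable[OF ccp hc])
  let ?F' = "\<lambda>p v. h (fst p) * (\<phi> p \<bullet> pd v \<phi> p + pd v \<phi> p \<bullet> \<phi> p) + fst v * h' (fst p) * (\<phi> p \<bullet> \<phi> p)"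
  have "integral\<^sup>L lborel (\<lambda>p. ?F' p (1, 0)) = 0"
  proof (rule integral_derivative_zero)
    show "cc (\<lambda>p. h (fst p) * (\<phi> p \<bullet> \<phi> p))" by (rule wint_cc[OF cc_inner[OF test_function_cc[OF \<phi>] \<phi>c(1)] hc])
    show "((\<lambda>p. h (fst p) * (\<phi> p \<bullet> \<phi> p)) has_derivative ?F' p) (at p)" for p
    proof -
      have 1: "((\<lambda>p::real \<times> 'b. h (fst p)) has_derivative (\<lambda>v. fst v * h' (fst p))) (at p)"
        using has_derivative_compose[OF has_derivative_fst[OF has_derivative_ident] h[unfolded has_field_derivative_def], of p UNIV]
        by (simp add: mult.commute)
      show ?thesis
        by (rule has_derivative_mult[OF 1 has_derivative_inner[OF test_function_has_derivative[OF \<phi>] test_function_has_derivative[OF \<phi>]]])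
    qed
    show "continuous_on UNIV (\<lambda>p. ?F' p (1, 0))"
      by (intro continuous_intros \<phi>c continuous_on_fst_comp[OF hc] continuous_on_fst_comp[OF h'])
  qed
  moreover have "(\<lambda>p. ?F' p (1, 0)) = (\<lambda>p. 2 * (h (fst p) * (pd (1, 0) \<phi> p \<bullet> \<phi> p)) + h' (fst p) * gm \<phi> p)"
    by (simp add: fun_eq_iff gm_def dot_square_norm inner_commute algebra_simps)
  ultimately show "2 * (\<integral>p. h (fst p) * (pd (1, 0) \<phi> p \<bullet> \<phi> p) \<partial>lborel) = - wint h' (gm \<phi>)"
    using i wint_integrable[OF g_cc(3)[OF \<phi>] h'] by (simp add: wint_def)
qed

text \<open>Integrating by parts, the left-hand side is -2 times the integral of \<open>h\<close>
  against the product of \<open>\<phi>\<close> with its x-derivative. The condition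
  \<open>ab\<close> is the discriminant condition for the pointwise bound by the two weighted
  squares.\<close>

lemma hardy:
  fixes \<phi> :: "real \<times> 'b::euclidean_space \<Rightarrow> complex"
  assumes \<phi>: "\<phi> \<in> test_functions \<Omega>" and h: "\<And>x. (h has_real_derivative h' x) (at x)" and h': "continuous_on UNIV h'"
    and a: "continuous_on UNIV a" "\<And>x. a x \<ge> 0" and b: "continuous_on UNIV b" "\<And>x. b x \<ge> 0" and ab: "\<And>x. (h x)\<^sup>2 \<le> a x * b x"
  shows "wint h' (gm \<phi>) \<le> wint a (gx \<phi>) + wint b (gm \<phi>)"
proof -
  have pt: "- (2 * (h (fst p) * (pd (1, 0) \<phi> p \<bullet> \<phi> p))) \<le> a (fst p) * gx \<phi> p + b (fst p) * gm \<phi> p" for p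
  proof -
    let ?u = "cmod (pd (1, 0) \<phi> p)" and ?v = "cmod (\<phi> p)" and ?x = "fst p"
    have "- (2 * (h ?x * (pd (1, 0) \<phi> p \<bullet> \<phi> p))) \<le> 2 * (\<bar>h ?x\<bar> * \<bar>pd (1, 0) \<phi> p \<bullet> \<phi> p\<bar>)"
      using abs_ge_minus_self[of "h ?x * (pd (1, 0) \<phi> p \<bullet> \<phi> p)"] by (simp add: abs_mult)
    also have "\<dots> \<le> 2 * (\<bar>h ?x\<bar> * (?u * ?v))" by (intro mult_left_mono Cauchy_Schwarz_ineq2) auto
    also have "\<dots> \<le> a ?x * ?u\<^sup>2 + b ?x * ?v\<^sup>2"
    proof (rule power2_le_imp_le)
      have "(2 * (\<bar>h ?x\<bar> * (?u * ?v)))\<^sup>2 = 4 * (h ?x)\<^sup>2 * (?u\<^sup>2 * ?v\<^sup>2)" by (simp add: power_mult_distrib)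
      also have "\<dots> \<le> 4 * (a ?x * b ?x) * (?u\<^sup>2 * ?v\<^sup>2)" using ab[of ?x] by (intro mult_right_mono) auto
      also have "\<dots> = 4 * (a ?x * ?u\<^sup>2) * (b ?x * ?v\<^sup>2)" by (simp add: mult_ac)
      also have "4 * u * v \<le> (u + v)\<^sup>2" for u v :: real
        using zero_le_power2[of "u - v"] by (simp add: power2_eq_square algebra_simps)
      finally show "(2 * (\<bar>h ?x\<bar> * (?u * ?v)))\<^sup>2 \<le> (a ?x * ?u\<^sup>2 + b ?x * ?v\<^sup>2)\<^sup>2" .
    qed (use a b in simp)
    finally show ?thesis by (simp add: gx_def gm_def)
  qed
  have "wint h' (gm \<phi>) = (\<integral>p. - (2 * (h (fst p) * (pd (1, 0) \<phi> p \<bullet> \<phi> p))) \<partial>lborel)"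
    using weighted_ibp(2)[OF \<phi> h h'] by simp
  also have "\<dots> \<le> (\<integral>p. a (fst p) * gx \<phi> p + b (fst p) * gm \<phi> p \<partial>lborel)"
    using weighted_ibp(1)[OF \<phi> h h'] wint_integrable[OF g_cc(1)[OF \<phi>] a(1)] wint_integrable[OF g_cc(3)[OF \<phi>] b(1)]
    by (intro integral_mono pt) auto
  also have "\<dots> = wint a (gx \<phi>) + wint b (gm \<phi>)"
    using wint_integrable[OF g_cc(1)[OF \<phi>] a(1)] wint_integrable[OF g_cc(3)[OF \<phi>] b(1)] by (simp add: wint_def)
  finally show ?thesis .
qed

section \<open>Multiplication by real functions of x\<close>

lemma multiplier_TF:
  fixes \<phi> :: "real \<times> 'b::euclidean_space \<Rightarrow> complex"
  assumes "\<phi> \<in> test_functions \<Omega>" "smooth m"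
  shows "(\<lambda>p. complex_of_real (m (fst p)) * \<phi> p) \<in> test_functions \<Omega>"
proof (rule test_function_mult[OF assms(1)])
  show "smooth (\<lambda>p::real \<times> 'b. complex_of_real (m (fst p)))"
    by (intro smooth_linear[OF bounded_linear_of_real] smooth_compose[OF assms(2)] smooth_linear[OF bounded_linear_fst] smooth_ident)
qed

lemma multiplier_pd:
  fixes \<phi> :: "real \<times> 'b::euclidean_space \<Rightarrow> complex"
  assumes \<phi>: "\<phi> \<in> test_functions \<Omega>" and m: "\<And>x. (m has_real_derivative m' x) (at x)"
  shows "pd (h, k) (\<lambda>p. complex_of_real (m (fst p)) * \<phi> p) p
    = m (fst p) *\<^sub>R pd (h, k) \<phi> p + (m' (fst p) * h) *\<^sub>R \<phi> p"
proof -
  have 1: "((\<lambda>p::real \<times> 'b. m (fst p)) has_derivative (\<lambda>v. fst v * m' (fst p))) (at p)"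
    using has_derivative_compose[OF has_derivative_fst[OF has_derivative_ident] m[unfolded has_field_derivative_def], of p UNIV]
    by (simp add: mult.commute)
  have "((\<lambda>p. m (fst p) *\<^sub>R \<phi> p) has_derivative (\<lambda>v. m (fst p) *\<^sub>R pd v \<phi> p + (fst v * m' (fst p)) *\<^sub>R \<phi> p)) (at p)"
    by (rule has_derivative_scaleR[OF 1 test_function_has_derivative[OF \<phi>]])
  then have "((\<lambda>p. complex_of_real (m (fst p)) * \<phi> p) has_derivative (\<lambda>v. m (fst p) *\<^sub>R pd v \<phi> p + (fst v * m' (fst p)) *\<^sub>R \<phi> p)) (at p)"
    by (simp only: scaleR_conv_of_real)
  from pd_eqI[OF this, of "(h, k)"] show ?thesis by (simp add: mult.commute)
qed

text \<open>The derivative of the multiplier creates a cross term with weight \<open>m'\<close>; a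
  second integration by parts turns it into \<open>- m'' / 2\<close> on the mass.\<close>

lemma multiplier_identity:
  fixes \<phi> :: "real \<times> 'b::euclidean_space \<Rightarrow> complex"
  assumes \<phi>: "\<phi> \<in> test_functions \<Omega>" and m: "\<And>x. (m has_real_derivative m' x) (at x)"
    and m': "\<And>x. (m' has_real_derivative m'' x) (at x)" and m'': "continuous_on UNIV m''"
  shows "dir \<phi> (\<lambda>p. complex_of_real (m (fst p)) * \<phi> p) = wint m (gx \<phi>) + wint m (gy \<phi>) - 1 / 2 * wint m'' (gm \<phi>)"
proof -
  have mc: "continuous_on UNIV m" by (rule DERIV_continuous_on) (use m in \<open>auto intro: has_field_derivative_at_within\<close>)
  have ix: "integrable lborel (\<lambda>p. m (fst p) * gx \<phi> p)" by (rule wint_integrable[OF g_cc(1)[OF \<phi>] mc])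
  have ib: "integrable lborel (\<lambda>p. m (fst p) * (cmod (pd v \<phi> p))\<^sup>2)" for v
    by (rule wint_integrable[OF cc_square[OF test_function_cc[OF test_function_pd[OF \<phi>]]] mc])
  have 1: "rip lborel (pd (1, 0) \<phi>) (pd (1, 0) (\<lambda>p. complex_of_real (m (fst p)) * \<phi> p)) = wint m (gx \<phi>) - 1 / 2 * wint m'' (gm \<phi>)"
  proof -
    have "rip lborel (pd (1, 0) \<phi>) (pd (1, 0) (\<lambda>p. complex_of_real (m (fst p)) * \<phi> p))
       = (\<integral>p. m (fst p) * gx \<phi> p + m' (fst p) * (pd (1, 0) \<phi> p \<bullet> \<phi> p) \<partial>lborel)"
      unfolding rip_def multiplier_pd[OF \<phi> m]
      by (rule Bochner_Integration.integral_cong) (simp_all add: inner_add_right gx_def dot_square_norm)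
    then show ?thesis using ix weighted_ibp[OF \<phi> m' m''] by (simp add: wint_def)
  qed
  have 2: "rip lborel (pd (0, b) \<phi>) (pd (0, b) (\<lambda>p. complex_of_real (m (fst p)) * \<phi> p)) = (\<integral>p. m (fst p) * (cmod (pd (0, b) \<phi> p))\<^sup>2 \<partial>lborel)" for b
    unfolding rip_def multiplier_pd[OF \<phi> m]
    by (rule Bochner_Integration.integral_cong) (simp_all add: dot_square_norm)
  have "wint m (gy \<phi>) = (\<integral>p. (\<Sum>b\<in>Basis. m (fst p) * (cmod (pd (0, b) \<phi> p))\<^sup>2) \<partial>lborel)"
    by (simp add: wint_def gy_def sum_distrib_left)
  also have "\<dots> = (\<Sum>b\<in>Basis. (\<integral>p. m (fst p) * (cmod (pd (0, b) \<phi> p))\<^sup>2 \<partial>lborel))"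
    by (rule Bochner_Integration.integral_sum) (rule ib)
  finally show ?thesis by (simp add: dir_def sum_Basis_prod 1 2)
qed

text \<open>Boundedness in the form norm is what \<open>friedrichs_form_limit\<close> asks of a map
  before its values may serve as test functions.\<close>

lemma multiplier_bounded:
  fixes \<phi> :: "real \<times> 'b::euclidean_space \<Rightarrow> complex"
  assumes op: "open \<Omega>" and \<phi>: "\<phi> \<in> test_functions \<Omega>" and sm: "smooth m" and m: "\<And>x. (m has_real_derivative m' x) (at x)"
    and B: "\<And>x. \<bar>m x\<bar> \<le> B" "\<And>x. \<bar>m' x\<bar> \<le> B"
  shows "hnorm \<Omega> (\<lambda>p. complex_of_real (m (fst p)) * \<phi> p) \<le> 2 * B * hnorm \<Omega> \<phi>"
proof -
  let ?\<psi> = "\<lambda>p. complex_of_real (m (fst p)) * \<phi> p"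
  have B0: "B \<ge> 0" using B(1)[of 0] by linarith
  have \<psi>: "?\<psi> \<in> test_functions \<Omega>" by (rule multiplier_TF[OF \<phi> sm])
  have gxb: "gx ?\<psi> p + gy ?\<psi> p \<le> 2 * B\<^sup>2 * (gx \<phi> p + gy \<phi> p) + 2 * B\<^sup>2 * gm \<phi> p" for p
  proof -
    have m2: "(m (fst p))\<^sup>2 \<le> B\<^sup>2" "(m' (fst p))\<^sup>2 \<le> B\<^sup>2"
      using power_mono[OF B(1)[of "fst p"], of 2] power_mono[OF B(2)[of "fst p"], of 2] by auto
    have "gx ?\<psi> p \<le> (\<bar>m (fst p)\<bar> * cmod (pd (1, 0) \<phi> p) + \<bar>m' (fst p)\<bar> * cmod (\<phi> p))\<^sup>2"
      unfolding gx_def multiplier_pd[OF \<phi> m]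
      using norm_triangle_ineq[of "m (fst p) *\<^sub>R pd (1, 0) \<phi> p" "(m' (fst p) * 1) *\<^sub>R \<phi> p"] by (intro power_mono) auto
    also have "\<dots> \<le> 2 * (\<bar>m (fst p)\<bar> * cmod (pd (1, 0) \<phi> p))\<^sup>2 + 2 * (\<bar>m' (fst p)\<bar> * cmod (\<phi> p))\<^sup>2"
      using zero_le_power2[of "\<bar>m (fst p)\<bar> * cmod (pd (1, 0) \<phi> p) - \<bar>m' (fst p)\<bar> * cmod (\<phi> p)"]
      unfolding power2_sum power2_diff by linarith
    also have "\<dots> = 2 * (m (fst p))\<^sup>2 * gx \<phi> p + 2 * (m' (fst p))\<^sup>2 * gm \<phi> p"
      by (simp add: power_mult_distrib gx_def gm_def)
    also have "\<dots> \<le> 2 * B\<^sup>2 * gx \<phi> p + 2 * B\<^sup>2 * gm \<phi> p"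
      using m2 by (intro add_mono mult_right_mono mult_left_mono) auto
    finally have 1: "gx ?\<psi> p \<le> 2 * B\<^sup>2 * gx \<phi> p + 2 * B\<^sup>2 * gm \<phi> p" .
    have "gy ?\<psi> p = (m (fst p))\<^sup>2 * gy \<phi> p"
      unfolding gy_def multiplier_pd[OF \<phi> m] by (simp add: power_mult_distrib sum_distrib_left)
    also have "\<dots> \<le> (2 * B\<^sup>2) * gy \<phi> p"
    proof (rule mult_right_mono)
      show "(m (fst p))\<^sup>2 \<le> 2 * B\<^sup>2" using m2(1) zero_le_power2[of B] by linarith
    qed simp
    finally show ?thesis using 1 by (simp add: algebra_simps)
  qed
  have "dir ?\<psi> ?\<psi> = (\<integral>p. gx ?\<psi> p + gy ?\<psi> p \<partial>lborel)"
    using g_cc[OF \<psi>] by (simp add: dir_eq[OF \<psi>] wint_def cc_integrable)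
  also have "\<dots> \<le> (\<integral>p. 2 * B\<^sup>2 * (gx \<phi> p + gy \<phi> p) + 2 * B\<^sup>2 * gm \<phi> p \<partial>lborel)"
    using cc_integrable[OF g_cc(1)[OF \<psi>]] cc_integrable[OF g_cc(2)[OF \<psi>]] cc_integrable[OF g_cc(1)[OF \<phi>]]
      cc_integrable[OF g_cc(2)[OF \<phi>]] cc_integrable[OF g_cc(3)[OF \<phi>]]
    by (intro integral_mono[OF _ _ gxb] Bochner_Integration.integrable_add integrable_mult_right)
  also have "\<dots> = 2 * B\<^sup>2 * dir \<phi> \<phi> + 2 * B\<^sup>2 * wint (\<lambda>_. 1) (gm \<phi>)"
    using g_cc[OF \<phi>] by (simp add: dir_eq[OF \<phi>] wint_def cc_integrable)
  finally have d: "dir ?\<psi> ?\<psi> \<le> 2 * B\<^sup>2 * dir \<phi> \<phi> + 2 * B\<^sup>2 * (nrm (lebesgue_on \<Omega>) \<phi>)\<^sup>2"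
    by (simp add: nrm_eq_gm[OF op \<phi>])
  have "nrm (lebesgue_on \<Omega>) ?\<psi> \<le> B * nrm (lebesgue_on \<Omega>) \<phi>"
  proof (rule l2_mult(2)[OF test_function_l2[OF op \<phi>]])
    have "continuous_on UNIV (\<lambda>p::real \<times> 'b. complex_of_real (m (fst p)))"
      by (intro continuous_intros continuous_on_fst_comp smooth_continuous[OF sm])
    then show "(\<lambda>p::real \<times> 'b. complex_of_real (m (fst p))) \<in> borel_measurable (lebesgue_on \<Omega>)"
      by (intro borel_measurable_lebesgue_on continuous_UNIV_borel)
  qed (use B in simp)
  then have n: "(nrm (lebesgue_on \<Omega>) ?\<psi>)\<^sup>2 \<le> B\<^sup>2 * (nrm (lebesgue_on \<Omega>) \<phi>)\<^sup>2"
    using power_mono[OF _ nrm_nonneg, of _ _ _ 2] by (fastforce simp flip: power_mult_distrib)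
  show ?thesis
  proof (rule power2_le_imp_le)
    have "(hnorm \<Omega> ?\<psi>)\<^sup>2 \<le> 4 * B\<^sup>2 * (hnorm \<Omega> \<phi>)\<^sup>2"
      unfolding hnorm_square distrib_left
      using d n mult_nonneg_nonneg[OF zero_le_power2[of B] dir_nonneg[of \<phi>]] mult_nonneg_nonneg[OF zero_le_power2[of B] zero_le_power2[of "nrm (lebesgue_on \<Omega>) \<phi>"]]
      by linarith
    then show "(hnorm \<Omega> ?\<psi>)\<^sup>2 \<le> (2 * B * hnorm \<Omega> \<phi>)\<^sup>2" by (simp add: power_mult_distrib)
  qed (use B0 in \<open>simp add: hnorm_nonneg\<close>)
qed

section \<open>The a priori estimate\<close>

text \<open>
  \<open>ws\<close> is the weight of the resolvent estimate, \<open>h\<close>, \<open>\<alpha>\<close> and \<open>b\<close> are the data of the Hardy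
  inequality. The last two inequalities say that the coefficients of \<open>gx \<phi>\<close> and \<open>gm \<phi>\<close> left over
  after all absorptions dominate \<open>c * (ws x)\<^sup>2\<close>.
\<close>

locale repulsive = flow \<Omega> w a \<xi> \<xi>' t0 W A X L Y dd
  for \<Omega> :: "(real \<times> 'b::euclidean_space) set" and w a \<xi> \<xi>' t0 W A X L Y dd +
  fixes \<mu> ws h h' b \<alpha> m' m'' :: "real \<Rightarrow> real" and Mm Lm c E0 Cw Bm :: real
  assumes \<mu>: "\<And>x. 0 \<le> \<mu> x" "\<And>x. \<mu> x \<le> Mm" "\<And>x. 2 * (\<xi>' x)\<^sup>2 * Y\<^sup>2 \<le> \<xi> x * \<mu> x"
    and lip_\<mu>: "\<And>x x'. \<bar>\<mu> x - \<mu> x'\<bar> \<le> Lm * \<bar>x - x'\<bar>" and \<xi>0: "\<And>x. \<xi> x = 0 \<Longrightarrow> \<xi>' x = 0"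
    and ws: "continuous_on UNIV ws" "\<And>x. 0 \<le> ws x" "\<And>x. ws x \<le> 1"
    and Cw: "Cw \<ge> 0" "\<And>x x'. \<bar>x - x'\<bar> \<le> W \<Longrightarrow> (ws x)\<^sup>2 \<le> Cw * (ws x')\<^sup>2"
    and smooth_a: "smooth a"
    and m': "\<And>x. ((\<lambda>x. a x + (dd - 1) * \<xi> x) has_real_derivative m' x) (at x)"
    and m'': "\<And>x. (m' has_real_derivative m'' x) (at x)" "continuous_on UNIV m''"
    and Bm: "\<And>x. \<bar>a x + (dd - 1) * \<xi> x\<bar> \<le> Bm" "\<And>x. \<bar>m' x\<bar> \<le> Bm"
    and h: "\<And>x. (h has_real_derivative h' x) (at x)" "continuous_on UNIV h'"
    and \<alpha>: "continuous_on UNIV \<alpha>" "\<And>x. 0 \<le> \<alpha> x" and b: "continuous_on UNIV b" "\<And>x. 0 \<le> b x"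
    and h\<alpha>b: "\<And>x. (h x)\<^sup>2 \<le> \<alpha> x * b x"
    and c: "0 < c" "c \<le> 1 / 2"
    and gx_coeff: "\<And>x. \<alpha> x + c * (ws x)\<^sup>2 \<le> 2 * a x - \<mu> x - \<xi> x"
    and gm_coeff: "\<And>x E. E \<ge> E0 \<Longrightarrow> c * (ws x)\<^sup>2 \<le> h' x - b x + E * \<xi> x - m'' x / 2"
    and E0: "E0 \<ge> 1"
begin

text \<open>This is \<open>\<gamma> - \<xi>\<close>: after combination with the first variation,
  \<open>E\<close> remains only in front of \<open>\<xi>\<close>, and the coefficient of the
  y-gradient stays positive.\<close>

definition m :: "real \<Rightarrow> real" where "m x = a x + (dd - 1) * \<xi> x"

definition om :: "real \<Rightarrow> real" where "om x = (ws x)\<^sup>2"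

text \<open>The quantity controlled by the commutator argument. The y-gradient is seen only where
  \<open>\<xi>\<close> is positive.\<close>

definition P :: "(real \<times> 'b \<Rightarrow> complex) \<Rightarrow> real" where
  "P \<phi> = wint om (gx \<phi>) + wint \<xi> (gy \<phi>) + wint om (gm \<phi>)"

definition \<delta> :: "real \<Rightarrow> (real \<times> 'b \<Rightarrow> complex) \<Rightarrow> real \<times> 'b \<Rightarrow> complex" where
  "\<delta> t \<phi> = (\<lambda>p. \<phi> (\<Psi> t p) - \<phi> p)"

definition mlt :: "(real \<times> 'b \<Rightarrow> complex) \<Rightarrow> real \<times> 'b \<Rightarrow> complex" where
  "mlt \<phi> = (\<lambda>p. complex_of_real (m (fst p)) * \<phi> p)"

lemma smooth_m: "smooth m"
  unfolding m_def by (intro smooth_add smooth_a smooth_mult smooth_const smooth_\<xi>)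

lemma om: "continuous_on UNIV om" "0 \<le> om x" "om x \<le> 1"
  using ws power_le_one[of "ws x" 2] unfolding om_def by (auto intro: continuous_intros)

lemma \<delta>_TF: "0 \<le> t \<Longrightarrow> t \<le> t0 \<Longrightarrow> \<phi> \<in> test_functions \<Omega> \<Longrightarrow> \<delta> t \<phi> \<in> test_functions \<Omega>"
  unfolding \<delta>_def by (intro test_function_diff pull_TF)

lemma mlt_TF: "\<phi> \<in> test_functions \<Omega> \<Longrightarrow> mlt \<phi> \<in> test_functions \<Omega>"
  unfolding mlt_def by (rule multiplier_TF[OF _ smooth_m])

lemma rip_mlt: "\<phi> \<in> test_functions \<Omega> \<Longrightarrow> rip (lebesgue_on \<Omega>) \<phi> (mlt \<phi>) = wint m (gm \<phi>)"
  by (subst test_function_rip[OF op _ mlt_TF])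
    (simp_all add: rip_def mlt_def wint_def gm_def dot_square_norm flip: scaleR_conv_of_real)

text \<open>Adding the multiplier identity to the first variation leaves the coefficients
  \<open>2 * a - \<mu> - \<xi>\<close> of \<open>gx\<close>, \<open>\<xi> / 2\<close> of
  \<open>gy\<close> and \<open>E * \<xi> - m'' / 2\<close> of \<open>gm\<close>. Hardy's inequality
  then exchanges the part \<open>\<alpha>\<close> of the first for \<open>h' - b\<close> in the
  last.\<close>

lemma weights_lower:
  assumes \<phi>: "\<phi> \<in> test_functions \<Omega>" and E: "E \<ge> E0"
  shows "c * P \<phi> \<le> wint (\<lambda>x. 2 * a x - \<mu> x - \<gamma> x) (gx \<phi>) + wint (\<lambda>x. 3 / 2 * \<xi> x - \<gamma> x) (gy \<phi>) + E * wint \<gamma> (gm \<phi>)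
     + (dir \<phi> (mlt \<phi>) - E * rip (lebesgue_on \<Omega>) \<phi> (mlt \<phi>))"
proof -
  note ccs = g_cc[OF \<phi>]
  have Lm: "Lm \<ge> 0" using lip_\<mu>[of 0 1] by (auto intro: order_trans[OF abs_ge_zero])
  have c\<mu>: "continuous_on UNIV \<mu>"
    by (rule lipschitz_on_continuous_on[of Lm]) (use lip_\<mu> Lm in \<open>auto intro!: lipschitz_onI simp: dist_real_def\<close>)
  have c\<gamma>: "continuous_on UNIV \<gamma>" unfolding \<gamma>_def by (intro continuous_intros cont)
  have cm: "continuous_on UNIV m" by (rule smooth_continuous[OF smooth_m])
  have mi: "dir \<phi> (mlt \<phi>) = wint m (gx \<phi>) + wint m (gy \<phi>) - 1 / 2 * wint m'' (gm \<phi>)"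
    unfolding mlt_def by (rule multiplier_identity[OF \<phi> _ m'']) (simp add: m_def[abs_def] m')
  have X1: "wint (\<lambda>x. 2 * a x - \<mu> x - \<gamma> x) (gx \<phi>) + wint m (gx \<phi>) = wint (\<lambda>x. 2 * a x - \<mu> x - \<xi> x) (gx \<phi>)"
  proof -
    have "(\<lambda>x. 2 * a x - \<mu> x - \<gamma> x + m x) = (\<lambda>x. 2 * a x - \<mu> x - \<xi> x)" by (simp add: fun_eq_iff m_def \<gamma>_def algebra_simps)
    then show ?thesis using wint_add[OF ccs(1), of "\<lambda>x. 2 * a x - \<mu> x - \<gamma> x" m] cm
      by (simp add: continuous_intros cont c\<mu> c\<gamma>)
  qed
  have Y1: "wint (\<lambda>x. 3 / 2 * \<xi> x - \<gamma> x) (gy \<phi>) + wint m (gy \<phi>) = 1 / 2 * wint \<xi> (gy \<phi>)"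
  proof -
    have "(\<lambda>x. 3 / 2 * \<xi> x - \<gamma> x + m x) = (\<lambda>x. 1 / 2 * \<xi> x)" by (simp add: fun_eq_iff m_def \<gamma>_def algebra_simps)
    moreover have "continuous_on UNIV (\<lambda>x. 3 / 2 * \<xi> x - \<gamma> x)" by (intro continuous_intros cont c\<gamma>)
    ultimately show ?thesis using wint_add[OF ccs(2), of "\<lambda>x. 3 / 2 * \<xi> x - \<gamma> x" m] cm
      by (simp only: wint_cmult)
  qed
  have M1: "wint \<gamma> (gm \<phi>) - wint m (gm \<phi>) = wint \<xi> (gm \<phi>)"
  proof -
    have "(\<lambda>x. \<gamma> x - m x) = \<xi>" by (simp add: fun_eq_iff m_def \<gamma>_def algebra_simps)
    then show ?thesis using wint_diff[OF ccs(3) c\<gamma> cm] by simp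
  qed
  have "wint \<alpha> (gx \<phi>) + c * wint om (gx \<phi>) = wint (\<lambda>x. \<alpha> x + c * om x) (gx \<phi>)"
    using wint_add[OF ccs(1) \<alpha>(1), of "\<lambda>x. c * om x"] om(1) by (simp add: wint_cmult continuous_intros)
  also have "\<dots> \<le> wint (\<lambda>x. 2 * a x - \<mu> x - \<xi> x) (gx \<phi>)"
  proof (rule wint_mono[OF ccs(1)])
    show "\<alpha> x + c * om x \<le> 2 * a x - \<mu> x - \<xi> x" for x using gx_coeff[of x] by (simp add: om_def)
  qed (intro continuous_intros \<alpha> om(1) cont c\<mu> g_nonneg)+
  finally have 1: "wint \<alpha> (gx \<phi>) + c * wint om (gx \<phi>) \<le> wint (\<lambda>x. 2 * a x - \<mu> x - \<xi> x) (gx \<phi>)" .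
  have 2: "wint h' (gm \<phi>) \<le> wint \<alpha> (gx \<phi>) + wint b (gm \<phi>)" by (rule hardy[OF \<phi> h \<alpha> b h\<alpha>b])
  have "c * wint om (gm \<phi>) = wint (\<lambda>x. c * om x) (gm \<phi>)" by (rule wint_cmult[symmetric])
  also have "\<dots> \<le> wint (\<lambda>x. (h' x - b x) + (E * \<xi> x - (1 / 2) * m'' x)) (gm \<phi>)"
  proof (rule wint_mono[OF ccs(3)])
    show "c * om x \<le> h' x - b x + (E * \<xi> x - 1 / 2 * m'' x)" for x using gm_coeff[OF E, of x] by (simp add: om_def)
  qed (intro continuous_intros h b om(1) cont m'' g_nonneg)+
  also have "\<dots> = (wint h' (gm \<phi>) - wint b (gm \<phi>)) + (E * wint \<xi> (gm \<phi>) - 1 / 2 * wint m'' (gm \<phi>))"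
  proof -
    have "wint (\<lambda>x. (h' x - b x) + (E * \<xi> x - (1 / 2) * m'' x)) (gm \<phi>)
      = wint (\<lambda>x. h' x - b x) (gm \<phi>) + wint (\<lambda>x. E * \<xi> x - (1 / 2) * m'' x) (gm \<phi>)"
      by (rule wint_add[OF ccs(3)]) (intro continuous_intros h b cont m'')+
    moreover have "wint (\<lambda>x. h' x - b x) (gm \<phi>) = wint h' (gm \<phi>) - wint b (gm \<phi>)" by (rule wint_diff[OF ccs(3) h(2) b(1)])
    moreover have "wint (\<lambda>x. E * \<xi> x - (1 / 2) * m'' x) (gm \<phi>) = wint (\<lambda>x. E * \<xi> x) (gm \<phi>) - wint (\<lambda>x. (1 / 2) * m'' x) (gm \<phi>)"
      by (rule wint_diff[OF ccs(3)]) (intro continuous_intros cont m'')+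
    ultimately show ?thesis by (simp only: wint_cmult)
  qed
  finally have 3: "c * wint om (gm \<phi>) \<le> wint h' (gm \<phi>) - wint b (gm \<phi>) + (E * wint \<xi> (gm \<phi>) - 1 / 2 * wint m'' (gm \<phi>))" .
  have "c * wint \<xi> (gy \<phi>) \<le> 1 / 2 * wint \<xi> (gy \<phi>)" using c \<xi> by (intro mult_right_mono wint_nonneg) auto
  then have "c * P \<phi> \<le> wint (\<lambda>x. 2 * a x - \<mu> x - \<xi> x) (gx \<phi>) + 1 / 2 * wint \<xi> (gy \<phi>) + (E * wint \<xi> (gm \<phi>) - 1 / 2 * wint m'' (gm \<phi>))"
    using 1 2 3 unfolding P_def distrib_left by linarith
  moreover have "E * wint \<xi> (gm \<phi>) = E * wint \<gamma> (gm \<phi>) - E * wint m (gm \<phi>)"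
    unfolding M1[symmetric] by (simp add: right_diff_distrib)
  ultimately show ?thesis unfolding mi rip_mlt[OF \<phi>] using X1 Y1 by linarith
qed

text \<open>Expand the energy and the mass of \<open>\<phi>\<close> plus its increment. The energy
  of the increment has the good sign and is dropped. Its squared L2 norm appears with the bad sign
  and the factor \<open>E\<close>, but it is of order \<open>t\<^sup>2\<close> and gets divided by
  \<open>t\<close> only once.\<close>

lemma key_inequality:
  "\<exists>K\<ge>0. \<exists>t1>0. t1 \<le> t0 \<and> (\<forall>t E \<phi>. 0 < t \<longrightarrow> t \<le> t1 \<longrightarrow> E \<ge> E0 \<longrightarrow> \<phi> \<in> test_functions \<Omega> \<longrightarrow>
     c * P \<phi> \<le> - (2 / t) * (dir \<phi> (\<delta> t \<phi>) - E * rip (lebesgue_on \<Omega>) \<phi> (\<delta> t \<phi>))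
       + (dir \<phi> (mlt \<phi>) - E * rip (lebesgue_on \<Omega>) \<phi> (mlt \<phi>))
       + E / t * (nrm (lebesgue_on \<Omega>) (\<delta> t \<phi>))\<^sup>2 + K * (1 + E) * t * (hnorm \<Omega> \<phi>)\<^sup>2)"
proof -
  obtain C1 t1 where C1: "C1 \<ge> 0" "t1 > 0" "t1 \<le> t0"
    "\<And>t \<phi>. 0 \<le> t \<Longrightarrow> t \<le> t1 \<Longrightarrow> \<phi> \<in> test_functions \<Omega> \<Longrightarrow>
     dir (\<lambda>p. \<phi> (\<Psi> t p)) (\<lambda>p. \<phi> (\<Psi> t p)) \<le> dir \<phi> \<phi> - t * (wint (\<lambda>x. 2 * a x - \<mu> x - \<gamma> x) (gx \<phi>) + wint (\<lambda>x. 3 / 2 * \<xi> x - \<gamma> x) (gy \<phi>))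
       + C1 * t\<^sup>2 * dir \<phi> \<phi>"
    using energy_pull[OF \<mu> lip_\<mu> \<xi>0] by blast
  obtain C2 t2 where C2: "C2 \<ge> 0" "t2 > 0" "t2 \<le> t0"
    "\<And>t \<phi>. 0 \<le> t \<Longrightarrow> t \<le> t2 \<Longrightarrow> \<phi> \<in> test_functions \<Omega> \<Longrightarrow>
     wint (\<lambda>_. 1) (gm \<phi>) + t * wint \<gamma> (gm \<phi>) - C2 * t\<^sup>2 * wint (\<lambda>_. 1) (gm \<phi>) \<le> wint (\<lambda>_. 1) (gm (\<lambda>p. \<phi> (\<Psi> t p)))"
    using mass_pull by blast
  define K where "K = C1 + C2"
  have main: "c * P \<phi> \<le> - (2 / t) * (dir \<phi> (\<delta> t \<phi>) - E * rip (lebesgue_on \<Omega>) \<phi> (\<delta> t \<phi>))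
       + (dir \<phi> (mlt \<phi>) - E * rip (lebesgue_on \<Omega>) \<phi> (mlt \<phi>))
       + E / t * (nrm (lebesgue_on \<Omega>) (\<delta> t \<phi>))\<^sup>2 + K * (1 + E) * t * (hnorm \<Omega> \<phi>)\<^sup>2"
    if t: "0 < t" "t \<le> min t1 t2" and E: "E \<ge> E0" and \<phi>: "\<phi> \<in> test_functions \<Omega>" for t E \<phi>
  proof -
    have tt: "0 \<le> t" "t \<le> t0" "t \<le> t1" "t \<le> t2" using t C1 by auto
    have E1: "E \<ge> 1" using E E0 by simp
    let ?n = "nrm (lebesgue_on \<Omega>)" and ?r = "rip (lebesgue_on \<Omega>)"
    have dT: "\<delta> t \<phi> \<in> test_functions \<Omega>" by (rule \<delta>_TF[OF tt(1,2) \<phi>])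
    have \<phi>t: "(\<lambda>p. \<phi> (\<Psi> t p)) \<in> test_functions \<Omega>" by (rule pull_TF[OF tt(1,2) \<phi>])
    have e: "(\<lambda>p. \<phi> (\<Psi> t p)) = (\<lambda>p. \<phi> p + \<delta> t \<phi> p)" by (simp add: \<delta>_def)
    have sT: "(\<lambda>p. \<phi> p + \<delta> t \<phi> p) \<in> test_functions \<Omega>" using \<phi>t unfolding e .
    have d: "dir (\<lambda>p. \<phi> (\<Psi> t p)) (\<lambda>p. \<phi> (\<Psi> t p)) = dir \<phi> \<phi> + 2 * dir \<phi> (\<delta> t \<phi>) + dir (\<delta> t \<phi>) (\<delta> t \<phi>)"
    proof -
      have "dir (\<lambda>p. \<phi> p + \<delta> t \<phi> p) (\<lambda>p. \<phi> p + \<delta> t \<phi> p) = dir \<phi> (\<lambda>p. \<phi> p + \<delta> t \<phi> p) + dir (\<delta> t \<phi>) (\<lambda>p. \<phi> p + \<delta> t \<phi> p)"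
        by (rule dir_add[OF \<phi> dT sT])
      moreover have "dir \<phi> (\<lambda>p. \<phi> p + \<delta> t \<phi> p) = dir \<phi> \<phi> + dir \<phi> (\<delta> t \<phi>)"
        using dir_add[OF \<phi> dT \<phi>] by (metis dir_sym)
      moreover have "dir (\<delta> t \<phi>) (\<lambda>p. \<phi> p + \<delta> t \<phi> p) = dir \<phi> (\<delta> t \<phi>) + dir (\<delta> t \<phi>) (\<delta> t \<phi>)"
        using dir_add[OF \<phi> dT dT] by (metis dir_sym)
      ultimately show ?thesis unfolding e by linarith
    qed
    have l: "\<phi> \<in> l2 (lebesgue_on \<Omega>)" "\<delta> t \<phi> \<in> l2 (lebesgue_on \<Omega>)" by (rule test_function_l2[OF op \<phi>], rule test_function_l2[OF op dT])
    have mm: "wint (\<lambda>_. 1) (gm (\<lambda>p. \<phi> (\<Psi> t p))) = wint (\<lambda>_. 1) (gm \<phi>) + 2 * ?r \<phi> (\<delta> t \<phi>) + (?n (\<delta> t \<phi>))\<^sup>2"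
    proof -
      have "wint (\<lambda>_. 1) (gm (\<lambda>p. \<phi> (\<Psi> t p))) = ?r (\<lambda>p. \<phi> p + \<delta> t \<phi> p) (\<lambda>p. \<phi> p + \<delta> t \<phi> p)"
        using nrm_eq_gm[OF op \<phi>t] unfolding e by (simp add: nrm_square_rip)
      also have "\<dots> = ?r \<phi> \<phi> + 2 * ?r \<phi> (\<delta> t \<phi>) + ?r (\<delta> t \<phi>) (\<delta> t \<phi>)"
        using l by (simp add: rip_add l2_add rip_commute[of _ "\<delta> t \<phi>" \<phi>])
      finally show ?thesis using nrm_eq_gm[OF op \<phi>] by (simp add: nrm_square_rip)
    qed
    define A1 where "A1 = wint (\<lambda>x. 2 * a x - \<mu> x - \<gamma> x) (gx \<phi>) + wint (\<lambda>x. 3 / 2 * \<xi> x - \<gamma> x) (gy \<phi>)"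
    define G where "G = wint \<gamma> (gm \<phi>)"
    define n1 where "n1 = wint (\<lambda>_. 1) (gm \<phi>)"
    define d1 where "d1 = dir \<phi> \<phi>"
    have n1: "n1 \<ge> 0" unfolding n1_def by (rule wint_nonneg) auto
    have d1: "d1 \<ge> 0" unfolding d1_def by (rule dir_nonneg)
    have e1: "2 * dir \<phi> (\<delta> t \<phi>) + dir (\<delta> t \<phi>) (\<delta> t \<phi>) \<le> - t * A1 + C1 * t\<^sup>2 * d1"
      using C1(4)[OF tt(1,3) \<phi>] unfolding d A1_def[symmetric] d1_def[symmetric] by simp
    have e2: "t * G - C2 * t\<^sup>2 * n1 \<le> 2 * ?r \<phi> (\<delta> t \<phi>) + (?n (\<delta> t \<phi>))\<^sup>2"
      using C2(4)[OF tt(1,4) \<phi>] unfolding mm G_def[symmetric] n1_def[symmetric] by simp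
    have "E * (t * G - C2 * t\<^sup>2 * n1) \<le> E * (2 * ?r \<phi> (\<delta> t \<phi>) + (?n (\<delta> t \<phi>))\<^sup>2)"
      using e2 E1 by (intro mult_left_mono) auto
    then have "t * (A1 + E * G) \<le> - 2 * (dir \<phi> (\<delta> t \<phi>) - E * ?r \<phi> (\<delta> t \<phi>)) + E * (?n (\<delta> t \<phi>))\<^sup>2 + (C1 * t\<^sup>2 * d1 + E * (C2 * t\<^sup>2 * n1))"
      using e1 dir_nonneg[of "\<delta> t \<phi>"] by (simp add: algebra_simps)
    also have "C1 * t\<^sup>2 * d1 + E * (C2 * t\<^sup>2 * n1) \<le> t * (K * (1 + E) * t * (hnorm \<Omega> \<phi>)\<^sup>2)"
    proof -
      have "C1 * d1 + E * C2 * n1 \<le> K * (1 + E) * d1 + K * (1 + E) * n1"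
      proof (intro add_mono mult_right_mono d1 n1)
        have "C1 * 1 \<le> K * (1 + E)" using C1(1) C2(1) E1 by (intro mult_mono) (auto simp: K_def)
        then show "C1 \<le> K * (1 + E)" by simp
        have "C2 * E \<le> K * (1 + E)" using C1(1) C2(1) E1 by (intro mult_mono) (auto simp: K_def)
        then show "E * C2 \<le> K * (1 + E)" by (simp add: mult.commute)
      qed
      then have "t\<^sup>2 * (C1 * d1 + E * C2 * n1) \<le> t\<^sup>2 * (K * (1 + E) * (d1 + n1))"
        by (intro mult_left_mono) (auto simp: distrib_left)
      moreover have "(hnorm \<Omega> \<phi>)\<^sup>2 = d1 + n1" by (simp add: hnorm_square d1_def n1_def nrm_eq_gm[OF op \<phi>])
      ultimately show ?thesis by (simp add: power2_eq_square algebra_simps)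
    qed
    finally have flow_le: "t * (A1 + E * G) \<le> - 2 * (dir \<phi> (\<delta> t \<phi>) - E * ?r \<phi> (\<delta> t \<phi>)) + E * (?n (\<delta> t \<phi>))\<^sup>2
       + t * (K * (1 + E) * t * (hnorm \<Omega> \<phi>)\<^sup>2)" by simp
    have "t * (A1 + E * G) \<le> t * (- (2 / t) * (dir \<phi> (\<delta> t \<phi>) - E * ?r \<phi> (\<delta> t \<phi>))
        + E / t * (?n (\<delta> t \<phi>))\<^sup>2 + K * (1 + E) * t * (hnorm \<Omega> \<phi>)\<^sup>2)"
    proof -
      have "t * (- (2 / t) * q + E / t * n + z) = - 2 * q + E * n + t * z" for q n z :: real
        using t by (simp add: field_simps)
      then show ?thesis using flow_le by (simp only:)
    qed
    then have "A1 + E * G \<le> - (2 / t) * (dir \<phi> (\<delta> t \<phi>) - E * ?r \<phi> (\<delta> t \<phi>))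
        + E / t * (?n (\<delta> t \<phi>))\<^sup>2 + K * (1 + E) * t * (hnorm \<Omega> \<phi>)\<^sup>2"
      using t mult_le_cancel_left_pos by blast
    then show ?thesis using weights_lower[OF \<phi> E] unfolding A1_def[symmetric] G_def[symmetric] by linarith
  qed
  have "K \<ge> 0" "min t1 t2 > 0" "min t1 t2 \<le> t0" using C1 C2 by (auto simp: K_def)
  then show ?thesis using main by blast
qed

lemma P_nonneg: "wint om (gx \<phi>) \<ge> 0" "wint \<xi> (gy \<phi>) \<ge> 0" "wint om (gm \<phi>) \<ge> 0" "P \<phi> \<ge> 0"
  using om \<xi> unfolding P_def by (auto intro!: wint_nonneg add_nonneg_nonneg)

text \<open>The weighted bound involves \<open>P\<close> alone, up to a term with an extra factor
  \<open>t\<close>, so no power of \<open>E\<close> enters it in the limit. The unweighted bound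
  needs the full Dirichlet energy, which for the solution is comparable to \<open>E\<close> times
  its mass up to data.\<close>

lemma shift_bounds:
  "\<exists>C>0. \<forall>t \<phi>. 0 \<le> t \<longrightarrow> t \<le> t0 \<longrightarrow> \<phi> \<in> test_functions \<Omega> \<longrightarrow>
     wint om (gm (\<delta> t \<phi>)) \<le> t\<^sup>2 * (C * (P \<phi> + t * dir \<phi> \<phi>)) \<and>
     (nrm (lebesgue_on \<Omega>) (\<delta> t \<phi>))\<^sup>2 \<le> t\<^sup>2 * (C * dir \<phi> \<phi>)"
proof -
  define S where "S = W\<^sup>2 + X * Y\<^sup>2 * (1 + X + L * W)"
  have S0: "S \<ge> 0" using AXLW Y by (simp add: S_def)
  define C where "C = 4 * (Cw + 1) * S + 1"
  have C: "C > 0" "4 * Cw * S \<le> C" "4 * S \<le> C" using S0 Cw by (auto simp: C_def algebra_simps add_pos_nonneg intro: add_nonneg_pos)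
  have "wint om (gm (\<delta> t \<phi>)) \<le> t\<^sup>2 * (C * (P \<phi> + t * dir \<phi> \<phi>)) \<and>
     (nrm (lebesgue_on \<Omega>) (\<delta> t \<phi>))\<^sup>2 \<le> t\<^sup>2 * (C * dir \<phi> \<phi>)"
    if t: "0 \<le> t" "t \<le> t0" and \<phi>: "\<phi> \<in> test_functions \<Omega>" for t \<phi>
  proof
    note ccs = g_cc[OF \<phi>]
    define gx1 where "gx1 = wint (\<lambda>_. 1) (gx \<phi>)"
    define gy1 where "gy1 = wint (\<lambda>_. 1) (gy \<phi>)"
    have g1: "gx1 \<ge> 0" "gy1 \<ge> 0" unfolding gx1_def gy1_def by (rule wint_nonneg; simp)+
    have dg: "dir \<phi> \<phi> = gx1 + gy1" unfolding gx1_def gy1_def by (rule dir_eq[OF \<phi>])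
    have co: "continuous_on UNIV (\<lambda>x. om x * \<xi> x)" by (intro continuous_intros om(1) cont)
    have o1: "wint om (gy \<phi>) \<le> gy1" unfolding gy1_def by (rule wint_mono[OF ccs(2) om(1)]) (auto simp: om)
    have o2: "wint (\<lambda>x. om x * \<xi> x) (gy \<phi>) \<le> wint \<xi> (gy \<phi>)"
    proof (rule wint_mono[OF ccs(2) co cont(3) g_nonneg(2)])
      show "om x * \<xi> x \<le> \<xi> x" for x using mult_right_mono[OF om(3), of "\<xi> x" x] \<xi>[of x] by simp
    qed
    have o3: "wint (\<lambda>x. 1 * \<xi> x) (gy \<phi>) \<le> X * gy1"
    proof -
      have "wint (\<lambda>x. 1 * \<xi> x) (gy \<phi>) \<le> wint (\<lambda>_. X) (gy \<phi>)"
        using \<xi> by (intro wint_mono[OF ccs(2)] cont continuous_intros) auto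
      then show ?thesis unfolding gy1_def using wint_const[of X "gy \<phi>"] by simp
    qed
    have XY: "X * Y\<^sup>2 \<ge> 0" using AXLW by simp
    have "wint om (gm (\<delta> t \<phi>)) \<le> t\<^sup>2 * (4 * Cw * (W\<^sup>2 * wint om (gx \<phi>)
       + X * Y\<^sup>2 * (wint (\<lambda>x. om x * \<xi> x) (gy \<phi>) + t * L * W * wint om (gy \<phi>))))"
      unfolding \<delta>_def by (rule pull_difference[OF om(1,2) Cw(2)[folded om_def] Cw(1) t \<phi>])
    also have "\<dots> \<le> t\<^sup>2 * (C * (P \<phi> + t * dir \<phi> \<phi>))"
    proof (intro mult_left_mono)
      have "W\<^sup>2 * wint om (gx \<phi>) + X * Y\<^sup>2 * (wint (\<lambda>x. om x * \<xi> x) (gy \<phi>) + t * L * W * wint om (gy \<phi>))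
         \<le> S * wint om (gx \<phi>) + (S * wint \<xi> (gy \<phi>) + t * (S * gy1))"
      proof -
        have s1: "W\<^sup>2 \<le> S" "X * Y\<^sup>2 \<le> S" "X * Y\<^sup>2 * (L * W) \<le> S"
          using XY AXLW zero_le_power2[of W] by (auto simp: S_def distrib_left intro!: add_increasing add_increasing2 mult_nonneg_nonneg)
        have "W\<^sup>2 * wint om (gx \<phi>) \<le> S * wint om (gx \<phi>)" by (intro mult_right_mono s1 P_nonneg)
        moreover have "X * Y\<^sup>2 * wint (\<lambda>x. om x * \<xi> x) (gy \<phi>) \<le> S * wint \<xi> (gy \<phi>)"
          using S0 om \<xi> by (intro mult_mono s1 o2 wint_nonneg) auto
        moreover have "t * (X * Y\<^sup>2 * (L * W) * wint om (gy \<phi>)) \<le> t * (S * gy1)"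
          using S0 om t by (intro mult_left_mono mult_mono s1 o1 wint_nonneg) auto
        ultimately show ?thesis by (simp add: algebra_simps)
      qed
      also have "\<dots> \<le> S * (P \<phi> + t * dir \<phi> \<phi>)"
      proof -
        have "S * wint om (gm \<phi>) \<ge> 0" "t * (S * gx1) \<ge> 0" using S0 P_nonneg(3) t g1 by auto
        then show ?thesis unfolding P_def dg by (simp add: algebra_simps)
      qed
      finally have "4 * Cw * (W\<^sup>2 * wint om (gx \<phi>) + X * Y\<^sup>2 * (wint (\<lambda>x. om x * \<xi> x) (gy \<phi>) + t * L * W * wint om (gy \<phi>)))
          \<le> 4 * Cw * (S * (P \<phi> + t * dir \<phi> \<phi>))" using Cw by (intro mult_left_mono) auto
      also have "\<dots> = (4 * Cw * S) * (P \<phi> + t * dir \<phi> \<phi>)" by simp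
      also have "\<dots> \<le> C * (P \<phi> + t * dir \<phi> \<phi>)"
        using P_nonneg(4)[of \<phi>] t dir_nonneg[of \<phi>] by (intro mult_right_mono C) auto
      finally show "4 * Cw * (W\<^sup>2 * wint om (gx \<phi>) + X * Y\<^sup>2 * (wint (\<lambda>x. om x * \<xi> x) (gy \<phi>) + t * L * W * wint om (gy \<phi>)))
          \<le> C * (P \<phi> + t * dir \<phi> \<phi>)" .
    qed simp
    finally show "wint om (gm (\<delta> t \<phi>)) \<le> t\<^sup>2 * (C * (P \<phi> + t * dir \<phi> \<phi>))" .
    have "(nrm (lebesgue_on \<Omega>) (\<delta> t \<phi>))\<^sup>2 = wint (\<lambda>_. 1) (gm (\<lambda>p. \<phi> (\<Psi> t p) - \<phi> p))"
      using nrm_eq_gm[OF op \<delta>_TF[OF t \<phi>]] by (simp add: \<delta>_def)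
    also have "\<dots> \<le> t\<^sup>2 * (4 * 1 * (W\<^sup>2 * wint (\<lambda>_. 1) (gx \<phi>)
       + X * Y\<^sup>2 * (wint (\<lambda>x. 1 * \<xi> x) (gy \<phi>) + t * L * W * wint (\<lambda>_. 1) (gy \<phi>))))"
      by (rule pull_difference[OF _ _ _ _ t \<phi>]) auto
    also have "\<dots> \<le> t\<^sup>2 * (C * dir \<phi> \<phi>)"
    proof (intro mult_left_mono)
      have "t * L * W \<le> 1 * L * W" using t t0 AXLW by (intro mult_right_mono) auto
      then have "t * L * W * gy1 \<le> L * W * gy1" using mult_right_mono[OF _ g1(2), of "t * L * W" "L * W"] by simp
      then have "X * Y\<^sup>2 * (wint (\<lambda>x. 1 * \<xi> x) (gy \<phi>) + t * L * W * gy1) \<le> X * Y\<^sup>2 * (X * gy1 + L * W * gy1)"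
        using o3 XY by (intro mult_left_mono add_mono) auto
      also have "\<dots> \<le> S * gy1"
      proof -
        have "X * Y\<^sup>2 * (X + L * W) \<le> S" using XY zero_le_power2[of W] unfolding S_def distrib_left by simp
        then have "X * Y\<^sup>2 * (X + L * W) * gy1 \<le> S * gy1" using g1 by (intro mult_right_mono) auto
        then show ?thesis by (simp add: algebra_simps)
      qed
      finally have 1: "X * Y\<^sup>2 * (wint (\<lambda>x. 1 * \<xi> x) (gy \<phi>) + t * L * W * gy1) \<le> S * gy1" .
      have "W\<^sup>2 * gx1 \<le> S * gx1" using XY AXLW g1 by (intro mult_right_mono) (auto simp: S_def)
      then have "4 * 1 * (W\<^sup>2 * gx1 + X * Y\<^sup>2 * (wint (\<lambda>x. 1 * \<xi> x) (gy \<phi>) + t * L * W * gy1)) \<le> (4 * S) * dir \<phi> \<phi>"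
        using 1 unfolding dg by (simp add: algebra_simps)
      also have "\<dots> \<le> C * dir \<phi> \<phi>" by (intro mult_right_mono C dir_nonneg)
      finally show "4 * 1 * (W\<^sup>2 * wint (\<lambda>_. 1) (gx \<phi>)
         + X * Y\<^sup>2 * (wint (\<lambda>x. 1 * \<xi> x) (gy \<phi>) + t * L * W * wint (\<lambda>_. 1) (gy \<phi>))) \<le> C * dir \<phi> \<phi>"
        unfolding gx1_def gy1_def .
    qed simp
    finally show "(nrm (lebesgue_on \<Omega>) (\<delta> t \<phi>))\<^sup>2 \<le> t\<^sup>2 * (C * dir \<phi> \<phi>)" .
  qed
  then show ?thesis using C(1) by blast
qed

text \<open>Makes \<open>\<delta> t\<close> admissible as the map in
  \<open>friedrichs_form_limit\<close>. The upper bound for the energy along the flow suffices, as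
  its first-order terms are bounded multiples of the energy itself.\<close>

lemma \<delta>_bounded:
  "\<exists>t1>0. t1 \<le> t0 \<and> (\<exists>K. \<forall>t \<phi>. 0 \<le> t \<longrightarrow> t \<le> t1 \<longrightarrow> \<phi> \<in> test_functions \<Omega> \<longrightarrow> hnorm \<Omega> (\<delta> t \<phi>) \<le> K * hnorm \<Omega> \<phi>)"
proof -
  obtain C1 t1 where C1: "C1 \<ge> 0" "t1 > 0" "t1 \<le> t0"
    "\<And>t \<phi>. 0 \<le> t \<Longrightarrow> t \<le> t1 \<Longrightarrow> \<phi> \<in> test_functions \<Omega> \<Longrightarrow>
     dir (\<lambda>p. \<phi> (\<Psi> t p)) (\<lambda>p. \<phi> (\<Psi> t p)) \<le> dir \<phi> \<phi> - t * (wint (\<lambda>x. 2 * a x - \<mu> x - \<gamma> x) (gx \<phi>) + wint (\<lambda>x. 3 / 2 * \<xi> x - \<gamma> x) (gy \<phi>))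
       + C1 * t\<^sup>2 * dir \<phi> \<phi>"
    using energy_pull[OF \<mu> lip_\<mu> \<xi>0] by blast
  have Mm: "Mm \<ge> 0" using \<mu>(1,2)[of 0] by linarith
  have Lm: "Lm \<ge> 0" using lip_\<mu>[of 0 1] by (auto intro: order_trans[OF abs_ge_zero])
  have c\<mu>: "continuous_on UNIV \<mu>"
    by (rule lipschitz_on_continuous_on[of Lm]) (use lip_\<mu> Lm in \<open>auto intro!: lipschitz_onI simp: dist_real_def\<close>)
  have c\<gamma>: "continuous_on UNIV \<gamma>" unfolding \<gamma>_def by (intro continuous_intros cont)
  define B where "B = Mm + (A + dd * X)"
  have B0: "B \<ge> 0" using Mm AXLW by (simp add: B_def)
  define Q where "Q = 2 + B + C1"
  have "hnorm \<Omega> (\<delta> t \<phi>) \<le> (sqrt Q + 1) * hnorm \<Omega> \<phi>" if t: "0 \<le> t" "t \<le> t1" and \<phi>: "\<phi> \<in> test_functions \<Omega>" for t \<phi>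
  proof -
    have tt: "t \<le> t0" "t \<le> 1" using t C1 t0 by auto
    let ?\<phi>t = "\<lambda>p. \<phi> (\<Psi> t p)"
    have \<phi>t: "?\<phi>t \<in> test_functions \<Omega>" by (rule pull_TF[OF t(1) tt(1) \<phi>])
    have b1: "- B * wint (\<lambda>_. 1) (gx \<phi>) \<le> wint (\<lambda>x. 2 * a x - \<mu> x - \<gamma> x) (gx \<phi>)"
    proof -
      have "wint (\<lambda>_. - B) (gx \<phi>) \<le> wint (\<lambda>x. 2 * a x - \<mu> x - \<gamma> x) (gx \<phi>)"
      proof (rule wint_mono[OF g_cc(1)[OF \<phi>]])
        show "- B \<le> 2 * a x - \<mu> x - \<gamma> x" for x using a[of x] \<mu>(2)[of x] \<gamma>_bound[of x] unfolding B_def by linarith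
      qed (intro continuous_intros cont c\<mu> c\<gamma> g_nonneg)+
      then show ?thesis using wint_const[of "- B" "gx \<phi>"] by simp
    qed
    have b2: "- B * wint (\<lambda>_. 1) (gy \<phi>) \<le> wint (\<lambda>x. 3 / 2 * \<xi> x - \<gamma> x) (gy \<phi>)"
    proof -
      have "wint (\<lambda>_. - B) (gy \<phi>) \<le> wint (\<lambda>x. 3 / 2 * \<xi> x - \<gamma> x) (gy \<phi>)"
      proof (rule wint_mono[OF g_cc(2)[OF \<phi>]])
        show "- B \<le> 3 / 2 * \<xi> x - \<gamma> x" for x using \<xi>[of x] Mm \<gamma>_bound[of x] unfolding B_def by linarith
      qed (intro continuous_intros cont c\<mu> c\<gamma> g_nonneg)+
      then show ?thesis using wint_const[of "- B" "gy \<phi>"] by simp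
    qed
    have "- B * dir \<phi> \<phi> \<le> wint (\<lambda>x. 2 * a x - \<mu> x - \<gamma> x) (gx \<phi>) + wint (\<lambda>x. 3 / 2 * \<xi> x - \<gamma> x) (gy \<phi>)"
      using b1 b2 unfolding dir_eq[OF \<phi>] distrib_left by linarith
    then have "t * (- B * dir \<phi> \<phi>) \<le> t * (wint (\<lambda>x. 2 * a x - \<mu> x - \<gamma> x) (gx \<phi>) + wint (\<lambda>x. 3 / 2 * \<xi> x - \<gamma> x) (gy \<phi>))"
      using t by (intro mult_left_mono) auto
    moreover have "t * (B * dir \<phi> \<phi>) \<le> 1 * (B * dir \<phi> \<phi>)" using tt B0 dir_nonneg[of \<phi>] by (intro mult_right_mono) auto
    moreover have "C1 * t\<^sup>2 * dir \<phi> \<phi> \<le> C1 * 1 * dir \<phi> \<phi>"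
      using C1(1) tt t dir_nonneg[of \<phi>] by (intro mult_right_mono mult_left_mono power_le_one) auto
    ultimately have "dir ?\<phi>t ?\<phi>t \<le> dir \<phi> \<phi> + B * dir \<phi> \<phi> + C1 * dir \<phi> \<phi>"
      using C1(4)[OF t \<phi>] by (simp add: algebra_simps)
    then have 1: "dir ?\<phi>t ?\<phi>t \<le> Q * dir \<phi> \<phi>"
      using dir_nonneg[of \<phi>] by (simp add: Q_def algebra_simps)
    have 2: "(nrm (lebesgue_on \<Omega>) ?\<phi>t)\<^sup>2 \<le> Q * (nrm (lebesgue_on \<Omega>) \<phi>)\<^sup>2"
    proof -
      have "(nrm (lebesgue_on \<Omega>) ?\<phi>t)\<^sup>2 \<le> 2 * (nrm (lebesgue_on \<Omega>) \<phi>)\<^sup>2"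
        using mass_upper[OF \<phi> t(1) tt(1)] by (simp add: nrm_eq_gm[OF op \<phi>] nrm_eq_gm[OF op \<phi>t])
      also have "\<dots> \<le> Q * (nrm (lebesgue_on \<Omega>) \<phi>)\<^sup>2" using B0 C1(1) by (intro mult_right_mono) (auto simp: Q_def)
      finally show ?thesis .
    qed
    have "(hnorm \<Omega> ?\<phi>t)\<^sup>2 \<le> (sqrt Q * hnorm \<Omega> \<phi>)\<^sup>2"
      using 1 2 B0 C1(1) unfolding power_mult_distrib hnorm_square by (simp add: Q_def distrib_left)
    then have 3: "hnorm \<Omega> ?\<phi>t \<le> sqrt Q * hnorm \<Omega> \<phi>"
      using B0 C1(1) by (intro power2_le_imp_le[OF _ mult_nonneg_nonneg]) (auto simp: hnorm_nonneg Q_def)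
    have "hnorm \<Omega> (\<lambda>p. ?\<phi>t p + (-1) * \<phi> p) \<le> hnorm \<Omega> ?\<phi>t + hnorm \<Omega> (\<lambda>p. (-1) * \<phi> p)"
      by (rule hnorm_triangle[OF op \<phi>t test_function_cmult[OF \<phi>]])
    also have "hnorm \<Omega> (\<lambda>p. (-1) * \<phi> p) = hnorm \<Omega> \<phi>" by (subst hnorm_cmult[OF \<phi>]) simp
    finally show ?thesis using 3 by (simp add: \<delta>_def algebra_simps)
  qed
  then show ?thesis using C1(2,3) by blast
qed

end

section \<open>From test functions to solutions\<close>

lemma nrm_tendsto:
  assumes f: "\<And>n. f n \<in> l2 M" "f0 \<in> l2 M" "(\<lambda>n. nrm M (\<lambda>p. f n p - f0 p)) \<longlonglongrightarrow> 0"
  shows "(\<lambda>n. nrm M (f n)) \<longlonglongrightarrow> nrm M f0"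
proof -
  have "(\<lambda>n. nrm M (f n) - nrm M f0) \<longlonglongrightarrow> 0"
  proof (rule Lim_null_comparison[OF _ f(3)])
    have "norm (nrm M (f n) - nrm M f0) \<le> nrm M (\<lambda>p. f n p - f0 p)" for n
      using nrm_triangle[OF l2_diff[OF f(1)[of n] f(2)] f(2)] nrm_triangle[OF l2_diff[OF f(2) f(1)[of n]] f(1)[of n]]
      by (simp add: nrm_minus_commute[of M f0])
    then show "\<forall>\<^sub>F n in sequentially. norm (nrm M (f n) - nrm M f0) \<le> nrm M (\<lambda>p. f n p - f0 p)" by simp
  qed
  then show ?thesis by (simp add: LIM_zero_iff)
qed

text \<open>For \<open>w \<le> F\<close> the claim follows from \<open>E \<ge> 1\<close>. Otherwise
  \<open>F\<^sup>2\<close> is at most \<open>sqrt E * F * w\<close>, and one factor \<open>w\<close>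
  cancels.\<close>

lemma quadratic_absorption:
  fixes c A1 A2 E F w :: real
  assumes c: "c > 0" and A: "A1 \<ge> 0" "A2 \<ge> 0" and E: "E \<ge> 1" and F: "F \<ge> 0" and w: "w \<ge> 0"
    and le: "c / 2 * w\<^sup>2 \<le> A1 * F\<^sup>2 + A2 * (sqrt E * F * w)"
  shows "w \<le> (1 + 2 * (A1 + A2) / c) * sqrt E * F"
proof (cases "w \<le> F")
  case True
  have "1 * F \<le> (1 + 2 * (A1 + A2) / c) * sqrt E * F"
  proof (rule mult_right_mono[OF _ F])
    have "1 * 1 \<le> (1 + 2 * (A1 + A2) / c) * sqrt E" using c A E by (intro mult_mono) auto
    then show "1 \<le> (1 + 2 * (A1 + A2) / c) * sqrt E" by simp
  qed
  then show ?thesis using True by simp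
next
  case False
  then have w0: "w > 0" "F \<le> w" using F by auto
  have sE: "sqrt E \<ge> 1" using E by simp
  have "F * F \<le> (sqrt E * F) * w"
  proof -
    have "F * F \<le> F * w" using w0 F by (intro mult_left_mono) auto
    also have "\<dots> \<le> sqrt E * (F * w)" using mult_right_mono[OF sE, of "F * w"] F w by simp
    finally show ?thesis by (simp add: mult_ac)
  qed
  then have "A1 * F\<^sup>2 \<le> A1 * (sqrt E * F * w)" using A by (intro mult_left_mono) (auto simp: power2_eq_square)
  then have "(c / 2 * w) * w \<le> ((A1 + A2) * (sqrt E * F)) * w" using le by (simp add: power2_eq_square algebra_simps)
  then have "c / 2 * w \<le> (A1 + A2) * (sqrt E * F)" using w0 mult_le_cancel_right_pos by blast
  then have "w \<le> 2 * (A1 + A2) / c * (sqrt E * F)" using c by (simp add: field_simps)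
  also have "\<dots> \<le> (1 + 2 * (A1 + A2) / c) * (sqrt E * F)" using F E by (intro mult_right_mono) auto
  finally show ?thesis by (simp add: mult_ac)
qed

context repulsive
begin

definition wsm :: "(real \<times> 'b \<Rightarrow> complex) \<Rightarrow> real \<times> 'b \<Rightarrow> complex" where
  "wsm f = (\<lambda>p. complex_of_real (ws (fst p)) * f p)"

abbreviation "N \<equiv> nrm (lebesgue_on \<Omega>)"
abbreviation "R \<equiv> rip (lebesgue_on \<Omega>)"
abbreviation "H2 \<equiv> l2 (lebesgue_on \<Omega>)"

lemma ws_measurable: "(\<lambda>p::real \<times> 'b. complex_of_real (ws (fst p))) \<in> borel_measurable (lebesgue_on \<Omega>)"
proof -
  have "continuous_on UNIV (\<lambda>p::real \<times> 'b. complex_of_real (ws (fst p)))"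
    by (intro continuous_intros continuous_on_fst_comp ws)
  then show ?thesis by (intro borel_measurable_lebesgue_on continuous_UNIV_borel)
qed

lemma wsm_l2: "f \<in> H2 \<Longrightarrow> wsm f \<in> H2" "f \<in> H2 \<Longrightarrow> N (wsm f) \<le> N f"
proof -
  assume f: "f \<in> H2"
  have b: "cmod (complex_of_real (ws (fst p))) \<le> 1" for p :: "real \<times> 'b" using ws by simp
  show "wsm f \<in> H2" unfolding wsm_def by (rule l2_mult(1)[OF f ws_measurable b])
  show "N (wsm f) \<le> N f" unfolding wsm_def using l2_mult(2)[OF f ws_measurable b] by simp
qed

lemma rip_wsm: "R (wsm f) g = R f (wsm g)"
  unfolding rip_def wsm_def by (rule Bochner_Integration.integral_cong) (simp_all add: inner_complex_def algebra_simps)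

lemma nrm_wsm: "\<phi> \<in> test_functions \<Omega> \<Longrightarrow> (N (wsm \<phi>))\<^sup>2 = wint om (gm \<phi>)"
proof -
  assume \<phi>: "\<phi> \<in> test_functions \<Omega>"
  have "(N (wsm \<phi>))\<^sup>2 = (\<integral>p. om (fst p) * gm \<phi> p \<partial>lebesgue_on \<Omega>)"
    unfolding nrm_square wsm_def om_def gm_def
    by (rule Bochner_Integration.integral_cong) (auto simp: norm_mult power_mult_distrib)
  also have "\<dots> = wint om (gm \<phi>)" unfolding wint_def
    using wint_cc[OF g_cc(3)[OF \<phi>] om(1)] test_function_outside[OF \<phi>]
    by (intro lebesgue_on_integral(1)[OF op] cc_borel) (auto simp: gm_def)
  finally show ?thesis .
qed

lemma nrm_wsm_mlt: "\<phi> \<in> test_functions \<Omega> \<Longrightarrow> N (wsm (mlt \<phi>)) \<le> Bm * N (wsm \<phi>)" "\<phi> \<in> test_functions \<Omega> \<Longrightarrow> N (mlt \<phi>) \<le> Bm * N \<phi>"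
proof -
  assume \<phi>: "\<phi> \<in> test_functions \<Omega>"
  have mm: "(\<lambda>p::real \<times> 'b. complex_of_real (m (fst p))) \<in> borel_measurable (lebesgue_on \<Omega>)"
  proof -
    have "continuous_on UNIV (\<lambda>p::real \<times> 'b. complex_of_real (m (fst p)))"
      by (intro continuous_intros continuous_on_fst_comp smooth_continuous[OF smooth_m])
    then show ?thesis by (intro borel_measurable_lebesgue_on continuous_UNIV_borel)
  qed
  have b: "cmod (complex_of_real (m (fst p))) \<le> Bm" for p :: "real \<times> 'b" unfolding norm_of_real m_def by (rule Bm(1))
  have l: "\<phi> \<in> H2" by (rule test_function_l2[OF op \<phi>])
  show "N (mlt \<phi>) \<le> Bm * N \<phi>" unfolding mlt_def by (rule l2_mult(2)[OF l mm b])
  have e: "wsm (mlt \<phi>) = (\<lambda>p. complex_of_real (m (fst p)) * wsm \<phi> p)" by (simp add: wsm_def mlt_def fun_eq_iff)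
  show "N (wsm (mlt \<phi>)) \<le> Bm * N (wsm \<phi>)" unfolding e by (rule l2_mult(2)[OF wsm_l2(1)[OF l] mm b])
qed

lemma a_priori:
  "\<exists>C>0. \<forall>E \<epsilon> f u. E \<ge> E0 \<longrightarrow> 0 < \<epsilon> \<longrightarrow> \<epsilon> \<le> 1 \<longrightarrow> f \<in> H2 \<longrightarrow>
     (u, \<lambda>p. wsm f p + Complex E \<epsilon> * u p) \<in> neg_dirichlet_laplacian \<Omega> \<longrightarrow>
     u \<in> H2 \<and> N (wsm u) \<le> C * sqrt E * N f"
proof -
  obtain K t1 where K: "K \<ge> 0" and t1: "t1 > 0" "t1 \<le> t0" and key:
    "\<And>t E \<phi>. 0 < t \<Longrightarrow> t \<le> t1 \<Longrightarrow> E \<ge> E0 \<Longrightarrow> \<phi> \<in> test_functions \<Omega> \<Longrightarrow>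
     c * P \<phi> \<le> - (2 / t) * (dir \<phi> (\<delta> t \<phi>) - E * R \<phi> (\<delta> t \<phi>)) + (dir \<phi> (mlt \<phi>) - E * R \<phi> (mlt \<phi>))
       + E / t * (N (\<delta> t \<phi>))\<^sup>2 + K * (1 + E) * t * (hnorm \<Omega> \<phi>)\<^sup>2"
    using key_inequality by blast
  obtain C where C: "C > 0" and sb:
    "\<And>t \<phi>. 0 \<le> t \<Longrightarrow> t \<le> t0 \<Longrightarrow> \<phi> \<in> test_functions \<Omega> \<Longrightarrow> wint om (gm (\<delta> t \<phi>)) \<le> t\<^sup>2 * (C * (P \<phi> + t * dir \<phi> \<phi>))"
    "\<And>t \<phi>. 0 \<le> t \<Longrightarrow> t \<le> t0 \<Longrightarrow> \<phi> \<in> test_functions \<Omega> \<Longrightarrow> (N (\<delta> t \<phi>))\<^sup>2 \<le> t\<^sup>2 * (C * dir \<phi> \<phi>)"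
    using shift_bounds by blast
  obtain t2 K2 where t2: "t2 > 0" "t2 \<le> t0" and db:
    "\<And>t \<phi>. 0 \<le> t \<Longrightarrow> t \<le> t2 \<Longrightarrow> \<phi> \<in> test_functions \<Omega> \<Longrightarrow> hnorm \<Omega> (\<delta> t \<phi>) \<le> K2 * hnorm \<Omega> \<phi>"
    using \<delta>_bounded by blast
  have Bm0: "Bm \<ge> 0" using Bm(1)[of 0] by linarith
  \<comment> \<open>\<open>A1\<close> is the price of absorbing the weighted term of the flow into
    half of \<open>c * P\<close>. In \<open>A2\<close>, \<open>4 * sqrt C\<close> stems from the
    \<open>\<epsilon>\<close> term of the flow and \<open>2 * Bm\<close> from the two terms of the
    multiplier.\<close>
  define A1 where "A1 = 2 * C / c"
  define A2 where "A2 = 4 * sqrt C + 2 * Bm"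
  have A: "A1 \<ge> 0" "A2 \<ge> 0" using C c Bm0 by (auto simp: A1_def A2_def)
  have "u \<in> H2 \<and> N (wsm u) \<le> (1 + 2 * (A1 + A2) / c) * sqrt E * N f"
    if E: "E \<ge> E0" and eps: "0 < \<epsilon>" "\<epsilon> \<le> 1" and f: "f \<in> H2"
      and res: "(u, \<lambda>p. wsm f p + Complex E \<epsilon> * u p) \<in> neg_dirichlet_laplacian \<Omega>" for E \<epsilon> f u
  proof -
    have E1: "E \<ge> 1" using E E0 by simp
    define g where "g = wsm f"
    define f' where "f' = (\<lambda>p. g p + Complex E \<epsilon> * u p)"
    define F where "F = N f"
    define U where "U = N u"
    define w0 where "w0 = N (wsm u)"
    have res': "(u, f') \<in> neg_dirichlet_laplacian \<Omega>" using res by (simp add: f'_def g_def)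
    obtain \<phi> where u: "u \<in> H2" and \<phi>0: "\<forall>n. \<phi> n \<in> test_functions \<Omega>"
      and lim: "(\<lambda>n. N (\<lambda>p. \<phi> n p - u p)) \<longlonglongrightarrow> 0" and Kh0: "\<exists>K. \<forall>n. hnorm \<Omega> (\<phi> n) \<le> K"
      and T0: "\<forall>T K. (\<forall>x\<in>test_functions \<Omega>. T x \<in> test_functions \<Omega> \<and> hnorm \<Omega> (T x) \<le> K * hnorm \<Omega> x) \<longrightarrow>
       (\<forall>x\<in>test_functions \<Omega>. \<forall>y\<in>test_functions \<Omega>. T (\<lambda>p. x p - y p) = (\<lambda>p. T x p - T y p)) \<longrightarrow>
       (\<lambda>n. dir (\<phi> n) (T (\<phi> n)) - R f' (T (\<phi> n))) \<longlonglongrightarrow> 0"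
      using friedrichs_form_limit[OF op res'] by (elim exE conjE) (rule that, assumption+, rule exI)
    have \<phi>: "\<And>n. \<phi> n \<in> test_functions \<Omega>" using \<phi>0 by blast
    obtain Kh where Kh: "\<And>n. hnorm \<Omega> (\<phi> n) \<le> Kh" using Kh0 by blast
    have T: "(\<lambda>n. dir (\<phi> n) (T (\<phi> n)) - R f' (T (\<phi> n))) \<longlonglongrightarrow> 0"
      if "\<And>x. x \<in> test_functions \<Omega> \<Longrightarrow> T x \<in> test_functions \<Omega> \<and> hnorm \<Omega> (T x) \<le> K * hnorm \<Omega> x"
        "\<And>x y. x \<in> test_functions \<Omega> \<Longrightarrow> y \<in> test_functions \<Omega> \<Longrightarrow> T (\<lambda>p. x p - y p) = (\<lambda>p. T x p - T y p)" for T K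
      by (rule T0[rule_format]) (use that in blast)+
    have g: "g \<in> H2" unfolding g_def by (rule wsm_l2(1)[OF f])
    have f'l: "f' \<in> H2" unfolding f'_def by (intro l2_add g l2_cmult u)
    have \<phi>l: "\<phi> n \<in> H2" for n by (rule test_function_l2[OF op \<phi>])
    have iu: "(\<lambda>p. \<i> * u p) \<in> H2" by (rule l2_cmult[OF u])
    have n0: "F \<ge> 0" "U \<ge> 0" "w0 \<ge> 0" by (auto simp: F_def U_def w0_def nrm_nonneg)
    have Rg: "\<bar>R g v\<bar> \<le> F * N (wsm v)" if "v \<in> H2" for v
      unfolding g_def F_def rip_wsm by (rule rip_le[OF f wsm_l2(1)[OF that]])
    have fsplit: "R f' v = R g v + E * R u v + \<epsilon> * R (\<lambda>p. \<i> * u p) v" if v: "v \<in> H2" for v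
    proof -
      have e: "f' = (\<lambda>p. g p + (complex_of_real E * u p + complex_of_real \<epsilon> * (\<i> * u p)))"
        by (simp add: f'_def fun_eq_iff complex_eq_iff)
      show ?thesis unfolding e using v g u iu by (simp add: rip_add rip_real_mult l2_cmult l2_add)
    qed
    define D where "D n = dir (\<phi> n) (\<phi> n)" for n
    have Dlim: "D \<longlonglongrightarrow> R g u + E * U\<^sup>2"
    proof -
      have "(\<lambda>n. dir (\<phi> n) (\<phi> n) - R f' (\<phi> n)) \<longlonglongrightarrow> 0" by (rule T[where T = "\<lambda>x. x" and K = 1]) auto
      moreover have "(\<lambda>n. R f' (\<phi> n)) \<longlonglongrightarrow> R f' u" by (rule rip_tendsto_right[OF f'l \<phi>l u lim])
      ultimately have "(\<lambda>n. (dir (\<phi> n) (\<phi> n) - R f' (\<phi> n)) + R f' (\<phi> n)) \<longlonglongrightarrow> 0 + R f' u" by (rule tendsto_add)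
      then show ?thesis unfolding D_def using fsplit[OF u] by (simp add: U_def nrm_square_rip rip_imag)
    qed
    \<comment> \<open>Testing with \<open>\<i>\<close> times the solution: the energy and the
      \<open>E\<close> term contribute no real part, which leaves
      \<open>\<epsilon> * U\<^sup>2\<close> against the data. The weight contained in
      \<open>g\<close> is moved onto \<open>u\<close>.\<close>
    have eU: "\<epsilon> * U\<^sup>2 \<le> F * w0"
    proof -
      have "(\<lambda>n. dir (\<phi> n) (\<lambda>p. \<i> * \<phi> n p) - R f' (\<lambda>p. \<i> * \<phi> n p)) \<longlonglongrightarrow> 0"
        by (rule T[where T = "\<lambda>x p. \<i> * x p" and K = 1])
          (auto simp: test_function_cmult hnorm_cmult right_diff_distrib)
      moreover have "dir (\<phi> n) (\<lambda>p. \<i> * \<phi> n p) = 0" for n by (subst dir_sym) (rule dir_imag[OF \<phi>])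
      moreover have "(\<lambda>n. R f' (\<lambda>p. \<i> * \<phi> n p)) \<longlonglongrightarrow> R f' (\<lambda>p. \<i> * u p)"
        by (rule rip_tendsto_right[OF f'l l2_cmult[OF \<phi>l] iu nrm_cmult_tendsto[OF lim]])
      ultimately have "(\<lambda>n. 0 - R f' (\<lambda>p. \<i> * \<phi> n p)) \<longlonglongrightarrow> 0" "(\<lambda>n. 0 - R f' (\<lambda>p. \<i> * \<phi> n p)) \<longlonglongrightarrow> 0 - R f' (\<lambda>p. \<i> * u p)"
        by (simp_all only: tendsto_diff[OF tendsto_const])
      then have "R f' (\<lambda>p. \<i> * u p) = 0" using LIMSEQ_unique by fastforce
      then have "\<epsilon> * R (\<lambda>p. \<i> * u p) (\<lambda>p. \<i> * u p) = - R g (\<lambda>p. \<i> * u p)"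
        using fsplit[OF iu] rip_imag[of "lebesgue_on \<Omega>" u] by (simp add: rip_commute[of _ u])
      also have "\<dots> \<le> F * N (wsm (\<lambda>p. \<i> * u p))" using Rg[OF iu] by (simp add: abs_le_iff)
      also have "wsm (\<lambda>p. \<i> * u p) = (\<lambda>p. \<i> * wsm u p)" by (simp add: wsm_def mult.left_commute)
      also have "N (\<lambda>p. \<i> * wsm u p) = w0" by (simp add: nrm_cmult w0_def)
      finally show ?thesis by (simp add: U_def nrm_cmult flip: nrm_square_rip)
    qed
    define wn where "wn n = N (wsm (\<phi> n))" for n
    have wlim: "wn \<longlonglongrightarrow> w0" unfolding wn_def w0_def
    proof (rule nrm_tendsto[OF wsm_l2(1)[OF \<phi>l] wsm_l2(1)[OF u]], rule tendsto_sandwich[OF _ _ tendsto_const lim])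
      have "N (\<lambda>p. wsm (\<phi> n) p - wsm u p) \<le> N (\<lambda>p. \<phi> n p - u p)" for n
        using wsm_l2(2)[OF l2_diff[OF \<phi>l[of n] u]] by (simp add: wsm_def right_diff_distrib)
      then show "\<forall>\<^sub>F n in sequentially. N (\<lambda>p. wsm (\<phi> n) p - wsm u p) \<le> N (\<lambda>p. \<phi> n p - u p)" by simp
    qed (simp add: nrm_nonneg)
    define Nn where "Nn n = N (\<phi> n)" for n
    have Nlim: "Nn \<longlonglongrightarrow> U" unfolding Nn_def U_def by (rule nrm_tendsto[OF \<phi>l u lim])
    define dn where "dn n = N (\<lambda>p. \<phi> n p - u p)" for n
    have dlim: "dn \<longlonglongrightarrow> 0" unfolding dn_def by (rule lim)
    have mT: "(\<lambda>n. dir (\<phi> n) (mlt (\<phi> n)) - R f' (mlt (\<phi> n))) \<longlonglongrightarrow> 0"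
    proof (rule T[where T = mlt and K = "2 * Bm"])
      show "mlt x \<in> test_functions \<Omega> \<and> hnorm \<Omega> (mlt x) \<le> 2 * Bm * hnorm \<Omega> x" if "x \<in> test_functions \<Omega>" for x
      proof
        show "mlt x \<in> test_functions \<Omega>" by (rule mlt_TF[OF that])
        show "hnorm \<Omega> (mlt x) \<le> 2 * Bm * hnorm \<Omega> x" unfolding mlt_def
          by (rule multiplier_bounded[OF op that smooth_m, of m']) (use m' Bm in \<open>auto simp: m_def[abs_def]\<close>)
      qed
    qed (simp add: mlt_def right_diff_distrib)
    define S where "S = R g u + E * U\<^sup>2"
    define K3 where "K3 = c / 2 * S + E * C * S + K * (1 + E) * Kh\<^sup>2"
    define R0 where "R0 = A1 * F\<^sup>2 + 2 * (\<epsilon> * U * sqrt (C * S)) + F * Bm * w0 + \<epsilon> * U * Bm * U"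
    \<comment> \<open>Here \<open>t\<close> is fixed and \<open>n\<close> tends to infinity. The
      residual of the increment gets divided by \<open>t\<close>, so the limit in \<open>n\<close>
      has to precede the limit in \<open>t\<close>.\<close>
    have step: "c / 2 * w0\<^sup>2 \<le> R0 + t * K3" if t: "0 < t" "t \<le> min t1 t2" for t
    proof -
      have tt: "0 \<le> t" "t \<le> t0" "t \<le> t1" "t \<le> t2" using t t1 by auto
      have \<delta>T: "\<delta> t (\<phi> n) \<in> test_functions \<Omega>" for n by (rule \<delta>_TF[OF tt(1,2) \<phi>])
      have \<delta>l: "\<delta> t (\<phi> n) \<in> H2" for n by (rule test_function_l2[OF op \<delta>T])
      have ml: "mlt (\<phi> n) \<in> H2" for n by (rule test_function_l2[OF op mlt_TF[OF \<phi>]])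
      define e where "e n = dir (\<phi> n) (\<delta> t (\<phi> n)) - R f' (\<delta> t (\<phi> n))" for n
      define e' where "e' n = dir (\<phi> n) (mlt (\<phi> n)) - R f' (mlt (\<phi> n))" for n
      have elim: "e \<longlonglongrightarrow> 0" unfolding e_def
      proof (rule T[where T = "\<delta> t" and K = K2])
        show "\<delta> t x \<in> test_functions \<Omega> \<and> hnorm \<Omega> (\<delta> t x) \<le> K2 * hnorm \<Omega> x" if "x \<in> test_functions \<Omega>" for x
          using \<delta>_TF[OF tt(1,2) that] db[OF tt(1,4) that] by blast
      qed (simp add: \<delta>_def fun_eq_iff)
      have e'lim: "e' \<longlonglongrightarrow> 0" unfolding e'_def by (rule mT)
      \<comment> \<open>The test function multiplies \<open>\<phi> n\<close> on the left-hand side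
        but \<open>u\<close> in \<open>f'\<close>; the mismatch costs \<open>E * dn n\<close>, which
        vanishes in the limit.\<close>
      have split: "\<bar>dir (\<phi> n) v - E * R (\<phi> n) v\<bar> \<le> \<bar>dir (\<phi> n) v - R f' v\<bar> + F * N (wsm v) + \<epsilon> * U * N v + E * dn n * N v"
        if v: "v \<in> H2" for n v
      proof -
        have "dir (\<phi> n) v - E * R (\<phi> n) v = (dir (\<phi> n) v - R f' v) + R g v + \<epsilon> * R (\<lambda>p. \<i> * u p) v - E * R (\<lambda>p. \<phi> n p - u p) v"
          unfolding fsplit[OF v] rip_diff(1)[OF \<phi>l[of n] u v] right_diff_distrib by simp
        moreover have "\<bar>\<epsilon> * R (\<lambda>p. \<i> * u p) v\<bar> \<le> \<epsilon> * (U * N v)"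
          using rip_le[OF iu v] eps by (simp add: abs_mult nrm_cmult U_def)
        moreover have "\<bar>E * R (\<lambda>p. \<phi> n p - u p) v\<bar> \<le> E * (dn n * N v)"
          using rip_le[OF l2_diff[OF \<phi>l[of n] u] v] E1 by (simp add: abs_mult dn_def)
        ultimately show ?thesis using Rg[OF v] unfolding mult.assoc by linarith
      qed
      define rhs where "rhs n = 2 / t * \<bar>e n\<bar> + \<bar>e' n\<bar> + A1 * F\<^sup>2 + c / 2 * (t * D n) + 2 * (\<epsilon> * U * sqrt (C * D n))
        + 2 * (E * dn n * sqrt (C * D n)) + F * Bm * wn n + \<epsilon> * U * Bm * Nn n + E * dn n * Bm * Nn n + E * t * C * D n + K * (1 + E) * t * Kh\<^sup>2" for n
      have le: "c / 2 * (wn n)\<^sup>2 \<le> rhs n" for n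
      proof -
        have D0: "D n \<ge> 0" unfolding D_def by (rule dir_nonneg)
        have P0: "P (\<phi> n) \<ge> 0" by (rule P_nonneg)
        define s where "s = sqrt (C * (P (\<phi> n) + t * D n))"
        have s: "s \<ge> 0" "s\<^sup>2 = C * (P (\<phi> n) + t * D n)" using C P0 D0 tt by (auto simp: s_def)
        have d0: "dn n \<ge> 0" by (simp add: dn_def nrm_nonneg)
        have b1: "N (wsm (\<delta> t (\<phi> n))) \<le> t * s"
        proof (rule power2_le_imp_le)
          show "(N (wsm (\<delta> t (\<phi> n))))\<^sup>2 \<le> (t * s)\<^sup>2"
            using sb(1)[OF tt(1,2) \<phi>, of n] by (simp add: nrm_wsm[OF \<delta>T] power_mult_distrib s D_def)
        qed (use tt s in simp)
        have b2: "N (\<delta> t (\<phi> n)) \<le> t * sqrt (C * D n)"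
        proof (rule power2_le_imp_le)
          show "(N (\<delta> t (\<phi> n)))\<^sup>2 \<le> (t * sqrt (C * D n))\<^sup>2"
            using sb(2)[OF tt(1,2) \<phi>, of n] C D0 by (simp add: power_mult_distrib D_def)
        qed (use tt C D0 in simp)
        have "\<bar>dir (\<phi> n) (\<delta> t (\<phi> n)) - E * R (\<phi> n) (\<delta> t (\<phi> n))\<bar>
           \<le> \<bar>e n\<bar> + F * (t * s) + \<epsilon> * U * (t * sqrt (C * D n)) + E * dn n * (t * sqrt (C * D n))"
        proof -
          have "F * N (wsm (\<delta> t (\<phi> n))) \<le> F * (t * s)" using b1 n0 by (intro mult_left_mono) auto
          moreover have "\<epsilon> * U * N (\<delta> t (\<phi> n)) \<le> \<epsilon> * U * (t * sqrt (C * D n))" using b2 n0 eps by (intro mult_left_mono) auto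
          moreover have "E * dn n * N (\<delta> t (\<phi> n)) \<le> E * dn n * (t * sqrt (C * D n))" using b2 E1 d0 by (intro mult_left_mono) auto
          ultimately show ?thesis using split[OF \<delta>l, of n n] unfolding e_def by linarith
        qed
        then have "2 / t * \<bar>dir (\<phi> n) (\<delta> t (\<phi> n)) - E * R (\<phi> n) (\<delta> t (\<phi> n))\<bar>
           \<le> 2 / t * (\<bar>e n\<bar> + F * (t * s) + \<epsilon> * U * (t * sqrt (C * D n)) + E * dn n * (t * sqrt (C * D n)))"
          using t by (intro mult_left_mono) auto
        also have "\<dots> = 2 / t * \<bar>e n\<bar> + 2 * (F * s) + 2 * (\<epsilon> * U * sqrt (C * D n)) + 2 * (E * dn n * sqrt (C * D n))"
          using t by (simp add: field_simps)
        finally have x1: "2 / t * \<bar>dir (\<phi> n) (\<delta> t (\<phi> n)) - E * R (\<phi> n) (\<delta> t (\<phi> n))\<bar>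
          \<le> 2 / t * \<bar>e n\<bar> + 2 * (F * s) + 2 * (\<epsilon> * U * sqrt (C * D n)) + 2 * (E * dn n * sqrt (C * D n))" .
        have x2: "- (2 / t) * (dir (\<phi> n) (\<delta> t (\<phi> n)) - E * R (\<phi> n) (\<delta> t (\<phi> n))) \<le> 2 / t * \<bar>dir (\<phi> n) (\<delta> t (\<phi> n)) - E * R (\<phi> n) (\<delta> t (\<phi> n))\<bar>"
        proof -
          have "- (2 / t) * q \<le> 2 / t * \<bar>q\<bar>" for q :: real
            using mult_left_mono[OF abs_ge_minus_self[of q], of "2 / t"] t by simp
          then show ?thesis .
        qed
        \<comment> \<open>Young's inequality in the form of a completed square, balanced so that
          exactly half of \<open>c * P\<close> is consumed.\<close>
        have x3: "2 * (F * s) \<le> c / 2 * (P (\<phi> n) + t * D n) + A1 * F\<^sup>2"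
        proof -
          have "(c * s - 2 * C * F)\<^sup>2 / (2 * c * C) \<ge> 0" using c C by simp
          also have "(c * s - 2 * C * F)\<^sup>2 / (2 * c * C) = c / 2 * (s\<^sup>2 / C) + A1 * F\<^sup>2 - 2 * (F * s)"
            using c C by (simp add: A1_def power2_eq_square field_simps)
          finally show ?thesis using C by (simp add: s)
        qed
        have "\<bar>dir (\<phi> n) (mlt (\<phi> n)) - E * R (\<phi> n) (mlt (\<phi> n))\<bar>
           \<le> \<bar>e' n\<bar> + F * Bm * wn n + \<epsilon> * U * Bm * Nn n + E * dn n * Bm * Nn n"
        proof -
          have "F * N (wsm (mlt (\<phi> n))) \<le> F * (Bm * wn n)"
            using nrm_wsm_mlt(1)[OF \<phi>, of n] n0 unfolding wn_def by (intro mult_left_mono) auto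
          moreover have "\<epsilon> * U * N (mlt (\<phi> n)) \<le> \<epsilon> * U * (Bm * Nn n)"
            using nrm_wsm_mlt(2)[OF \<phi>, of n] n0 eps unfolding Nn_def by (intro mult_left_mono) auto
          moreover have "E * dn n * N (mlt (\<phi> n)) \<le> E * dn n * (Bm * Nn n)"
            using nrm_wsm_mlt(2)[OF \<phi>, of n] d0 E1 unfolding Nn_def by (intro mult_left_mono) auto
          ultimately show ?thesis using split[OF ml, of n n] unfolding e'_def mult.assoc by linarith
        qed
        then have x4: "dir (\<phi> n) (mlt (\<phi> n)) - E * R (\<phi> n) (mlt (\<phi> n)) \<le> \<bar>e' n\<bar> + F * Bm * wn n + \<epsilon> * U * Bm * Nn n + E * dn n * Bm * Nn n"
          by linarith
        have x5: "E / t * (N (\<delta> t (\<phi> n)))\<^sup>2 \<le> E * t * C * D n"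
        proof -
          have "E / t * (N (\<delta> t (\<phi> n)))\<^sup>2 \<le> E / t * (t\<^sup>2 * (C * dir (\<phi> n) (\<phi> n)))"
            using sb(2)[OF tt(1,2) \<phi>, of n] E1 t by (intro mult_left_mono) auto
          also have "\<dots> = E * t * C * D n" using t by (simp add: D_def power2_eq_square)
          finally show ?thesis .
        qed
        have x6: "K * (1 + E) * t * (hnorm \<Omega> (\<phi> n))\<^sup>2 \<le> K * (1 + E) * t * Kh\<^sup>2"
          using K E1 tt Kh[of n] hnorm_nonneg by (intro mult_left_mono power_mono) auto
        have x7: "c / 2 * (wn n)\<^sup>2 \<le> c / 2 * P (\<phi> n)"
          unfolding wn_def nrm_wsm[OF \<phi>] P_def using c P_nonneg(1,2) by (intro mult_left_mono) (auto simp: add_nonneg_nonneg)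
        have x8: "c / 2 * (P (\<phi> n) + t * D n) = c * P (\<phi> n) - c / 2 * P (\<phi> n) + c / 2 * (t * D n)" by (simp add: algebra_simps)
        show ?thesis unfolding rhs_def using key[OF t(1) tt(3) E \<phi>, of n] x1 x2 x3 x4 x5 x6 x7 x8 by linarith
      qed
      have Dl: "D \<longlonglongrightarrow> S" using Dlim by (simp add: S_def)
      have "rhs \<longlonglongrightarrow> 2 / t * \<bar>0\<bar> + \<bar>0\<bar> + A1 * F\<^sup>2 + c / 2 * (t * S) + 2 * (\<epsilon> * U * sqrt (C * S))
        + 2 * (E * 0 * sqrt (C * S)) + F * Bm * w0 + \<epsilon> * U * Bm * U + E * 0 * Bm * U + E * t * C * S + K * (1 + E) * t * Kh\<^sup>2"
        unfolding rhs_def by (intro tendsto_intros elim e'lim Dl dlim wlim Nlim)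
      moreover have "(\<lambda>n. c / 2 * (wn n)\<^sup>2) \<longlonglongrightarrow> c / 2 * w0\<^sup>2" by (intro tendsto_intros wlim)
      ultimately have "c / 2 * w0\<^sup>2 \<le> 2 / t * \<bar>0\<bar> + \<bar>0\<bar> + A1 * F\<^sup>2 + c / 2 * (t * S) + 2 * (\<epsilon> * U * sqrt (C * S))
        + 2 * (E * 0 * sqrt (C * S)) + F * Bm * w0 + \<epsilon> * U * Bm * U + E * 0 * Bm * U + E * t * C * S + K * (1 + E) * t * Kh\<^sup>2"
        using le by (intro LIMSEQ_le) auto
      then show ?thesis by (simp add: R0_def K3_def algebra_simps)
    qed
    have bnd: "c / 2 * w0\<^sup>2 \<le> R0"
    proof (rule field_le_epsilon)
      fix \<eta> :: real assume \<eta>: "\<eta> > 0"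
      define t where "t = min (min t1 t2) (\<eta> / (\<bar>K3\<bar> + 1))"
      have t: "0 < t" "t \<le> min t1 t2" using t1 t2 \<eta> by (auto simp: t_def)
      have "t * K3 \<le> t * (\<bar>K3\<bar> + 1)" using t by (intro mult_left_mono) auto
      also have "\<dots> \<le> \<eta> / (\<bar>K3\<bar> + 1) * (\<bar>K3\<bar> + 1)" by (intro mult_right_mono) (auto simp: t_def)
      also have "\<dots> = \<eta>" by (simp add: add_nonneg_eq_0_iff)
      finally show "c / 2 * w0\<^sup>2 \<le> R0 + \<eta>" using step[OF t] by linarith
    qed
    have Sb: "S \<le> E * U\<^sup>2 + F * w0" using Rg[OF u] by (simp add: S_def w0_def abs_le_iff)
    have sE: "sqrt E \<ge> 1" using E1 by simp
    have Fw: "F * w0 \<ge> 0" using n0 by simp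
    \<comment> \<open>The origin of \<open>sqrt E\<close>. The limit energy \<open>S\<close> is at
      most \<open>E * U\<^sup>2 + F * w0\<close>; the first part is handled by \<open>eU\<close>,
      and for the second part \<open>\<epsilon> \<le> 1\<close> turns \<open>eU\<close> into
      \<open>\<epsilon> * U \<le> sqrt (F * w0)\<close>.\<close>
    have eUS: "\<epsilon> * U * sqrt (C * S) \<le> 2 * sqrt C * (sqrt E * F * w0)"
    proof -
      have "sqrt (C * S) \<le> sqrt C * (sqrt E * U + sqrt (F * w0))"
      proof -
        have "sqrt S \<le> sqrt (E * U\<^sup>2 + F * w0)" using Sb by simp
        also have "\<dots> \<le> sqrt (E * U\<^sup>2) + sqrt (F * w0)" using E1 Fw by (intro sqrt_add_le_add_sqrt) auto
        also have "sqrt (E * U\<^sup>2) = sqrt E * U" using n0 by (simp add: real_sqrt_mult)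
        finally show ?thesis using C by (simp add: real_sqrt_mult mult_left_mono)
      qed
      then have "\<epsilon> * U * sqrt (C * S) \<le> \<epsilon> * U * (sqrt C * (sqrt E * U + sqrt (F * w0)))"
        using eps n0 by (intro mult_left_mono) auto
      also have "\<dots> = sqrt C * (sqrt E * (\<epsilon> * U\<^sup>2) + (\<epsilon> * U) * sqrt (F * w0))"
        by (simp add: power2_eq_square algebra_simps)
      also have "\<dots> \<le> sqrt C * (sqrt E * (F * w0) + sqrt (F * w0) * sqrt (F * w0))"
      proof (intro mult_left_mono add_mono mult_right_mono eU)
        show "\<epsilon> * U \<le> sqrt (F * w0)"
        proof (rule real_le_rsqrt)
          have "(\<epsilon> * U)\<^sup>2 = \<epsilon> * (\<epsilon> * U\<^sup>2)" by (simp add: power2_eq_square)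
          also have "\<dots> \<le> 1 * (\<epsilon> * U\<^sup>2)" using eps by (intro mult_right_mono) auto
          finally show "(\<epsilon> * U)\<^sup>2 \<le> F * w0" using eU by simp
        qed
      qed (use E1 C Fw in auto)
      also have "\<dots> = sqrt C * (sqrt E * (F * w0) + F * w0)" using Fw by simp
      also have "\<dots> \<le> sqrt C * (sqrt E * (F * w0) + sqrt E * (F * w0))"
        using mult_right_mono[OF sE Fw] C by (intro mult_left_mono add_left_mono) auto
      finally show ?thesis by (simp add: algebra_simps)
    qed
    have FB: "F * Bm * w0 \<le> Bm * (sqrt E * F * w0)" "\<epsilon> * U * Bm * U \<le> Bm * (sqrt E * F * w0)"
    proof -
      have le: "F * w0 \<le> sqrt E * F * w0" using mult_right_mono[OF sE Fw] by simp
      show "F * Bm * w0 \<le> Bm * (sqrt E * F * w0)" using mult_left_mono[OF le Bm0] by (simp add: mult_ac)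
      have "\<epsilon> * U\<^sup>2 \<le> sqrt E * F * w0" using eU le by linarith
      from mult_left_mono[OF this Bm0] show "\<epsilon> * U * Bm * U \<le> Bm * (sqrt E * F * w0)" by (simp add: power2_eq_square mult_ac)
    qed
    have "A2 * (sqrt E * F * w0) = 2 * (2 * sqrt C * (sqrt E * F * w0)) + Bm * (sqrt E * F * w0) + Bm * (sqrt E * F * w0)"
      by (simp add: A2_def algebra_simps)
    then have "c / 2 * w0\<^sup>2 \<le> A1 * F\<^sup>2 + A2 * (sqrt E * F * w0)"
      using bnd eUS FB unfolding R0_def by linarith
    from quadratic_absorption[OF c(1) A E1 n0(1,3) this] show ?thesis using u by (simp add: w0_def F_def)
  qed
  moreover have "1 + 2 * (A1 + A2) / c > 0" using A c by (simp add: add_pos_nonneg)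
  ultimately show ?thesis by blast
qed

end

section \<open>The choice of the flow and of the weights\<close>

lemma smooth_real_derivative:
  fixes f :: "real \<Rightarrow> real"
  assumes "smooth f"
  shows "smooth (\<lambda>x. frechet_derivative f (at x) 1)" "(f has_real_derivative frechet_derivative f (at x) 1) (at x)"
proof -
  show "smooth (\<lambda>x. frechet_derivative f (at x) 1)" by (rule smooth_derivative[OF assms])
  have d: "(f has_derivative frechet_derivative f (at x)) (at x)" by (rule smooth_has_derivative[OF assms])
  have "frechet_derivative f (at x) h = frechet_derivative f (at x) 1 * h" for h
    using linear_scale[OF has_derivative_linear[OF d], of h 1] by simp
  then have "frechet_derivative f (at x) = (*) (frechet_derivative f (at x) 1)" by (intro ext)
  then show "(f has_real_derivative frechet_derivative f (at x) 1) (at x)"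
    using d by (simp add: has_field_derivative_def)
qed

lemma derivative_zero_outside:
  fixes f f' :: "real \<Rightarrow> real"
  assumes f: "\<And>x. (f has_real_derivative f' x) (at x)" and z: "\<And>x. \<bar>x - x0\<bar> > b \<Longrightarrow> f x = 0" and x: "\<bar>x - x0\<bar> > b"
  shows "f' x = 0"
proof -
  have "open {x. \<bar>x - x0\<bar> > b}" by (intro open_Collect_less continuous_intros)
  then have "((\<lambda>_. 0) has_real_derivative f' x) (at x)"
    using has_field_derivative_transform_within_open[OF f, of "{x. \<bar>x - x0\<bar> > b}" x "\<lambda>_. 0"] x z by auto
  then show ?thesis using DERIV_unique DERIV_const by blast
qed

lemma compactly_supported_bounded:
  fixes f :: "real \<Rightarrow> real"
  assumes "continuous_on UNIV f" and z: "\<And>x. \<bar>x - x0\<bar> > b \<Longrightarrow> f x = 0"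
  shows "\<exists>B\<ge>1. \<forall>x. \<bar>f x\<bar> \<le> B"
proof -
  have "bounded (f ` {x0 - b..x0 + b})"
    by (intro compact_imp_bounded compact_continuous_image continuous_on_subset[OF assms(1)]) auto
  then obtain B where "\<forall>y\<in>f ` {x0 - b..x0 + b}. norm y \<le> B" unfolding bounded_iff by blast
  then have B: "\<bar>f x\<bar> \<le> B" if "x \<in> {x0 - b..x0 + b}" for x using that by auto
  have "\<bar>f x\<bar> \<le> max B 1" for x
  proof (cases "\<bar>x - x0\<bar> > b")
    case False
    then have "x \<in> {x0 - b..x0 + b}" by auto
    then show ?thesis using B by fastforce
  qed (simp add: z)
  then show ?thesis by (intro exI[of _ "max B 1"]) auto
qed

lemma lipschitz_if_derivative_bounded:
  fixes f f' :: "real \<Rightarrow> real"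
  assumes f: "\<And>x. (f has_real_derivative f' x) (at x)" and B: "\<And>x. \<bar>f' x\<bar> \<le> B"
  shows "\<bar>f x - f y\<bar> \<le> B * \<bar>x - y\<bar>"
  using field_differentiable_bound[of UNIV f f' B x y] assms by auto

lemma positive_lower_bound:
  fixes f :: "real \<Rightarrow> real"
  assumes "continuous_on {u..v} f" "u \<le> v" "\<And>x. x \<in> {u..v} \<Longrightarrow> f x > 0"
  shows "\<exists>e>0. \<forall>x\<in>{u..v}. e \<le> f x"
proof -
  have "{u..v} \<noteq> {}" using assms(2) by auto
  from continuous_attains_inf[OF compact_Icc this assms(1)] obtain y where "y \<in> {u..v}" "\<forall>x\<in>{u..v}. f y \<le> f x" by blast
  then show ?thesis using assms(3) by (intro exI[of _ "f y"]) blast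
qed

lemma quadratic_powr_derivative:
  fixes x0 r q :: real
  assumes "r > 0"
  shows "((\<lambda>x. ((x - x0)\<^sup>2 + r\<^sup>2) powr q) has_real_derivative (2 * q * (x - x0) * ((x - x0)\<^sup>2 + r\<^sup>2) powr (q - 1))) (at x)"
proof -
  have "(x - x0)\<^sup>2 + r\<^sup>2 > 0" using assms by (simp add: add_nonneg_pos)
  then show ?thesis by (auto intro!: derivative_eq_intros simp: algebra_simps)
qed

text \<open>Beyond \<open>x0 + 1\<close> the derivative is at most
  \<open>(y - x0) powr (- 1 - \<delta>)\<close>, whose integral from there to infinity is
  \<open>1 / \<delta>\<close>.\<close>

lemma profile_upper_bound:
  fixes x0 r \<delta> :: real and w :: "real \<Rightarrow> real"
  assumes r: "r > 0" and \<delta>: "\<delta> > 0"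
    and w: "\<And>x. (w has_real_derivative ((x - x0)\<^sup>2 + r\<^sup>2) powr (- (1 + \<delta>) / 2)) (at x)"
  shows "w x \<le> w (x0 + 1) + 1 / \<delta>"
proof (cases "x \<le> x0 + 1")
  case True
  have "w x \<le> w (x0 + 1)"
    by (rule DERIV_nonneg_imp_nondecreasing[OF True]) (use w in \<open>auto intro!: exI\<close>)
  then show ?thesis using \<delta> by (simp add: add_increasing2)
next
  case False
  define f where "f y = w y + (y - x0) powr (- \<delta>) / \<delta>" for y
  have "f x \<le> f (x0 + 1)"
  proof (rule DERIV_nonpos_imp_nonincreasing[of "x0 + 1" x f])
    show "x0 + 1 \<le> x" using False by simp
    fix y assume y: "x0 + 1 \<le> y" "y \<le> x"
    then have pos: "y - x0 > 0" by simp
    have d: "(f has_real_derivative (((y - x0)\<^sup>2 + r\<^sup>2) powr (- (1 + \<delta>) / 2) - (y - x0) powr (- \<delta> - 1))) (at y)"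
      unfolding f_def using pos \<delta> by (auto intro!: derivative_eq_intros w)
    have "((y - x0)\<^sup>2 + r\<^sup>2) powr (- (1 + \<delta>) / 2) \<le> ((y - x0)\<^sup>2) powr (- (1 + \<delta>) / 2)"
      using pos \<delta> by (intro powr_mono2') auto
    also have "\<dots> = (y - x0) powr (2 * (- (1 + \<delta>) / 2))"
      unfolding powr_powr[symmetric] using pos by simp
    also have "2 * (- (1 + \<delta>) / 2) = - \<delta> - 1" by simp
    finally show "\<exists>d. (f has_real_derivative d) (at y) \<and> d \<le> 0" using d by (intro exI conjI) auto
  qed
  then have "w x + (x - x0) powr (- \<delta>) / \<delta> \<le> w (x0 + 1) + 1 / \<delta>" by (simp add: f_def)
  moreover have "(x - x0) powr (- \<delta>) / \<delta> \<ge> 0" using \<delta> by simp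
  ultimately show ?thesis by linarith
qed

lemma profile_exists:
  fixes x0 r \<delta> :: real
  assumes r: "r > 0" and \<delta>: "\<delta> > 0"
  shows "\<exists>w W. (\<forall>x. (w has_real_derivative ((x - x0)\<^sup>2 + r\<^sup>2) powr (- (1 + \<delta>) / 2)) (at x)) \<and> w 0 = 0 \<and> (\<forall>x. \<bar>w x\<bar> \<le> W)"
proof -
  let ?a = "\<lambda>x. ((x - x0)\<^sup>2 + r\<^sup>2) powr (- (1 + \<delta>) / 2)"
  have "isCont ?a x" for x
    using quadratic_powr_derivative[OF r, where q = "- (1 + \<delta>) / 2" and ?x0.0 = x0 and x = x] DERIV_isCont by blast
  then obtain F where "\<forall>x::real. -\<infinity> < ereal x \<longrightarrow> ereal x < \<infinity> \<longrightarrow> (F has_vector_derivative ?a x) (at x)"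
    using einterval_antiderivative[of "-\<infinity>" "\<infinity>" ?a] by auto
  then have F: "(F has_real_derivative ?a x) (at x)" for x
    by (simp add: has_real_derivative_iff_has_vector_derivative)
  define w where "w x = F x - F 0" for x
  have w: "(w has_real_derivative ?a x) (at x)" for x
    unfolding w_def by (auto intro!: derivative_eq_intros F)
  \<comment> \<open>Reflection about \<open>x0\<close> preserves the derivative and turns the lower
    bound for \<open>w\<close> into an upper bound for \<open>v\<close>.\<close>
  define v where "v y = - w (2 * x0 - y)" for y
  have v: "(v has_real_derivative ?a y) (at y)" for y
  proof -
    have "(v has_real_derivative - (?a (2 * x0 - y) * (- 1))) (at y)"
      unfolding v_def by (intro DERIV_minus DERIV_chain2[OF w]) (auto intro!: derivative_eq_intros)
    moreover have "(2 * x0 - y - x0)\<^sup>2 = (y - x0)\<^sup>2" by (simp add: power2_eq_square algebra_simps)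
    ultimately show ?thesis by simp
  qed
  have up: "w x \<le> w (x0 + 1) + 1 / \<delta>" for x by (rule profile_upper_bound[OF r \<delta> w])
  have lo: "- w x \<le> v (x0 + 1) + 1 / \<delta>" for x
    using profile_upper_bound[OF r \<delta> v, of "2 * x0 - x"] by (simp add: v_def)
  have "\<bar>w x\<bar> \<le> \<bar>w (x0 + 1)\<bar> + \<bar>v (x0 + 1)\<bar> + 1 / \<delta>" for x using up[of x] lo[of x] by linarith
  then show ?thesis using w by (intro exI[of _ w] exI) (auto simp: w_def)
qed

lemma polynomial_weight_comparison:
  fixes x y W s :: real
  assumes "\<bar>x - y\<bar> \<le> W" "s \<ge> 0"
  shows "(1 + \<bar>x\<bar>) powr (- s) \<le> (1 + W) powr s * (1 + \<bar>y\<bar>) powr (- s)"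
proof -
  have W: "W \<ge> 0" using assms(1) by linarith
  have "1 + \<bar>y\<bar> \<le> (1 + W) * (1 + \<bar>x\<bar>)"
  proof -
    have "0 \<le> W * \<bar>x\<bar>" using W by simp
    moreover have "\<bar>y\<bar> \<le> W + \<bar>x\<bar>" using assms(1) by linarith
    ultimately show ?thesis by (simp add: algebra_simps)
  qed
  then have "((1 + W) * (1 + \<bar>x\<bar>)) powr (- s) \<le> (1 + \<bar>y\<bar>) powr (- s)" using assms by (intro powr_mono2') auto
  then have "(1 + W) powr s * ((1 + W) powr (- s) * (1 + \<bar>x\<bar>) powr (- s)) \<le> (1 + W) powr s * (1 + \<bar>y\<bar>) powr (- s)"
    using W by (intro mult_left_mono) (auto simp: powr_mult)
  moreover have "(1 + W) powr s * (1 + W) powr (- s) = 1" using W by (simp flip: powr_add)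
  ultimately show ?thesis by (simp flip: mult.assoc)
qed

text \<open>All constants of \<open>repulsive\<close> are chosen here. The amplitude
  \<open>\<eta>\<close> of the bump is small in terms of the profile \<open>a\<close>, the bump
  \<open>\<zeta>\<close> and the geometry over \<open>I\<close>; the time \<open>t0\<close> and the
  energy threshold \<open>E0\<close> are chosen after it.\<close>

theorem weighted_resolvent_estimate:
  fixes \<Omega> :: "(real \<times> 'b::euclidean_space) set"
  assumes op: "open \<Omega>" and lip: "lipschitz_boundary \<Omega>" and reg: "locally_convex_or_C11 \<Omega>"
    and sgn: "\<And>p n. outward_unit_normal \<Omega> p n \<Longrightarrow> fst p * fst n \<le> 0"
    and I: "open I" "I \<noteq> {}" and CI: "CI > 0"
    and sgnI: "\<And>p n. p \<in> I \<times> UNIV \<Longrightarrow> outward_unit_normal \<Omega> p n \<Longrightarrow> fst p * fst n \<le> - CI"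
    and bd: "bounded (\<Omega> \<inter> (I \<times> UNIV))" and \<delta>: "\<delta> > 0"
  defines "ws \<equiv> \<lambda>x. (1 + \<bar>x\<bar>) powr (- ((3 + \<delta>) / 2))"
  shows "\<exists>E0>0. \<exists>C>0. \<forall>E \<epsilon> f u. E \<ge> E0 \<longrightarrow> 0 < \<epsilon> \<longrightarrow> \<epsilon> \<le> 1 \<longrightarrow> f \<in> l2 (lebesgue_on \<Omega>) \<longrightarrow>
     (u, \<lambda>p. complex_of_real (ws (fst p)) * f p + Complex E \<epsilon> * u p) \<in> neg_dirichlet_laplacian \<Omega> \<longrightarrow>
     u \<in> l2 (lebesgue_on \<Omega>) \<and>
     nrm (lebesgue_on \<Omega>) (\<lambda>p. complex_of_real (ws (fst p)) * u p) \<le> C * sqrt E * nrm (lebesgue_on \<Omega>) f"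
proof -
  obtain x0 b where x0: "x0 \<noteq> 0" and b: "b > 0" "2 * b < \<bar>x0\<bar>" "\<And>x. \<bar>x - x0\<bar> < 2 * b \<Longrightarrow> x \<in> I"
  proof -
    obtain y where y: "y \<in> I" using I by blast
    obtain e where e: "e > 0" "ball y e \<subseteq> I" using I y open_contains_ball by blast
    \<comment> \<open>The centre has to be nonzero: \<open>w\<close> vanishes at 0, and only a
      nonzero horizontal speed can compensate for the motion in y.\<close>
    define x0 where "x0 = (if y = 0 then e / 2 else y)"
    have x0: "x0 \<noteq> 0" "x0 \<in> ball y e" using e by (auto simp: x0_def dist_real_def)
    then obtain e' where e': "e' > 0" "ball x0 e' \<subseteq> I" using I e open_contains_ball by blast
    define b where "b = min e' \<bar>x0\<bar> / 3"
    have b: "b > 0" "2 * b < \<bar>x0\<bar>" "2 * b < e'" using e' x0 by (auto simp: b_def)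
    have "x \<in> I" if "\<bar>x - x0\<bar> < 2 * b" for x using e'(2) that b by (auto simp: dist_real_def)
    then show ?thesis using that x0 b by blast
  qed
  \<comment> \<open>Radius \<open>2 * b\<close> instead of \<open>b\<close>: the flow will move
    points over the support of the bump by at most \<open>b\<close>.\<close>
  define J where "J = {x. \<bar>x - x0\<bar> < 2 * b}"
  have oJ: "open J" unfolding J_def by (intro open_Collect_less continuous_intros)
  obtain R where R: "R \<ge> 1" "\<And>p. p \<in> \<Omega> \<Longrightarrow> fst p \<in> J \<Longrightarrow> norm (snd p) \<le> R"
  proof -
    obtain B where B: "\<And>p. p \<in> \<Omega> \<inter> (I \<times> UNIV) \<Longrightarrow> norm p \<le> B" using bd unfolding bounded_iff by blast
    have "norm (snd p) \<le> max B 1" if "p \<in> \<Omega>" "fst p \<in> J" for p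
    proof -
      have "p \<in> \<Omega> \<inter> (I \<times> UNIV)" using that b(3) by (auto simp: J_def mem_Times_iff)
      then show ?thesis using B norm_snd_le[of "snd p" "fst p"] by fastforce
    qed
    then show ?thesis using that[of "max B 1"] by auto
  qed
  \<comment> \<open>A lower bound over \<open>J\<close> for the absolute value of the first
    component of the normal.\<close>
  define cn where "cn = CI / (\<bar>x0\<bar> + 2 * b)"
  have cn: "cn > 0" using CI b by (simp add: cn_def)
  have sgnJ: "\<bar>fst p\<bar> * cn \<le> - (fst p * fst n)" if "fst p \<in> J" "outward_unit_normal \<Omega> p n" for p n
  proof -
    have "fst p \<in> I" "\<bar>fst p\<bar> \<le> \<bar>x0\<bar> + 2 * b" using that b by (auto simp: J_def)
    then have "\<bar>fst p\<bar> * cn \<le> (\<bar>x0\<bar> + 2 * b) * cn" using cn by (intro mult_right_mono) auto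
    also have "\<dots> = CI" using b by (simp add: cn_def)
    also have "CI \<le> - (fst p * fst n)" using sgnI[of p n] \<open>fst p \<in> I\<close> that by (auto simp: mem_Times_iff)
    finally show ?thesis .
  qed
  define p where "p = 1 + \<delta>"
  have p: "p > 1" using \<delta> by (simp add: p_def)
  \<comment> \<open>With this ratio \<open>(x - x0)\<^sup>2 \<ge> 16 * r\<^sup>2\<close> as soon as
    \<open>\<bar>x - x0\<bar> \<ge> b / 2\<close>, that is, outside the zone where the bump is
    bounded below.\<close>
  define r where "r = b / 8"
  have r: "r > 0" using b by (simp add: r_def)
  define S where "S x = (x - x0)\<^sup>2 + r\<^sup>2" for x
  have S: "S x > 0" "S x \<ge> r\<^sup>2" "S x \<ge> (x - x0)\<^sup>2" for x using r by (auto simp: S_def add_nonneg_pos)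
  \<comment> \<open>\<open>a\<close>, \<open>T\<close> and \<open>V\<close> are powers of
    \<open>S\<close> with exponents decreasing by 1, so \<open>a x * V x = (T x)\<^sup>2\<close>,
    and the derivatives of \<open>a\<close> and \<open>T\<close> are expressed within this family.
    They decay with the powers \<open>p\<close>, \<open>p + 2\<close> and \<open>p + 4\<close> of
    the distance.\<close>
  define a where "a x = S x powr (- p / 2)" for x
  define T where "T x = S x powr (- p / 2 - 1)" for x
  define V where "V x = S x powr (- p / 2 - 1 - 1)" for x
  have powr_S: "S x * S x powr (q - 1) = S x powr q" for x q
    using powr_mult_base[of "S x" "q - 1"] S(1)[of x] by simp
  have ST: "S x * T x = a x" "S x * V x = T x" for x
    unfolding T_def V_def a_def by (rule powr_S)+
  have pos: "a x > 0" "T x > 0" "V x > 0" for x using S(1)[of x] by (auto simp: a_def T_def V_def)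
  have a': "(a has_real_derivative (- p * (x - x0) * T x)) (at x)" for x
    using quadratic_powr_derivative[OF r, of x0 "- p / 2" x] unfolding a_def[abs_def] T_def S_def by simp
  have T': "(T has_real_derivative (- (p + 2) * (x - x0) * V x)) (at x)" for x
    using quadratic_powr_derivative[OF r, of x0 "- p / 2 - 1" x] by (simp add: T_def[abs_def] V_def S_def algebra_simps)
  define \<rho>2V where "\<rho>2V x = (x - x0)\<^sup>2 * V x" for x
  have a'': "((\<lambda>x. - p * (x - x0) * T x) has_real_derivative (- p * T x + p * (p + 2) * \<rho>2V x)) (at x)" for x
    by (rule derivative_eq_intros refl T')+ (simp add: \<rho>2V_def power2_eq_square algebra_simps)
  have T_eq: "T x = \<rho>2V x + r\<^sup>2 * V x" for x
    using ST(2)[of x] by (simp add: S_def \<rho>2V_def distrib_right)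
  have \<rho>2V0: "\<rho>2V x \<ge> 0" "\<rho>2V x \<le> T x" for x using pos(3)[of x] T_eq[of x] by (auto simp: \<rho>2V_def)
  have smS: "smooth (\<lambda>x. S x powr q)" for q unfolding S_def by (rule smooth_powr_quadratic[OF r])
  have sma: "smooth a" and smT: "smooth T" and smV: "smooth V" unfolding a_def T_def V_def by (rule smS)+
  have contV: "continuous_on UNIV V" and contT: "continuous_on UNIV T" and conta: "continuous_on UNIV a"
    by (rule smooth_continuous smV smT sma)+
  have cont\<rho>: "continuous_on UNIV \<rho>2V" unfolding \<rho>2V_def by (intro continuous_intros contV)
  define A where "A = (r\<^sup>2) powr (- p / 2)"
  define Tb where "Tb = (r\<^sup>2) powr (- p / 2 - 1)"
  define Vb where "Vb = (r\<^sup>2) powr (- p / 2 - 1 - 1)"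
  have r2: "r\<^sup>2 > 0" using r by simp
  have ub: "a x \<le> A" "T x \<le> Tb" "V x \<le> Vb" for x
    unfolding a_def A_def T_def Tb_def V_def Vb_def using S(2)[of x] p r2 by (auto intro!: powr_mono2')
  have b0: "A > 0" "Tb > 0" "Vb > 0" using r2 by (auto simp: A_def Tb_def Vb_def)
  have rT: "\<bar>x - x0\<bar> * T x \<le> Tb + A" for x
  proof -
    have "\<bar>x - x0\<bar> \<le> 1 + S x"
    proof -
      have "0 \<le> (\<bar>x - x0\<bar> - 1 / 2)\<^sup>2" by simp
      then show ?thesis using r2 by (simp add: S_def power2_eq_square algebra_simps flip: abs_mult)
    qed
    then have "\<bar>x - x0\<bar> * T x \<le> (1 + S x) * T x" using pos(2)[of x] by (intro mult_right_mono) auto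
    also have "\<dots> = T x + a x" using ST(1)[of x] by (simp add: distrib_right)
    also have "\<dots> \<le> Tb + A" using ub by (intro add_mono)
    finally show ?thesis .
  qed
  have a'b: "\<bar>- p * (x - x0) * T x\<bar> \<le> p * (Tb + A)" for x
    using mult_left_mono[OF rT[of x], of p] p pos(2)[of x] by (simp add: abs_mult mult.assoc)
  obtain w W where w: "\<And>x. (w has_real_derivative a x) (at x)" "w 0 = 0" "\<And>x. \<bar>w x\<bar> \<le> W"
  proof -
    obtain w W where "\<forall>x. (w has_real_derivative ((x - x0)\<^sup>2 + r\<^sup>2) powr (- (1 + \<delta>) / 2)) (at x)" "w 0 = 0" "\<forall>x. \<bar>w x\<bar> \<le> W"
      using profile_exists[OF r \<delta>, of x0] by blast
    then show ?thesis using that[of w W] by (simp add: a_def S_def p_def)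
  qed
  have smw: "smooth w" by (rule smooth_real_antiderivative[OF w(1) sma])
  have W0: "W \<ge> 0" using w(3)[of 0] by simp
  have wsgn: "x * w x > 0" if "x \<noteq> 0" for x
  proof (cases "x > 0")
    case True
    then have "w 0 < w x" by (rule DERIV_pos_imp_increasing) (use w pos in blast)
    then show ?thesis using True w by simp
  next
    case False
    then have "x < 0" using that by simp
    then have "w x < w 0" by (rule DERIV_pos_imp_increasing) (use w pos in blast)
    then show ?thesis using \<open>x < 0\<close> w by (simp add: mult_neg_neg)
  qed
  have wlin: "\<bar>w x\<bar> \<le> A * \<bar>x\<bar>" for x
  proof -
    have "\<bar>a x\<bar> \<le> A" for x using ub(1)[of x] pos(1)[of x] by simp
    then show ?thesis using lipschitz_if_derivative_bounded[OF w(1), of A x 0] w(2) by simp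
  qed
  obtain wmin where wmin: "wmin > 0" "\<And>x. \<bar>x - x0\<bar> \<le> b \<Longrightarrow> wmin \<le> \<bar>w x\<bar>"
  proof -
    have "\<exists>e>0. \<forall>x\<in>{x0 - b..x0 + b}. e \<le> \<bar>w x\<bar>"
    proof (rule positive_lower_bound)
      show "continuous_on {x0 - b..x0 + b} (\<lambda>x. \<bar>w x\<bar>)"
        by (intro continuous_intros continuous_on_subset[OF smooth_continuous[OF smw]]) auto
      fix x assume "x \<in> {x0 - b..x0 + b}"
      then have "x \<noteq> 0" using b by auto
      then show "\<bar>w x\<bar> > 0" using wsgn[of x] by auto
    qed (use b in auto)
    then obtain e where e: "e > 0" "\<forall>x\<in>{x0 - b..x0 + b}. e \<le> \<bar>w x\<bar>" by blast
    have "e \<le> \<bar>w x\<bar>" if "\<bar>x - x0\<bar> \<le> b" for x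
    proof -
      have "x \<in> {x0 - b..x0 + b}" using that by auto
      then show ?thesis using e by blast
    qed
    then show ?thesis using that e by blast
  qed
  obtain \<zeta> :: "real \<Rightarrow> real" where \<zeta>: "smooth \<zeta>" "\<And>x. \<zeta> x \<ge> 0" "\<And>x. \<bar>x - x0\<bar> < b \<Longrightarrow> \<zeta> x > 0" "\<And>x. \<bar>x - x0\<bar> \<ge> b \<Longrightarrow> \<zeta> x = 0"
    using smooth_bump_exists[OF b(1), of x0] by blast
  define \<zeta>1 where "\<zeta>1 x = frechet_derivative \<zeta> (at x) 1" for x
  have \<zeta>1: "smooth \<zeta>1" "(\<zeta> has_real_derivative \<zeta>1 x) (at x)" for x
    unfolding \<zeta>1_def by (rule smooth_real_derivative[OF \<zeta>(1)])+
  define \<zeta>2 where "\<zeta>2 x = frechet_derivative \<zeta>1 (at x) 1" for x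
  have \<zeta>2: "smooth \<zeta>2" "(\<zeta>1 has_real_derivative \<zeta>2 x) (at x)" for x
    unfolding \<zeta>2_def by (rule smooth_real_derivative[OF \<zeta>1(1)])+
  have out: "\<zeta> x = 0" "\<zeta>1 x = 0" "\<zeta>2 x = 0" if "\<bar>x - x0\<bar> > b" for x
  proof -
    have z: "\<zeta> x = 0" if "\<bar>x - x0\<bar> > b" for x using that \<zeta>(4) by simp
    have z1: "\<zeta>1 x = 0" if "\<bar>x - x0\<bar> > b" for x by (rule derivative_zero_outside[OF \<zeta>1(2) z that])
    show "\<zeta> x = 0" "\<zeta>1 x = 0" "\<zeta>2 x = 0" using z[OF that] z1[OF that] derivative_zero_outside[OF \<zeta>2(2) z1 that] by auto
  qed
  obtain Z where Z: "Z \<ge> 1" "\<And>x. \<bar>\<zeta> x\<bar> \<le> Z" "\<And>x. \<bar>\<zeta>1 x\<bar> \<le> Z" "\<And>x. \<bar>\<zeta>2 x\<bar> \<le> Z"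
  proof -
    obtain B0 where B0: "B0 \<ge> 1" "\<forall>x. \<bar>\<zeta> x\<bar> \<le> B0" using compactly_supported_bounded[OF smooth_continuous[OF \<zeta>(1)] out(1)] by blast
    obtain B1 where B1: "B1 \<ge> 1" "\<forall>x. \<bar>\<zeta>1 x\<bar> \<le> B1" using compactly_supported_bounded[OF smooth_continuous[OF \<zeta>1(1)] out(2)] by blast
    obtain B2 where B2: "B2 \<ge> 1" "\<forall>x. \<bar>\<zeta>2 x\<bar> \<le> B2" using compactly_supported_bounded[OF smooth_continuous[OF \<zeta>2(1)] out(3)] by blast
    show ?thesis
    proof (rule that[of "max B0 (max B1 B2)"])
      show "\<bar>\<zeta> x\<bar> \<le> max B0 (max B1 B2)" for x using B0(2) by (meson max.coboundedI1)
      show "\<bar>\<zeta>1 x\<bar> \<le> max B0 (max B1 B2)" for x using B1(2) by (meson max.coboundedI1 max.coboundedI2)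
      show "\<bar>\<zeta>2 x\<bar> \<le> max B0 (max B1 B2)" for x using B2(2) by (meson max.coboundedI2)
    qed (use B0 in auto)
  qed
  have Zprod: "\<bar>u * v\<bar> \<le> Z\<^sup>2" if "\<bar>u\<bar> \<le> Z" "\<bar>v\<bar> \<le> Z" for u v
    unfolding abs_mult power2_eq_square using that Z(1) by (intro mult_mono) auto
  have Zsq: "u\<^sup>2 \<le> Z\<^sup>2" if "\<bar>u\<bar> \<le> Z" for u using Zprod[OF that that] by (simp add: power2_eq_square)
  have Z2: "Z\<^sup>2 \<ge> 1" using Z(1) by (simp add: one_le_power)
  obtain z0 where z0: "z0 > 0" "\<And>x. \<bar>x - x0\<bar> \<le> b / 2 \<Longrightarrow> z0 \<le> (\<zeta> x)\<^sup>2"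
  proof -
    have "\<exists>e>0. \<forall>x\<in>{x0 - b/2..x0 + b/2}. e \<le> (\<zeta> x)\<^sup>2"
    proof (rule positive_lower_bound)
      show "continuous_on {x0 - b/2..x0 + b/2} (\<lambda>x. (\<zeta> x)\<^sup>2)"
        by (intro continuous_intros continuous_on_subset[OF smooth_continuous[OF \<zeta>(1)]]) auto
      fix x assume "x \<in> {x0 - b/2..x0 + b/2}"
      then have "\<bar>x - x0\<bar> < b" using b(1) by (auto simp: abs_le_iff)
      then show "(\<zeta> x)\<^sup>2 > 0" using \<zeta>(3)[of x] by simp
    qed (use b in auto)
    then obtain e where e: "e > 0" "\<forall>x\<in>{x0 - b/2..x0 + b/2}. e \<le> (\<zeta> x)\<^sup>2" by blast
    have "e \<le> (\<zeta> x)\<^sup>2" if "\<bar>x - x0\<bar> \<le> b / 2" for x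
    proof -
      have "x0 - b/2 \<le> x" "x \<le> x0 + b/2" using that by linarith+
      then have "x \<in> {x0 - b/2..x0 + b/2}" by simp
      then show ?thesis using e by blast
    qed
    then show ?thesis using that e by blast
  qed
  define dd where "dd = real DIM('b)"
  have dd: "dd \<ge> 1" unfolding dd_def using DIM_positive[where 'a = 'b] by linarith
  \<comment> \<open>Far from \<open>x0\<close>, the net Hardy gain is
    \<open>\<kappa> * (p + 1) / 2\<close> and the loss through \<open>m''\<close> is
    \<open>p * (p + 1) / 2\<close>, in units of \<open>T\<close>; this asks for
    \<open>\<kappa> > p\<close>. The Hardy cost \<open>2 * \<kappa> / (p + 1)\<close> in units of
    \<open>a\<close> has to stay below the available 2, which asks for
    \<open>\<kappa> < p + 1\<close>. What then remains of the 2 is \<open>\<theta>\<close>.\<close>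
  define \<kappa> where "\<kappa> = p + 3 / 4"
  define \<theta> where "\<theta> = 1 / (2 * (p + 1))"
  have \<theta>: "\<theta> > 0" using p by (simp add: \<theta>_def)
  define am where "am = (b\<^sup>2 + r\<^sup>2) powr (- p / 2)"
  define Tm where "Tm = (b\<^sup>2 + r\<^sup>2) powr (- p / 2 - 1)"
  have am: "am > 0" "Tm > 0" using r2 by (auto simp: am_def Tm_def add_nonneg_pos intro: less_imp_neq)
  have lowr: "am \<le> a x" "Tm \<le> T x" if "\<bar>x - x0\<bar> \<le> b" for x
  proof -
    have "(x - x0)\<^sup>2 \<le> b\<^sup>2" using that b abs_le_square_iff[of "x - x0" b] by simp
    then have "S x \<le> b\<^sup>2 + r\<^sup>2" by (simp add: S_def)
    then show "am \<le> a x" "Tm \<le> T x" unfolding am_def a_def Tm_def T_def using S(1)[of x] p by (auto intro!: powr_mono2')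
  qed
  \<comment> \<open>Three demands: over the bump the vertical displacement is at most
    \<open>cn\<close> times the horizontal one; \<open>\<mu> + \<xi>\<close> takes at most half of
    \<open>\<theta> * a\<close>; and the term with \<open>\<xi>''\<close> takes at most a tenth of
    \<open>T\<close>.\<close>
  define \<eta> where "\<eta> = min (cn * wmin / (2 * R * Z\<^sup>2)) (min (\<theta> * am / (2 * (32 * R\<^sup>2 * Z\<^sup>2 + Z\<^sup>2))) (Tm / (20 * dd * Z\<^sup>2)))"
  have RZ: "2 * R * Z\<^sup>2 > 0" "2 * (32 * R\<^sup>2 * Z\<^sup>2 + Z\<^sup>2) > 0" "20 * dd * Z\<^sup>2 > 0"
    using R(1) Z2 dd by (auto intro!: mult_pos_pos add_pos_pos)
  have \<eta>0: "\<eta> > 0" unfolding \<eta>_def using cn wmin(1) \<theta> am RZ by simp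
  have \<eta>1: "\<eta> * (2 * R * Z\<^sup>2) \<le> cn * wmin" "\<eta> * (2 * (32 * R\<^sup>2 * Z\<^sup>2 + Z\<^sup>2)) \<le> \<theta> * am" "\<eta> * (20 * dd * Z\<^sup>2) \<le> Tm"
  proof -
    have "\<eta> \<le> cn * wmin / (2 * R * Z\<^sup>2)" "\<eta> \<le> \<theta> * am / (2 * (32 * R\<^sup>2 * Z\<^sup>2 + Z\<^sup>2))" "\<eta> \<le> Tm / (20 * dd * Z\<^sup>2)"
      by (auto simp: \<eta>_def)
    then show "\<eta> * (2 * R * Z\<^sup>2) \<le> cn * wmin" "\<eta> * (2 * (32 * R\<^sup>2 * Z\<^sup>2 + Z\<^sup>2)) \<le> \<theta> * am" "\<eta> * (20 * dd * Z\<^sup>2) \<le> Tm"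
      using RZ by (simp_all only: pos_le_divide_eq)
  qed
  \<comment> \<open>A multiple of a square, so that the square of \<open>\<xi>'\<close> is
    \<open>\<xi>\<close> times a bounded function. \<open>\<mu>\<close> below is the factor that
    results for the bound \<open>2 * R\<close> on y, with equality.\<close>
  define \<xi> where "\<xi> x = \<eta> * (\<zeta> x)\<^sup>2" for x
  define \<xi>' where "\<xi>' x = 2 * \<eta> * (\<zeta> x * \<zeta>1 x)" for x
  define \<xi>'' where "\<xi>'' x = 2 * \<eta> * ((\<zeta>1 x)\<^sup>2 + \<zeta> x * \<zeta>2 x)" for x
  define \<mu> where "\<mu> x = 32 * \<eta> * R\<^sup>2 * (\<zeta>1 x)\<^sup>2" for x
  have d\<xi>: "(\<xi> has_real_derivative \<xi>' x) (at x)" for x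
    unfolding \<xi>_def \<xi>'_def by (auto intro!: derivative_eq_intros \<zeta>1)
  have d\<xi>': "(\<xi>' has_real_derivative \<xi>'' x) (at x)" for x
    unfolding \<xi>'_def \<xi>''_def by (auto intro!: derivative_eq_intros \<zeta>1 \<zeta>2 simp: power2_eq_square algebra_simps)
  have d\<mu>: "(\<mu> has_real_derivative 64 * \<eta> * R\<^sup>2 * (\<zeta>1 x * \<zeta>2 x)) (at x)" for x
    unfolding \<mu>_def by (auto intro!: derivative_eq_intros \<zeta>2)
  have cont\<xi>'': "continuous_on UNIV \<xi>''" unfolding \<xi>''_def
    by (intro continuous_intros smooth_continuous \<zeta> \<zeta>1(1) \<zeta>2(1))
  have sm\<xi>: "smooth \<xi>" unfolding \<xi>_def power2_eq_square by (intro smooth_mult smooth_const \<zeta>(1))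
  define X where "X = \<eta> * Z\<^sup>2"
  have \<xi>b: "0 \<le> \<xi> x" "\<xi> x \<le> X" for x
    using \<eta>0 Zsq[OF Z(2), of x] by (auto simp: \<xi>_def X_def)
  have \<xi>'b: "\<bar>\<xi>' x\<bar> \<le> 2 * X" for x
  proof -
    have "\<bar>\<xi>' x\<bar> = 2 * \<eta> * \<bar>\<zeta> x * \<zeta>1 x\<bar>" using \<eta>0 by (simp add: \<xi>'_def abs_mult)
    also have "\<dots> \<le> 2 * \<eta> * Z\<^sup>2" using Zprod[OF Z(2) Z(3)] \<eta>0 by (intro mult_left_mono) auto
    finally show ?thesis by (simp add: X_def)
  qed
  have \<xi>''b: "\<bar>\<xi>'' x\<bar> \<le> 4 * X" for x
  proof -
    have "\<bar>(\<zeta>1 x)\<^sup>2 + \<zeta> x * \<zeta>2 x\<bar> \<le> 2 * Z\<^sup>2"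
      using Zprod[OF Z(2) Z(4), of x x] Zsq[OF Z(3), of x] zero_le_power2[of "\<zeta>1 x"] by linarith
    then have "2 * \<eta> * \<bar>(\<zeta>1 x)\<^sup>2 + \<zeta> x * \<zeta>2 x\<bar> \<le> 2 * \<eta> * (2 * Z\<^sup>2)" using \<eta>0 by (intro mult_left_mono) auto
    then show ?thesis using \<eta>0 by (simp add: \<xi>''_def X_def abs_mult)
  qed
  have \<mu>b: "0 \<le> \<mu> x" "\<mu> x \<le> 32 * R\<^sup>2 * X" for x
    using \<eta>0 Zsq[OF Z(3), of x] by (auto simp: \<mu>_def X_def mult_ac intro!: mult_left_mono)
  have \<mu>'b: "\<bar>64 * \<eta> * R\<^sup>2 * (\<zeta>1 x * \<zeta>2 x)\<bar> \<le> 64 * R\<^sup>2 * X" for x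
  proof -
    have "\<bar>64 * \<eta> * R\<^sup>2 * (\<zeta>1 x * \<zeta>2 x)\<bar> = 64 * \<eta> * R\<^sup>2 * \<bar>\<zeta>1 x * \<zeta>2 x\<bar>" using \<eta>0 by (simp add: abs_mult)
    also have "\<dots> \<le> 64 * \<eta> * R\<^sup>2 * Z\<^sup>2" using Zprod[OF Z(3) Z(4)] \<eta>0 by (intro mult_left_mono) auto
    finally show ?thesis by (simp add: X_def mult_ac)
  qed
  have X0: "X > 0" unfolding X_def using \<eta>0 Z2 by (intro mult_pos_pos) auto
  define L where "L = p * (Tb + A) + 2 * X"
  define t0 where "t0 = min (min 1 (b / (W + 1))) (min (1 / (4 * (A + 1))) (1 / (4 * (dd * X + 1))))"
  have t0: "0 < t0" "t0 \<le> 1" "t0 * W \<le> b" "t0 * A \<le> 1 / 4" "t0 * (dd * X) \<le> 1 / 4"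
  proof -
    have frac: "t0 * k \<le> m" if "t0 \<le> m / (k + 1)" "k \<ge> 0" "m \<ge> 0" for k m :: real
    proof -
      have "t0 * k \<le> m / (k + 1) * k" using that by (intro mult_right_mono) auto
      also have "\<dots> \<le> m" using that by (simp add: field_simps)
      finally show ?thesis .
    qed
    show "0 < t0" using b W0 b0 dd X0 by (simp add: t0_def add_nonneg_pos)
    show "t0 \<le> 1" by (simp add: t0_def)
    show "t0 * W \<le> b" using b W0 by (intro frac) (auto simp: t0_def)
    show "t0 * A \<le> 1 / 4" using b0 by (intro frac) (auto simp: t0_def)
    show "t0 * (dd * X) \<le> 1 / 4" using dd X0 by (intro frac) (auto simp: t0_def)
  qed
  have t\<xi>: "t * \<xi> x \<le> 1 / 4" if "0 \<le> t" "t \<le> t0" for t x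
  proof -
    have "1 * X \<le> dd * X" using dd X0 by (intro mult_right_mono) auto
    then have "t * \<xi> x \<le> t0 * (dd * X)" using that \<xi>b[of x] by (intro mult_mono) auto
    then show ?thesis using t0 by simp
  qed
  \<comment> \<open>The point \<open>q\<close> is recovered from its image by adding
    \<open>v\<close>, which points away from x = 0. So \<open>shift_in_domain\<close> starts at the
    image, which is known to lie in \<open>\<Omega>\<close>, and ends at \<open>q\<close>. The bound
    on y doubles from \<open>R\<close> to \<open>2 * R\<close> because the flow contracts y by a
    factor of at least one half.\<close>
  have flowpt: "q \<in> \<Omega> \<and> (\<xi> (fst q) \<noteq> 0 \<longrightarrow> norm (snd q) \<le> 2 * R)"
    if t: "0 \<le> t" "t \<le> t0" and im: "(fst q - t * w (fst q), (1 - t * \<xi> (fst q)) *\<^sub>R snd q) \<in> \<Omega>" for t and q :: "real \<times> 'b"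
  proof -
    define x where "x = fst q"
    define v where "v = (t * w x, (t * \<xi> x) *\<^sub>R snd q)"
    define q' where "q' = (x - t * w x, (1 - t * \<xi> x) *\<^sub>R snd q)"
    have q': "q' \<in> \<Omega>" using im by (simp add: q'_def x_def)
    have qv: "q' + v = q" by (simp add: q'_def v_def x_def algebra_simps prod_eq_iff)
    have tw: "\<bar>t * w x\<bar> \<le> b"
    proof -
      have "\<bar>t * w x\<bar> \<le> t0 * W" unfolding abs_mult using t w(3) W0 by (intro mult_mono) auto
      then show ?thesis using t0 by simp
    qed
    have \<xi>out: "\<bar>x - x0\<bar> < b" if "\<xi> x \<noteq> 0" using that \<zeta>(4)[of x] by (cases "\<bar>x - x0\<bar> < b") (auto simp: \<xi>_def)
    have Yb: "norm (snd q) \<le> 2 * R" if "\<xi> x \<noteq> 0"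
    proof -
      have "fst q' \<in> J" using \<xi>out[OF that] tw by (auto simp: J_def q'_def abs_le_iff)
      then have "norm (snd q') \<le> R" using R(2) q' by blast
      then have "\<bar>1 - t * \<xi> x\<bar> * norm (snd q) \<le> R" by (simp add: q'_def)
      moreover have "1 / 2 * norm (snd q) \<le> \<bar>1 - t * \<xi> x\<bar> * norm (snd q)"
        using t\<xi>[OF t, of x] by (intro mult_right_mono) auto
      ultimately show ?thesis by simp
    qed
    have "q \<in> \<Omega>"
    proof (cases "t = 0 \<or> x = 0")
      case True
      then have "v = 0"
      proof
        assume "x = 0"
        moreover from this have "\<xi> x = 0" using \<zeta>(4)[of x] b by (simp add: \<xi>_def)
        ultimately show "v = 0" using w(2) by (simp add: v_def zero_prod_def)
      qed (simp add: v_def zero_prod_def)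
      then show ?thesis using q' qv by simp
    next
      case False
      then have tx: "t > 0" "x \<noteq> 0" using t by auto
      have "q' + v \<in> \<Omega>"
      proof (rule shift_in_domain[OF op lip reg sgn oJ less_imp_le[OF cn] sgnJ q'])
        \<comment> \<open>The displacement is at most a quarter of \<open>\<bar>x\<bar>\<close>, so
          the image stays on the same side of x = 0.\<close>
        have twx: "\<bar>t * w x\<bar> \<le> \<bar>x\<bar> / 4"
        proof -
          have "\<bar>t * w x\<bar> \<le> t0 * (A * \<bar>x\<bar>)" unfolding abs_mult using t wlin[of x] b0 by (intro mult_mono) auto
          also have "\<dots> = (t0 * A) * \<bar>x\<bar>" by simp
          also have "\<dots> \<le> 1 / 4 * \<bar>x\<bar>" using t0 by (intro mult_right_mono) auto
          finally show ?thesis by simp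
        qed
        have xw: "x * (t * w x) > 0" using wsgn[OF tx(2)] tx(1) by (simp add: mult.left_commute)
        have "(t * w x)\<^sup>2 < x * (t * w x)"
        proof -
          have "(t * w x)\<^sup>2 = \<bar>t * w x\<bar> * \<bar>t * w x\<bar>" by (simp add: power2_eq_square flip: abs_mult)
          also have "\<dots> \<le> \<bar>x\<bar> / 4 * \<bar>t * w x\<bar>" using twx by (intro mult_right_mono) auto
          also have "\<dots> = (x * (t * w x)) / 4" using xw by (simp flip: abs_mult)
          finally show ?thesis using xw by linarith
        qed
        then show "fst q' * fst v > 0" by (simp add: q'_def v_def power2_eq_square left_diff_distrib)
        show "snd v = 0 \<or> ((\<forall>s\<in>{0..1}. fst q' + s * fst v \<in> J) \<and> norm (snd v) \<le> cn * \<bar>fst v\<bar>)"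
        proof (cases "\<xi> x = 0")
          case True then show ?thesis by (simp add: v_def)
        next
          case False
          note xb = \<xi>out[OF False]
          have "fst q' + s * fst v \<in> J" if s: "s \<in> {0..1}" for s
          proof -
            have "\<bar>(1 - s) * (t * w x)\<bar> \<le> 1 * b" unfolding abs_mult[of "1 - s"] using s tw b by (intro mult_mono) auto
            moreover have "fst q' + s * fst v = x - (1 - s) * (t * w x)" by (simp add: q'_def v_def algebra_simps)
            ultimately show ?thesis using xb by (auto simp: J_def abs_le_iff)
          qed
          moreover have "norm (snd v) \<le> cn * \<bar>fst v\<bar>"
          proof -
            have "norm (snd v) = t * (\<xi> x * norm (snd q))" using t \<xi>b[of x] by (simp add: v_def)
            also have "\<dots> \<le> t * (X * (2 * R))" using t \<xi>b[of x] Yb[OF False] X0 by (intro mult_left_mono mult_mono) auto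
            also have "X * (2 * R) \<le> cn * wmin" using \<eta>1(1) by (simp add: X_def mult_ac)
            also have "cn * wmin \<le> cn * \<bar>w x\<bar>" using wmin(2)[of x] xb cn by (intro mult_left_mono) auto
            finally show ?thesis using t by (simp add: v_def abs_mult mult.left_commute mult_left_mono)
          qed
          ultimately show ?thesis by blast
        qed
      qed
      then show ?thesis using qv by simp
    qed
    then show ?thesis using Yb by (simp add: x_def)
  qed
  have wsq: "(ws x)\<^sup>2 = (1 + \<bar>x\<bar>) powr (- (p + 2))" for x
  proof -
    have "- ((3 + \<delta>) / 2) + - ((3 + \<delta>) / 2) = - (p + 2)" by (simp add: p_def)
    then show ?thesis by (simp only: ws_def power2_eq_square flip: powr_add)
  qed
  define K1 where "K1 = 1 + \<bar>x0\<bar> + r"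
  have K1: "K1 > 0" using r by (simp add: K1_def add_nonneg_pos)
  define K where "K = K1 powr (p + 2)"
  have K: "K > 0" using K1 by (simp add: K_def)
  \<comment> \<open>\<open>T\<close> decays with the power \<open>p + 2 = 3 + \<delta>\<close>,
    which is that of the squared resolvent weight.\<close>
  have wsT: "(ws x)\<^sup>2 \<le> K * T x" for x
  proof -
    have sx: "S x \<le> (K1 * (1 + \<bar>x\<bar>))\<^sup>2"
    proof -
      have "S x \<le> (\<bar>x - x0\<bar> + r)\<^sup>2" using r by (simp add: S_def power2_sum)
      also have "\<dots> \<le> (K1 * (1 + \<bar>x\<bar>))\<^sup>2"
      proof (rule power_mono)
        have "0 \<le> (\<bar>x0\<bar> + r) * \<bar>x\<bar>" using r by simp
        then show "\<bar>x - x0\<bar> + r \<le> K1 * (1 + \<bar>x\<bar>)" using abs_triangle_ineq4[of x x0] by (simp add: K1_def algebra_simps)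
      qed (use r in simp)
      finally show ?thesis .
    qed
    have "((K1 * (1 + \<bar>x\<bar>))\<^sup>2) powr (- p / 2 - 1) \<le> T x"
      unfolding T_def using p S(1)[of x] sx by (intro powr_mono2') auto
    moreover have "((K1 * (1 + \<bar>x\<bar>))\<^sup>2) powr (- p / 2 - 1) = (K1 * (1 + \<bar>x\<bar>)) powr (- (p + 2))"
    proof -
      have e: "2 * (- p / 2 - 1) = - (p + 2)" by simp
      have "(K1 * (1 + \<bar>x\<bar>))\<^sup>2 = (K1 * (1 + \<bar>x\<bar>)) powr 2" using K1 by (simp add: powr_numeral)
      then show ?thesis by (simp only: powr_powr e)
    qed
    moreover have "(K1 * (1 + \<bar>x\<bar>)) powr (- (p + 2)) = K1 powr (- (p + 2)) * (ws x)\<^sup>2"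
      unfolding wsq using K1 by (simp add: powr_mult)
    ultimately have "K * (K1 powr (- (p + 2)) * (ws x)\<^sup>2) \<le> K * T x" using K by (intro mult_left_mono) auto
    moreover have "K * K1 powr (- (p + 2)) = 1" unfolding K_def using K1 by (simp flip: powr_add)
    ultimately show ?thesis by (simp flip: mult.assoc)
  qed
  have Ta: "T x \<le> a x / r\<^sup>2" for x
  proof -
    have "r\<^sup>2 * T x \<le> S x * T x" using S(2)[of x] pos(2)[of x] by (intro mult_right_mono) auto
    then show ?thesis using ST(1)[of x] r2 by (simp add: field_simps)
  qed
  \<comment> \<open>The weight may use up a tenth of \<open>T\<close> in the mass and half of
    \<open>\<theta> * a\<close> in the x-gradient.\<close>
  define c where "c = min (1 / 2) (min (1 / (10 * K)) (\<theta> * r\<^sup>2 / (2 * K)))"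
  have c: "0 < c" "c \<le> 1 / 2" "c \<le> 1 / (10 * K)" "c \<le> \<theta> * r\<^sup>2 / (2 * K)" using K \<theta> r2 by (auto simp: c_def)
  have cT: "c * (ws x)\<^sup>2 \<le> T x / 10" for x
  proof -
    have "c * (ws x)\<^sup>2 \<le> 1 / (10 * K) * (K * T x)" using c(1,3) wsT[of x] K by (intro mult_mono) auto
    then show ?thesis using K by simp
  qed
  have ca: "c * (ws x)\<^sup>2 \<le> \<theta> / 2 * a x" for x
  proof -
    have "c * (ws x)\<^sup>2 \<le> \<theta> * r\<^sup>2 / (2 * K) * (K * T x)" using c(1,4) wsT[of x] K \<theta> by (intro mult_mono) auto
    also have "\<dots> = \<theta> / 2 * (r\<^sup>2 * T x)" using K by simp
    also have "\<dots> \<le> \<theta> / 2 * a x" using Ta[of x] r2 \<theta> by (intro mult_left_mono) (auto simp: field_simps)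
    finally show ?thesis .
  qed
  \<comment> \<open>On \<open>\<bar>x - x0\<bar> \<le> b / 2\<close>, where \<open>\<xi>\<close> is
    at least \<open>\<eta> * z0\<close>, the term \<open>E * \<xi>\<close> must outweigh the
    negative Hardy remainder and the term with \<open>\<xi>''\<close>, with 1 left over for the
    weight.\<close>
  define E0 where "E0 = max 1 ((1 + (p / 2 + 3 / 4) * r\<^sup>2 * Vb + 2 * dd * X) / (\<eta> * z0))"
  have E0: "E0 \<ge> 1" "(1 + (p / 2 + 3 / 4) * r\<^sup>2 * Vb + 2 * dd * X) / (\<eta> * z0) \<le> E0" by (auto simp: E0_def)
  \<comment> \<open>The Hardy inequality costs \<open>lam * a\<close> out of \<open>2 * a\<close>; the rest \<open>\<theta> * a\<close> has to dominate \<open>\<mu> + \<xi>\<close> and the weight.\<close>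
  define lam where "lam = 2 * \<kappa> / (p + 1)"
  have lam: "lam > 0" "2 - lam = \<theta>" using p by (auto simp: lam_def \<kappa>_def \<theta>_def field_simps)
  define Bm where "Bm = (A + dd * X) + (p * (Tb + A) + dd * (2 * X))"
  have flw: "flow \<Omega> w a \<xi> \<xi>' t0 W A X L (2 * R) dd"
  proof
    show "dd = real DIM('b)" by (rule dd_def)
    show "\<bar>a x - a x'\<bar> \<le> L * \<bar>x - x'\<bar>" for x x'
    proof -
      have "\<bar>a x - a x'\<bar> \<le> (p * (Tb + A)) * \<bar>x - x'\<bar>" by (rule lipschitz_if_derivative_bounded[OF a' a'b])
      also have "\<dots> \<le> L * \<bar>x - x'\<bar>" using X0 by (intro mult_right_mono) (auto simp: L_def)
      finally show ?thesis .
    qed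
    show "\<bar>\<xi> x - \<xi> x'\<bar> \<le> L * \<bar>x - x'\<bar>" for x x'
    proof -
      have "\<bar>\<xi> x - \<xi> x'\<bar> \<le> (2 * X) * \<bar>x - x'\<bar>" by (rule lipschitz_if_derivative_bounded[OF d\<xi> \<xi>'b])
      also have "\<dots> \<le> L * \<bar>x - x'\<bar>" using p b0 by (intro mult_right_mono) (auto simp: L_def)
      finally show ?thesis .
    qed
    show "0 \<le> a x" for x using pos(1)[of x] by simp
    show "q \<in> \<Omega>" if "0 \<le> t" "t \<le> t0" "(fst q - t * w (fst q), (1 - t * \<xi> (fst q)) *\<^sub>R snd q) \<in> \<Omega>" for t q
      using flowpt[OF that] by blast
    show "norm (snd q) \<le> 2 * R" if "0 \<le> t" "t \<le> t0" "(fst q - t * w (fst q), (1 - t * \<xi> (fst q)) *\<^sub>R snd q) \<in> \<Omega>" "\<xi> (fst q) \<noteq> 0" for t q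
      using flowpt[OF that(1-3)] that(4) by blast
  qed (use op smw sm\<xi> w d\<xi> ub \<xi>b t0 R in auto)
  \<comment> \<open>The sign of \<open>h\<close> makes \<open>h'\<close> positive far from
    \<open>x0\<close>. \<open>b\<close> is half of the coefficient of \<open>\<rho>2V\<close> in
    \<open>h'\<close> after splitting \<open>T\<close>, and \<open>lam\<close> is then fixed by
    equality in the condition on \<open>h\<close>.\<close>
  have rep: "repulsive \<Omega> w a \<xi> \<xi>' t0 W A X L (2 * R) dd \<mu> ws (\<lambda>x. - \<kappa> * (x - x0) * T x)
     (\<lambda>x. - \<kappa> * T x + \<kappa> * (p + 2) * \<rho>2V x) (\<lambda>x. \<kappa> * (p + 1) / 2 * \<rho>2V x) (\<lambda>x. lam * a x)
     (\<lambda>x. - p * (x - x0) * T x + (dd - 1) * \<xi>' x) (\<lambda>x. (- p * T x + p * (p + 2) * \<rho>2V x) + (dd - 1) * \<xi>'' x)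
     (32 * R\<^sup>2 * X) (64 * R\<^sup>2 * X) c E0 ((1 + W) powr (p + 2)) Bm"
  proof (intro repulsive.intro flw repulsive_axioms.intro)
    show "2 * (\<xi>' x)\<^sup>2 * (2 * R)\<^sup>2 \<le> \<xi> x * \<mu> x" for x
      by (simp add: \<xi>'_def \<xi>_def \<mu>_def power_mult_distrib power2_eq_square mult_ac)
    show "\<bar>\<mu> x - \<mu> x'\<bar> \<le> 64 * R\<^sup>2 * X * \<bar>x - x'\<bar>" for x x'
      by (rule lipschitz_if_derivative_bounded[OF d\<mu> \<mu>'b])
    show "\<xi>' x = 0" if "\<xi> x = 0" for x using that \<eta>0 by (simp add: \<xi>_def \<xi>'_def)
    show "continuous_on UNIV ws" unfolding ws_def by (intro continuous_intros) auto
    show "0 \<le> ws x" "ws x \<le> 1" for x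
    proof -
      show "0 \<le> ws x" by (simp add: ws_def)
      have "(1 + \<bar>x\<bar>) powr (- ((3 + \<delta>) / 2)) \<le> 1 powr (- ((3 + \<delta>) / 2))" using \<delta> by (intro powr_mono2') auto
      then show "ws x \<le> 1" by (simp add: ws_def)
    qed
    show "(ws x)\<^sup>2 \<le> (1 + W) powr (p + 2) * (ws x')\<^sup>2" if "\<bar>x - x'\<bar> \<le> W" for x x'
      unfolding wsq by (rule polynomial_weight_comparison[OF that]) (use p in simp)
    show "((\<lambda>x. a x + (dd - 1) * \<xi> x) has_real_derivative - p * (x - x0) * T x + (dd - 1) * \<xi>' x) (at x)" for x
      by (intro DERIV_add a' DERIV_cmult d\<xi>)
    show "((\<lambda>x. - p * (x - x0) * T x + (dd - 1) * \<xi>' x) has_real_derivative (- p * T x + p * (p + 2) * \<rho>2V x) + (dd - 1) * \<xi>'' x) (at x)" for x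
      by (intro DERIV_add a'' DERIV_cmult d\<xi>')
    show "continuous_on UNIV (\<lambda>x. - p * T x + p * (p + 2) * \<rho>2V x + (dd - 1) * \<xi>'' x)"
      by (intro continuous_intros contT cont\<rho> cont\<xi>'')
    have dX: "\<bar>(dd - 1) * k\<bar> \<le> dd * B" if "\<bar>k\<bar> \<le> B" for k B
      unfolding abs_mult using that dd by (intro mult_mono) auto
    show "\<bar>a x + (dd - 1) * \<xi> x\<bar> \<le> Bm" for x
    proof -
      have "\<bar>(dd - 1) * \<xi> x\<bar> \<le> dd * X" using \<xi>b[of x] by (intro dX) auto
      moreover have "0 \<le> p * (Tb + A) + dd * (2 * X)" using p b0 dd X0 by (intro add_nonneg_nonneg mult_nonneg_nonneg) auto
      ultimately show ?thesis using ub(1)[of x] pos(1)[of x] unfolding Bm_def by linarith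
    qed
    show "\<bar>- p * (x - x0) * T x + (dd - 1) * \<xi>' x\<bar> \<le> Bm" for x
    proof -
      have "0 \<le> A + dd * X" using b0 dd X0 by (intro add_nonneg_nonneg mult_nonneg_nonneg) auto
      then show ?thesis using dX[OF \<xi>'b[of x]] a'b[of x] unfolding Bm_def by linarith
    qed
    show "((\<lambda>x. - \<kappa> * (x - x0) * T x) has_real_derivative - \<kappa> * T x + \<kappa> * (p + 2) * \<rho>2V x) (at x)" for x
      by (rule derivative_eq_intros refl T')+ (simp add: \<rho>2V_def power2_eq_square algebra_simps)
    show "continuous_on UNIV (\<lambda>x. - \<kappa> * T x + \<kappa> * (p + 2) * \<rho>2V x)" by (intro continuous_intros contT cont\<rho>)
    show "continuous_on UNIV (\<lambda>x. lam * a x)" by (intro continuous_intros conta)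
    show "0 \<le> lam * a x" for x using lam pos(1)[of x] by simp
    show "continuous_on UNIV (\<lambda>x. \<kappa> * (p + 1) / 2 * \<rho>2V x)" by (intro continuous_intros cont\<rho>)
    show "0 \<le> \<kappa> * (p + 1) / 2 * \<rho>2V x" for x using p \<rho>2V0(1)[of x] by (simp add: \<kappa>_def)
    show "(- \<kappa> * (x - x0) * T x)\<^sup>2 \<le> lam * a x * (\<kappa> * (p + 1) / 2 * \<rho>2V x)" for x
    proof -
      have "lam * a x * (\<kappa> * (p + 1) / 2 * \<rho>2V x) = (lam * (p + 1)) * \<kappa> / 2 * (x - x0)\<^sup>2 * (a x * V x)"
        by (simp add: \<rho>2V_def)
      also have "lam * (p + 1) = 2 * \<kappa>" using p by (simp add: lam_def)
      also have "a x * V x = (T x)\<^sup>2" using ST[of x] by (simp add: power2_eq_square) (metis mult.assoc mult.commute)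
      also have "2 * \<kappa> * \<kappa> / 2 * (x - x0)\<^sup>2 * (T x)\<^sup>2 = (- \<kappa> * (x - x0) * T x)\<^sup>2"
        by (simp add: power_mult_distrib power2_eq_square)
      finally show ?thesis by linarith
    qed
    show "lam * a x + c * (ws x)\<^sup>2 \<le> 2 * a x - \<mu> x - \<xi> x" for x
    proof -
      have "\<mu> x + \<xi> x \<le> \<theta> / 2 * a x"
      proof (cases "\<bar>x - x0\<bar> \<le> b")
        case True
        have "\<mu> x + \<xi> x \<le> 32 * R\<^sup>2 * X + X" using \<mu>b(2)[of x] \<xi>b(2)[of x] by linarith
        also have "\<dots> = (\<eta> * (2 * (32 * R\<^sup>2 * Z\<^sup>2 + Z\<^sup>2))) / 2" by (simp add: X_def algebra_simps)
        also have "\<dots> \<le> \<theta> * am / 2" using \<eta>1(2) by simp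
        also have "\<dots> \<le> \<theta> * a x / 2" using lowr(1)[OF True] \<theta> by (simp add: mult_left_mono)
        finally show ?thesis by simp
      next
        case False
        then show ?thesis using out[of x] \<theta> pos(1)[of x] by (simp add: \<mu>_def \<xi>_def)
      qed
      moreover have "\<theta> / 2 * a x + \<theta> / 2 * a x = 2 * a x - lam * a x" unfolding lam(2)[symmetric] by (simp add: field_simps)
      ultimately show ?thesis using ca[of x] by linarith
    qed
    show "c * (ws x)\<^sup>2 \<le> (- \<kappa> * T x + \<kappa> * (p + 2) * \<rho>2V x) - \<kappa> * (p + 1) / 2 * \<rho>2V x + E * \<xi> x
        - ((- p * T x + p * (p + 2) * \<rho>2V x) + (dd - 1) * \<xi>'' x) / 2" if E: "E \<ge> E0" for x E
    proof -
      have E1: "E \<ge> 1" using E E0 by simp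
      \<comment> \<open>\<open>T\<close> is split into \<open>\<rho>2V\<close> and
        \<open>r\<^sup>2\<close> times \<open>V\<close>. The former gets a positive coefficient
        because \<open>\<kappa> > p\<close>; the latter is the negative part, which dominates near
        \<open>x0\<close>.\<close>
      have main: "(- \<kappa> * T x + \<kappa> * (p + 2) * \<rho>2V x) - \<kappa> * (p + 1) / 2 * \<rho>2V x + E * \<xi> x
        - ((- p * T x + p * (p + 2) * \<rho>2V x) + (dd - 1) * \<xi>'' x) / 2
        = 3 / 8 * (p + 1) * \<rho>2V x - (p / 2 + 3 / 4) * (r\<^sup>2 * V x) + E * \<xi> x - (dd - 1) * \<xi>'' x / 2"
        unfolding T_eq[of x] \<kappa>_def by (simp add: field_simps)
      have \<xi>''X: "(dd - 1) * \<xi>'' x / 2 \<le> 2 * dd * X" using dX[OF \<xi>''b[of x]] by (simp add: abs_le_iff)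
      show ?thesis
      proof (cases "\<bar>x - x0\<bar> \<le> b / 2")
        case True
        have "(p / 2 + 3 / 4) * (r\<^sup>2 * V x) \<le> (p / 2 + 3 / 4) * (r\<^sup>2 * Vb)" using p ub(3)[of x] by (intro mult_left_mono) auto
        moreover have "1 + (p / 2 + 3 / 4) * (r\<^sup>2 * Vb) + 2 * dd * X \<le> E * \<xi> x"
        proof -
          have "1 + (p / 2 + 3 / 4) * r\<^sup>2 * Vb + 2 * dd * X \<le> E0 * (\<eta> * z0)"
            using E0(2) \<eta>0 z0(1) by (simp add: pos_divide_le_eq)
          also have "\<dots> \<le> E * \<xi> x"
            unfolding \<xi>_def using E E0 \<eta>0 z0 z0(2)[OF True] by (intro mult_mono mult_left_mono) auto
          finally show ?thesis by (simp add: mult.assoc)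
        qed
        moreover have "c * (ws x)\<^sup>2 \<le> 1"
        proof -
          have "(1 + \<bar>x\<bar>) powr (- (p + 2)) \<le> 1 powr (- (p + 2))" using p by (intro powr_mono2') auto
          then have "c * (ws x)\<^sup>2 \<le> 1 * 1" unfolding wsq using c by (intro mult_mono) auto
          then show ?thesis by simp
        qed
        moreover have "3 / 8 * (p + 1) * \<rho>2V x \<ge> 0" using p \<rho>2V0(1)[of x] by simp
        ultimately show ?thesis unfolding main using \<xi>''X by linarith
      next
        case False
        \<comment> \<open>The negative part is small here, and \<open>T\<close> is at most 17/16 of
          \<open>\<rho>2V\<close>. What remains is at least \<open>T x / 5\<close>, one half of it
          for the term with \<open>\<xi>''\<close> and the other for the weight.\<close>
        have far: "16 * (r\<^sup>2 * V x) \<le> \<rho>2V x"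
        proof -
          have "(b / 2)\<^sup>2 \<le> (x - x0)\<^sup>2" using False b abs_le_square_iff[of "b / 2" "x - x0"] by simp
          moreover have "(b / 2)\<^sup>2 = 16 * r\<^sup>2" by (simp add: r_def power2_eq_square)
          ultimately have "16 * r\<^sup>2 * V x \<le> (x - x0)\<^sup>2 * V x" using pos(3)[of x] by (intro mult_right_mono) auto
          then show ?thesis by (simp add: \<rho>2V_def)
        qed
        have "(p / 2 + 3 / 4) * (16 * (r\<^sup>2 * V x)) \<le> (p / 2 + 3 / 4) * \<rho>2V x" using far p by (intro mult_left_mono) auto
        moreover have "p * \<rho>2V x \<ge> \<rho>2V x" using p \<rho>2V0(1)[of x] by (simp add: mult_le_cancel_right1)
        ultimately have "3 / 8 * (p + 1) * \<rho>2V x - (p / 2 + 3 / 4) * (r\<^sup>2 * V x) \<ge> 1 / 4 * \<rho>2V x"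
          using \<rho>2V0(1)[of x] by (simp add: algebra_simps)
        moreover have "1 / 4 * \<rho>2V x \<ge> T x / 5" using far T_eq[of x] \<rho>2V0(1)[of x] by simp
        moreover have "(dd - 1) * \<xi>'' x / 2 \<le> T x / 10"
        proof (cases "\<bar>x - x0\<bar> \<le> b")
          case True
          have "2 * dd * X = \<eta> * (20 * dd * Z\<^sup>2) / 10" by (simp add: X_def)
          then show ?thesis using \<xi>''X \<eta>1(3) lowr(2)[OF True] by linarith
        next
          case False
          then show ?thesis using out[of x] pos(2)[of x] by (simp add: \<xi>''_def)
        qed
        moreover have "E * \<xi> x \<ge> 0" using E1 \<xi>b by simp
        ultimately show ?thesis unfolding main using cT[of x] by linarith
      qed
    qed
  qed (use \<mu>b sma c E0 in auto)
  interpret repulsive \<Omega> w a \<xi> \<xi>' t0 W A X L "2 * R" dd \<mu> ws "\<lambda>x. - \<kappa> * (x - x0) * T x"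
     "\<lambda>x. - \<kappa> * T x + \<kappa> * (p + 2) * \<rho>2V x" "\<lambda>x. \<kappa> * (p + 1) / 2 * \<rho>2V x" "\<lambda>x. lam * a x"
     "\<lambda>x. - p * (x - x0) * T x + (dd - 1) * \<xi>' x" "\<lambda>x. (- p * T x + p * (p + 2) * \<rho>2V x) + (dd - 1) * \<xi>'' x"
     "32 * R\<^sup>2 * X" "64 * R\<^sup>2 * X" c E0 "(1 + W) powr (p + 2)" Bm
    by (rule rep)
  have "E0 > 0" using E0 by simp
  then show ?thesis using a_priori unfolding wsm_def by blast
qed

text \<open>The choice in \<open>resolvent\<close> is harmless: a solution exists because the
  spectral parameter has positive imaginary part, and \<open>est\<close> applies to every
  solution.\<close>

lemma weighted_resolvent_opnorm:
  fixes \<Omega> :: "(real \<times> (real ^ 'n::finite)) set"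
  assumes op: "open \<Omega>" and E: "E > 0" and eps: "\<epsilon> > 0" and C: "C \<ge> 0" and s: "s \<ge> 0"
    and est: "\<And>f u. f \<in> l2 (lebesgue_on \<Omega>) \<Longrightarrow>
     (u, \<lambda>p. complex_of_real ((1 + \<bar>fst p\<bar>) powr (- s)) * f p + Complex E \<epsilon> * u p) \<in> neg_dirichlet_laplacian \<Omega> \<Longrightarrow>
     u \<in> l2 (lebesgue_on \<Omega>) \<and>
     nrm (lebesgue_on \<Omega>) (\<lambda>p. complex_of_real ((1 + \<bar>fst p\<bar>) powr (- s)) * u p) \<le> C * nrm (lebesgue_on \<Omega>) f"
  shows "L2_opnorm \<Omega> (weighted_resolvent \<Omega> s (Complex E \<epsilon>)) \<le> ennreal C"
  unfolding L2_opnorm_def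
proof (rule Inf_lower, rule CollectI, intro exI[of _ C] conjI refl C ballI)
  fix f assume "f \<in> L2_space \<Omega>"
  then have f: "f \<in> l2 (lebesgue_on \<Omega>)" by (simp add: L2_space_eq)
  let ?w = "\<lambda>p::real \<times> (real ^ 'n). complex_of_real ((1 + \<bar>fst p\<bar>) powr (- s))"
  have "continuous_on UNIV ?w" by (intro continuous_intros) auto
  then have wm: "?w \<in> borel_measurable (lebesgue_on \<Omega>)"
    by (intro borel_measurable_lebesgue_on continuous_UNIV_borel)
  have w1: "cmod (?w p) \<le> 1" for p
    using powr_mono2'[of "- s" 1 "1 + \<bar>fst p\<bar>"] s by simp
  have g: "(\<lambda>p. ?w p * f p) \<in> l2 (lebesgue_on \<Omega>)" by (rule l2_mult(1)[OF f wm w1])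
  define u where "u = resolvent (neg_dirichlet_laplacian \<Omega>) (Complex E \<epsilon>) (\<lambda>p. ?w p * f p)"
  have "\<exists>u. (u, \<lambda>p. ?w p * f p + Complex E \<epsilon> * u p) \<in> neg_dirichlet_laplacian \<Omega>"
    by (rule resolvent_exists[OF op g]) (use E eps in auto)
  then have "(u, \<lambda>p. ?w p * f p + Complex E \<epsilon> * u p) \<in> neg_dirichlet_laplacian \<Omega>"
    unfolding u_def resolvent_def by (rule someI_ex)
  from est[OF f this] have u: "u \<in> l2 (lebesgue_on \<Omega>)"
    and le: "nrm (lebesgue_on \<Omega>) (\<lambda>p. ?w p * u p) \<le> C * nrm (lebesgue_on \<Omega>) f" by auto
  have e: "weighted_resolvent \<Omega> s (Complex E \<epsilon>) f = (\<lambda>p. ?w p * u p)"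
    by (simp add: weighted_resolvent_def u_def)
  show "weighted_resolvent \<Omega> s (Complex E \<epsilon>) f \<in> L2_space \<Omega>"
    unfolding e L2_space_eq by (rule l2_mult(1)[OF u wm w1])
  show "L2_norm \<Omega> (weighted_resolvent \<Omega> s (Complex E \<epsilon>) f) \<le> C * L2_norm \<Omega> f"
    unfolding e L2_norm_eq by (rule le)
qed

theorem theorem2:
  fixes \<Omega> :: "(real \<times> (real ^ 'n::finite)) set" and I :: "real set" and C\<^sub>I :: real
  assumes "open \<Omega>" and "emeasure lebesgue \<Omega> = \<infinity>"
    and "lipschitz_boundary \<Omega>" and "locally_convex_or_C11 \<Omega>"
    and "\<And>p \<nu>. outward_unit_normal \<Omega> p \<nu> \<Longrightarrow> fst p * fst \<nu> \<le> 0"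
    and "open I" and "is_interval I" and "I \<noteq> {}" and "C\<^sub>I > 0"
    and "\<And>p \<nu>. p \<in> I \<times> UNIV \<Longrightarrow> outward_unit_normal \<Omega> p \<nu> \<Longrightarrow> fst p * fst \<nu> \<le> - C\<^sub>I"
    and "bounded (\<Omega> \<inter> (I \<times> UNIV))"
  shows "\<forall>\<delta>>0. \<exists>E\<^sub>0>0. \<exists>C>0. \<forall>E\<ge>E\<^sub>0. \<forall>\<epsilon>\<in>{0<..1}.
    L2_opnorm \<Omega> (weighted_resolvent \<Omega> ((3 + \<delta>) / 2) (Complex E \<epsilon>)) \<le> ennreal (C * sqrt E)"
proof (intro allI impI)
  fix \<delta> :: real assume \<delta>: "\<delta> > 0"
  from weighted_resolvent_estimate[OF assms(1,3,4,5) assms(6,8,9,10,11) \<delta>]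
  obtain E0 C where E0: "E0 > 0" and C: "C > 0" and est: "\<And>E \<epsilon> f u. E \<ge> E0 \<Longrightarrow> 0 < \<epsilon> \<Longrightarrow> \<epsilon> \<le> 1 \<Longrightarrow> f \<in> l2 (lebesgue_on \<Omega>) \<Longrightarrow>
     (u, \<lambda>p. complex_of_real ((1 + \<bar>fst p\<bar>) powr (- ((3 + \<delta>) / 2))) * f p + Complex E \<epsilon> * u p) \<in> neg_dirichlet_laplacian \<Omega> \<Longrightarrow>
     u \<in> l2 (lebesgue_on \<Omega>) \<and>
     nrm (lebesgue_on \<Omega>) (\<lambda>p. complex_of_real ((1 + \<bar>fst p\<bar>) powr (- ((3 + \<delta>) / 2))) * u p) \<le> C * sqrt E * nrm (lebesgue_on \<Omega>) f"
    by blast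
  show "\<exists>E\<^sub>0>0. \<exists>C>0. \<forall>E\<ge>E\<^sub>0. \<forall>\<epsilon>\<in>{0<..1}.
    L2_opnorm \<Omega> (weighted_resolvent \<Omega> ((3 + \<delta>) / 2) (Complex E \<epsilon>)) \<le> ennreal (C * sqrt E)"
  proof (rule exI[of _ E0], intro conjI E0 exI[of _ C] C allI impI ballI)
    fix E \<epsilon> :: real assume "E0 \<le> E" "\<epsilon> \<in> {0<..1}"
    then have E: "E > 0" "E \<ge> E0" and eps: "\<epsilon> > 0" "\<epsilon> \<le> 1" using E0 by auto
    show "L2_opnorm \<Omega> (weighted_resolvent \<Omega> ((3 + \<delta>) / 2) (Complex E \<epsilon>)) \<le> ennreal (C * sqrt E)"
    proof (rule weighted_resolvent_opnorm[OF assms(1) E(1) eps(1)])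
      show "0 \<le> C * sqrt E" "0 \<le> (3 + \<delta>) / 2" using C E \<delta> by auto
    qed (rule est[OF E(2) eps])
  qed
qed

end
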